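(* Let $n \ge 4$ and $a \ge 2$ be integers. Then there is no Ulrich vector bundle of rank $r$ with $1 \le r \le 3$ for $(\mathbb{P}^n, \mathcal{O}_{\mathbb{P}^n}(a))$. In other words, there is no vector bundle $\mathcal{E}$ of rank $1 \le r \le 3$ on $\mathbb{P}^n$ such that $H^i(\mathbb{P}^n, \mathcal{E}(-pa)) = 0$ for all $i \ge 0$ and all $1 \le p \le n$.
   Context: We work over the complex numbers. For a smooth irreducible projective variety $X$ and a very ample line bundle $L$ on $X$, a vector bundle $\mathcal{E}$ on $X$ is called an Ulrich bundle for (or with respect to) $(X, L)$ if $H^i(X, \mathcal{E} \otimes L^{-p}) = 0$ for all $i \ge 0$ and all $1 \le p \le \dim X$. Here $X = \mathbb{P}^n$, $L = \mathcal{O}_{\mathbb{P}^n}(a)$, and $\mathcal{E}(k) = \mathcal{E} \otimes \mathcal{O}_{\mathbb{P}^n}(k)$. *)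

theory Defs
  imports "HOL-Analysis.Abstract_Topology" "HOL-Library.Function_Algebras"
begin

section \<open>Complex projective space with the Zariski topology\<close>

text \<open>A point of \<open>P\<^sup>n\<close> is the set of all its homogeneous coordinate vectors; a vector
  \<open>v :: nat \<Rightarrow> complex\<close> uses the coordinates \<open>v 0, \<dots>, v n\<close> and is \<open>0\<close> beyond.\<close>

type_synonym point = "(nat \<Rightarrow> complex) set"

definition proj_space :: "nat \<Rightarrow> point set" where
  "proj_space n = {{\<lambda>i. c * v i | c. c \<noteq> 0} | v. (\<forall>i>n. v i = 0) \<and> (\<exists>i\<le>n. v i \<noteq> 0)}"

text \<open>\<open>form n d f\<close>: \<open>f\<close> is (the function defined by) a homogeneous polynomial of degree \<open>d\<close>
  in the variables \<open>x\<^sub>0, \<dots>, x\<^sub>n\<close>; the zero polynomial has every degree.\<close>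

inductive form :: "nat \<Rightarrow> nat \<Rightarrow> ((nat \<Rightarrow> complex) \<Rightarrow> complex) \<Rightarrow> bool" for n where
  const: "form n 0 (\<lambda>v. c)"
| mult_var: "form n d f \<Longrightarrow> i \<le> n \<Longrightarrow> form n (Suc d) (\<lambda>v. v i * f v)"
| add: "form n d f \<Longrightarrow> form n d g \<Longrightarrow> form n d (\<lambda>v. f v + g v)"

lemma form_homogeneous:
  assumes "form n d f" shows "f (\<lambda>i. c * v i) = c ^ d * f v"
  using assms by induction (auto simp: algebra_simps)

lemma form_mult:
  assumes f: "form n d f" and g: "form n e g" shows "form n (d + e) (\<lambda>v. f v * g v)"
  using f
proof induction
  case (const c)
  show ?case using g
  proof induction
    case (const c')
    show ?case using form.const[of n "c * c'"] by simp
  next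
    case (mult_var e g i)
    then show ?case using form.mult_var[of n "0 + e" "\<lambda>v. c * g v" i]
      by (simp add: algebra_simps)
  next
    case (add e g h)
    then show ?case using form.add[of n "0 + e" "\<lambda>v. c * g v" "\<lambda>v. c * h v"]
      by (simp add: algebra_simps)
  qed
next
  case (mult_var d f i)
  then show ?case using form.mult_var[of n "d + e" "\<lambda>v. f v * g v" i]
    by (simp add: algebra_simps)
next
  case (add d f h)
  then show ?case using form.add[of n "d + e" "\<lambda>v. f v * g v" "\<lambda>v. h v * g v"]
    by (simp add: algebra_simps)
qed

definition zero_locus :: "nat \<Rightarrow> ((nat \<Rightarrow> complex) \<Rightarrow> complex) set \<Rightarrow> point set" where
  "zero_locus n T = {P \<in> proj_space n. \<forall>f\<in>T. \<forall>v\<in>P. f v = 0}"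

definition zariski :: "nat \<Rightarrow> point topology" where
  "zariski n = topology (\<lambda>U. \<exists>T. (\<forall>f\<in>T. \<exists>d. form n d f) \<and> U = proj_space n - zero_locus n T)"

lemma form_zero_on_point:
  assumes "form n d f" "P \<in> proj_space n" "v \<in> P" "w \<in> P" "f v = 0" shows "f w = 0"
proof -
  obtain u where P: "P = {\<lambda>i. c * u i | c. c \<noteq> 0}"
    using assms(2) by (auto simp: proj_space_def)
  then obtain b c where "v = (\<lambda>i. b * u i)" "b \<noteq> 0" "w = (\<lambda>i. c * u i)"
    using assms(3,4) by auto
  with assms(5) show ?thesis by (simp add: form_homogeneous[OF assms(1)])
qed

lemma notin_zero_locus: "f \<in> T \<Longrightarrow> v \<in> P \<Longrightarrow> f v \<noteq> 0 \<Longrightarrow> P \<notin> zero_locus n T"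
  by (auto simp: zero_locus_def)

lemma openin_zariski:
  "openin (zariski n) U \<longleftrightarrow>
     (\<exists>T. (\<forall>f\<in>T. \<exists>d. form n d f) \<and> U = proj_space n - zero_locus n T)"
proof -
  let ?L = "\<lambda>U. \<exists>T. (\<forall>f\<in>T. \<exists>d. form n d f) \<and> U = proj_space n - zero_locus n T"
  have "istopology ?L"
    unfolding istopology_def
  proof (intro conjI allI impI)
    fix U V assume "?L U" "?L V"
    then obtain S T where S: "\<forall>f\<in>S. \<exists>d. form n d f" "U = proj_space n - zero_locus n S"
      and T: "\<forall>f\<in>T. \<exists>d. form n d f" "V = proj_space n - zero_locus n T" by blast
    let ?M = "{\<lambda>v. f v * g v | f g. f \<in> S \<and> g \<in> T}"
    have "\<forall>h\<in>?M. \<exists>d. form n d h" 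
    proof
      fix h assume "h \<in> ?M"
      then obtain f g where h: "h = (\<lambda>v. f v * g v)" "f \<in> S" "g \<in> T" by blast
      obtain d e where "form n d f" "form n e g" using S(1) T(1) h(2,3) by blast
      then show "\<exists>d. form n d h" unfolding h(1) using form_mult by blast
    qed
    moreover have "U \<inter> V = proj_space n - zero_locus n ?M"
    proof (rule set_eqI)
      fix P
      show "P \<in> U \<inter> V \<longleftrightarrow> P \<in> proj_space n - zero_locus n ?M"
      proof
        assume P: "P \<in> U \<inter> V"
        then obtain f v g w where *: "f \<in> S" "v \<in> P" "f v \<noteq> 0" "g \<in> T" "w \<in> P" "g w \<noteq> 0"
          and P': "P \<in> proj_space n" unfolding S(2) T(2) zero_locus_def by blast
        obtain e where "form n e g" using T(1) *(4) by blast
        from form_zero_on_point[OF this P' *(2,5)] *(6) have "g v \<noteq> 0" by blast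
        with *(2,3) have "f v * g v \<noteq> 0" by simp
        have "(\<lambda>v. f v * g v) \<in> ?M" using *(1,4) by blast
        from notin_zero_locus[OF this *(2) \<open>f v * g v \<noteq> 0\<close>]
        have "P \<notin> zero_locus n ?M" .
        with P' show "P \<in> proj_space n - zero_locus n ?M" by blast
      next
        assume "P \<in> proj_space n - zero_locus n ?M"
        then obtain f g v where *: "f \<in> S" "g \<in> T" "v \<in> P" "f v \<noteq> 0" "g v \<noteq> 0"
          and P': "P \<in> proj_space n" unfolding zero_locus_def by auto
        from * P' have "P \<in> U" "P \<in> V" unfolding S(2) T(2) zero_locus_def by blast+
        then show "P \<in> U \<inter> V" by blast
      qed
    qed
    ultimately show "?L (U \<inter> V)" by (intro exI[of _ ?M]) simp
  next
    fix K assume "\<forall>U\<in>K. ?L U"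
    then obtain T where T: "\<And>U. U \<in> K \<Longrightarrow> \<forall>f\<in>T U. \<exists>d. form n d f"
      "\<And>U. U \<in> K \<Longrightarrow> U = proj_space n - zero_locus n (T U)" by metis
    have "\<Union>K = (\<Union>U\<in>K. proj_space n - zero_locus n (T U))" using T(2) by blast
    also have "\<dots> = proj_space n - zero_locus n (\<Union>U\<in>K. T U)" by (auto simp: zero_locus_def)
    finally have "\<Union>K = proj_space n - zero_locus n (\<Union>U\<in>K. T U)" .
    moreover have "\<forall>f\<in>\<Union>U\<in>K. T U. \<exists>d. form n d f" using T(1) by blast
    ultimately show "?L (\<Union>K)" by (intro exI[of _ "\<Union>U\<in>K. T U"]) simp
  qed
  then show ?thesis by (simp add: zariski_def)
qed

lemma proj_space_nonempty: assumes "P \<in> proj_space n" shows "\<exists>v. v \<in> P"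
proof -
  obtain u where P: "P = {\<lambda>i. c * u i | c. c \<noteq> 0}"
    using assms by (auto simp: proj_space_def)
  have "(\<lambda>i. 1 * u i) \<in> P" unfolding P using one_neq_zero by blast
  then show ?thesis by blast
qed

lemma topspace_zariski: "topspace (zariski n) = proj_space n"
proof -
  have "zero_locus n {\<lambda>v. 1} = {}"
    unfolding zero_locus_def by (auto dest: proj_space_nonempty)
  then have "proj_space n = proj_space n - zero_locus n {\<lambda>v. 1}" by simp
  moreover have "\<forall>f\<in>{\<lambda>v. 1}. \<exists>d. form n d f" using form.const by blast
  ultimately have "openin (zariski n) (proj_space n)"
    unfolding openin_zariski by metis
  moreover have "topspace (zariski n) \<subseteq> proj_space n"
    using openin_topspace[of "zariski n"] unfolding openin_zariski by auto
  ultimately show ?thesis using openin_subset by blast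
qed

definition regular :: "nat \<Rightarrow> point set \<Rightarrow> (point \<Rightarrow> complex) \<Rightarrow> bool" where
  "regular n U f \<longleftrightarrow>
     (\<forall>P\<in>U. \<exists>W d F G. openin (zariski n) W \<and> P \<in> W \<and> W \<subseteq> U \<and> form n d F \<and> form n d G \<and>
        (\<forall>Q\<in>W. \<forall>v\<in>Q. G v \<noteq> 0 \<and> f Q = F v / G v))"


section \<open>Algebraic vector bundles\<close>

text \<open>A vector bundle is given by an open cover \<open>chart i\<close> (\<open>i \<in> charts\<close>) over which it is
  trivialised and by its transition matrices: \<open>transition i j P a b\<close> is the \<open>(a, b)\<close> entry
  (\<open>a, b < bundle_rank\<close>) of \<open>g\<^sub>i\<^sub>j(P)\<close>, where fibre coordinates over
  \<open>chart i \<inter> chart j\<close> are related by \<open>s\<^sub>i = g\<^sub>i\<^sub>j s\<^sub>j\<close>.  Invertibility of \<open>g\<^sub>i\<^sub>j\<close> follows from \<open>g\<^sub>i\<^sub>i = 1\<close> and the cocycle condition.\<close>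

record 'i vbundle =
  bundle_rank :: nat
  charts :: "'i set"
  chart :: "'i \<Rightarrow> point set"
  transition :: "'i \<Rightarrow> 'i \<Rightarrow> point \<Rightarrow> nat \<Rightarrow> nat \<Rightarrow> complex"

definition vector_bundle :: "nat \<Rightarrow> 'i vbundle \<Rightarrow> bool" where
  "vector_bundle n E \<longleftrightarrow>
     (\<forall>i\<in>charts E. openin (zariski n) (chart E i)) \<and>
     (\<Union>i\<in>charts E. chart E i) = proj_space n \<and>
     (\<forall>i\<in>charts E. \<forall>j\<in>charts E. \<forall>a<bundle_rank E. \<forall>b<bundle_rank E.
        regular n (chart E i \<inter> chart E j) (\<lambda>P. transition E i j P a b)) \<and>
     (\<forall>i\<in>charts E. \<forall>P\<in>chart E i. \<forall>a<bundle_rank E. \<forall>b<bundle_rank E.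
        transition E i i P a b = (if a = b then 1 else 0)) \<and>
     (\<forall>i\<in>charts E. \<forall>j\<in>charts E. \<forall>k\<in>charts E. \<forall>P\<in>chart E i \<inter> chart E j \<inter> chart E k.
        \<forall>a<bundle_rank E. \<forall>b<bundle_rank E.
        transition E i k P a b = (\<Sum>c<bundle_rank E. transition E i j P a c * transition E j k P c b))"

text \<open>Kronecker product of transition matrices: the basis vector \<open>e\<^sub>a \<otimes> f\<^sub>b\<close> has index
  \<open>a * bundle_rank F + b\<close>.\<close>

definition tensor_bundle :: "'i vbundle \<Rightarrow> 'j vbundle \<Rightarrow> ('i \<times> 'j) vbundle" where
  "tensor_bundle E F =
     \<lparr>bundle_rank = bundle_rank E * bundle_rank F,
      charts = charts E \<times> charts F,
      chart = (\<lambda>(i, j). chart E i \<inter> chart F j),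
      transition = (\<lambda>(i, j) (i', j') P a b.
        transition E i i' P (a div bundle_rank F) (b div bundle_rank F) *
        transition F j j' P (a mod bundle_rank F) (b mod bundle_rank F))\<rparr>"

text \<open>The power \<open>L\<^sup>k\<close>, \<open>k \<in> \<int>\<close>, of a line bundle (\<open>bundle_rank L = 1\<close>).\<close>

definition line_power :: "'i vbundle \<Rightarrow> int \<Rightarrow> 'i vbundle" where
  "line_power L k =
     \<lparr>bundle_rank = bundle_rank L, charts = charts L, chart = chart L,
      transition = (\<lambda>i j P a b. transition L i j P a b powi k)\<rparr>"

definition coord_ratio :: "nat \<Rightarrow> nat \<Rightarrow> point \<Rightarrow> complex" where
  "coord_ratio j i P = (let v = (SOME v. v \<in> P) in v j / v i)"

text \<open>The line bundle \<open>O(k)\<close>: on \<open>x\<^sub>i \<noteq> 0\<close> its local generator is \<open>x\<^sub>i\<^sup>k\<close>, so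
  \<open>g\<^sub>i\<^sub>j = (x\<^sub>j/x\<^sub>i)\<^sup>k\<close>.\<close>

definition twisting :: "nat \<Rightarrow> int \<Rightarrow> nat vbundle" where
  "twisting n k =
     \<lparr>bundle_rank = 1, charts = {..n},
      chart = (\<lambda>i. {P \<in> proj_space n. \<forall>v\<in>P. v i \<noteq> 0}),
      transition = (\<lambda>i j P a b. coord_ratio j i P powi k)\<rparr>"

definition twist :: "nat \<Rightarrow> 'i vbundle \<Rightarrow> int \<Rightarrow> ('i \<times> nat) vbundle" where
  "twist n E k = tensor_bundle E (twisting n k)"


section \<open>Cech cohomology of presheaves\<close>

text \<open>A presheaf of abelian groups: \<open>sec U\<close> is a subgroup of \<open>'s\<close> and \<open>res U V\<close> is the
  restriction from \<open>U\<close> to \<open>V \<subseteq> U\<close>.\<close>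

record ('p, 's) presheaf =
  sec :: "'p set \<Rightarrow> 's set"
  res :: "'p set \<Rightarrow> 'p set \<Rightarrow> 's \<Rightarrow> 's"

text \<open>Open covers are families of open sets indexed by themselves; every indexed cover is
  equivalent, under refinement, to its underlying set of open sets.\<close>

definition open_cover :: "'p topology \<Rightarrow> 'p set set \<Rightarrow> bool" where
  "open_cover X \<U> \<longleftrightarrow> (\<forall>U\<in>\<U>. openin X U) \<and> \<Union>\<U> = topspace X"

definition simplices :: "'p set set \<Rightarrow> nat \<Rightarrow> 'p set list set" where
  "simplices \<U> q = {\<sigma>. length \<sigma> = Suc q \<and> set \<sigma> \<subseteq> \<U>}"

definition supp :: "'p set list \<Rightarrow> 'p set" where
  "supp \<sigma> = \<Inter>(set \<sigma>)"

definition face :: "nat \<Rightarrow> 'a list \<Rightarrow> 'a list" where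
  "face j \<sigma> = take j \<sigma> @ drop (Suc j) \<sigma>"

text \<open>Cochains are not required to be alternating.\<close>

definition cochains ::
    "('p, 's::ab_group_add) presheaf \<Rightarrow> 'p set set \<Rightarrow> nat \<Rightarrow> ('p set list \<Rightarrow> 's) set" where
  "cochains F \<U> q =
     {c. (\<forall>\<sigma>\<in>simplices \<U> q. c \<sigma> \<in> sec F (supp \<sigma>)) \<and> (\<forall>\<sigma>. \<sigma> \<notin> simplices \<U> q \<longrightarrow> c \<sigma> = 0)}"

definition coboundary ::
    "('p, 's::ab_group_add) presheaf \<Rightarrow> 'p set set \<Rightarrow> nat \<Rightarrow> ('p set list \<Rightarrow> 's) \<Rightarrow> 'p set list \<Rightarrow> 's"
  where
  "coboundary F \<U> q c = (\<lambda>\<sigma>. if \<sigma> \<in> simplices \<U> (Suc q) then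
     (\<Sum>j\<le>Suc q. let x = res F (supp (face j \<sigma>)) (supp \<sigma>) (c (face j \<sigma>)) in
        if even j then x else - x) else 0)"

definition cocycles ::
    "('p, 's::ab_group_add) presheaf \<Rightarrow> 'p set set \<Rightarrow> nat \<Rightarrow> ('p set list \<Rightarrow> 's) set" where
  "cocycles F \<U> q = {c \<in> cochains F \<U> q. coboundary F \<U> q c = 0}"

definition coboundaries ::
    "('p, 's::ab_group_add) presheaf \<Rightarrow> 'p set set \<Rightarrow> nat \<Rightarrow> ('p set list \<Rightarrow> 's) set" where
  "coboundaries F \<U> q = (case q of 0 \<Rightarrow> {0} | Suc p \<Rightarrow> coboundary F \<U> p ` cochains F \<U> p)"

definition refinement :: "'p set set \<Rightarrow> 'p set set \<Rightarrow> ('p set \<Rightarrow> 'p set) \<Rightarrow> bool" where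
  "refinement \<V> \<U> \<tau> \<longleftrightarrow> (\<forall>V\<in>\<V>. \<tau> V \<in> \<U> \<and> V \<subseteq> \<tau> V)"

definition refine_cochain ::
    "('p, 's::ab_group_add) presheaf \<Rightarrow> 'p set set \<Rightarrow> nat \<Rightarrow> ('p set \<Rightarrow> 'p set) \<Rightarrow>
     ('p set list \<Rightarrow> 's) \<Rightarrow> 'p set list \<Rightarrow> 's" where
  "refine_cochain F \<V> q \<tau> c = (\<lambda>\<sigma>. if \<sigma> \<in> simplices \<V> q then
     res F (supp (map \<tau> \<sigma>)) (supp \<sigma>) (c (map \<tau> \<sigma>)) else 0)"

text \<open>\<open>H\<^sup>q(X, F)\<close> is the direct limit, over all open covers \<open>\<U>\<close> of \<open>X\<close> under refinement, of the
  groups \<open>H\<^sup>q(\<U>, F)\<close> (Serre, Faisceaux algebriques coherents): two cocycles define the same class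
  iff they become cohomologous on a common refinement.\<close>

definition cocycle_pairs ::
    "'p topology \<Rightarrow> ('p, 's::ab_group_add) presheaf \<Rightarrow> nat \<Rightarrow>
     ('p set set \<times> ('p set list \<Rightarrow> 's)) set" where
  "cocycle_pairs X F q = {(\<U>, c). open_cover X \<U> \<and> c \<in> cocycles F \<U> q}"

definition cohomologous ::
    "'p topology \<Rightarrow> ('p, 's::ab_group_add) presheaf \<Rightarrow> nat \<Rightarrow>
     (('p set set \<times> ('p set list \<Rightarrow> 's)) \<times> ('p set set \<times> ('p set list \<Rightarrow> 's))) set" where
  "cohomologous X F q = {((\<U>, c), (\<U>', c')).
     (\<U>, c) \<in> cocycle_pairs X F q \<and> (\<U>', c') \<in> cocycle_pairs X F q \<and>
     (\<exists>\<V> \<tau> \<tau>'. open_cover X \<V> \<and> refinement \<V> \<U> \<tau> \<and> refinement \<V> \<U>' \<tau>' \<and>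
        refine_cochain F \<V> q \<tau> c - refine_cochain F \<V> q \<tau>' c' \<in> coboundaries F \<V> q)}"

definition cohomology ::
    "'p topology \<Rightarrow> ('p, 's::ab_group_add) presheaf \<Rightarrow> nat \<Rightarrow>
     ('p set set \<times> ('p set list \<Rightarrow> 's)) set set" where
  "cohomology X F q = cocycle_pairs X F q // cohomologous X F q"

definition cohomology_zero ::
    "'p topology \<Rightarrow> ('p, 's::ab_group_add) presheaf \<Rightarrow> nat \<Rightarrow>
     ('p set set \<times> ('p set list \<Rightarrow> 's)) set" where
  "cohomology_zero X F q = cohomologous X F q `` {({topspace X}, 0)}"


section \<open>Cohomology of vector bundles and Ulrich bundles\<close>

text \<open>A section over \<open>U\<close> is a family of regular coordinate vectors \<open>s i\<close> on \<open>U \<inter> chart i\<close>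
  with \<open>s\<^sub>i = g\<^sub>i\<^sub>j s\<^sub>j\<close>; irrelevant values are \<open>0\<close>, so that sections add pointwise.\<close>

definition sections :: "nat \<Rightarrow> 'i vbundle \<Rightarrow> point set \<Rightarrow> ('i \<Rightarrow> point \<Rightarrow> nat \<Rightarrow> complex) set" where
  "sections n E U = {s.
     (\<forall>i\<in>charts E. \<forall>a<bundle_rank E. regular n (U \<inter> chart E i) (\<lambda>P. s i P a)) \<and>
     (\<forall>i\<in>charts E. \<forall>j\<in>charts E. \<forall>P\<in>U \<inter> chart E i \<inter> chart E j. \<forall>a<bundle_rank E.
        s i P a = (\<Sum>b<bundle_rank E. transition E i j P a b * s j P b)) \<and>
     (\<forall>i P a. \<not> (i \<in> charts E \<and> P \<in> U \<inter> chart E i \<and> a < bundle_rank E) \<longrightarrow> s i P a = 0)}"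

definition section_sheaf ::
    "nat \<Rightarrow> 'i vbundle \<Rightarrow> (point, 'i \<Rightarrow> point \<Rightarrow> nat \<Rightarrow> complex) presheaf" where
  "section_sheaf n E =
     \<lparr>sec = sections n E,
      res = (\<lambda>U V s i P a. if P \<in> V then s i P a else 0)\<rparr>"

definition bundle_cohomology_vanishes :: "nat \<Rightarrow> 'i vbundle \<Rightarrow> nat \<Rightarrow> bool" where
  "bundle_cohomology_vanishes n E q \<longleftrightarrow>
     cohomology (zariski n) (section_sheaf n E) q =
       {cohomology_zero (zariski n) (section_sheaf n E) q}"

text \<open>Ulrich bundles for \<open>(P\<^sup>n, L)\<close>, \<open>L\<close> a line bundle; note \<open>dim P\<^sup>n = n\<close>.\<close>

definition ulrich_bundle :: "nat \<Rightarrow> 'j vbundle \<Rightarrow> 'i vbundle \<Rightarrow> bool" where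
  "ulrich_bundle n L E \<longleftrightarrow> vector_bundle n E \<and>
     (\<forall>q. \<forall>p\<in>{1..n}.
        bundle_cohomology_vanishes n (tensor_bundle E (line_power L (- int p))) q)"

end

theory Submission
  imports Defs "HOL-Analysis.Analysis" "HOL-Computational_Algebra.Computational_Algebra"
begin

text \<open>The sections of the twists of an Ulrich bundle \<open>E\<close> for \<open>O(a)\<close> form a graded module \<open>N\<close> on which \<open>a\<close>-th powers of linear
  forms act regularly by the vanishing of cohomology, so \<open>dim N\<^bsub>ka\<^esub> = h\<^sup>0(E) (k+n choose n)\<close>.
  Cutting \<open>N \<otimes> N'\<close> by the equations of the diagonal computes the K-polynomials of products and exterior squares modulo
  \<open>(1-z)\<^bsup>n+1\<^esup>\<close>, so \<open>K(e\<^bsup>h\<^esup>)\<close> acts as a Chern character. In rank at most 3, comparing coefficients up to \<open>h\<^sup>4\<close>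
  (here \<open>n \<ge> 4\<close> enters) gives a contradiction.\<close>

text \<open>Cohomology is controlled only for twists by multiples of \<open>a\<close>, so dimensions
  are known in a single residue class of degrees modulo \<open>a\<close>. Multiplying the
  K-polynomial by the power \<open>n+1\<close> of (1-z^a)/(1-z) and averaging over the
  \<open>a\<close>-th roots of unity shows that this class already determines it modulo (1-z)^(n+1):
  K(e^h) is a constant times e^(ch) divided by the power \<open>n+1\<close> of 1 + e^h + ... +
  e^((a-1)h). After centring only even powers of h survive up to order 4, and their coefficients p,
  pA, pC satisfy C \<ge> A^2/2, which is what the last comparison contradicts. The number p is not
  known to be the rank beforehand. It is forced by the relations of exterior algebra: the exterior
  square vanishes in rank 1, the exterior square of the exterior square vanishes in rank 2, and in
  rank 3 it is E tensor det E, where det E has exterior square zero. The relations can be checked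
  only locally. A graded Nullstellensatz turns local agreement of graded modules into agreement in
  all high degrees; the finitely many remaining degrees change a Hilbert series by a polynomial,
  hence a K-polynomial by a multiple of (1-z)^(n+1).\<close>

type_synonym vec = "nat=>complex"

section \<open>Forms in finitely many variables\<close>

text \<open>Here the variables are counted, so \<open>form n\<close> is \<open>hform (Suc n)\<close>
  and inductions on \<open>m\<close> can start at no variables at all. In that case zero is no
  longer derivable in positive degree from the other rules, hence the rule
  \<open>zero\<close>.\<close>

inductive hform :: "nat=>nat=>(vec=>complex)=>bool" for m where
 zero: "hform m d (%v. 0)"
| const: "hform m 0 (%v. c)"
| mult_var: "hform m d f==>i<m==>hform m (Suc d) (%v. v i * f v)"
| add: "hform m d f==>hform m d g==>hform m d (%v. f v+g v)"

lemma form_zero: "form n d (%v. 0)"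
proof (induction d)
 case 0 show ?case by (rule form.const)
next
 case (Suc d)
 from form.mult_var[OF this, of 0] show ?case by simp
qed

lemma form_iff_hform: "form n d f \<longleftrightarrow> hform (Suc n) d f"
proof
 show "form n d f==>hform (Suc n) d f"
  by (induction rule: form.induct) (auto intro: hform.intros)
 show "hform (Suc n) d f==>form n d f"
  by (induction rule: hform.induct) (auto intro: form.intros form_zero)
qed

lemma hform_homogeneous: "hform m d f==>f (%i. c * v i) = c ^ d * f v"
 by (induction rule: hform.induct) (auto simp: algebra_simps)

lemma hform_cong: "hform m d f==>(!!i. i<m==>v i=w i)==>f v=f w"
 by (induction rule: hform.induct) auto

lemma hform_scale: "hform m d f==>hform m d (%v. c * f v)"
proof (induction rule: hform.induct)
 case (zero d) show ?case by (simp add: hform.zero)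
next
 case (const c') show ?case by (rule hform.const)
next
 case (mult_var d f i)
 from hform.mult_var[OF mult_var.IH mult_var.hyps(2)] show ?case by (simp add: algebra_simps)
next
 case (add d f g)
 from hform.add[OF add.IH] show ?case by (simp add: algebra_simps)
qed

lemma hform_mult: "hform m d f==>hform m e g==>hform m (d+e) (%v. f v * g v)"
proof (induction rule: hform.induct)
 case (zero d) show ?case by (simp add: hform.zero)
next
 case (const c) then show ?case by (simp add: hform_scale)
next
 case (mult_var d f i)
 from hform.mult_var[OF mult_var.IH[OF mult_var.prems] mult_var.hyps(2)]
 show ?case by (simp add: algebra_simps)
next
 case (add d f h)
 from hform.add[OF add.IH(1)[OF add.prems] add.IH(2)[OF add.prems]]
 show ?case by (simp add: algebra_simps)
qed

lemma hform_mult': "hform m d f==>hform m e g==>k=d+e==>hform m k (%v. f v * g v)"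
 using hform_mult by blast

lemma hform_diff: "hform m d f==>hform m d g==>hform m d (%v. f v-g v)"
 using hform.add[OF _ hform_scale[of m d g "-1"], of f] by simp

lemma hform_sum: "(!!i. i:I==>hform m d (f i))==>hform m d (%v. SUM i:I. f i v)"
 by (induction I rule: infinite_finite_induct) (auto intro: hform.zero hform.add)

lemma hform_power: "hform m d f==>hform m (k * d) (%v. f v ^ k)"
proof (induction k)
 case 0 show ?case by (simp add: hform.const)
next
 case (Suc k)
 then show ?case using hform_mult[of m d f "k * d" "%v. f v ^ k"] by simp
qed

lemma hform_prod: "(!!i. i:I==>hform m (d i) (f i))==>hform m (SUM i:I. d i) (%v. PROD i:I. f i v)"
 by (induction I rule: infinite_finite_induct) (auto intro: hform.const hform_mult)

lemma hform_var: "i<m==>hform m 1 (%v. v i)"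
 using hform.mult_var[OF hform.const[of m 1], of i] by simp

lemma hform_mono: "hform m d f==>m<=m'==>hform m' d f"
 by (induction rule: hform.induct) (auto intro: hform.intros)

lemma hform_compose:
 assumes "hform m d f" and A: "!!i. i<m==>hform m' 1 (%v. A v i)"
 shows "hform m' d (%v. f (A v))"
 using assms(1)
proof (induction rule: hform.induct)
 case (mult_var d f i)
 from hform_mult[OF A[OF mult_var.hyps(2)] mult_var.IH] show ?case by simp
qed (auto intro: hform.intros)

lemma hform_line:
 assumes "hform m d f" shows "EX P. ALL t. f (%i. p i+t * q i)=poly P t"
 using assms
proof (induction rule: hform.induct)
 case (zero d) show ?case by (auto intro: exI[of _ 0])
next
 case (const c) show ?case by (auto intro: exI[of _ "[:c:]"])
next
 case (mult_var d f i)
 then obtain P where "ALL t. f (%i. p i+t * q i)=poly P t" by blast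
 then show ?case by (intro exI[of _ "[:p i, q i:] * P"]) (auto simp: algebra_simps)
next
 case (add d f g)
 then obtain P Q where "ALL t. f (%i. p i+t * q i)=poly P t" "ALL t. g (%i. p i+t * q i)=poly Q t"
  by blast
 then show ?case by (intro exI[of _ "P+Q"]) auto
qed

text \<open>On the line through \<open>p\<close> and \<open>q\<close> both forms become polynomials
  in one variable, one nonzero at 0 and the other at 1; their product is a nonzero polynomial and so
  has a non-root.\<close>

lemma hform_mult_nonzero:
 assumes "hform m d f" "hform m e g" "f p~=0" "g q~=0"
 shows "EX v. f v * g v~=0"
proof -
 obtain P Q where P: "!!t. f (%i. p i+t * (q i-p i))=poly P t"
  and Q: "!!t. g (%i. p i+t * (q i-p i))=poly Q t"
  using hform_line[OF assms(1), of p "%i. q i-p i"] hform_line[OF assms(2), of p "%i. q i-p i"]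
  by metis
 have "P~=0" using P[of 0] assms(3) by auto
 moreover have "Q~=0" using Q[of 1] assms(4) by auto
 ultimately have "P * Q~=0" by simp
 then obtain t where "poly (P * Q) t~=0" using poly_all_0_iff_0 by blast
 then show ?thesis using P Q by (intro exI[of _ "%i. p i+t * (q i-p i)"]) simp
qed

lemma hform_mult_eq_0:
 assumes "hform m d f" "hform m e g" "!!v. f v * g v=0" "g q~=0"
 shows "f v=0"
 using hform_mult_nonzero[OF assms(1,2) _ assms(4), of v] assms(3) by blast

lemma hform_expand:
 assumes "hform (Suc m) d f"
 shows "EX c. (ALL k<=d. hform m (d - k) (c k))&(ALL v. f v=(SUM k<=d. c k v * v m ^ k))"
 using assms
proof (induction rule: hform.induct)
 case (zero d) show ?case by (intro exI[of _ "%k v. 0"]) (auto intro: hform.zero)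
next
 case (const c) show ?case by (intro exI[of _ "%k v. c"]) (auto intro: hform.const)
next
 case (mult_var d f i)
 then obtain c where c: "!!k. k<=d==>hform m (d - k) (c k)" "!!v. f v=(SUM k<=d. c k v * v m ^ k)"
  by blast
 show ?case
 proof (cases "i=m")
  case True
  let ?c = "%k v. if k=0 then 0 else c (k-1) v"
  have "hform m (Suc d - k) (?c k)" if "k<=Suc d" for k
  using that c(1)[of "k-1"] by (cases k) (auto intro: hform.zero)
  moreover have "v i * f v=(SUM k<=Suc d. ?c k v * v m ^ k)" for v
  unfolding sum.atMost_Suc_shift by (simp add: c(2) True sum_distrib_left algebra_simps)
  ultimately show ?thesis by (intro exI[of _ ?c]) simp
 next
  case False
  then have i: "i<m" using mult_var by simp
  let ?c = "%k v. if k=Suc d then 0 else v i * c k v"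
  have "hform m (Suc d - k) (?c k)" if "k<=Suc d" for k
  proof (cases "k=Suc d")
  case False
  then have "hform m (Suc (d - k)) (%v. v i * c k v)"
  using that c(1)[of k] i by (auto intro: hform.mult_var)
  then show ?thesis using False that by (simp add: Suc_diff_le)
  qed (auto intro: hform.zero)
  moreover have "v i * f v=(SUM k<=Suc d. ?c k v * v m ^ k)" for v
  by (auto simp: c(2) sum_distrib_left algebra_simps intro!: sum.cong)
  ultimately show ?thesis by (intro exI[of _ ?c]) simp
 qed
next
 case (add d f g)
 obtain c where c: "!!k. k<=d==>hform m (d - k) (c k)" "!!v. f v=(SUM k<=d. c k v * v m ^ k)"
  using add.IH(1) by blast
 obtain c' where c': "!!k. k<=d==>hform m (d - k) (c' k)" "!!v. g v=(SUM k<=d. c' k v * v m ^ k)"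
  using add.IH(2) by blast
 have "hform m (d - k) (%v. c k v + c' k v)" if "k<=d" for k
  using hform.add[OF c(1)[OF that] c'(1)[OF that]] .
 then show ?case
  by (intro exI[of _ "%k v. c k v + c' k v"]) (simp add: c(2) c'(2) sum.distrib algebra_simps)
qed

lemma hform_power_last: "hform m e c==>hform (Suc m) (e + k) (%v. c v * v m ^ k)"
 using hform_mult[OF hform_mono[of m e c "Suc m"] hform_power[OF hform_var[of m "Suc m"], of k]] by simp

section \<open>Vectors of functions and finite-dimensional spaces of them\<close>

text \<open>Elements of free modules, with coordinates indexed by \<open>'b\<close>. The index type
  grows when modules are multiplied; degrees and the finite index set actually used are recorded
  separately by \<open>VF\<close>.\<close>

type_synonym 'b vf = "'b=>vec=>complex"

definition scl :: "complex=>'b vf=>'b vf" where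
 "scl c ph=(%b v. c * ph b v)"

definition smul :: "(vec=>complex)=>'b vf=>'b vf" where
 "smul f ph=(%b v. f v * ph b v)"

interpretation fv: vector_space "scl :: complex=>'b vf=>_"
 by unfold_locales (auto simp: scl_def fun_eq_iff algebra_simps)

lemma smul_add [simp]: "smul f (ph+ps) = smul f ph + smul f ps"
 by (auto simp: smul_def fun_eq_iff algebra_simps)
lemma smul_diff [simp]: "smul f (ph-ps) = smul f ph - smul f ps"
 by (auto simp: smul_def fun_eq_iff algebra_simps)
lemma smul_0 [simp]: "smul f 0=0"
 by (auto simp: smul_def fun_eq_iff)
lemma smul_uminus [simp]: "smul f (- ph) = - smul f ph"
 by (auto simp: smul_def fun_eq_iff)
lemma smul_scl: "smul f (scl c ph) = scl c (smul f ph)"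
 by (auto simp: smul_def scl_def fun_eq_iff)
lemma smul_smul: "smul f (smul g ph) = smul (%v. f v * g v) ph"
 by (auto simp: smul_def fun_eq_iff)
lemma smul_commute: "smul f (smul g ph) = smul g (smul f ph)"
 by (auto simp: smul_def fun_eq_iff)
lemma smul_const: "smul (%v. c) ph = scl c ph"
 by (auto simp: smul_def scl_def)
lemma smul_one [simp]: "smul (%v. 1) ph=ph"
 by (auto simp: smul_def)
lemma smul_zero [simp]: "smul (%v. 0) ph=0"
 by (auto simp: smul_def fun_eq_iff)
lemma smul_plus: "smul (%v. f v+g v) ph = smul f ph + smul g ph"
 by (auto simp: smul_def fun_eq_iff algebra_simps)
lemma sum_apply2: "(SUM i:I. ph i) b v=(SUM i:I. ph i b v)" for ph :: "'i=>'b vf"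
 by (induction I rule: infinite_finite_induct) auto
lemma smul_sum: "smul f (SUM i:I. ph i)=(SUM i:I. smul f (ph i))"
 by (intro ext) (simp add: smul_def sum_apply2 sum_distrib_left)
lemma smul_sum_left: "smul (%v. SUM i:I. f i v) ph=(SUM i:I. smul (f i) ph)"
 by (intro ext) (simp add: smul_def sum_apply2 sum_distrib_right)

text \<open>\<open>fv.dim\<close> is 0 on an infinite-dimensional space, so every dimension count
  has to carry finiteness separately.\<close>

definition findim :: "'b vf set=>bool" where
 "findim W \<longleftrightarrow> (EX S. finite S&W \<subseteq> fv.span S)"

lemma findim_subset: "findim W==>U \<subseteq> W==>findim U"
 by (auto simp: findim_def)

lemma findim_basis:
 assumes "findim W" "fv.subspace W"
 obtains B where "finite B" "fv.independent B" "fv.span B=W" "B \<subseteq> W" "card B=fv.dim W"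
proof -
 obtain S where S: "finite S" "W \<subseteq> fv.span S" using assms(1) by (auto simp: findim_def)
 obtain B where B: "B \<subseteq> W" "fv.independent B" "W \<subseteq> fv.span B" "card B=fv.dim W"
  by (rule fv.basis_exists)
 have "finite B" using fv.independent_span_bound[OF S(1) B(2)] B(1) S(2) by blast
 moreover have "fv.span B=W" using fv.span_minimal[OF B(1) assms(2)] B(3) by auto
 ultimately show ?thesis using B that by blast
qed

lemma findim_basis_extend:
 assumes "findim W" "fv.subspace W" "A \<subseteq> W" "fv.independent A"
 obtains B where "A \<subseteq> B" "finite B" "fv.independent B" "fv.span B=W" "B \<subseteq> W" "card B=fv.dim W"
proof -
 obtain S where S: "finite S" "W \<subseteq> fv.span S" using assms(1) by (auto simp: findim_def)
 obtain B where B: "A \<subseteq> B" "B \<subseteq> W" "fv.independent B" "W \<subseteq> fv.span B"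
  using fv.maximal_independent_subset_extend[OF assms(3,4)] by blast
 have "finite B" using fv.independent_span_bound[OF S(1) B(3)] B(2) S(2) by blast
 moreover have "fv.span B=W" using fv.span_minimal[OF B(2) assms(2)] B(4) by auto
 ultimately have "card B=fv.dim W" using fv.dim_eq_card[of B W] B(3) assms(2)
  by (simp add: fv.span_eq_iff[THEN iffD2])
 with \<open>finite B\<close> \<open>fv.span B = W\<close> B that show ?thesis by blast
qed

lemma findim_dim_eq:
 assumes "findim W" "fv.subspace W" "fv.subspace U" "U \<subseteq> W" "fv.dim W<=fv.dim U"
 shows "U=W"
proof -
 obtain A where A: "finite A" "fv.independent A" "fv.span A=U" "A \<subseteq> U" "card A=fv.dim U"
  using findim_basis[OF findim_subset[OF assms(1,4)] assms(3)] .
 have "A \<subseteq> W" using A(4) assms(4) by blast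
 obtain B where B: "A \<subseteq> B" "finite B" "fv.independent B" "fv.span B=W" "B \<subseteq> W" "card B=fv.dim W"
  using findim_basis_extend[OF assms(1,2) \<open>A \<subseteq> W\<close> A(2)] .
 have "A=B" using card_seteq[OF B(2,1)] A(5) B(6) assms(5) by simp
 then show ?thesis using A B by blast
qed

lemma findim_chain:
 assumes "findim V" "!!j. fv.subspace (W j)" "!!j. W j \<subseteq> V" "!!j. W j \<subseteq> W (Suc j)"
 shows "EX J. ALL j>=J. W j=W (J::nat)"
proof -
 obtain S where S: "finite S" "V \<subseteq> fv.span S" using assms(1) by (auto simp: findim_def)
 have mono: "W i \<subseteq> W j" if "i<=j" for i j using lift_Suc_mono_le[of W, OF assms(4) that] .
 have bound: "fv.dim (W j) <= card S" for j
  using fv.dim_le_card[of "W j" S] S assms(3)[of j] by auto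
 have "finite (range (%j. fv.dim (W j)))"
  by (rule finite_subset[of _ "{..card S}"]) (use bound in auto)
 then have "Max (range (%j. fv.dim (W j))):range (%j. fv.dim (W j))" by (intro Max_in) auto
 then obtain J where J: "fv.dim (W J)=Max (range (%j. fv.dim (W j)))" by auto
 have "W j=W J" if "j >= J" for j
 proof -
  have "fv.dim (W j)<=fv.dim (W J)" using J \<open>finite (range _)\<close> by (simp add: Max_ge)
  then show ?thesis
  using findim_dim_eq[of "W j" "W J"] assms mono[OF that] findim_subset[OF assms(1), of "W j"] by auto
 qed
 then show ?thesis by blast
qed

primrec monomials :: "nat=>nat=>(vec=>complex) set" where
 "monomials 0 d={%v. 1}"
| "monomials (Suc m) d=(UN k<=d. (%f v. f v * v m ^ k) ` monomials m (d - k))"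

lemma finite_monomials: "finite (monomials m d)"
 by (induction m arbitrary: d) auto

definition single :: "'b=>(vec=>complex)=>'b vf" where
 "single b f=(%b' v. if b'=b then f v else 0)"

lemma single_scale: "single b (%v. c * f v) = scl c (single b f)"
 by (auto simp: single_def scl_def fun_eq_iff)
lemma single_sum: "single b (%v. SUM i:I. f i v)=(SUM i:I. single b (f i))"
 by (intro ext) (simp add: single_def sum_apply2)

lemma hform_0_iff: "hform 0 d f==>(EX c. f=(%v. c))"
 by (induction rule: hform.induct) auto

text \<open>The arbitrary factor \<open>g\<close> carries the powers of the later variables through
  the induction; afterwards it also serves to multiply all monomials by a power of one fixed
  coordinate.\<close>

lemma single_span_monomials:
 "hform m d f==>single b (%v. f v * g v):fv.span ((%f. single b (%v. f v * g v)) ` monomials m d)"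
proof (induction m arbitrary: d f g)
 case 0
 then obtain c where "f=(%v. c)" using hform_0_iff by blast
 then have "single b (%v. f v * g v) = scl c (single b g)" by (simp add: single_scale)
 then show "single b (%v. f v * g v):fv.span ((%f. single b (%v. f v * g v)) ` monomials 0 d)"
  by (simp add: fv.span_scale fv.span_base)
next
 case (Suc m)
 from hform_expand[OF Suc.prems] obtain c where c: "!!k. k<=d==>hform m (d - k) (c k)"
  "!!v. f v=(SUM k<=d. c k v * v m ^ k)" by blast
 have eq: "single b (%v. f v * g v)=(SUM k<=d. single b (%v. c k v * (v m ^ k * g v)))"
  unfolding c(2) sum_distrib_right single_sum by (simp add: mult.assoc)
 show ?case unfolding eq
 proof (rule fv.span_sum)
  fix k assume k: "k:{..d}"
  have "(%f. single b (%v. f v * (v m ^ k * g v))) ` monomials m (d - k) \<subseteq>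
  (%f. single b (%v. f v * g v)) ` monomials (Suc m) d"
  using k by (force simp: mult.assoc image_iff)
  with Suc.IH[OF c(1), of k "%v. v m ^ k * g v"] k
  show "single b (%v. c k v * (v m ^ k * g v)):fv.span ((%f. single b (%v. f v * g v)) ` monomials (Suc m) d)"
  using fv.span_mono by (metis (no_types, lifting) atMost_iff subsetD)
 qed
qed

section \<open>Graded submodules of a free module and the ascending chain condition\<close>

definition VF :: "nat=>'b set=>nat=>'b vf set" where
 "VF m B d={ph. (ALL b:B. hform m d (ph b))&(ALL b. b~:B-->ph b=(%v. 0))}"

lemma VF_hform: "ph : VF m B d==>hform m d (ph b)"
 by (cases "b:B") (auto simp: VF_def hform.zero)

lemma subspace_VF: "fv.subspace (VF m B d)"
 by (auto simp: fv.subspace_def VF_def scl_def zero_fun_def plus_fun_def hform.zero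
  intro: hform.add hform_scale)

lemma smul_VF: "hform m e f==>ph : VF m B d==>smul f ph : VF m B (e+d)"
 by (auto simp: VF_def smul_def intro: hform_mult)

lemma findim_VF:
 assumes "finite B" shows "findim (VF m B d)"
proof -
 let ?S = "UN b:B. (%f. single b f) ` monomials m d"
 have "ph : fv.span ?S" if "ph : VF m B d" for ph
 proof -
  have "ph=(SUM b:B. single b (ph b))"
  proof (intro ext)
  fix b v
  show "ph b v=(SUM b:B. single b (ph b)) b v"
  using that assms by (cases "b:B") (auto simp: sum_apply2 single_def sum.delta VF_def)
  qed
  moreover have "single b (ph b):fv.span ?S" if "b:B" for b
  using single_span_monomials[of m d "ph b" b "%v. 1"] VF_hform[OF \<open>ph : _\<close>, of b]
  fv.span_mono[of "(%f. single b f) ` monomials m d" ?S] that by auto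
  ultimately show ?thesis by (metis (no_types, lifting) fv.span_sum)
 qed
 moreover have "finite ?S" using assms finite_monomials by auto
 ultimately show ?thesis unfolding findim_def by blast
qed

text \<open>Graded submodules of a free module over the polynomial ring in \<open>m\<close> variables.\<close>

definition gsub :: "nat=>'b set=>(nat=>'b vf set)=>bool" where
 "gsub m B W \<longleftrightarrow> (ALL d. W d \<subseteq> VF m B d&fv.subspace (W d)) &
  (ALL d i w. i<m-->w:W d-->smul (%v. v i) w:W (Suc d))"

lemma gsub_subspace: "gsub m B W==>fv.subspace (W d)"
 by (auto simp: gsub_def)

lemma gsub_VF: "gsub m B W==>w:W d==>w:VF m B d"
 by (auto simp: gsub_def)

lemma gsub_0: "gsub m B W==>0:W d"
 and gsub_add: "gsub m B W==>w:W d==>w':W d==>w+w':W d"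
 and gsub_diff: "gsub m B W==>w:W d==>w':W d==>w-w':W d"
 and gsub_scl: "gsub m B W==>w:W d==>scl c w:W d"
 and gsub_sum: "gsub m B W==>(!!i. i:I==>f i:W d)==>(SUM i:I. f i):W d"
 by (meson gsub_subspace fv.subspace_0 fv.subspace_add fv.subspace_diff fv.subspace_scale fv.subspace_sum)+

lemma gsub_var: "gsub m B W==>i<m==>w:W d==>smul (%v. v i) w:W (Suc d)"
 by (auto simp: gsub_def)

lemma gsub_smul:
 assumes "gsub m B W" "hform m e f" shows "w:W d==>smul f w:W (e+d)"
 using assms(2)
proof (induction arbitrary: w rule: hform.induct)
 case (zero e) show "smul (%v. 0) w:W (e+d)" using gsub_0[OF assms(1)] by simp
next
 case (const c) then show ?case by (simp add: smul_const gsub_scl[OF assms(1)])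
next
 case (mult_var e f i)
 then show ?case using gsub_var[OF assms(1) mult_var.hyps(2) mult_var.IH[OF mult_var.prems]]
  by (simp add: smul_smul)
next
 case (add e f g)
 then show "smul (%v. f v+g v) w:W (e+d)" by (simp add: smul_plus gsub_add[OF assms(1)])
qed

lemma gsub_smul': "gsub m B W==>hform m e f==>w:W d==>k=e+d==>smul f w:W k"
 using gsub_smul by blast

lemma gsub_findim: "gsub m B W==>finite B==>findim (W d)"
 using findim_VF findim_subset gsub_VF by (metis subsetI)

lemma hform_0_pos: "hform 0 d f==>0<d==>f=(%v. 0)"
 by (induction rule: hform.induct) auto

definition horner :: "nat=>nat=>(nat=>'b vf)=>'b vf" where
 "horner m k C=(%b v. SUM l<k. C l b v * v m ^ l)"

lemma horner_add: "horner m k (%l. C l+C' l)=horner m k C+horner m k C'"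
 by (auto simp: horner_def fun_eq_iff sum.distrib algebra_simps)
lemma horner_diff: "horner m k (%l. C l-C' l)=horner m k C-horner m k C'"
 by (auto simp: horner_def fun_eq_iff sum_subtractf algebra_simps)
lemma horner_scl: "horner m k (%l. scl c (C l)) = scl c (horner m k C)"
 by (auto simp: horner_def scl_def fun_eq_iff sum_distrib_left algebra_simps)
lemma horner_smul: "horner m k (%l. smul f (C l)) = smul f (horner m k C)"
 by (auto simp: horner_def smul_def fun_eq_iff sum_distrib_left algebra_simps)
lemma horner_zero: "horner m k (%l. 0)=0"
 by (auto simp: horner_def fun_eq_iff)
lemma horner_shift:
 "horner m (Suc k) (%l. if l=0 then 0 else C (l-1)) = smul (%v. v m) (horner m k C)"
 by (intro ext) (simp add: horner_def smul_def sum.lessThan_Suc_shift sum_distrib_left algebra_simps del: sum.lessThan_Suc)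

lemma VF_expand:
 assumes "ph : VF (Suc m) B d"
 shows "EX C. (ALL l<=d. C l:VF m B (d-l))&ph=horner m (Suc d) C"
proof -
 have "EX c. (ALL k<=d. hform m (d - k) (c k))&(ALL v. ph b v=(SUM k<=d. c k v * v m ^ k))" for b
  using hform_expand[OF VF_hform[OF assms]] .
 then obtain c where c: "!!b k. k<=d==>hform m (d - k) (c b k)"
  "!!b v. ph b v=(SUM k<=d. c b k v * v m ^ k)" by metis
 let ?C = "%l b. if b:B then c b l else (%v. 0)"
 have "ph=horner m (Suc d) ?C"
 proof (intro ext)
  fix b v
  show "ph b v=horner m (Suc d) ?C b v"
  proof (cases "b:B")
  case False then have "ph b=(%v. 0)" using assms by (simp add: VF_def)
  with False show ?thesis by (simp add: horner_def)
  qed (simp add: horner_def c(2) lessThan_Suc_atMost)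
 qed
 moreover have "ALL l<=d. ?C l:VF m B (d-l)" by (auto simp: VF_def c(1))
 ultimately show ?thesis by (intro exI[of _ ?C]) simp
qed

text \<open>Leading coefficients (with respect to the last variable) of the elements of degree \<open>k\<close>
 in that variable, as in Hilbert's proof of the basis theorem.\<close>

definition lead :: "nat=>'b set=>(nat=>'b vf set)=>nat=>nat=>'b vf set" where
 "lead m B W k e={c. EX C. C k = c&(ALL l<=k. C l:VF m B (e + k-l))&horner m (Suc k) C:W (e + k)}"

lemma gsub_lead:
 assumes W: "gsub (Suc m) B W" shows "gsub m B (lead m B W k)"
 unfolding gsub_def
proof (intro conjI allI impI)
 note sub = subspace_VF[of m B]
 fix d
 show "lead m B W k d \<subseteq> VF m B d" by (force simp: lead_def)
 show "fv.subspace (lead m B W k d)"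
  unfolding fv.subspace_def
 proof (intro conjI ballI allI)
  show "0:lead m B W k d"
  unfolding lead_def mem_Collect_eq
  by (rule exI[of _ "%l. 0"]) (simp add: horner_zero gsub_0[OF W] fv.subspace_0[OF sub])
 next
  fix x y assume "x:lead m B W k d" "y:lead m B W k d"
  then obtain C C' where C: "C k=x" "ALL l<=k. C l:VF m B (d + k-l)" "horner m (Suc k) C:W (d + k)"
  "C' k=y" "ALL l<=k. C' l:VF m B (d + k-l)" "horner m (Suc k) C':W (d + k)"
  unfolding lead_def by blast
  then show "x+y:lead m B W k d"
  unfolding lead_def mem_Collect_eq
  by (intro exI[of _ "%l. C l+C' l"]) (simp add: horner_add gsub_add[OF W] fv.subspace_add[OF sub])
 next
  fix c x assume "x:lead m B W k d"
  then obtain C where C: "C k=x" "ALL l<=k. C l:VF m B (d + k-l)" "horner m (Suc k) C:W (d + k)"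
  unfolding lead_def by blast
  then show "scl c x:lead m B W k d"
  unfolding lead_def mem_Collect_eq
  by (intro exI[of _ "%l. scl c (C l)"]) (simp add: horner_scl gsub_scl[OF W] fv.subspace_scale[OF sub])
 qed
next
 fix d i w assume i: "i<m" and "w:lead m B W k d"
 then obtain C where C: "C k=w" "ALL l<=k. C l:VF m B (d + k-l)" "horner m (Suc k) C:W (d + k)"
  unfolding lead_def by blast
 have "smul (%v. v i) (C l):VF m B (Suc d + k-l)" if "l <= k" for l
  using smul_VF[OF hform_var[OF i], of "C l" B "d + k-l"] C(2) that by (simp add: Suc_diff_le)
 moreover have "smul (%v. v i) (horner m (Suc k) C):W (Suc (d + k))"
  using gsub_var[OF W _ C(3), of i] i by simp
 ultimately show "smul (%v. v i) w:lead m B W k (Suc d)"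
  unfolding lead_def mem_Collect_eq using C(1)
  by (intro exI[of _ "%l. smul (%v. v i) (C l)"]) (simp add: horner_smul)
qed

lemma lead_Suc:
 assumes W: "gsub (Suc m) B W" shows "lead m B W k e \<subseteq> lead m B W (Suc k) e"
proof
 fix w assume "w:lead m B W k e"
 then obtain C where C: "C k=w" "ALL l<=k. C l:VF m B (e + k-l)" "horner m (Suc k) C:W (e + k)"
  unfolding lead_def by blast
 let ?C = "%l. if l=0 then 0 else C (l-1)"
 have "?C l:VF m B (e+Suc k-l)" if "l<=Suc k" for l
  using C(2) that fv.subspace_0[OF subspace_VF[of m B]] by (cases l) auto
 moreover have "horner m (Suc (Suc k)) ?C:W (e+Suc k)"
  unfolding horner_shift using gsub_var[OF W _ C(3), of m] by simp
 ultimately show "w:lead m B W (Suc k) e"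
  unfolding lead_def mem_Collect_eq using C(1) by (intro exI[of _ ?C]) simp
qed

lemma lead_mono: "(!!d. W d \<subseteq> W' d)==>lead m B W k e \<subseteq> lead m B W' k e"
 unfolding lead_def by blast

text \<open>Descent on the number of powers of the last variable: the leading coefficient of an
  element of \<open>W'\<close> is also that of an element of \<open>W\<close>, and their difference
  involves one power less.\<close>

lemma lead_eqD:
 assumes W: "gsub (Suc m) B W" and W': "gsub (Suc m) B W'" and sub: "!!d. W d \<subseteq> W' d"
  and lead: "!!k e. lead m B W' k e \<subseteq> lead m B W k e"
 shows "W' d \<subseteq> W d"
proof -
 have "w:W d" if "w:W' d" "K<=Suc d" "!!l. l<K==>C l:VF m B (d-l)" "w=horner m K C"
  for K w C
  using that
 proof (induction K arbitrary: w C)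
  case 0 then have "w=0" by (auto simp: horner_def fun_eq_iff)
  then show ?case using gsub_0[OF W] by metis
 next
  case (Suc K)
  then have "C K:lead m B W' K (d-K)" unfolding lead_def by auto
  then have "C K:lead m B W K (d-K)" using lead by blast
  then obtain C' where C': "C' K=C K" "ALL l<=K. C' l:VF m B (d-l)" "horner m (Suc K) C':W d"
  unfolding lead_def using Suc.prems(2) by auto
  let ?w = "w-horner m (Suc K) C'"
  have "?w:W' d" using gsub_diff[OF W' Suc.prems(1)] C'(3) sub by blast
  define D where "D=(%l. C l-C' l)"
  have "?w=horner m K D"
  unfolding Suc.prems(4) D_def horner_diff[symmetric] by (auto simp: horner_def C'(1) fun_eq_iff)
  moreover have "D l:VF m B (d-l)" if "l<K" for l
  unfolding D_def by (rule fv.subspace_diff[OF subspace_VF]) (use Suc.prems(3)[of l] C'(2) that in simp_all)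
  ultimately have "?w:W d" using \<open>?w:W' d\<close> Suc.prems(2) by (intro Suc.IH[of ?w D]) simp_all
  then show ?case using gsub_add[OF W _ C'(3), of ?w] by simp
 qed
 then show ?thesis using VF_expand[OF gsub_VF[OF W']] by (metis le_refl less_Suc_eq_le subsetI)
qed

text \<open>Hilbert's basis theorem as a chain condition. The modules \<open>?L j k\<close> of
  leading coefficients increase in both arguments. Once their diagonal is constant from
  \<open>J0\<close> on, all rows with \<open>k\<close> at least \<open>J0\<close> are settled
  together; the finitely many other rows stabilise one by one. By \<open>lead_eqD\<close> equal
  leading coefficients force equal modules.\<close>

theorem gsub_chain:
 assumes "finite B" "!!j. gsub m B (W j)" "!!j d. W j d \<subseteq> W (Suc j) d"
 shows "EX J. ALL j>=J. W j=W (J::nat)"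
 using assms(2,3)
proof (induction m arbitrary: W)
 case 0
 have "EX J. ALL j>=J. W j 0=W J 0"
  by (rule findim_chain[OF findim_VF[OF assms(1), of 0 0]])
  (use 0 in \<open>auto intro: gsub_subspace gsub_VF\<close>)
 then obtain J where J: "!!j. j >= J==>W j 0=W J 0" by blast
 have "W j d={0}" if "d > 0" for j d
 proof -
  have "w=0" if "w:W j d" for w
  using hform_0_pos[OF VF_hform[OF gsub_VF[OF 0(1) that]] \<open>d > 0\<close>] by (auto simp: fun_eq_iff)
  then show ?thesis using gsub_0[OF 0(1), of j d] by auto
 qed
 then have "W j=W J" if "j >= J" for j
  using J[OF that] by (intro ext) (metis not_gr0)
 then show ?case by blast
next
 case (Suc m)
 let ?L = "%j k. lead m B (W j) k"
 have mono: "W i d \<subseteq> W j d" if "i<=j" for i j d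
  using lift_Suc_mono_le[of "%j. W j d", OF Suc.prems(2) that] .
 have monoL: "?L i k e \<subseteq> ?L j l e" if "i<=j" "k<=l" for i j k l e
  using lead_mono[of "W i" "W j" m B k e, OF mono[OF that(1)]]
  lift_Suc_mono_le[of "%k. ?L j k e", OF lead_Suc[OF Suc.prems(1)] that(2)] by blast
 have "EX J. ALL j>=J. ?L j j=?L J J"
  by (rule Suc.IH) (simp_all add: gsub_lead[OF Suc.prems(1)] monoL)
 then obtain J0 where J0: "!!j. j >= J0==>?L j j=?L J0 J0" by metis
 have "EX J. ALL j>=J. ?L j k=?L J k" for k
  by (rule Suc.IH) (simp_all add: gsub_lead[OF Suc.prems(1)] monoL)
 then obtain J1 where J1: "!!k j. j >= J1 k==>?L j k=?L (J1 k) k" by metis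
 define J where "J=Max (insert J0 (J1 ` {..<J0}))"
 have J_ge: "J >= J0" "!!k. k<J0==>J >= J1 k" unfolding J_def by simp_all
 have eq: "?L j k=?L J k" if "j >= J" for j k
 proof (cases "k<J0")
  case True then show ?thesis using J1 J_ge(2) that by (metis le_trans)
 next
  case False
  have "?L i k=?L J0 J0" if "i >= J0" for i
  proof (intro ext equalityI)
  fix e
  show "?L i k e \<subseteq> ?L J0 J0 e"
  using monoL[of i "max i k" k "max i k" e] J0[of "max i k"] that by simp
  show "?L J0 J0 e \<subseteq> ?L i k e" using monoL[of J0 i J0 k e] that False by simp
  qed
  then show ?thesis using J_ge(1) that by simp
 qed
 have "W j=W J" if "j >= J" for j
 proof (intro ext equalityI)
  fix d
  show "W J d \<subseteq> W j d" using mono[OF that] .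
  show "W j d \<subseteq> W J d"
  by (rule lead_eqD[OF Suc.prems(1)[of J] Suc.prems(1)[of j]]) (use mono[OF that] eq[OF that] in auto)
 qed
 then show ?case by blast
qed

lemma gsub_maximal:
 assumes "finite B" "P W" "!!W. P W==>gsub m B W"
 shows "EX M. P M&(ALL W'. P W'-->(ALL d. M d \<subseteq> W' d)-->W'=M)"
proof (rule ccontr)
  assume "~?thesis"
  then have step: "!!M. P M==>EX W'. P W'&(ALL d. M d \<subseteq> W' d)&W'~=M" by metis
  obtain f where f: "!!j. P (f j)" "!!j. (ALL d. f j d \<subseteq> f (Suc j) d)&f (Suc j)~=f j"
  using dependent_nat_choice[of "%j M. P M" "%j M W'. (ALL d. M d \<subseteq> W' d)&W'~=M"]
  assms(2) step by metis
  then obtain J where "!!j. j >= J==>f j=f J"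
  using gsub_chain[OF assms(1), of m f] assms(3) by metis
  then show False using f(2)[of J] by (metis le_SucI le_refl)
qed

section \<open>The graded Nullstellensatz\<close>

text \<open>Says that \<open>f\<close> annihilates the quotient \<open>V / W\<close>, without
  forming the quotient.\<close>

definition kills :: "nat=>(vec=>complex)=>(nat=>'b vf set) =>
  (nat=>'b vf set)=>bool" where
 "kills d f V W \<longleftrightarrow> (ALL k. ALL w:V k. smul f w:W (d + k))"

lemma gsub_comap:
 assumes V: "gsub m B V" and W: "gsub m B W" and f: "hform m e f"
 shows "gsub m B (%d. {w:V d. smul f w:W (e+d)})"
 unfolding gsub_def
proof (intro conjI allI impI)
 fix d
 show "{w:V d. smul f w:W (e+d)} \<subseteq> VF m B d" using gsub_VF[OF V] by blast
 show "fv.subspace {w:V d. smul f w:W (e+d)}"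
  by (auto simp: fv.subspace_def gsub_0[OF V] gsub_0[OF W] gsub_add[OF V] gsub_add[OF W]
  gsub_scl[OF V] gsub_scl[OF W] smul_scl)
next
 fix d i w assume i: "i<m" and w: "w:{w:V d. smul f w:W (e+d)}"
 then have "smul (%v. v i) (smul f w):W (Suc (e+d))" using gsub_var[OF W i] by blast
 then show "smul (%v. v i) w:{w:V (Suc d). smul f w:W (e+Suc d)}"
  using gsub_var[OF V i] w by (simp add: smul_commute[of f])
qed

lemma gsub_plus_smul:
 assumes V: "gsub m B V" and W: "gsub m B W" and h: "hform m 1 h"
 shows "gsub m B (%d. {w. EX u x. w=u + smul h x&u:W d&(if d=0 then x=0 else x:V (d-1))})"
  (is "gsub m B ?B")
 unfolding gsub_def
proof (intro conjI allI impI)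
 fix d
 have hx: "smul h x:VF m B d" if "if d=0 then x=0 else x:V (d-1)" for x
  using that smul_VF[OF h gsub_VF[OF V], of x "d-1"] fv.subspace_0[OF subspace_VF[of m B d]]
  by (auto split: if_splits)
 show "?B d \<subseteq> VF m B d"
  using hx fv.subspace_add[OF subspace_VF] gsub_VF[OF W] by blast
 let ?X = "if d=0 then {0} else V (d-1)"
 have X: "fv.subspace ?X" using gsub_subspace[OF V] fv.subspace_single_0 by auto
 have B: "?B d={u + smul h x | u x. u:W d&x : ?X}" by auto
 show "fv.subspace (?B d)"
  unfolding B fv.subspace_def
 proof (intro conjI ballI allI)
  show "0:{u + smul h x |u x. u:W d&x : ?X}"
  using fv.subspace_0[OF X] gsub_0[OF W, of d] by (intro CollectI exI[of _ 0]) simp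
 next
  fix a b assume "a:{u + smul h x |u x. u:W d&x : ?X}" "b:{u + smul h x |u x. u:W d&x : ?X}"
  then obtain u x u' x' where "a=u + smul h x" "u:W d" "x : ?X"
  "b=u' + smul h x'" "u':W d" "x' : ?X" by blast
  then show "a+b:{u + smul h x |u x. u:W d&x : ?X}"
  using fv.subspace_add[OF X] gsub_add[OF W]
  by (intro CollectI exI[of _ "u+u'"] exI[of _ "x+x'"]) (auto simp: algebra_simps)
 next
  fix c a assume "a:{u + smul h x |u x. u:W d&x : ?X}"
  then obtain u x where "a=u + smul h x" "u:W d" "x : ?X" by blast
  then show "scl c a:{u + smul h x |u x. u:W d&x : ?X}"
  using fv.subspace_scale[OF X] gsub_scl[OF W]
  by (intro CollectI exI[of _ "scl c u"] exI[of _ "scl c x"]) (auto simp: fv.scale_right_distrib smul_scl)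
 qed
next
 fix d i w assume i: "i<m" and "w : ?B d"
 then obtain u x where w: "w=u + smul h x" "u:W d" "if d=0 then x=0 else x:V (d-1)" by blast
 have "smul (%v. v i) w = smul (%v. v i) u + smul h (smul (%v. v i) x)"
  unfolding w(1) by (simp add: smul_commute)
 moreover have "smul (%v. v i) x:V d"
  using w(3) gsub_var[OF V i, of x "d-1"] gsub_0[OF V, of 0] by (cases d) auto
 ultimately show "smul (%v. v i) w : ?B (Suc d)" using gsub_var[OF W i w(2)] by auto
qed

lemma hform_pow1: "hform m 1 h==>hform m k (%v. h v ^ k)"
 using hform_power[of m 1 h k] by simp

text \<open>On \<open>V / W\<close> each coordinate acts as the multiple \<nu> j of one linear form
  \<open>s\<close>, so a form of degree \<open>e\<close> acts as its value at \<nu> times the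
  \<open>e\<close>-th power of \<open>s\<close>: the quotient sees only the point \<nu>.\<close>

lemma kills_hform_eval:
 assumes V: "gsub m B V" and W: "gsub m B W" and WV: "!!d. W d \<subseteq> V d" and s: "hform m 1 s"
  and kill: "!!j. j<m==>kills 1 (%v. v j - \<nu> j * s v) V W" and f: "hform m e f"
 shows "w:V d==>smul (%v. f v-f \<nu> * s v ^ e) w:W (e+d)"
 using f
proof (induction arbitrary: w rule: hform.induct)
 case (zero e)
 have "smul (%v. 0-0 * s v ^ e) w=0" by simp
 then show "smul (%v. 0-0 * s v ^ e) w:W (e+d)" using gsub_0[OF W, of "e+d"] by (simp only:)
next
 case (const c)
 have "smul (%v. c - c * s v ^ 0) w=0" by simp
 then show "smul (%v. c - c * s v ^ 0) w:W (0+d)" using gsub_0[OF W, of "0+d"] by (simp only:)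
next
 case (mult_var e f i)
 have "smul (%v. v i * f v - \<nu> i * f \<nu> * s v ^ Suc e) w =
  smul (%v. v i) (smul (%v. f v-f \<nu> * s v ^ e) w) + smul (%v. v i - \<nu> i * s v) (smul (%v. f \<nu> * s v ^ e) w)"
  by (intro ext) (simp add: smul_def algebra_simps)
 moreover have "smul (%v. v i) (smul (%v. f v-f \<nu> * s v ^ e) w):W (Suc (e+d))"
  using gsub_var[OF W mult_var.hyps(2) mult_var.IH[OF mult_var.prems]] .
 moreover have "smul (%v. f \<nu> * s v ^ e) w:V (e+d)"
  using gsub_smul[OF V hform_scale[OF hform_pow1[OF s]] mult_var.prems] .
 then have "smul (%v. v i - \<nu> i * s v) (smul (%v. f \<nu> * s v ^ e) w):W (Suc (e+d))"
  using kill[OF mult_var.hyps(2)] unfolding kills_def by auto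
 ultimately show "smul (%v. v i * f v - \<nu> i * f \<nu> * s v ^ Suc e) w:W (Suc e+d)"
  using gsub_add[OF W] by simp
next
 case (add e f g)
 have "smul (%v. f v+g v-(f \<nu> + g \<nu>) * s v ^ e) w =
  smul (%v. f v-f \<nu> * s v ^ e) w + smul (%v. g v-g \<nu> * s v ^ e) w"
  by (simp add: fun_eq_iff smul_def algebra_simps)
 then show "smul (%v. f v+g v-(f \<nu> + g \<nu>) * s v ^ e) w:W (e+d)"
  using gsub_add[OF W add.IH(1)[OF add.prems] add.IH(2)[OF add.prems]] by simp
qed

text \<open>The homogenisation of \<open>P\<close> to degree \<open>N\<close>, with t = v j / v
  i.\<close>

definition binary :: "nat=>nat=>nat=>complex poly=>vec=>complex" where
 "binary i j N P v=(SUM t<=N. coeff P t * v j ^ t * v i ^ (N-t))"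

lemma binary_add: "binary i j N (P+Q) v=binary i j N P v+binary i j N Q v"
 by (simp add: binary_def sum.distrib algebra_simps)
lemma binary_smult: "binary i j N (smult c P) v = c * binary i j N P v"
 by (simp add: binary_def sum_distrib_left algebra_simps)
lemma binary_0: "binary i j N 0 v=0"
 by (simp add: binary_def)
lemma binary_sum: "binary i j N (SUM x:X. P x) v=(SUM x:X. binary i j N (P x) v)"
 by (induction X rule: infinite_finite_induct) (auto simp: binary_add binary_0)

lemma binary_Suc: "degree P<=N==>binary i j (Suc N) P v = v i * binary i j N P v"
 by (simp add: binary_def sum_distrib_left coeff_eq_0 Suc_diff_le algebra_simps)

lemma binary_pCons: "binary i j (Suc N) (pCons 0 P) v = v j * binary i j N P v"
 unfolding binary_def sum.atMost_Suc_shift by (simp add: sum_distrib_left algebra_simps)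

lemma binary_linear:
 assumes "degree P<=N"
 shows "binary i j (Suc N) ([:-\<nu>, 1:] * P) v=(v j - \<nu> * v i) * binary i j N P v"
proof -
 have eq: "[:-\<nu>, 1:] * P = smult (-\<nu>) P+pCons 0 P" by simp
 show ?thesis unfolding eq binary_add binary_smult binary_pCons binary_Suc[OF assms]
  by (simp add: algebra_simps)
qed

lemma binary_prod:
 assumes "finite L"
 shows "binary i j (card L) (PROD \<mu>:L. [:-\<mu>, 1:]) v=(PROD \<mu>:L. v j - \<mu> * v i)"
 using assms
proof (induction L rule: finite_induct)
 case empty show ?case by (simp add: binary_def)
next
 case (insert \<mu> L)
 have "degree (PROD \<mu>:L. [:-\<mu>, 1:]) <= card L"
  using degree_prod_sum_le[OF insert(1), of "%\<mu>. [:-\<mu>, 1:]"] by simp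
 with insert show ?case by (simp add: binary_linear del: mult_pCons_left)
qed

lemma hform_binary: "i<m==>j<m==>hform m N (binary i j N P)"
 unfolding binary_def
 by (intro hform_sum hform_mult'[OF hform_scale[OF hform_pow1[OF hform_var]] hform_pow1[OF hform_var]]) auto

text \<open>If every linear form in the pencil spanned by \<open>x\<^sub>i, x\<^sub>j\<close> is injective modulo \<open>W\<close>, then so is every
  nonzero binary form in \<open>x\<^sub>i, x\<^sub>j\<close>, because it splits into linear factors.\<close>

lemma binary_injective:
 assumes V: "gsub m B V" and ij: "i<m" "j<m"
  and inj_i: "!!d w. w:V d==>smul (%v. v i) w:W (Suc d)==>w:W d"
  and inj: "!!\<nu> d w. w:V d==>smul (%v. v j - \<nu> * v i) w:W (Suc d)==>w:W d"
  and W: "gsub m B W"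
 shows "P~=0==>degree P<=N==>w:V d==>smul (binary i j N P) w:W (N+d)==>w:W d"
proof (induction N arbitrary: P)
 case 0
 then have c: "coeff P 0~=0" by (metis le_zero_eq leading_coeff_0_iff)
 have "smul (binary i j 0 P) w = scl (coeff P 0) w"
  by (simp add: smul_def scl_def binary_def fun_eq_iff)
 with 0 have "scl (coeff P 0) w:W d" by simp
 from gsub_scl[OF W this, of "1 / coeff P 0"] show ?case using c by simp
next
 case (Suc N)
 have V': "smul (binary i j N Q) w:V (N+d)" for Q
  using gsub_smul[OF V hform_binary[OF ij] Suc.prems(3)] .
 show ?case
 proof (cases "degree P<=N")
  case True
  have "smul (%v. v i) (smul (binary i j N P) w):W (Suc (N+d))"
  using Suc.prems(4) by (simp add: smul_def binary_Suc[OF True] algebra_simps)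
  then show ?thesis using Suc.IH[OF Suc.prems(1) True Suc.prems(3)] inj_i[OF V'] by blast
 next
  case False
  then have deg: "degree P=Suc N" using Suc.prems by simp
  then obtain \<nu> where "poly P \<nu> = 0"
  using fundamental_theorem_of_algebra[of P] by (auto simp: constant_degree)
  then obtain Q where Q: "P=[:-\<nu>, 1:] * Q" by (auto simp: poly_eq_0_iff_dvd dvd_def)
  have "Q~=0" using Q Suc.prems(1) by auto
  then have "degree Q<=N" using deg unfolding Q by (subst (asm) degree_mult_eq) auto
  have "smul (%v. v j - \<nu> * v i) (smul (binary i j N Q) w):W (Suc (N+d))"
  proof -
  have "binary i j (Suc N) P=(%v. (v j - \<nu> * v i) * binary i j N Q v)"
  unfolding Q using binary_linear[OF \<open>degree Q <= N\<close>] by blast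
  then show ?thesis using Suc.prems(4) by (simp add: smul_smul)
  qed
  then show ?thesis using Suc.IH[OF \<open>Q ~= 0\<close> \<open>degree Q <= N\<close> Suc.prems(3)] inj[OF V'] by blast
 qed
qed

lemma findim_dependent:
 assumes "findim V" "infinite \<Lambda>" "!!t. t:\<Lambda> ==> u t:V"
 shows "EX L c. finite L&L \<subseteq> \<Lambda> & (EX t:L. c t~=0)&(SUM t:L. scl (c t) (u t))=0"
proof (cases "inj_on u \<Lambda>")
 case False
 then obtain x y where xy: "x:\<Lambda>" "y:\<Lambda>" "x~=y" "u x=u y" unfolding inj_on_def by blast
 have "(SUM t:{x, y}. scl (if t=x then 1 else -1) (u t))=0" using xy by simp
 then show ?thesis using xy
  by (intro exI[of _ "{x, y}"] exI[of _ "% t. if t=x then 1 else -1"]) simp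
next
 case True
 obtain S where S: "finite S" "V \<subseteq> fv.span S" using assms(1) by (auto simp: findim_def)
 obtain L where L: "finite L" "card L=Suc (card S)" "L \<subseteq> \<Lambda>"
  using infinite_arbitrarily_large[OF assms(2)] by blast
 have inj: "inj_on u L" using True L(3) inj_on_subset by blast
 have "~fv.independent (u ` L)"
  using fv.independent_span_bound[OF S(1), of "u ` L"] S(2) assms(3) L card_image[OF inj] by fastforce
 then obtain c where c: "EX w:u ` L. c w~=0" "(SUM w:u ` L. scl (c w) w)=0"
  using fv.dependent_finite[of "u ` L"] L(1) by auto
 then have "(SUM t:L. scl (c (u t)) (u t))=0" by (simp add: sum.reindex[OF inj])
 then show ?thesis using c(1) L by (intro exI[of _ L] exI[of _ "% t. c (u t)"]) auto
qed

text \<open>If all fibres were finite, the complex numbers would be a countable union of finite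
  sets. This lets one exponent serve infinitely many members of a pencil.\<close>

lemma infinite_fiber:
 fixes k :: "complex=>nat" shows "EX K. infinite {t. k t=K}"
proof (rule ccontr)
 assume "~?thesis"
 then have "countable (\<Union>K. {t. k t=K})" by (intro countable_UN) (auto simp: countable_finite)
 moreover have "(\<Union>K. {t. k t=K})=UNIV" by auto
 ultimately show False using uncountable_UNIV_complex by simp
qed

text \<open>By the chain condition there is a largest \<open>W\<close> between \<open>U\<close> and
  \<open>V\<close> such that no power of \<open>g\<close> annihilates \<open>V / W\<close>.
  Maximality makes \<open>g\<close> injective on \<open>V / W\<close> and makes every linear form
  either injective or zero there. A pencil argument then shows that all coordinates are proportional
  on \<open>V / W\<close>, so the quotient sits at one point \<nu>. There \<open>g\<close> cannot
  vanish, and the form \<open>f\<close> given by the local hypothesis would act both as zero and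
  injectively.\<close>

theorem graded_nullstellensatz:
 fixes V U :: "nat=>'b vf set"
 assumes B: "finite B" and U: "gsub m B U" and V: "gsub m B V" and UV: "!!d. U d \<subseteq> V d"
  and g: "hform m e g" and e: "0<e"
  and local: "!!p. g p~=0==>EX d f. hform m d f&f p~=0&kills d f V U"
 shows "EX k. kills (k * e) (%v. g v ^ k) V U"
proof (rule ccontr)
 assume none: "~?thesis"
 define Q where "Q=(%W. gsub m B W&(ALL d. U d \<subseteq> W d&W d \<subseteq> V d) &
  (ALL k. ~kills (k * e) (%v. g v ^ k) V W))"
 have "Q U" using none U UV by (auto simp: Q_def)
 have Qg: "!!W. Q W==>gsub m B W" by (simp add: Q_def)
 obtain W where QW: "Q W" and max: "!!W'. Q W'==>(!!d. W d \<subseteq> W' d)==>W'=W"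
  using gsub_maximal[where P = Q, OF B \<open>Q U\<close> Qg] by blast
 have W: "gsub m B W" and UW: "!!d. U d \<subseteq> W d" and WV: "!!d. W d \<subseteq> V d"
  and noneW: "!!k. ~kills (k * e) (%v. g v ^ k) V W"
  using QW by (auto simp: Q_def)
 have bigger: "EX k. kills (k * e) (%v. g v ^ k) V W'"
  if "gsub m B W'" "!!d. W d \<subseteq> W' d" "!!d. W' d \<subseteq> V d" "W'~=W" for W'
  using max[of W'] that UW unfolding Q_def by (meson subset_trans)
 have gk: "hform m (k * e) (%v. g v ^ k)" for k using hform_power[OF g] .
 have g_inj: "w:W d" if "w:V d" "smul g w:W (e+d)" for w d
 proof (rule ccontr)
  assume "w~:W d"
  let ?T = "%d. {w:V d. smul g w:W (e+d)}"
  have "W d \<subseteq> ?T d" for d using WV gsub_smul[OF W g] by blast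
  moreover have "?T~=W" using that \<open>w~:W d\<close> by (auto dest: fun_cong[of _ _ d])
  ultimately obtain k where k: "kills (k * e) (%v. g v ^ k) V ?T"
  using bigger[OF gsub_comap[OF V W g]] by blast
  have "kills (Suc k * e) (%v. g v ^ Suc k) V W"
  using k unfolding kills_def by (simp add: smul_smul add.assoc)
  then show False using noneW by blast
 qed
 have gk_inj: "w:W d" if "w:V d" "smul (%v. g v ^ k) w:W (k * e+d)" for w d k
  using that(2)
 proof (induction k)
  case 0 then show ?case by simp
 next
  case (Suc k)
  have "smul g (smul (%v. g v ^ k) w):W (e+(k * e+d))"
  using Suc.prems by (simp add: smul_smul add.assoc)
  from Suc.IH[OF g_inj[OF gsub_smul[OF V gk that(1)] this]] show ?case .
 qed
 \<comment> \<open>The elements that \<open>h\<close> maps into \<open>W\<close> form a module; if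
   it is larger than \<open>W\<close>, a power of \<open>g\<close> maps all of \<open>V\<close> into
   it, and injectivity of \<open>g\<close> shows that \<open>h\<close> kills everything.\<close>
 have lin_inj: "w:W d" if h: "hform m 1 h" "~kills 1 h V W" and w: "w:V d" "smul h w:W (Suc d)" for h w d
 proof (rule ccontr)
  assume "w~:W d"
  let ?T = "%d. {w:V d. smul h w:W (1+d)}"
  have "W d \<subseteq> ?T d" for d using WV gsub_smul[OF W h(1)] by blast
  moreover have "?T~=W" using w \<open>w~:W d\<close> by (auto dest: fun_cong[of _ _ d])
  ultimately obtain k where k: "kills (k * e) (%v. g v ^ k) V ?T"
  using bigger[OF gsub_comap[OF V W h(1)]] by blast
  have "kills 1 h V W" unfolding kills_def
  proof (intro allI ballI)
  fix j x assume x: "x:V j"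
  have "smul h (smul (%v. g v ^ k) x):W (1+(k * e+j))" using k x unfolding kills_def by blast
  then have "smul (%v. g v ^ k) (smul h x):W (k * e+(1+j))"
  by (simp add: smul_commute[of h])
  then show "smul h x:W (1+j)" using gk_inj[OF gsub_smul[OF V h(1) x]] by blast
  qed
  then show False using h(2) by blast
 qed
 obtain d0 v0 where v0: "v0:V d0" "v0~:W d0"
  using noneW[of 0] unfolding kills_def by auto
 \<comment> \<open>Otherwise each \<open>W\<close> + (v j - \<nu> v i) \<open>V\<close> is larger
   than \<open>W\<close> and contains g^k \<open>v0\<close> for some k; one exponent
   \<open>K\<close> works for infinitely many \<nu>. The cofactors \<open>x\<close> lie in a
   finite-dimensional space, so a linear dependency among them yields a nonzero binary form mapping
   g^K \<open>v0\<close> into \<open>W\<close>, contrary to injectivity.\<close>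
 have pencil: "EX \<nu>. kills 1 (%v. v j - \<nu> * v i) V W"
  if i: "i<m" and j: "j<m" and ni: "~kills 1 (%v. v i) V W" for i j
 proof (rule ccontr)
  assume nk: "~?thesis"
  have h: "hform m 1 (%v. v j - \<nu> * v i)" for \<nu>
  using hform_diff[OF hform_var[OF j] hform_scale[OF hform_var[OF i]]] .
  let ?T = "%\<nu> d. {w. EX u x. w=u + smul (%v. v j - \<nu> * v i) x&u:W d&(if d=0 then x=0 else x:V (d-1))}"
  have "EX k. kills (k * e) (%v. g v ^ k) V (?T \<nu>)" for \<nu>
  proof (rule bigger)
  show "gsub m B (?T \<nu>)" by (rule gsub_plus_smul[OF V W h])
  show "W d \<subseteq> ?T \<nu> d" for d
  proof
  fix w assume w: "w:W d"
  show "w : ?T \<nu> d"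
  using gsub_0[OF V] w by (intro CollectI exI[of _ w] exI[of _ 0]) simp
  qed
  show "?T \<nu> d \<subseteq> V d" for d
  proof
  fix w assume "w : ?T \<nu> d"
  then obtain u x where ux: "w=u + smul (%v. v j - \<nu> * v i) x" "u:W d" "if d=0 then x=0 else x:V (d-1)"
  by blast
  have "smul (%v. v j - \<nu> * v i) x:V d"
  using ux(3) gsub_smul[OF V h, of x "d-1" \<nu>] gsub_0[OF V, of d] by (cases d) auto
  then show "w:V d" using ux gsub_add[OF V] WV by blast
  qed
  show "?T \<nu> ~= W"
  proof
  assume eq: "?T \<nu> = W"
  have "kills 1 (%v. v j - \<nu> * v i) V W" unfolding kills_def
  proof (intro allI ballI)
  fix k w assume w: "w:V k"
  have "smul (%v. v j - \<nu> * v i) w : ?T \<nu> (Suc k)"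
  using w gsub_0[OF W] by (intro CollectI exI[of _ 0] exI[of _ w]) simp
  then show "smul (%v. v j - \<nu> * v i) w:W (1 + k)" unfolding fun_cong[OF eq, of "Suc k"] by simp
  qed
  then show False using nk by blast
  qed
  qed
  then have "ALL \<nu>. EX k. kills (k * e) (%v. g v ^ k) V (?T \<nu>)" ..
  from choice[OF this] obtain k where k: "!!\<nu>. kills (k \<nu> * e) (%v. g v ^ k \<nu>) V (?T \<nu>)" by (elim exE) (rule that, erule spec)
  obtain K where K: "infinite {\<nu>. k \<nu> = K}" using infinite_fiber by blast
  let ?y = "smul (%v. g v ^ K) v0" and ?D = "K * e+d0"
  define R where "R=(%\<nu> u x. ?y=u + smul (%v. v j - \<nu> * v i) x&u:W ?D&(if ?D=0 then x=0 else x:V (?D-1)))"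
  have "EX u x. R \<nu> u x" if "k \<nu> = K" for \<nu>
  proof -
  have "?y : ?T \<nu> ?D" using k[of \<nu>] v0(1) that unfolding kills_def by blast
  then show ?thesis unfolding R_def by (rule CollectD)
  qed
  then obtain u x where "!!\<nu>. k \<nu> = K==>R \<nu> (u \<nu>) (x \<nu>)" by metis
  then have ux: "!!\<nu>. k \<nu> = K==>?y=u \<nu> + smul (%v. v j - \<nu> * v i) (x \<nu>)"
  "!!\<nu>. k \<nu> = K==>u \<nu> : W ?D" "!!\<nu>. k \<nu> = K==>(if ?D=0 then x \<nu> = 0 else x \<nu> : V (?D-1))"
  unfolding R_def by blast+
  have "EX L c. finite L&L \<subseteq> {\<nu>. k \<nu> = K}&(EX t:L. c t~=0)&(SUM t:L. scl (c t) (x t))=0"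
  proof (rule findim_dependent[OF _ K])
  show "findim (insert 0 (V (?D-1)))"
  using gsub_findim[OF V B] gsub_0[OF V] by (simp add: insert_absorb)
  show "!!t. t:{\<nu>. k \<nu> = K}==>x t:insert 0 (V (?D-1))" using ux(3) by (metis insertCI mem_Collect_eq)
  qed
  then obtain L c where L: "finite L" "L \<subseteq> {\<nu>. k \<nu> = K}" "EX t:L. c t~=0" "(SUM t:L. scl (c t) (x t))=0"
  by blast
  \<comment> \<open>A Lagrange combination: at a node \<open>t\<close> every summand but its own
    vanishes, so \<open>P\<close> is nonzero as soon as some \<open>c t\<close> is. Multiplying by
    it brings all cofactor terms under the same product over \<open>L\<close>, where the dependency
    cancels them.\<close>
  define P where "P=(SUM t:L. smult (c t) (PROD \<mu>:L-{t}. [:-\<mu>, 1:]))"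
  define N where "N = card L-1"
  have card: "card (L-{t})=N" if "t:L" for t using that L(1) by (simp add: N_def)
  have bin: "binary i j N P v=(SUM t:L. c t * (PROD \<mu>:L-{t}. v j - \<mu> * v i))" for v
  unfolding P_def binary_sum binary_smult
  proof (rule sum.cong[OF refl])
  fix t assume t: "t:L"
  show "c t * binary i j N (PROD \<mu>:L-{t}. [:-\<mu>, 1:]) v = c t * (PROD \<mu>:L-{t}. v j - \<mu> * v i)"
  using binary_prod[of "L-{t}" i j v] card[OF t] L(1) by simp
  qed
  have degP: "degree P<=N" unfolding P_def
  proof (rule degree_sum_le[OF L(1)])
  fix t assume "t:L"
  have "degree (PROD \<mu>:L-{t}. [:-\<mu>, 1:]) <= card (L-{t})"
  using degree_prod_sum_le[of "L-{t}" "%\<mu>. [:-\<mu>, 1:]"] L(1) by simp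
  then show "degree (smult (c t) (PROD \<mu>:L-{t}. [:-\<mu>, 1:]))<=N"
  using card[OF \<open>t:L\<close>] degree_smult_le le_trans by metis
  qed
  have "P~=0"
  proof
  assume "P=0"
  obtain t where t: "t:L" "c t~=0" using L(3) by blast
  have "poly P t=(SUM s:L. c s * (PROD \<mu>:L-{s}. t - \<mu>))"
  by (simp add: P_def poly_sum poly_prod)
  also have "... = (SUM s:L. if s=t then c t * (PROD \<mu>:L-{t}. t - \<mu>) else 0)"
  using t(1) L(1) by (intro sum.cong) (auto intro!: prod_zero)
  also have "... = c t * (PROD \<mu>:L-{t}. t - \<mu>)" using t(1) L(1) by simp
  also have "... ~= 0" using t(2) L(1) by simp
  finally show False using \<open>P = 0\<close> by simp
  qed
  have prodh: "hform m N (%v. PROD \<mu>:L-{t}. v j - \<mu> * v i)" if "t:L" for t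
  using hform_prod[of "L-{t}" m "%\<mu>. 1" "%\<mu> v. v j - \<mu> * v i", OF h] card[OF that] by simp
  have "smul (binary i j N P) ?y =
  (SUM t:L. scl (c t) (smul (%v. PROD \<mu>:L-{t}. v j - \<mu> * v i) ?y))"
  by (intro ext) (simp add: smul_def scl_def bin sum_apply2 sum_distrib_left sum_distrib_right algebra_simps)
  also have "... = (SUM t:L. scl (c t) (smul (%v. PROD \<mu>:L-{t}. v j - \<mu> * v i) (u t))) +
  (SUM t:L. smul (%v. PROD \<mu>:L. v j - \<mu> * v i) (scl (c t) (x t)))"
  unfolding sum.distrib[symmetric]
  proof (rule sum.cong[OF refl])
  fix t assume t: "t:L"
  have "(%v. PROD \<mu>:L. v j - \<mu> * v i)=(%v. (v j-t * v i) * (PROD \<mu>:L-{t}. v j - \<mu> * v i))"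
  using prod.remove[OF L(1) t] by blast
  moreover have "?y=u t + smul (%v. v j-t * v i) (x t)" using ux(1)[of t] t L(2) by blast
  ultimately show "scl (c t) (smul (%v. PROD \<mu>:L-{t}. v j - \<mu> * v i) ?y) =
  scl (c t) (smul (%v. PROD \<mu>:L-{t}. v j - \<mu> * v i) (u t)) + smul (%v. PROD \<mu>:L. v j - \<mu> * v i) (scl (c t) (x t))"
  by (simp add: fv.scale_right_distrib smul_smul smul_scl mult.commute)
  qed
  also have "(SUM t:L. smul (%v. PROD \<mu>:L. v j - \<mu> * v i) (scl (c t) (x t)))=0"
  unfolding smul_sum[symmetric] L(4) by simp
  finally have "smul (binary i j N P) ?y=(SUM t:L. scl (c t) (smul (%v. PROD \<mu>:L-{t}. v j - \<mu> * v i) (u t)))"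
  by simp
  moreover have "... : W (N+?D)"
  using ux(2) L(2) by (intro gsub_sum[OF W] gsub_scl[OF W] gsub_smul[OF W prodh]) auto
  ultimately have yW: "smul (binary i j N P) ?y:W (N+?D)" by simp
  have yV: "?y:V ?D" using gsub_smul[OF V gk v0(1)] .
  have inj_i: "!!d w. w:V d==>smul (%v. v i) w:W (Suc d)==>w:W d"
  using lin_inj[OF hform_var[OF i] ni] .
  have inj_h: "!!\<nu> d w. w:V d==>smul (%v. v j - \<nu> * v i) w:W (Suc d)==>w:W d"
  using lin_inj[OF h] nk by blast
  from binary_injective[OF V i j inj_i inj_h W \<open>P ~= 0\<close> degP yV yW] have "?y:W ?D" .
  then show False using gk_inj[OF v0(1)] v0(2) by blast
 qed
 \<comment> \<open>If all coordinates acted as zero, so would every form of positive degree,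
   \<open>g\<close> included.\<close>
 have "EX i<m. ~kills 1 (%v. v i) V W"
 proof (rule ccontr)
  assume all: "~?thesis"
  have "kills 1 (%v. v j-0 * 0) V W" if "j<m" for j using all that by simp
  from kills_hform_eval[OF V W WV hform.zero[of m 1], of "%j. 0", OF this g]
  have *: "smul (%v. g v-g (%j. 0) * 0 ^ e) w:W (e+d)" if "w:V d" for w d using that by blast
  have "(%v. g v-g (%j. 0) * 0 ^ e)=g" using e by (simp add: power_0_left)
  with * have "kills (1 * e) (%v. g v ^ 1) V W" unfolding kills_def by simp
  then show False using noneW by blast
 qed
 then obtain i where i: "i<m" "~kills 1 (%v. v i) V W" by blast
 have "ALL j. EX \<nu>. j<m-->kills 1 (%v. v j - \<nu> * v i) V W" using pencil[OF i(1) _ i(2)] by blast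
 from choice[OF this] obtain \<nu> where \<nu>: "!!j. j<m==>kills 1 (%v. v j - \<nu> j * v i) V W" by blast
 note eval = kills_hform_eval[OF V W WV hform_var[OF i(1)] \<nu>]
 have pow_inj: "w:W d" if "w:V d" "smul (%v. v i ^ k) w:W (k+d)" for w d k
  using that(2)
 proof (induction k)
  case 0 then show ?case by simp
 next
  case (Suc k)
  have "smul (%v. v i) (smul (%v. v i ^ k) w):W (Suc (k+d))"
  using Suc.prems by (simp add: smul_smul)
  from Suc.IH[OF lin_inj[OF hform_var[OF i(1)] i(2) gsub_smul[OF V hform_pow1[OF hform_var[OF i(1)]] that(1)] this]]
  show ?case .
 qed
 have "g \<nu> ~= 0"
 proof
  assume "g \<nu> = 0"
  then have "kills (1 * e) (%v. g v ^ 1) V W" using eval[OF _ g] unfolding kills_def by simp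
  then show False using noneW by blast
 qed
 then obtain d f where f: "hform m d f" "f \<nu> ~= 0" "kills d f V U" using local by blast
 have "smul (%v. v i ^ d) v0:W (d+d0)"
 proof -
  have "smul f v0:W (d+d0)" using f(3) v0(1) UW unfolding kills_def by blast
  moreover have "smul (%v. f \<nu> * v i ^ d) v0 = smul f v0 - smul (%v. f v-f \<nu> * v i ^ d) v0"
  by (intro ext) (simp add: smul_def algebra_simps)
  moreover have "smul (%v. f v-f \<nu> * v i ^ d) v0:W (d+d0)"
  using eval[OF _ f(1) v0(1)] .
  ultimately have "smul (%v. f \<nu> * v i ^ d) v0:W (d+d0)"
  by (simp only: gsub_diff[OF W])
  from gsub_scl[OF W this, of "1 / f \<nu>"] show ?thesis using f(2)
  by (simp add: smul_def scl_def)
 qed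
 then show False using pow_inj[OF v0(1)] v0(2) by blast
qed

section \<open>Modules that agree locally agree in high degrees\<close>

text \<open>Pigeonhole: a monomial of degree above \<open>m * k\<close> contains some variable to
  the power \<open>k\<close>.\<close>

lemma hform_split_powers:
 "hform m N f==>m * k<N==>EX g. (ALL i<m. hform m (N - k) (g i))&(ALL v. f v=(SUM i<m. g i v * v i ^ k))"
proof (induction m arbitrary: N f)
 case 0
 then show ?case using hform_0_pos[of N f] by auto
next
 case (Suc m)
 obtain c where c: "!!l. l<=N==>hform m (N-l) (c l)" "!!v. f v=(SUM l<=N. c l v * v m ^ l)"
  using hform_expand[OF Suc.prems(1)] by blast
 have kN: "k<=N" using Suc.prems(2) by simp
 have "ALL l. EX g. l < k-->(ALL i<m. hform m (N-l - k) (g i))&(ALL v. c l v=(SUM i<m. g i v * v i ^ k))"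
 proof
  fix l
  show "EX g. l < k-->(ALL i<m. hform m (N-l - k) (g i))&(ALL v. c l v=(SUM i<m. g i v * v i ^ k))"
  proof (cases "l < k")
  case True
  then have "m * k<N-l" using Suc.prems(2) by simp
  then show ?thesis using Suc.IH[OF c(1)[of l]] True kN by (meson le_trans less_imp_le_nat)
  qed simp
 qed
 from choice[OF this] obtain g where g: "!!l i. l < k==>i<m==>hform m (N-l - k) (g l i)"
  "!!l v. l < k==>c l v=(SUM i<m. g l i v * v i ^ k)" by blast
 let ?g = "%i v. if i=m then (SUM l=k..N. c l v * v m ^ (l - k)) else (SUM l<k. g l i v * v m ^ l)"
 have "hform (Suc m) (N - k) (?g i)" if "i<Suc m" for i
 proof (cases "i=m")
  case True
  have "hform (Suc m) (N - k) (%v. c l v * v m ^ (l - k))" if "l:{k..N}" for l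
  using hform_power_last[OF c(1)[of l], of "l - k"] that by simp
  then show ?thesis using True hform_sum[of "{k..N}" "Suc m" "N - k" "%l v. c l v * v m ^ (l - k)"] by simp
 next
  case False
  then have i: "i<m" using that by simp
  then have "k<=m * k" by (cases m) auto
  then have "hform (Suc m) (N - k) (%v. g l i v * v m ^ l)" if "l < k" for l
  proof -
  have "N-l - k+l=N - k" using that Suc.prems(2) \<open>k <= m * k\<close> mult_Suc[of m k] by linarith
  then show ?thesis using hform_power_last[OF g(1)[OF that i], of l] by metis
  qed
  then show ?thesis using False hform_sum[of "{..<k}" "Suc m" "N - k" "%l v. g l i v * v m ^ l"] by simp
 qed
 moreover have "f v=(SUM i<Suc m. ?g i v * v i ^ k)" for v
 proof -
  have "f v=(SUM l<k. c l v * v m ^ l)+(SUM l=k..N. c l v * v m ^ l)"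
  proof -
  have "{..N}={..<k} \<union> {k..N}" "{..<k} \<inter> {k..N}={}" using kN by auto
  then show ?thesis unfolding c(2) by (simp add: sum.union_disjoint)
  qed
  also have "(SUM l<k. c l v * v m ^ l)=(SUM l<k. SUM i<m. g l i v * v i ^ k * v m ^ l)"
  by (intro sum.cong refl) (simp add: g(2) sum_distrib_right)
  also have "... = (SUM i<m. (SUM l<k. g l i v * v m ^ l) * v i ^ k)"
  by (subst sum.swap) (simp add: sum_distrib_left sum_distrib_right mult_ac)
  also have "(SUM l=k..N. c l v * v m ^ l)=(SUM l=k..N. c l v * v m ^ (l - k)) * v m ^ k"
  unfolding sum_distrib_right by (intro sum.cong refl) (simp add: mult.assoc flip: power_add)
  finally show ?thesis by simp
 qed
 ultimately show ?case by (intro exI[of _ ?g]) simp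
qed

abbreviation lin :: "('b vf=>'c vf)=>bool" where
 "lin T \<equiv> Vector_Spaces.linear scl scl T"

lemma linI:
 assumes "!!x y. T (x+y)=T x+T y" "!!c x. T (scl c x) = scl c (T x)"
 shows "lin T"
 using assms by unfold_locales

lemma lin_add: "lin T==>T (x+y)=T x+T y"
 and lin_scl: "lin T==>T (scl c x) = scl c (T x)"
 by (simp_all add: linear_iff_module_hom module_hom.add module_hom.scale)

lemma lin_0: "lin T==>T 0=0"
 and lin_diff: "lin T==>T (x-y)=T x-T y"
 and lin_sum: "lin T==>T (sum f S)=(SUM i:S. T (f i))"
 by (simp_all add: linear_iff_module_hom module_hom.zero module_hom.diff module_hom.sum)

lemma lin_subspace_image: "lin T==>fv.subspace W==>fv.subspace (T ` W)"
 by (simp add: linear_iff_module_hom module_hom.subspace_image)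

lemma lin_subspace_kernel:
 assumes T: "lin T" and W: "fv.subspace W" shows "fv.subspace {w:W. T w=0}"
proof -
 note lins = lin_0[OF T] lin_add[OF T] lin_scl[OF T]
 show ?thesis unfolding fv.subspace_def
  using fv.subspace_0[OF W] fv.subspace_add[OF W] fv.subspace_scale[OF W] lin_0[OF T]
  by (simp only: mem_Collect_eq) (simp add: lin_add[OF T] lin_scl[OF T] del: plus_fun_apply)
qed

lemma lin_smul: "lin (smul f)"
 by (rule linI) (simp_all add: smul_scl)

lemma lin_span_mono:
 assumes "lin T" "T ` S \<subseteq> S'" shows "T ` fv.span S \<subseteq> fv.span S'"
 using module_hom.span_image[of scl scl T S] fv.span_mono[OF assms(2)] assms(1)
 by (simp add: linear_iff_module_hom)

text \<open>The Nullstellensatz for each coordinate gives one \<open>K\<close> such that all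
  \<open>K\<close>-th powers of coordinates annihilate \<open>V / U\<close>. As \<open>V\<close> is
  generated in bounded degrees, an element of high degree is a combination of generators whose
  coefficients, by \<open>hform_split_powers\<close>, lie in the ideal of these powers.\<close>

lemma gsub_eventually_eq:
 fixes V U :: "nat=>'b vf set"
 assumes B: "finite B" and U: "gsub m B U" and V: "gsub m B V" and UV: "!!d. U d \<subseteq> V d"
  and local: "!!p. EX i<m. p i~=0==>EX d f. hform m d f&f p~=0&kills d f V U"
 shows "EX D. ALL d>=D. V d=U d"
proof -
 have "EX k. kills k (%v. v i ^ k) V U" if "i<m" for i
  using graded_nullstellensatz[OF B U V UV hform_var[OF that], OF _ local] that by auto
 then obtain k where k: "!!i. i<m==>kills (k i) (%v. v i ^ k i) V U" by metis
 define K where "K=(SUM i<m. k i)"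
 have K: "kills K (%v. v i ^ K) V U" if "i<m" for i
 proof -
  have ik: "k i<=K" unfolding K_def using that by (intro member_le_sum) auto
  have "smul (%v. v i ^ K) w:U (K+d)" if w: "w:V d" for w d
  proof -
  have "smul (%v. v i ^ (K - k i)) (smul (%v. v i ^ k i) w):U (K - k i+(k i+d))"
  using gsub_smul[OF U hform_pow1[OF hform_var[OF \<open>i < m\<close>]]] k[OF \<open>i < m\<close>] w
  unfolding kills_def by blast
  then show ?thesis using ik by (simp add: smul_smul flip: power_add)
  qed
  then show ?thesis by (simp add: kills_def)
 qed
 \<comment> \<open>The submodule generated by the part of \<open>V\<close> in degrees at most
   \<open>D\<close>; the chain condition makes it constant in \<open>D\<close>, hence equal to
   \<open>V\<close>.\<close>
 define G where "G=(%D d. fv.span {smul f w | f w e. e<=D&e<=d&w:V e&hform m (d-e) f})"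
 have G: "gsub m B (G D)" for D
  unfolding gsub_def
 proof (intro conjI allI impI)
  fix d
  have "{smul f w | f w e. e<=D&e<=d&w:V e&hform m (d-e) f} \<subseteq> VF m B d"
  using smul_VF gsub_VF[OF V] by force
  then show "G D d \<subseteq> VF m B d" unfolding G_def by (rule fv.span_minimal[OF _ subspace_VF])
  show "fv.subspace (G D d)" by (simp add: G_def)
 next
  fix d i w assume i: "i<m" and w: "w:G D d"
  have "smul (%v. v i) ` {smul f w | f w e. e<=D&e<=d&w:V e&hform m (d-e) f}
  \<subseteq> {smul f w | f w e. e<=D&e<=Suc d&w:V e&hform m (Suc d-e) f}"
  proof (rule image_subsetI)
  fix x assume "x:{smul f w | f w e. e<=D&e<=d&w:V e&hform m (d-e) f}"
  then obtain f w e where *: "x = smul f w" "e<=D" "e<=d" "w:V e" "hform m (d-e) f" by blast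
  have "hform m (Suc d-e) (%v. v i * f v)"
  using hform.mult_var[OF *(5) i] *(3) by (simp add: Suc_diff_le)
  then show "smul (%v. v i) x:{smul f w | f w e. e<=D&e<=Suc d&w:V e&hform m (Suc d-e) f}"
  unfolding *(1) smul_smul using *(2-4) le_SucI by blast
  qed
  from lin_span_mono[OF lin_smul this] w show "smul (%v. v i) w:G D (Suc d)"
  unfolding G_def by blast
 qed
 have GV: "G D d \<subseteq> V d" for D d
  unfolding G_def by (rule fv.span_minimal[OF _ gsub_subspace[OF V]]) (use gsub_smul'[OF V] in force)
 have VG: "V d \<subseteq> G d d" for d
 proof
  fix w assume "w:V d"
  then have "smul (%v. 1) w:{smul f w | f w e. e<=d&e<=d&w:V e&hform m (d-e) f}"
  using hform.const[of m 1] by (metis (mono_tags, lifting) diff_self_eq_0 le_refl mem_Collect_eq)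
  then show "w:G d d" unfolding G_def by (simp add: fv.span_base)
 qed
 have "G D d \<subseteq> G (Suc D) d" for D d unfolding G_def by (rule fv.span_mono) (use le_SucI in blast)
 from gsub_chain[where W = G, OF B G this] obtain J where J: "!!j. j >= J==>G j=G J" by blast
 have "V d=U d" if d: "d >= J+m * K+1" for d
 proof
  show "U d \<subseteq> V d" by (rule UV)
  have "V d \<subseteq> G J d" using VG[of d] J[of d] d by simp
  also have "G J d \<subseteq> U d" unfolding G_def
  proof (rule fv.span_minimal[OF _ gsub_subspace[OF U]], safe)
  fix f w e assume e: "e<=J" "e<=d" and w: "w:V e" and f: "hform m (d-e) f"
  obtain g where g: "!!i. i<m==>hform m (d-e-K) (g i)" "!!v. f v=(SUM i<m. g i v * v i ^ K)"
  proof -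
  have "m * K<d-e" using d e by linarith
  from hform_split_powers[OF f this] show ?thesis using that by blast
  qed
  have "f=(%v. SUM i<m. g i v * v i ^ K)" using g(2) by blast
  then have "smul f w=(SUM i<m. smul (g i) (smul (%v. v i ^ K) w))"
  by (simp add: smul_sum_left smul_smul)
  also have "... : U d"
  proof (rule gsub_sum[OF U])
  fix i assume i: "i:{..<m}"
  have "smul (%v. v i ^ K) w:U (K+e)" using K w i unfolding kills_def by blast
  moreover have "d=d-e-K+(K+e)"
  proof -
  have "K<=m * K" using i by (cases m) auto
  then show ?thesis using d e by linarith
  qed
  ultimately show "smul (g i) (smul (%v. v i ^ K) w):U d"
  using gsub_smul'[OF U g(1)] i by blast
  qed
  finally show "smul f w:U d" .
  qed
  finally show "V d \<subseteq> U d" .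
 qed
 then show ?thesis by blast
qed

section \<open>Linear maps and dimension counts\<close>

lemma dim_0: "fv.dim {0 :: 'b vf}=0"
 using fv.dim_span[of "{} :: 'b vf set"]
  fv.dim_eq_card_independent[of "{} :: 'b vf set", OF fv.independent_empty] by simp

lemma rank_nullity:
 assumes T: "lin T" and W: "findim W" "fv.subspace W"
 shows "fv.dim W=fv.dim {w:W. T w=0}+fv.dim (T ` W)"
proof -
 let ?K = "{w:W. T w=0}"
 have K: "fv.subspace ?K" by (rule lin_subspace_kernel[OF T W(2)])
 have "findim ?K" by (rule findim_subset[OF W(1)]) auto
 from findim_basis[OF this K] obtain A where
  A: "finite A" "fv.independent A" "fv.span A=?K" "A \<subseteq> ?K" "card A=fv.dim ?K" .
 have "A \<subseteq> W" using A(4) by blast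
 from findim_basis_extend[OF W this A(2)] obtain B where
  B: "A \<subseteq> B" "finite B" "fv.independent B" "fv.span B=W" "B \<subseteq> W" "card B=fv.dim W" .
 have hom: "module_hom scl scl T" using T by (simp add: linear_iff_module_hom)
 have indC: "fv.independent (B-A)" using B(3) fv.independent_mono by blast
 have "inj_on T (fv.span (B-A))"
 proof (rule inj_onI)
  fix x y assume x: "x:fv.span (B-A)" and y: "y:fv.span (B-A)" and eq: "T x=T y"
  define z where "z=x-y"
  have zC: "z:fv.span (B-A)" unfolding z_def using x y by (rule fv.span_diff)
  then have "z:W" using B(4) fv.span_mono[of "B-A" B] by blast
  moreover have "T z=0" unfolding z_def lin_diff[OF T] using eq by simp
  ultimately have zA: "z:fv.span A" using A(3) by blast
  have "fv.representation B z b=0" for b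
  proof -
  have "fv.representation B z=fv.representation A z"
  using fv.representation_extend[OF B(3) zA B(1)] .
  moreover have "fv.representation B z=fv.representation (B-A) z"
  using fv.representation_extend[OF B(3) zC] by blast
  ultimately show ?thesis
  using fv.representation_ne_zero[of A z b] fv.representation_ne_zero[of "B-A" z b] by force
  qed
  then have "z=0"
  using fv.sum_nonzero_representation_eq[OF B(3), of z] \<open>z:W\<close> B(4) by simp
  then show "x=y" by (simp add: z_def)
 qed
 note inj_span = this
 have ind: "fv.independent (T ` (B-A))"
  by (rule module_hom.independent_injective_image[OF hom indC inj_span])
 have inj: "inj_on T (B-A)" by (rule inj_on_subset[OF inj_span fv.span_superset])
 have "T ` W=fv.span (T ` (B-A))"
 proof -
  have "T ` W=fv.span (T ` B)" unfolding B(4)[symmetric] by (rule module_hom.span_image[OF hom, symmetric])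
  also have "T ` B=T ` (B-A) \<union> T ` A" using B(1) by blast
  also have "fv.span ... = fv.span (T ` (B-A))"
  proof -
  have "T ` A \<subseteq> {0}" using A(4) by auto
  then have "T ` A \<subseteq> fv.span (T ` (B-A))" by (rule subset_trans) (simp add: fv.span_zero)
  then have "T ` (B-A) \<union> T ` A \<subseteq> fv.span (T ` (B-A))"
  using fv.span_superset[of "T ` (B-A)"] by simp
  then show ?thesis by (intro equalityI fv.span_mono fv.span_minimal) auto
  qed
  finally show ?thesis .
 qed
 then have "fv.dim (T ` W) = card (B-A)"
  using fv.dim_span_eq_card_independent[OF ind] card_image[OF inj] by simp
 also have "... = card B - card A" using B(1) A(1) by (rule card_Diff_subset[rotated])
 finally show ?thesis using A(5) B(6) card_mono[OF B(2,1)] by simp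
qed

lemma dim_image_inj:
 assumes T: "lin T" and W: "findim W" "fv.subspace W" and inj: "!!w. w:W==>T w=0==>w=0"
 shows "fv.dim (T ` W)=fv.dim W"
proof -
 have "{w:W. T w=0}={0}" using inj fv.subspace_0[OF W(2)] lin_0[OF T] by blast
 then show ?thesis using rank_nullity[OF T W] by (simp add: dim_0)
qed

text \<open>Rank-nullity for the map sending (u, y) to u + T y on the direct sum of \<open>U\<close>
  and \<open>V\<close>, which is realised by functions on a sum type; the kernel projects
  isomorphically to the \<open>y\<close> with \<open>T y\<close> in \<open>U\<close>.\<close>

lemma dim_sum_image:
 fixes U :: "'b vf set" and V :: "'c vf set"
 assumes U: "findim U" "fv.subspace U" and V: "findim V" "fv.subspace V" and T: "lin T"
 shows "fv.dim {u+T y | u y. u:U&y:V}+fv.dim {y:V. T y:U}=fv.dim U+fv.dim V"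
proof -
 define p :: "('b+'c=>vec=>complex)=>'b vf" where "p ph=(%b. ph (Inl b))" for ph
 define q :: "('b+'c=>vec=>complex)=>'c vf" where "q ph=(%b. ph (Inr b))" for ph
 have lp: "lin p" "lin q" by (rule linI; auto simp: p_def q_def scl_def fun_eq_iff)+
 define e where "e x y=(%b. case b of Inl b=>x b | Inr b=>y b)" for x :: "'b vf" and y :: "'c vf"
 have pe: "p (e x y)=x" "q (e x y)=y" for x y by (auto simp: p_def q_def e_def)
 have ep: "e (p ph) (q ph)=ph" for ph by (auto simp: p_def q_def e_def fun_eq_iff split: sum.split)
 define W where "W={ph. p ph : U&q ph : V}"
 have sW: "fv.subspace W"
  unfolding fv.subspace_def W_def
  by (auto simp: lin_0[OF lp(1)] lin_0[OF lp(2)] lin_add[OF lp(1)] lin_add[OF lp(2)] lin_scl[OF lp(1)] lin_scl[OF lp(2)]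
  intro: fv.subspace_0 fv.subspace_add fv.subspace_scale U V)
 obtain A B where A: "finite A" "U \<subseteq> fv.span A" and B: "finite B" "V \<subseteq> fv.span B" using U V by (auto simp: findim_def)
 have l1: "lin (%x. e x 0)" "lin (e 0)" by (rule linI; auto simp: e_def scl_def fun_eq_iff split: sum.split)+
 have "W \<subseteq> fv.span ((%x. e x 0) ` A \<union> e 0 ` B)"
 proof
  fix ph assume "ph : W"
  then have pq: "p ph : fv.span A" "q ph : fv.span B" using A B by (auto simp: W_def)
  have "ph=e (p ph) 0+e 0 (q ph)" by (subst ep[symmetric]) (auto simp: e_def fun_eq_iff split: sum.split)
  moreover have "e (p ph) 0:fv.span ((%x. e x 0) ` A \<union> e 0 ` B)"
  using lin_span_mono[OF l1(1), of A "(%x. e x 0) ` A \<union> e 0 ` B"] pq by blast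
  moreover have "e 0 (q ph):fv.span ((%x. e x 0) ` A \<union> e 0 ` B)"
  using lin_span_mono[OF l1(2), of B "(%x. e x 0) ` A \<union> e 0 ` B"] pq by blast
  ultimately show "ph : fv.span ((%x. e x 0) ` A \<union> e 0 ` B)" using fv.span_add by metis
 qed
 moreover have "finite ((%x. e x 0) ` A \<union> e 0 ` B)" using A B by simp
 ultimately have fW: "findim W" unfolding findim_def by (intro exI conjI)
 have kq: "fv.dim {ph : W. q ph=0}=fv.dim U"
 proof -
  have "x:p ` {ph : W. q ph=0}" if "x:U" for x
  by (rule image_eqI[of _ _ "e x 0"]) (use that fv.subspace_0[OF V(2)] in \<open>simp_all add: W_def pe\<close>)
  then have "p ` {ph : W. q ph=0}=U" by (auto simp: W_def)
  moreover have "fv.dim (p ` {ph : W. q ph=0})=fv.dim {ph : W. q ph=0}"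
  proof (rule dim_image_inj[OF lp(1) findim_subset[OF fW] lin_subspace_kernel[OF lp(2) sW]])
  fix w assume "w:{ph : W. q ph=0}" "p w=0"
  then have "w=e 0 0" using ep[of w] by simp
  then show "w=0" by (auto simp: e_def fun_eq_iff split: sum.split)
  qed blast
  ultimately show ?thesis by simp
 qed
 have "y:q ` W" if "y:V" for y
  by (rule image_eqI[of _ _ "e 0 y"]) (use that fv.subspace_0[OF U(2)] in \<open>simp_all add: W_def pe\<close>)
 then have "q ` W=V" by (auto simp: W_def)
 with rank_nullity[OF lp(2) fW sW] kq have dW: "fv.dim W=fv.dim U+fv.dim V" by simp
 define S where "S ph=p ph+T (q ph)" for ph
 have lS: "lin S" by (rule linI) (simp_all add: S_def lin_add[OF lp(1)] lin_add[OF lp(2)] lin_scl[OF lp(1)] lin_scl[OF lp(2)]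
  lin_add[OF T] lin_scl[OF T] fv.scale_right_distrib)
 have "S ` W={u+T y | u y. u:U&y:V}"
 proof
  show "{u+T y | u y. u:U&y:V} \<subseteq> S ` W"
  proof
  fix z assume "z:{u+T y | u y. u:U&y:V}"
  then obtain u y where z: "z=u+T y" "u:U" "y:V" by blast
  show "z:S ` W" by (rule image_eqI[of _ _ "e u y"]) (use z in \<open>simp_all add: S_def W_def pe\<close>)
  qed
 qed (auto simp: S_def W_def)
 moreover have "fv.dim {ph : W. S ph=0}=fv.dim {y:V. T y:U}"
 proof -
  have im: "q ` {ph : W. S ph=0}={y:V. T y:U}"
  proof
  show "q ` {ph : W. S ph=0} \<subseteq> {y:V. T y:U}"
  proof
  fix y assume "y:q ` {ph : W. S ph=0}"
  then obtain ph where ph: "p ph : U" "q ph : V" "p ph+T (q ph)=0" "y=q ph" by (auto simp: W_def S_def)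
  have "T y = - p ph" using ph(3,4) by (simp add: add_eq_0_iff)
  then show "y:{y:V. T y:U}" using ph fv.subspace_neg[OF U(2) ph(1)] by simp
  qed
  show "{y:V. T y:U} \<subseteq> q ` {ph : W. S ph=0}"
  proof
  fix y assume y: "y:{y:V. T y:U}"
  have "e (- T y) y:{ph : W. S ph=0}" using y fv.subspace_neg[OF U(2)] by (simp add: W_def S_def pe)
  then show "y:q ` {ph : W. S ph=0}" using pe(2)[of "- T y" y] by (intro image_eqI[of _ _ "e (- T y) y"]) simp_all
  qed
  qed
  have "fv.dim (q ` {ph : W. S ph=0})=fv.dim {ph : W. S ph=0}"
  proof (rule dim_image_inj[OF lp(2) findim_subset[OF fW] lin_subspace_kernel[OF lS sW]])
  fix w assume w: "w:{ph : W. S ph=0}" "q w=0"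
  then have "p w=0" by (simp add: S_def lin_0[OF T])
  then have "w=e 0 0" using ep[of w] w(2) by simp
  then show "w=0" by (auto simp: e_def fun_eq_iff split: sum.split)
  qed blast
  then show ?thesis using im by simp
 qed
 ultimately show ?thesis using rank_nullity[OF lS fW sW] dW by simp
qed

lemma lin_comp:
 assumes "lin S" "lin T" shows "lin (%x. S (T x))"
 by (rule linI) (simp_all only: lin_add[OF assms(1)] lin_add[OF assms(2)] lin_scl[OF assms(1)] lin_scl[OF assms(2)])

section \<open>The tensor product over two sets of variables and the equations of the
  diagonal\<close>

text \<open>The shift of \<open>T\<close> by one degree, with nothing below degree 0.\<close>

definition tm :: "(nat=>'b vf set)=>nat=>'b vf set" where
 "tm T e=(case e of 0=>{0} | Suc e'=>T e')"

lemma tm_simps [simp]: "tm T 0={0}" "tm T (Suc e)=T e"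
 by (simp_all add: tm_def)

lemma subspace_tm: "(!!e. fv.subspace (T e))==>fv.subspace (tm T e)"
 by (cases e) (simp_all add: fv.subspace_single_0)

lemma tm_smul:
 assumes "gsub m B T" "hform m 1 u" "x:tm T e" shows "smul u x:T e"
proof (cases e)
 case 0 then show ?thesis using assms gsub_0[OF assms(1)] by simp
next
 case (Suc e') then show ?thesis using gsub_smul[OF assms(1,2)] assms(3) by auto
qed

text \<open>With \<open>X\<close> = \<open>tm T e\<close> this is the degree \<open>e\<close> part
  of the ideal (u 0, ..., u (j-1)) times the module \<open>T\<close>.\<close>

definition comb :: "(nat=>vec=>complex)=>nat=>'b vf set=>'b vf set" where
 "comb u j X={SUM i<j. smul (u i) (t i) | t. ALL i<j. t i:X}"

lemma hform_var1: "i<m==>hform m (Suc 0) (%v. v i)"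
 using hform_var by simp

definition yv :: "nat=>vec=>vec" where "yv m v=(%i. v (m+i))"

definition tns :: "nat=>'b vf=>'c vf=>'b \<times> 'c=>vec=>complex" where
 "tns m n n'=(%(b, b') v. n b v * n' b' (yv m v))"

text \<open>\<open>N\<close> tensor \<open>N'\<close> over the complex numbers, as a module over the
  polynomial ring in \<open>2 * m\<close> variables and graded by total degree. The second factor is
  written in the variables \<open>m\<close>, ..., \<open>2 * m - 1\<close>.\<close>

definition box :: "nat=>(nat=>'b vf set)=>(nat=>'c vf set) =>
  nat=>('b \<times> 'c=>vec=>complex) set" where
 "box m N N' e=fv.span {tns m n n' | n n' d. d<=e&n:N d&n':N' (e-d)}"

lemma lin_tns_left: "lin (%n. tns m n n')"
 and lin_tns_right: "lin (%n'. tns m n n')"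
 by (rule linI; auto simp: tns_def scl_def fun_eq_iff algebra_simps)+

lemma tns_in_box: "n:N d==>n':N' d'==>d+d'=e==>tns m n n':box m N N' e"
 unfolding box_def by (rule fv.span_base) (intro CollectI exI[of _ n] exI[of _ n'] exI[of _ d], auto)

lemma box_map:
 assumes T: "lin T" and Y: "fv.subspace Y"
  and gen: "!!n n' d d'. n:N d==>n':N' d'==>d+d'=e==>T (tns m n n'):Y"
  and "x:box m N N' e"
 shows "T x:Y"
proof -
 have "T ` {tns m n n' | n n' d. d<=e&n:N d&n':N' (e-d)} \<subseteq> Y"
  using gen by (auto simp: image_subset_iff)
 then have "T ` box m N N' e \<subseteq> fv.span Y" unfolding box_def by (rule lin_span_mono[OF T])
 moreover have "fv.span Y=Y" using Y by (simp add: fv.span_eq_iff)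
 ultimately show ?thesis using assms(4) by blast
qed

lemma lin_id: "lin (%x. x)"
 by (rule linI) simp_all

lemma tns_VF:
 assumes "n:VF m B d" "n':VF m B' d'"
 shows "tns m n n':VF (2 * m) (B \<times> B') (d+d')"
proof -
 have "hform (2 * m) (d+d') (%v. n b v * n' b' (yv m v))" for b b'
 proof (rule hform_mult)
  show "hform (2 * m) d (n b)" by (rule hform_mono[OF VF_hform[OF assms(1)]]) simp
  show "hform (2 * m) d' (%v. n' b' (yv m v))"
  by (rule hform_compose[OF VF_hform[OF assms(2)]]) (simp add: yv_def hform_var1)
 qed
 moreover have "n b v * n' b' (yv m v)=0" if "(b, b')~:B \<times> B'" for b b' v
  using that assms by (auto simp: VF_def)
 ultimately show ?thesis by (auto simp: VF_def tns_def)
qed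

lemma gsub_box:
 assumes N: "gsub m B N" and N': "gsub m B' N'"
 shows "gsub (2 * m) (B \<times> B') (box m N N')"
 unfolding gsub_def
proof (intro conjI allI impI)
 fix e
 show "box m N N' e \<subseteq> VF (2 * m) (B \<times> B') e"
 proof
  fix x assume "x:box m N N' e"
  show "x:VF (2 * m) (B \<times> B') e"
  proof (rule box_map[OF lin_id subspace_VF _ \<open>x:_\<close>])
  fix n n' d d' assume n: "n:N d" "n':N' d'" "d+d'=e"
  show "tns m n n':VF (2 * m) (B \<times> B') e"
  using tns_VF[OF gsub_VF[OF N n(1)] gsub_VF[OF N' n(2)]] n(3) by simp
  qed
 qed
 show sub: "fv.subspace (box m N N' e)" for e by (simp add: box_def)
 fix i w assume i: "i<2 * m" and w: "w:box m N N' e"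
 show "smul (%v. v i) w:box m N N' (Suc e)"
 proof (rule box_map[OF lin_smul sub _ w])
  fix n n' d d' assume n: "n:N d" "n':N' d'" "d+d'=e"
  show "smul (%v. v i) (tns m n n'):box m N N' (Suc e)"
  proof (cases "i<m")
  case True
  have "smul (%v. v i) (tns m n n')=tns m (smul (%v. v i) n) n'"
  by (auto simp: smul_def tns_def fun_eq_iff)
  then show ?thesis using gsub_var[OF N True n(1)] n by (simp add: tns_in_box)
  next
  case False
  have "smul (%v. v i) (tns m n n')=tns m n (smul (%v. v (i-m)) n')"
  using False by (auto simp: smul_def tns_def yv_def fun_eq_iff)
  moreover have im: "i-m<m" using i False by simp
  ultimately show ?thesis using tns_in_box[where N = N and N' = N', OF n(1) gsub_var[OF N' im n(2)]] n(3) by simp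
  qed
 qed
qed

definition df :: "nat=>nat=>vec=>complex" where "df m j v = v j - v (m+j)"

lemma hform_df: "j<m==>hform (2 * m) 1 (df m j)"
 unfolding df_def by (intro hform_diff hform_var) simp_all

definition subst :: "(vec=>vec)=>'b vf=>'b vf" where
 "subst A ph=(%b v. ph b (A v))"

lemma lin_subst: "lin (subst A)"
 by (rule linI) (auto simp: subst_def scl_def fun_eq_iff)

lemma subst_smul: "subst A (smul f ph) = smul (%v. f (A v)) (subst A ph)"
 by (simp add: subst_def smul_def)

lemma subst_VF:
 assumes "!!i. i<m==>hform m' 1 (%v. A v i)" "ph : VF m B d" shows "subst A ph : VF m' B d"
 using assms by (auto simp: VF_def subst_def intro: hform_compose)

text \<open>Replaces the first \<open>j\<close> coordinates of the first point by those of the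
  second. This makes the first \<open>j\<close> diagonal equations vanish and so models the quotient
  by them.\<close>

definition sb :: "nat=>nat=>vec=>vec" where
 "sb m j v=(%i. if i<j then v (m+i) else v i)"

definition dbl :: "nat=>vec=>vec" where
 "dbl m v=(%i. if i<m then v i else v (i-m))"

lemma df_dbl: "j<m==>df m j (dbl m v)=0"
 by (simp add: df_def dbl_def)

abbreviation dg :: "nat=>'b vf=>'b vf" where
 "dg m \<equiv> subst (dbl m)"

lemma dg_VF: "ph : VF (2 * m) B d==>dg m ph : VF m B d"
proof (rule subst_VF)
 show "hform m 1 (%v. dbl m v i)" if "i<2 * m" for i
  using that by (cases "i<m") (simp_all add: dbl_def hform_var1)
qed

abbreviation SF :: "nat=>nat=>(unit=>vec=>complex) set" where
 "SF m \<equiv> VF m UNIV"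

lemma gsub_full: "gsub m B (VF m B)"
 unfolding gsub_def using subspace_VF smul_VF[OF hform_var] by auto

lemmas gsub_SF = gsub_full[of _ UNIV]

lemma comb_0: "fv.subspace X==>0:comb u j X"
 unfolding comb_def using fv.subspace_0[of X] by (intro CollectI exI[of _ "%i. 0"]) simp

lemma subspace_comb:
 assumes X: "fv.subspace X" shows "fv.subspace (comb u j X)"
 unfolding fv.subspace_def
proof (intro conjI ballI allI)
 show "0:comb u j X" by (rule comb_0[OF X])
next
 fix x y assume "x:comb u j X" "y:comb u j X"
 then obtain s t where "x=(SUM i<j. smul (u i) (s i))" "ALL i<j. s i:X" "y=(SUM i<j. smul (u i) (t i))" "ALL i<j. t i:X"
  unfolding comb_def by blast
 then show "x+y:comb u j X" unfolding comb_def
  by (intro CollectI exI[of _ "%i. s i+t i"]) (simp add: sum.distrib fv.subspace_add[OF X])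
next
 fix c x assume "x:comb u j X"
 then obtain s where "x=(SUM i<j. smul (u i) (s i))" "ALL i<j. s i:X" unfolding comb_def by blast
 then show "scl c x:comb u j X" unfolding comb_def
  by (intro CollectI exI[of _ "%i. scl c (s i)"]) (simp add: fv.scale_sum_right smul_scl fv.subspace_scale[OF X])
qed

lemma comb_smul:
 assumes "!!x. x:X==>smul f x:Y" "x:comb u j X" shows "smul f x:comb u j Y"
proof -
 obtain s where "x=(SUM i<j. smul (u i) (s i))" "ALL i<j. s i:X" using assms(2) unfolding comb_def by blast
 then show ?thesis unfolding comb_def
  by (intro CollectI exI[of _ "%i. smul f (s i)"]) (simp add: smul_sum smul_commute[of f] assms(1))
qed

lemma comb_base:
 assumes "fv.subspace X" "i<j" "x:X" shows "smul (u i) x:comb u j X"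
proof -
 have "smul (u i) x=(SUM k<j. smul (u k) (if k=i then x else 0))"
  using assms(2) by (subst sum.remove[of _ i]) (auto intro!: sum.neutral)
 then show ?thesis unfolding comb_def using assms fv.subspace_0[of X]
  by (intro CollectI exI[of _ "%k. if k=i then x else 0"]) auto
qed

lemma gsub_comb:
 assumes T: "gsub m B T" and u: "!!i. i<j==>hform m 1 (u i)"
 shows "comb u j (tm T e) \<subseteq> T e" "gsub m B (%e. comb u j (tm T e))"
proof -
 note sT = gsub_subspace[OF T]
 show sub: "comb u j (tm T e) \<subseteq> T e" for e
 proof
  fix x assume "x:comb u j (tm T e)"
  then obtain t where "x=(SUM i<j. smul (u i) (t i))" "ALL i<j. t i:tm T e" unfolding comb_def by blast
  then show "x:T e" using tm_smul[OF T u] by (auto intro!: fv.subspace_sum[OF sT])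
 qed
 show "gsub m B (%e. comb u j (tm T e))"
  unfolding gsub_def
 proof (intro conjI allI impI)
  show "comb u j (tm T d) \<subseteq> VF m B d" for d using sub gsub_VF[OF T] by blast
  show "fv.subspace (comb u j (tm T d))" for d by (rule subspace_comb[OF subspace_tm[OF sT]])
  show "smul (%v. v i) w:comb u j (tm T (Suc d))" if "i<m" "w:comb u j (tm T d)" for d i w
  by (rule comb_smul[OF _ that(2)]) (use tm_smul[OF T hform_var[OF that(1)]] in simp)
 qed
qed

lemma comb_Suc: "x:comb u (Suc j) X \<longleftrightarrow> (EX a:comb u j X. EX y:X. x=a + smul (u j) y)"
proof
 assume "x:comb u (Suc j) X"
 then obtain t where t: "x=(SUM i<Suc j. smul (u i) (t i))" "ALL i<Suc j. t i:X" unfolding comb_def by blast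
 show "EX a:comb u j X. EX y:X. x=a + smul (u j) y"
  by (rule bexI[of _ "SUM i<j. smul (u i) (t i)"], rule bexI[of _ "t j"]) (use t in \<open>auto simp: comb_def\<close>)
next
 assume "EX a:comb u j X. EX y:X. x=a + smul (u j) y"
 then obtain t y where "x=(SUM i<j. smul (u i) (t i)) + smul (u j) y" "ALL i<j. t i:X" "y:X"
  unfolding comb_def by blast
 then show "x:comb u (Suc j) X" unfolding comb_def
  by (intro CollectI exI[of _ "t(j := y)"]) auto
qed

lemma VF_smul_eq_0:
 assumes "ph : VF k B d" "hform k e f" "f p~=0" "smul f ph=0" shows "ph=0"
proof (intro ext)
 fix b v
 have "ph b v * f v=0" for v using fun_cong[OF fun_cong[OF assms(4), of b], of v] by (simp add: smul_def mult.commute)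
 from hform_mult_eq_0[OF VF_hform[OF assms(1)] assms(2) this assms(3)] show "ph b v=0 b v" by simp
qed

context
 fixes m :: nat and N' :: "nat=>'c vf set" and B' :: "'c set"
 assumes N': "gsub m B' N'"
begin

abbreviation "SB \<equiv> box m (SF m) N'"

lemmas gsub_SB = gsub_box[OF gsub_SF N']

text \<open>The congruence is required inside the box module and not merely in the surrounding free
  module, where it would say nothing about the ideal generated in \<open>SB\<close>.\<close>

definition sb_good :: "nat=>nat=>(unit \<times> 'c=>vec=>complex)=>bool" where
 "sb_good j e g \<longleftrightarrow> subst (sb m j) g:SB e&g - subst (sb m j) g:comb (df m) j (tm SB e)"

lemma subspace_tm_SB: "fv.subspace (tm SB e)"
 by (rule subspace_tm[OF gsub_subspace[OF gsub_SB]])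

lemma sb_good_fixed:
 assumes "g:SB e" "subst (sb m j) g=g" shows "sb_good j e g"
proof -
 have "0:comb (df m) j (tm SB e)" by (rule comb_0[OF subspace_tm_SB])
 then show ?thesis unfolding sb_good_def assms(2) using assms(1) by (simp only: diff_self simp_thms)
qed

text \<open>Induction on \<open>f\<close>. Writing x for a coordinate, x' for its substitute and
  likewise g, g', the step for a variable is x g - x' g' = (x - x') g + x' (g - g').\<close>

lemma SB_subst_gen:
 assumes "j<=m" "hform m d f"
 shows "n':N' d'==>sb_good j (d+d') (tns m (%_. f) n')"
 using assms(2)
proof (induction rule: hform.induct)
 case (zero d)
 have "tns m (%_ :: unit. %v. 0) n'=0" by (auto simp: tns_def fun_eq_iff)
 then show "sb_good j (d+d') (tns m (%_ v. 0) n')"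
  using sb_good_fixed[OF gsub_0[OF gsub_SB] lin_0[OF lin_subst]] by (simp only:)
next
 case (const c)
 have "subst (sb m j) (tns m (%_ :: unit. %v. c) n')=tns m (%_ v. c) n'"
  using assms(1) by (auto simp: tns_def subst_def yv_def sb_def fun_eq_iff)
 moreover have "tns m (%_ v. c) n':SB (0+d')"
  using const by (intro tns_in_box[where d = 0 and d' = d']) (auto simp: VF_def hform.const)
 ultimately show "sb_good j (0+d') (tns m (%_ v. c) n')" by (rule sb_good_fixed[rotated])
next
 case (mult_var d f i)
 let ?g = "tns m (%_ :: unit. f) n'" and ?h = "tns m (%_ :: unit. %v. v i * f v) n'"
 have IH: "subst (sb m j) ?g:SB (d+d')" "?g - subst (sb m j) ?g:comb (df m) j (tm SB (d+d'))"
  using mult_var.IH[OF mult_var.prems] unfolding sb_good_def by simp_all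
 have gS: "?g:SB (d+d')"
  using mult_var by (intro tns_in_box[where d = d and d' = d']) (auto simp: VF_def)
 have sS: "fv.subspace (SB k)" for k by (rule gsub_subspace[OF gsub_SB])
 have h: "?h = smul (%v. v i) ?g" by (auto simp: tns_def smul_def fun_eq_iff)
 define i' where "i'=(if i<j then m+i else i)"
 have i': "i'<2 * m" using mult_var.hyps(2) by (simp add: i'_def)
 have sh: "subst (sb m j) ?h = smul (%v. v i') (subst (sb m j) ?g)"
  unfolding h subst_smul by (simp add: sb_def i'_def)
 have 1: "subst (sb m j) ?h:SB (Suc d+d')"
  unfolding sh using gsub_var[OF gsub_SB i' IH(1)] by simp
 have "smul (%v. v i') (?g - subst (sb m j) ?g):comb (df m) j (SB (d+d'))"
  by (rule comb_smul[OF _ IH(2)]) (use tm_smul[OF gsub_SB hform_var[OF i']] in blast)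
 moreover have "?h - subst (sb m j) ?h=(if i<j then smul (df m i) ?g else 0) + smul (%v. v i') (?g - subst (sb m j) ?g)"
  unfolding sh unfolding h by (auto simp: smul_def df_def i'_def fun_eq_iff algebra_simps)
 moreover have "(if i<j then smul (df m i) ?g else 0):comb (df m) j (SB (d+d'))"
  using comb_base[OF sS _ gS, of i j "df m"] comb_0[OF sS, of "df m" j] by simp
 ultimately have "?h - subst (sb m j) ?h:comb (df m) j (tm SB (Suc d+d'))"
  using fv.subspace_add[OF subspace_comb[OF sS]] by simp
 with 1 show "sb_good j (Suc d+d') ?h" unfolding sb_good_def by (rule conjI)
next
 case (add d f g)
 let ?f = "tns m (%_ :: unit. f) n'" and ?g = "tns m (%_ :: unit. g) n'"
 have e: "tns m (%_ :: unit. %v. f v+g v) n'=?f+?g" by (auto simp: tns_def fun_eq_iff algebra_simps)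
 have IH: "subst (sb m j) ?f:SB (d+d')" "?f - subst (sb m j) ?f:comb (df m) j (tm SB (d+d'))"
  "subst (sb m j) ?g:SB (d+d')" "?g - subst (sb m j) ?g:comb (df m) j (tm SB (d+d'))"
  using add.IH(1)[OF add.prems] add.IH(2)[OF add.prems] unfolding sb_good_def by simp_all
 have s: "subst (sb m j) (?f+?g) = subst (sb m j) ?f + subst (sb m j) ?g" by (rule lin_add[OF lin_subst])
 have "?f+?g-(subst (sb m j) ?f + subst (sb m j) ?g)=(?f - subst (sb m j) ?f)+(?g - subst (sb m j) ?g)"
  by (simp only: algebra_simps)
 moreover have "... : comb (df m) j (tm SB (d+d'))"
  by (rule fv.subspace_add[OF subspace_comb[OF subspace_tm[OF gsub_subspace[OF gsub_SB]]] IH(2,4)])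
 moreover have "subst (sb m j) ?f + subst (sb m j) ?g:SB (d+d')" by (rule gsub_add[OF gsub_SB IH(1,3)])
 ultimately show "sb_good j (d+d') (tns m (%_ v. f v+g v) n')" unfolding sb_good_def e s by (simp only: simp_thms)
qed

lemma SB_subst:
 assumes "j<=m" "x:SB e"
 shows "subst (sb m j) x:SB e" "x - subst (sb m j) x:comb (df m) j (tm SB e)"
proof -
 have gen: "subst (sb m j) (tns m f n'):SB e&tns m f n' - subst (sb m j) (tns m f n'):comb (df m) j (tm SB e)"
  if "f:SF m d" "n':N' d'" "d+d'=e" for f n' d d'
 proof -
  have "f=(%_. f ())" by auto
  then show ?thesis using SB_subst_gen[OF assms(1) VF_hform[OF that(1), of "()"] that(2)] that(3)
  unfolding sb_good_def by metis
 qed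
 show "subst (sb m j) x:SB e"
  by (rule box_map[OF lin_subst gsub_subspace[OF gsub_SB] _ assms(2)]) (use gen in blast)
 have "lin (%x. x - subst (sb m j) x)"
  by (rule linI) (simp_all add: lin_add[OF lin_subst] lin_scl[OF lin_subst] fv.scale_right_diff_distrib)
 then show "x - subst (sb m j) x:comb (df m) j (tm SB e)"
  by (rule box_map[OF _ subspace_comb[OF subspace_tm[OF gsub_subspace[OF gsub_SB]]] _ assms(2)]) (use gen in blast)
qed

text \<open>The substitution annihilates the ideal of the earlier equations but fixes
  \<open>df m j\<close>. Hence \<open>df m j\<close> times the substituted \<open>x\<close> is zero,
  the substituted \<open>x\<close> is zero, and \<open>x\<close> lies in the ideal because it is
  congruent to its substitute.\<close>

lemma SB_regular:
 assumes "j<m" "x:SB e" "smul (df m j) x:comb (df m) j (SB e)"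
 shows "x:comb (df m) j (tm SB e)"
proof -
 let ?s = "subst (sb m j)"
 obtain t where t: "smul (df m j) x=(SUM i<j. smul (df m i) (t i))" using assms(3) unfolding comb_def by blast
 have "?s (smul (df m j) x)=(SUM i<j. smul (%v. df m i (sb m j v)) (?s (t i)))"
  unfolding t lin_sum[OF lin_subst] subst_smul ..
 also have "... = 0" using assms(1) by (intro sum.neutral) (simp add: df_def sb_def)
 finally have "smul (%v. df m j (sb m j v)) (?s x)=0" by (simp only: subst_smul)
 moreover have "(%v. df m j (sb m j v))=df m j" using assms(1) by (auto simp: df_def sb_def)
 ultimately have "smul (df m j) (?s x)=0" by simp
 moreover have "df m j (%i. if i=j then 1 else 0)~=0" using assms(1) by (simp add: df_def)
 moreover have "?s x:VF (2 * m) (UNIV \<times> B') e"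
  using SB_subst(1)[of j x e] assms gsub_VF[OF gsub_SB] by simp
 ultimately have "?s x=0" using VF_smul_eq_0 hform_df[OF assms(1)] by blast
 then show ?thesis using SB_subst(2)[of j x e] assms by simp
qed

lemma SB_dg:
 assumes "x:SB e" "dg m x=0" shows "x:comb (df m) m (tm SB e)"
proof -
 have "subst (sb m m) x=0"
 proof (intro ext)
  fix b v
  have "x b (sb m m v)=x b (dbl m (yv m v))"
  by (rule hform_cong[OF VF_hform[OF gsub_VF[OF gsub_SB assms(1)]]]) (auto simp: sb_def dbl_def yv_def)
  also have "... = 0" using fun_cong[OF fun_cong[OF assms(2), of b], of "yv m v"] by (simp add: subst_def)
  finally show "subst (sb m m) x b v=0 b v" by (simp add: subst_def)
 qed
 then show ?thesis using SB_subst(2)[of m x e] assms(1) by simp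
qed

end

section \<open>Local bases, and the diagonal equations near a point\<close>

text \<open>Multiplication by \<open>f\<close> factors \<open>N\<close> through the free module on \<open>s 0, \<dots>, s (r - 1)\<close>.\<close>

definition locbasis :: "nat=>(nat=>'b vf set)=>nat=>(vec=>complex)=>nat =>
  (nat=>'b vf)=>nat=>bool" where
 "locbasis m N e f r s c \<longleftrightarrow> hform m e f&c<=e&(ALL k<r. s k:N c) &
  (EX e' h q. hform m e' h&h q~=0&(ALL v a. h v~=0-->(ALL b. (SUM k<r. a k * s k b v)=0)-->(ALL k<r. a k=0))) &
  (ALL d. ALL n:N d. EX al. (ALL k<r. hform m (e+d - c) (al k))&smul f n=(SUM k<r. smul (al k) (s k)))"

text \<open>Local freeness away from the vertex of the cone, that is, on projective space. The
  number \<open>r\<close> may depend on the point and may be 0; this matters when a determinant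
  module could turn out to be zero.\<close>

definition locfree :: "nat=>(nat=>'b vf set)=>bool" where
 "locfree m N \<longleftrightarrow> (ALL p. (EX i<m. p i~=0)-->(EX e f r s c. locbasis m N e f r s c&f p~=0))"

definition mulS :: "'b vf=>(unit \<times> 'c=>vec=>complex)=>'b \<times> 'c=>vec=>complex" where
 "mulS s ps=(%(b, b') v. s b v * ps ((), b') v)"

lemma lin_mulS: "lin (mulS s)"
 by (rule linI) (auto simp: mulS_def scl_def fun_eq_iff algebra_simps)

lemma mulS_smul: "mulS s (smul f ps) = smul f (mulS s ps)"
 by (auto simp: mulS_def smul_def fun_eq_iff)

context
 fixes m :: nat and N :: "nat=>'b vf set" and N' :: "nat=>'c vf set"
  and B :: "'b set" and B' :: "'c set"
 assumes N: "gsub m B N" and N': "gsub m B' N'"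
begin

lemma mulS_SB:
 assumes s: "s:N c" and x: "x:box m (SF m) N' E" shows "mulS s x:box m N N' (c+E)"
proof (rule box_map[OF lin_mulS gsub_subspace[OF gsub_box[OF N N']] _ x])
 fix f n' d d' assume f: "f:SF m d" "n':N' d'" "d+d'=E"
 have "mulS s (tns m f n')=tns m (smul (f ()) s) n'"
  by (auto simp: mulS_def tns_def smul_def fun_eq_iff)
 moreover have "smul (f ()) s:N (d + c)" using gsub_smul[OF N VF_hform[OF f(1)] s] .
 ultimately show "mulS s (tns m f n'):box m N N' (c+E)"
  using tns_in_box[where N = N and N' = N', of "smul (f ()) s" "d + c" n' d' "c+E"] f by simp
qed

lemma mulS_tm_SB:
 assumes s: "s:N c" and x: "x:tm (box m (SF m) N') E" shows "mulS s x:tm (box m N N') (c+E)"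
proof (cases E)
 case 0
 then have "mulS s x=0" using x lin_0[OF lin_mulS] by simp
 have "0:tm (box m N N') (c+E)" by (rule fv.subspace_0[OF subspace_tm[OF gsub_subspace[OF gsub_box[OF N N']]]])
 with \<open>mulS s x = 0\<close> show ?thesis by (simp only:)
next
 case (Suc E')
 then show ?thesis using mulS_SB[OF s, of x E'] x by simp
qed

context
 fixes e r c :: nat and f :: "vec=>complex" and s :: "nat=>'b vf" and p :: vec
 assumes lb: "locbasis m N e f r s c" and fp: "f p~=0"
begin

lemma f: "hform m e f" "f p~=0" and ce: "c<=e" and s: "k<r==>s k:N c"
 using lb fp by (simp_all add: locbasis_def)

lemma indep:
 obtains e' h q where "hform m e' h" "h q~=0"
  "!!v a k. h v~=0==>(!!b. (SUM k<r. a k * s k b v)=0)==>k<r==>a k=0"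
proof -
 from lb have "EX e' h q. hform m e' h&h q~=0&(ALL v a. h v~=0-->(ALL b. (SUM k<r. a k * s k b v)=0)-->(ALL k<r. a k=0))"
  unfolding locbasis_def by simp
 then show ?thesis
 proof (elim exE conjE)
  fix e' h q
  assume a: "hform m e' h" "h q~=0"
  and b: "ALL v a. h v~=0-->(ALL b. (SUM k<r. a k * s k b v)=0)-->(ALL k<r. a k=0)"
  show ?thesis by (rule that[OF a]) (use b in simp)
 qed
qed

lemma gen: "n:N d==>EX al. (ALL k<r. hform m (e+d - c) (al k))&smul f n=(SUM k<r. smul (al k) (s k))"
 using lb unfolding locbasis_def by simp

lemma split_ex:
 assumes "ph : box m N N' E"
 shows "EX ps. (ALL k. ps k:box m (SF m) N' (e+E - c))&smul f ph=(SUM k<r. mulS (s k) (ps k))"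
proof -
 let ?X = "{ph. EX ps. (ALL k. ps k:box m (SF m) N' (e+E - c))&smul f ph=(SUM k<r. mulS (s k) (ps k))}"
 note sub = gsub_subspace[OF gsub_box[OF gsub_SF N'], of "e+E - c"]
 have "fv.subspace ?X"
  unfolding fv.subspace_def
 proof (intro conjI ballI allI)
  show "0 : ?X"
  proof (intro CollectI exI conjI allI)
  show "(0 :: unit \<times> 'c=>vec=>complex):box m (SF m) N' (e+E - c)" by (rule fv.subspace_0[OF sub])
  have "mulS (s k) (0 :: unit \<times> 'c=>vec=>complex)=0" for k by (rule lin_0[OF lin_mulS])
  then show "smul f 0=(SUM k<r. mulS (s k) (0 :: unit \<times> 'c=>vec=>complex))" by (simp only: smul_0 sum.neutral_const)
  qed
 next
  fix x y assume "x : ?X" "y : ?X"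
  then obtain ps ps' where *: "ALL k. ps k:box m (SF m) N' (e+E - c)" "smul f x=(SUM k<r. mulS (s k) (ps k))"
  "ALL k. ps' k:box m (SF m) N' (e+E - c)" "smul f y=(SUM k<r. mulS (s k) (ps' k))" by blast
  show "x+y : ?X"
  proof (intro CollectI exI conjI allI)
  show "ps k+ps' k:box m (SF m) N' (e+E - c)" for k using * fv.subspace_add[OF sub] by blast
  show "smul f (x+y)=(SUM k<r. mulS (s k) (ps k+ps' k))"
  by (simp only: smul_add *(2,4) lin_add[OF lin_mulS] sum.distrib)
  qed
 next
  fix a x assume "x : ?X"
  then obtain ps where *: "ALL k. ps k:box m (SF m) N' (e+E - c)" "smul f x=(SUM k<r. mulS (s k) (ps k))" by blast
  show "scl a x : ?X"
  proof (intro CollectI exI conjI allI)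
  show "scl a (ps k):box m (SF m) N' (e+E - c)" for k using * fv.subspace_scale[OF sub] by blast
  show "smul f (scl a x)=(SUM k<r. mulS (s k) (scl a (ps k)))"
  by (simp only: smul_scl *(2) lin_scl[OF lin_mulS] fv.scale_sum_right)
  qed
 qed
 have "ph : ?X"
 proof (rule box_map[OF lin_id \<open>fv.subspace ?X\<close> _ assms])
  fix n n' d d' assume n: "n:N d" "n':N' d'" "d+d'=E"
  obtain al where al: "!!k. k<r==>hform m (e+d - c) (al k)" "smul f n=(SUM k<r. smul (al k) (s k))"
  using gen[OF n(1)] by blast
  let ?ps = "%k. if k<r then tns m (%_. al k) n' else 0"
  show "tns m n n' : ?X"
  proof (intro CollectI exI[of _ ?ps] conjI allI)
  fix k
  show "?ps k:box m (SF m) N' (e+E - c)"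
  using fv.subspace_0[OF sub] al(1)[of k] n ce
  by (auto intro!: tns_in_box[where d = "e+d - c" and d' = d'] simp: VF_def)
  next
  have "smul f (tns m n n')=tns m (smul f n) n'"
  by (auto simp: smul_def tns_def fun_eq_iff)
  also have "... = (SUM k<r. tns m (smul (al k) (s k)) n')"
  unfolding al(2) by (rule lin_sum[OF lin_tns_left])
  also have "... = (SUM k<r. mulS (s k) (?ps k))"
  by (intro sum.cong refl) (auto simp: tns_def smul_def mulS_def fun_eq_iff)
  finally show "smul f (tns m n n')=(SUM k<r. mulS (s k) (?ps k))" .
  qed
 qed
 then show ?thesis by blast
qed

lemma split_unique:
 assumes ps: "!!k. k<r==>ps k:VF (2 * m) (UNIV \<times> B') E" and 0: "(SUM k<r. mulS (s k) (ps k))=0" and k: "k<r"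
 shows "ps k=0"
proof (rule indep)
 fix e' h q
 assume h: "hform m e' h" "h q~=0"
  and ind: "!!v a k. h v~=0==>(!!b. (SUM k<r. a k * s k b v)=0)==>k<r==>a k=0"
 have h2: "hform (2 * m) e' h" by (rule hform_mono[OF h(1)]) simp
 show "ps k=0"
 proof (rule VF_smul_eq_0[where f = h and p = q, OF ps[OF k] h2 h(2)])
  show "smul h (ps k)=0"
  proof (intro ext)
  fix ub :: "unit \<times> 'c" and v
  obtain b' where ub: "ub=((), b')" by (cases ub) auto
  show "smul h (ps k) ub v=0 ub v"
  proof (cases "h v=0")
  case False
  have "(SUM k<r. ps k ((), b') v * s k b v)=0" for b
  using fun_cong[OF fun_cong[OF 0, of "(b, b')"], of v] by (simp add: sum_apply2 mulS_def mult.commute)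
  from ind[OF False, of "%k. ps k ((), b') v", OF this k] show ?thesis
  by (simp add: smul_def ub)
  qed (simp add: smul_def)
  qed
 qed
qed

lemma mulS_comb:
 assumes k: "k<r" and x: "x:comb u j (tm (box m (SF m) N') (e+E - c))"
 shows "mulS (s k) x:comb u j (tm (box m N N') (e+E))"
proof -
 obtain t where t: "x=(SUM i<j. smul (u i) (t i))" "!!i. i<j==>t i:tm (box m (SF m) N') (e+E - c)"
  using x unfolding comb_def by blast
 have "mulS (s k) x=(SUM i<j. smul (u i) (mulS (s k) (t i)))"
  unfolding t(1) lin_sum[OF lin_mulS] mulS_smul ..
 moreover have "mulS (s k) (t i):tm (box m N N') (e+E)" if "i<j" for i
  using mulS_tm_SB[OF s[OF k] t(2)[OF that]] ce by simp
 ultimately show ?thesis unfolding comb_def by (intro CollectI exI[of _ "%i. mulS (s k) (t i)"]) simp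
qed

text \<open>After multiplication by \<open>f\<close> elements are written in the local basis. The
  coefficients are unique because the basis is generically independent, so the claim splits into one
  claim per coefficient, each in the tensor product of the polynomial ring with \<open>N'\<close>,
  where \<open>SB_regular\<close> applies.\<close>

lemma regular_local:
 assumes j: "j<m" and y: "y:box m N N' E" "smul (df m j) y:comb (df m) j (box m N N' E)"
 shows "smul f y:comb (df m) j (tm (box m N N') (e+E))"
proof -
 let ?E = "e+E - c" and ?SB = "box m (SF m) N'"
 note gSB = gsub_box[OF gsub_SF N']
 obtain ps where ps: "!!k. ps k : ?SB ?E" "smul f y=(SUM k<r. mulS (s k) (ps k))"
  using split_ex[OF y(1)] by blast
 obtain t where t: "smul (df m j) y=(SUM i<j. smul (df m i) (t i))" "!!i. i<j==>t i:box m N N' E"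
  using y(2) unfolding comb_def by blast
 have "EX th. ALL i<j. (ALL k. th i k : ?SB ?E)&smul f (t i)=(SUM k<r. mulS (s k) (th i k))"
  using split_ex[OF t(2)] by metis
 then obtain th where th: "!!i k. i<j==>th i k : ?SB ?E" "!!i. i<j==>smul f (t i)=(SUM k<r. mulS (s k) (th i k))"
  by blast
 define rh where "rh k = smul (df m j) (ps k)-(SUM i<j. smul (df m i) (th i k))" for k
 have dSB: "smul (df m i) x : ?SB (Suc ?E)" if "i<m" "x : ?SB ?E" for i x
  using gsub_smul[OF gSB hform_df[OF that(1)] that(2)] by simp
 have "rh k : ?SB (Suc ?E)" for k unfolding rh_def
  by (intro gsub_diff[OF gSB] fv.subspace_sum[OF gsub_subspace[OF gSB]] dSB j ps(1) th(1)) (use j in auto)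
 note rhV = gsub_VF[OF gSB this]
 have "(SUM k<r. mulS (s k) (rh k)) = smul (df m j) (smul f y)-(SUM k<r. SUM i<j. smul (df m i) (mulS (s k) (th i k)))"
  unfolding rh_def ps(2) lin_diff[OF lin_mulS] lin_sum[OF lin_mulS] mulS_smul smul_sum sum_subtractf ..
 also have "(SUM k<r. SUM i<j. smul (df m i) (mulS (s k) (th i k)))=(SUM i<j. smul (df m i) (smul f (t i)))"
  by (subst sum.swap) (intro sum.cong refl, simp add: th(2) smul_sum)
 also have "... = smul (df m j) (smul f y)"
  unfolding smul_commute[of "df m _" f] t(1) smul_sum ..
 finally have 0: "(SUM k<r. mulS (s k) (rh k))=0" by (simp only: diff_self)
 have "ps k:comb (df m) j (tm ?SB ?E)" if k: "k<r" for k
 proof (rule SB_regular[OF N' j ps(1)])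
  have "smul (df m j) (ps k)=(SUM i<j. smul (df m i) (th i k))"
  using split_unique[OF rhV 0 k] unfolding rh_def by simp
  then show "smul (df m j) (ps k):comb (df m) j (?SB ?E)" unfolding comb_def
  by (intro CollectI exI[of _ "%i. th i k"]) (use th(1) in simp)
 qed
 then show ?thesis unfolding ps(2)
  by (intro fv.subspace_sum[OF subspace_comb[OF subspace_tm[OF gsub_subspace[OF gsub_box[OF N N']]]]] mulS_comb) simp_all
qed

text \<open>The same splitting: the coefficients of an element vanishing on the diagonal vanish
  there themselves, since \<open>h\<close> is unchanged by doubling a point, and
  \<open>SB_dg\<close> puts each of them into the diagonal ideal.\<close>

lemma kills_diag:
 assumes ph: "ph : box m N N' E" and z: "dg m ph=0"
 shows "smul f ph : comb (df m) m (tm (box m N N') (e+E))"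
proof -
 let ?E = "e+E - c" and ?SB = "box m (SF m) N'"
 note gSB = gsub_box[OF gsub_SF N']
 obtain ps where ps: "!!k. ps k : ?SB ?E" "smul f ph=(SUM k<r. mulS (s k) (ps k))"
  using split_ex[OF ph] by blast
 have dg0: "dg m (ps k)=0" if k: "k<r" for k
 proof (rule indep)
  fix e' h q
  assume h: "hform m e' h" "h q~=0"
  and ind: "!!v a k. h v~=0==>(!!b. (SUM k<r. a k * s k b v)=0)==>k<r==>a k=0"
  show "dg m (ps k)=0"
  proof (rule VF_smul_eq_0[where f = h and p = q, OF dg_VF[OF gsub_VF[OF gSB ps(1)]] h])
  show "smul h (dg m (ps k))=0"
  proof (intro ext)
  fix ub :: "unit \<times> 'c" and v
  obtain b' where ub: "ub=((), b')" by (cases ub) auto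
  show "smul h (dg m (ps k)) ub v=0 ub v"
  proof (cases "h v=0")
  case False
  have fd: "h (dbl m v)=h v" by (rule hform_cong[OF h(1)]) (simp add: dbl_def)
  have "(SUM k<r. ps k ((), b') (dbl m v) * s k b (dbl m v))=0" for b
  proof -
  have "smul f ph (b, b') (dbl m v)=0"
  using fun_cong[OF fun_cong[OF z, of "(b, b')"], of v] by (simp add: smul_def subst_def)
  then show ?thesis unfolding ps(2) by (simp add: sum_apply2 mulS_def mult.commute)
  qed
  from ind[of "dbl m v" "%k. ps k ((), b') (dbl m v)", OF _ this k] fd False
  show ?thesis by (simp add: smul_def subst_def ub)
  qed (simp add: smul_def)
  qed
  qed
 qed
 show ?thesis unfolding ps(2)
  by (intro fv.subspace_sum[OF subspace_comb[OF subspace_tm[OF gsub_subspace[OF gsub_box[OF N N']]]]] mulS_comb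
  SB_dg[OF N' ps(1) dg0]) simp_all
qed

end

end

lemma dbl_point:
 assumes "EX k<2 * m. P k~=(0 :: complex)" "ALL j<m. df m j P=0" shows "EX i<m. P i~=0"
proof -
 obtain k where k: "k<2 * m" "P k~=0" using assms(1) by blast
 show ?thesis
 proof (cases "k<m")
  case False
  then have "P (k-m)~=0" using assms(2)[rule_format, of "k-m"] k by (simp add: df_def)
  then show ?thesis using k False by (intro exI[of _ "k-m"]) simp
 qed (use k in blast)
qed

section \<open>The dimension of a tensor product\<close>

lemma dim_span_family:
 assumes fin: "finite I" and ind: "!!c. (SUM i:I. scl (c i) (g i))=0==>ALL i:I. c i=0"
 shows "fv.dim (fv.span (g ` I)) = card I"
proof -
 have inj: "inj_on g I"
 proof (rule inj_onI, rule ccontr)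
  fix i j assume ij: "i:I" "j:I" "g i=g j" "i~=j"
  let ?c = "%k. if k=i then 1 else if k=j then -1 else 0 :: complex"
  have "(SUM k:I. scl (?c k) (g k))=(SUM k:{i, j}. scl (?c k) (g k))"
  using ij fin by (intro sum.mono_neutral_right) (auto simp: fv.scale_zero_left)
  also have "... = 0" using ij by simp
  finally have "ALL k:I. ?c k=0" by (rule ind)
  then show False using ij by auto
 qed
 have "fv.independent (g ` I)"
 proof (rule ccontr)
  assume "~?thesis"
  then have "EX u. (EX w:g ` I. u w~=0)&(SUM w:g ` I. scl (u w) w)=0"
  using fv.dependent_finite[of "g ` I"] fin by simp
  then obtain u where u: "EX w:g ` I. u w~=0" "(SUM w:g ` I. scl (u w) w)=0" by (elim exE conjE) (rule that)
  have "(SUM i:I. scl (u (g i)) (g i))=0" using u(2) by (simp add: sum.reindex[OF inj])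
  from ind[OF this] u(1) show False by auto
 qed
 then show ?thesis using fv.dim_span_eq_card_independent card_image[OF inj] by metis
qed

lemma independent_family:
 assumes "fv.independent A" "finite A" "(SUM a:A. scl (c a) a)=0" "a:A"
 shows "c a=0"
 using fv.independentD[OF assms(1,2) subset_refl assms(3,4)] .

definition join :: "nat=>vec=>vec=>vec" where
 "join m x y=(%i. if i<m then x i else y (i-m))"

lemma yv_join: "yv m (join m x y)=y"
 by (auto simp: yv_def join_def)

lemma hform_join: "hform m d f==>f (join m x y)=f x"
 by (rule hform_cong[of m d f]) (simp_all add: join_def)

context
 fixes m :: nat and N :: "nat=>'b vf set" and N' :: "nat=>'c vf set"
  and B :: "'b set" and B' :: "'c set"
  and A :: "nat=>'b vf set" and A' :: "nat=>'c vf set"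
 assumes N: "gsub m B N" and N': "gsub m B' N'"
  and A: "!!d. finite (A d)" "!!d. fv.independent (A d)" "!!d. fv.span (A d)=N d"
  and A': "!!d. finite (A' d)" "!!d. fv.independent (A' d)" "!!d. fv.span (A' d)=N' d"
begin

definition "bx e=(SIGMA d:{..e}. A d \<times> A' (e-d))"

abbreviation "bxt \<equiv> (%(d::nat, n, n'). tns m n n')"

lemma finite_bx: "finite (bx e)"
 unfolding bx_def using A(1) A'(1) by auto

lemma A_N: "n:A d==>n:N d" "n':A' d==>n':N' d"
 using A(3)[of d] A'(3)[of d] by (metis fv.span_base)+

text \<open>The two points are evaluated independently through \<open>join\<close>. Scaling the
  first one by \<open>t\<close> multiplies the terms of first degree \<open>d\<close> by t^d, which
  separates the bidegrees; then independence of \<open>A d\<close> and of \<open>A' (e-d)\<close> is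
  used in turn.\<close>

lemma bx_indep:
 assumes "(SUM x:bx e. scl (c x) (bxt x))=0" "x:bx e" shows "c x=0"
proof -
 have *: "(SUM d<=e. SUM n:A d. (SUM n':A' (e-d). c (d, n, n') * n' b' y) * n b x)=0" for b b' x y
 proof -
  have "(SUM x:bx e. scl (c x) (bxt x)) (b, b') (join m x y)=0" using assms(1) by simp
  moreover have "(SUM x:bx e. scl (c x) (bxt x)) (b, b') (join m x y) =
  (SUM (d, n, n'):bx e. c (d, n, n') * n' b' y * n b x)"
  unfolding sum_apply2
  proof (rule sum.cong[OF refl])
  fix z assume "z:bx e"
  then obtain d n n' where z: "z=(d, n, n')" "n:A d" "n':A' (e-d)" by (auto simp: bx_def)
  have "n b (join m x y)=n b x"
  by (rule hform_join[OF VF_hform[OF gsub_VF[OF N A_N(1)[OF z(2)]]]])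
  then show "scl (c z) (bxt z) (b, b') (join m x y)=(case z of (d, n, n')=>c (d, n, n') * n' b' y * n b x)"
  by (simp add: z scl_def tns_def yv_join)
  qed
  moreover have "(SUM (d, n, n'):bx e. c (d, n, n') * n' b' y * n b x) =
  (SUM d<=e. SUM n:A d. (SUM n':A' (e-d). c (d, n, n') * n' b' y) * n b x)"
  unfolding bx_def sum_distrib_right using A(1) A'(1)
  by (simp add: sum.Sigma sum.cartesian_product split_def)
  ultimately show ?thesis by simp
 qed
 obtain d n n' where x: "x=(d, n, n')" "d<=e" "n:A d" "n':A' (e-d)"
  using assms(2) by (auto simp: bx_def)
 have "(SUM n':A' (e-d). c (d, n, n') * n' b' y)=0" for b' y
 proof (rule independent_family[OF A(2,1) _ x(3)])
  show "(SUM n:A d. scl (SUM n':A' (e-d). c (d, n, n') * n' b' y) n)=0"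
  proof (intro ext)
  fix b v
  let ?X = "%d. SUM n:A d. (SUM n':A' (e-d). c (d, n, n') * n' b' y) * n b v"
  have "(SUM d<=e. ?X d * t ^ d)=0" for t
  proof -
  have "n b (%i. t * v i)=t ^ d * n b v" if "n:A d" for n d
  using hform_homogeneous[OF VF_hform[OF gsub_VF[OF N A_N(1)[OF that]]]] .
  then have "(SUM d<=e. SUM n:A d. (SUM n':A' (e-d). c (d, n, n') * n' b' y) * n b (%i. t * v i))=(SUM d<=e. ?X d * t ^ d)"
  unfolding sum_distrib_right by (intro sum.cong refl) (simp add: mult_ac sum_distrib_left)
  then show ?thesis using * by simp
  qed
  then have "?X d=0" using polyfun_eq_0[of ?X e] x(2) by blast
  then show "(SUM n:A d. scl (SUM n':A' (e-d). c (d, n, n') * n' b' y) n) b v=0 b v"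
  by (simp add: sum_apply2 scl_def)
  qed
 qed
 then have "(SUM n':A' (e-d). scl (c (d, n, n')) n')=0"
  by (intro ext) (simp add: sum_apply2 scl_def)
 from independent_family[OF A'(2,1) this x(4)] show ?thesis by (simp add: x(1))
qed

lemma box_span: "box m N N' e=fv.span (bxt ` bx e)"
proof
 show "fv.span (bxt ` bx e) \<subseteq> box m N N' e"
 proof (rule fv.span_minimal)
  show "bxt ` bx e \<subseteq> box m N N' e"
  proof (rule image_subsetI)
  fix x assume "x:bx e"
  then obtain d n n' where x: "x=(d, n, n')" "d<=e" "n:A d" "n':A' (e-d)" by (auto simp: bx_def)
  show "bxt x:box m N N' e" using tns_in_box[of n N d n' N' "e-d" e m] A_N x by simp
  qed
  show "fv.subspace (box m N N' e)" by (rule gsub_subspace[OF gsub_box[OF N N']])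
 qed
 show "box m N N' e \<subseteq> fv.span (bxt ` bx e)"
 proof
  fix x assume x: "x:box m N N' e"
  show "x:fv.span (bxt ` bx e)"
  proof (rule box_map[OF lin_id fv.subspace_span _ x])
  fix n n' d d' assume n: "n:N d" "n':N' d'" "d+d'=e"
  have 1: "tns m a n':fv.span (bxt ` bx e)" if a: "a:A d" for a
  proof -
  have "(%n'. tns m a n') ` A' d' \<subseteq> bxt ` bx e"
  proof (rule image_subsetI)
  fix a' assume "a':A' d'"
  then have "bxt (d, a, a'):bxt ` bx e" using a n(3) by (intro imageI) (auto simp: bx_def)
  then show "tns m a a':bxt ` bx e" by simp
  qed
  from lin_span_mono[OF lin_tns_right this] show ?thesis using n(2) A'(3)[of d'] by blast
  qed
  have "(%n. tns m n n') ` A d \<subseteq> fv.span (bxt ` bx e)" using 1 by blast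
  from lin_span_mono[OF lin_tns_left this] show "tns m n n':fv.span (bxt ` bx e)"
  using n(1) A(3)[of d] by (simp only: fv.span_span) blast
  qed
 qed
qed

lemma dim_box: "fv.dim (box m N N' e)=(SUM d<=e. card (A d) * card (A' (e-d)))"
proof -
 have "fv.dim (box m N N' e) = card (bx e)"
  unfolding box_span by (rule dim_span_family[OF finite_bx]) (use bx_indep in blast)
 then show ?thesis unfolding bx_def using A(1) A'(1) by (simp add: card_cartesian_product)
qed

end

section \<open>The flip of a tensor square and its two eigenspaces\<close>

definition swv :: "nat=>vec=>vec" where
 "swv m v=(%i. if i<m then v (m+i) else v (i-m))"

definition twist_swap :: "nat=>('b \<times> 'c=>vec=>complex)=>'c \<times> 'b=>vec=>complex" where
 "twist_swap m ph=(%(b, b') v. ph (b', b) (swv m v))"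

lemma lin_swap: "lin (twist_swap m)"
 by (rule linI) (auto simp: twist_swap_def scl_def fun_eq_iff)

text \<open>The minus sign is what makes multiplication by a diagonal equation carry symmetric
  elements to skew ones and conversely.\<close>

lemma swap_df: "j<m==>twist_swap m (smul (df m j) ph) = - smul (df m j) (twist_swap m ph)"
 by (auto simp: twist_swap_def smul_def df_def swv_def fun_eq_iff algebra_simps)

lemma twist_swap_comb:
 assumes x: "x:comb (df m) j X" and j: "j<=m" and Y: "fv.subspace Y" and XY: "!!x. x:X==>twist_swap m x:Y"
 shows "twist_swap m x:comb (df m) j Y"
proof -
 obtain t where t: "x=(SUM i<j. smul (df m i) (t i))" "ALL i<j. t i:X" using x unfolding comb_def by blast
 have "twist_swap m x=(SUM i<j. smul (df m i) (- twist_swap m (t i)))"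
  unfolding t(1) lin_sum[OF lin_swap] using j by (intro sum.cong refl) (simp add: swap_df)
 then show ?thesis unfolding comb_def
  by (intro CollectI exI[of _ "%i. - twist_swap m (t i)"]) (use t(2) XY fv.subspace_neg[OF Y] in simp)
qed

lemma twist_swap_tns:
 assumes N: "gsub m B N" and N': "gsub m B' N'" and n: "n:N d" "n':N' d'"
 shows "twist_swap m (tns m n n')=tns m n' n"
proof -
 have 1: "n' b (yv m (swv m v))=n' b v" for b v
  by (rule hform_cong[OF VF_hform[OF gsub_VF[OF N' n(2)]]]) (simp add: yv_def swv_def)
 have 2: "n b (swv m v)=n b (yv m v)" for b v
  by (rule hform_cong[OF VF_hform[OF gsub_VF[OF N n(1)]]]) (simp add: yv_def swv_def)
 show ?thesis by (auto simp: twist_swap_def tns_def fun_eq_iff 1 2 mult.commute)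
qed

lemma twist_swap_box:
 assumes N: "gsub m B N" and N': "gsub m B' N'" and x: "x:box m N N' e"
 shows "twist_swap m x:box m N' N e" "twist_swap m (twist_swap m x)=x"
proof -
 show "twist_swap m x:box m N' N e"
  by (rule box_map[OF lin_swap gsub_subspace[OF gsub_box[OF N' N]] _ x])
  (auto simp: twist_swap_tns[OF N N'] add.commute intro: tns_in_box)
 have "lin (%x :: 'a \<times> 'b=>vec=>complex. twist_swap m (twist_swap m x)-x)"
  by (rule linI) (simp_all add: lin_add[OF lin_swap] lin_scl[OF lin_swap] fv.scale_right_diff_distrib)
 then have "twist_swap m (twist_swap m x)-x:{0}"
  by (rule box_map[OF _ fv.subspace_single_0 _ x]) (simp add: twist_swap_tns[OF N N'] twist_swap_tns[OF N' N])
 then show "twist_swap m (twist_swap m x)=x" by simp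
qed

context
 fixes m :: nat and N :: "nat=>'b vf set" and B :: "'b set"
 assumes N: "gsub m B N" and finB: "finite B"
begin

lemmas swap_tns = twist_swap_tns[OF N N]
 and swap_box = twist_swap_box(1)[OF N N]
 and swap_swap = twist_swap_box(2)[OF N N]

definition "skew e={x:box m N N e. twist_swap m x = - x}"
definition "symm e={x:box m N N e. twist_swap m x=x}"

lemma subspace_skew: "fv.subspace (skew e)"
proof -
 have "lin (%x. twist_swap m x+x)"
  by (rule linI) (simp_all add: lin_add[OF lin_swap] lin_scl[OF lin_swap] fv.scale_right_distrib)
 from lin_subspace_kernel[OF this gsub_subspace[OF gsub_box[OF N N]], of e]
 show ?thesis unfolding skew_def by (simp add: eq_neg_iff_add_eq_0)
qed

lemma lin_antisym: "lin (%x. x-twist_swap m x)"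
 by (rule linI) (simp_all add: lin_add[OF lin_swap] lin_scl[OF lin_swap] fv.scale_right_diff_distrib)

lemma symm_kernel: "symm e={x:box m N N e. x-twist_swap m x=0}"
 unfolding symm_def by (auto simp del: right_minus_eq simp: right_minus_eq[of _ "twist_swap m _"])

lemma subspace_symm: "fv.subspace (symm e)"
 unfolding symm_kernel by (rule lin_subspace_kernel[OF lin_antisym gsub_subspace[OF gsub_box[OF N N]]])

lemma skew_image: "(%x. x-twist_swap m x) ` box m N N e = skew e"
proof
 show "(%x. x-twist_swap m x) ` box m N N e \<subseteq> skew e"
 proof (rule image_subsetI)
  fix x assume x: "x:box m N N e"
  show "x-twist_swap m x:skew e" unfolding skew_def mem_Collect_eq lin_diff[OF lin_swap] swap_swap[OF x]
  using gsub_diff[OF gsub_box[OF N N] x swap_box[OF x]] by simp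
 qed
 show "skew e \<subseteq> (%x. x-twist_swap m x) ` box m N N e"
 proof
  fix x assume x: "x:skew e"
  have "twist_swap m x = - x" using x by (simp only: skew_def mem_Collect_eq)
  then have "twist_swap m (scl (1/2) x) = scl (1/2) (- x)" by (simp only: lin_scl[OF lin_swap])
  then have "scl (1/2) x-twist_swap m (scl (1/2) x) = scl (1/2) x - scl (1/2) (- x)" by (simp only:)
  also have "... = x" by (auto simp: scl_def fun_eq_iff)
  finally have "scl (1/2) x-twist_swap m (scl (1/2) x)=x" .
  moreover have half: "scl (1/2) x:box m N N e" using x gsub_scl[OF gsub_box[OF N N]] by (simp add: skew_def)
  ultimately show "x:(%x. x-twist_swap m x) ` box m N N e" using imageI[OF half, of "%x. x-twist_swap m x"] by (simp only:)
 qed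
qed

text \<open>The flip permutes the basis of pure tensors. One member of each two-element orbit
  contributes one skew element, and the fixed basis tensors are the squares n tensor n, which exist
  only when \<open>e\<close> is even and n has degree \<open>e div 2\<close>.\<close>

lemma dim_skew_symm:
 "2 * fv.dim (skew e)+(if even e then fv.dim (N (e div 2)) else 0)=(SUM d<=e. fv.dim (N d) * fv.dim (N (e-d)))"
 "fv.dim (symm e)=fv.dim (skew e)+(if even e then fv.dim (N (e div 2)) else 0)"
proof -
 have "ALL d. EX A. finite A&fv.independent A&fv.span A=N d&card A=fv.dim (N d)"
  by (metis findim_basis[OF gsub_findim[OF N finB] gsub_subspace[OF N]])
 from choice[OF this] obtain A where A: "!!d. finite (A d)" "!!d. fv.independent (A d)" "!!d. fv.span (A d)=N d"
  and cA: "!!d. card (A d)=fv.dim (N d)" by blast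
 note ctx = N N A A
 let ?X = "bx A A e" and ?g = "%(d::nat, n, n'). tns m n n'"
 have finX: "finite ?X" by (rule finite_bx[OF ctx])
 define Q where "Q=(SIGMA d:{..e}. A d)"
 have "finite Q" unfolding Q_def using A(1) by simp
 \<comment> \<open>An injection into the natural numbers orders the basis elements, so that
   \<open>L\<close> can select exactly one from each two-element orbit.\<close>
 then obtain ka :: "nat \<times> 'b vf=>nat" where ka: "inj_on ka Q"
  using finite_imp_inj_to_nat_seg by blast
 define sw where "sw=(%(d::nat, n :: 'b vf, n' :: 'b vf). (e-d, n', n))"
 define L where "L={(d, n, n') : ?X. ka (d, n) < ka (e-d, n')}"
 define F where "F={(d, n, n') : ?X. e-d=d&n=n'}"
 have bxX: "(d, n, n') : ?X \<longleftrightarrow> d<=e&n:A d&n':A (e-d)" for d n n'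
  by (auto simp: bx_def[OF ctx])
 have swX: "sw x : ?X" "sw (sw x)=x" if "x : ?X" for x
  using that by (auto simp: sw_def bxX split: prod.splits)
 have XU: "?X=L \<union> (sw ` L \<union> F)"
 proof (intro equalityI subsetI)
  fix x assume x: "x : ?X"
  obtain d n n' where xe: "x=(d, n, n')" by (cases x) auto
  have dn: "d<=e" "n:A d" "n':A (e-d)" using x by (simp_all add: xe bxX)
  consider "ka (d, n) < ka (e-d, n')" | "ka (e-d, n') < ka (d, n)" | "ka (d, n) = ka (e-d, n')" by linarith
  then show "x:L \<union> (sw ` L \<union> F)"
  proof cases
  case 1 then show ?thesis using x by (auto simp: L_def xe)
  next
  case 2
  then have "sw x:L" using swX(1)[OF x] dn by (simp add: L_def xe sw_def)
  then show ?thesis using swX(2)[OF x] by (metis UnI1 UnI2 imageI)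
  next
  case 3
  then have "(d, n)=(e-d, n')" using ka dn by (auto simp: Q_def dest!: inj_onD)
  then show ?thesis using x by (auto simp: F_def xe)
  qed
 next
  fix x assume "x:L \<union> (sw ` L \<union> F)"
  then show "x : ?X" using swX(1) by (auto simp: L_def F_def)
 qed
 have LX: "L \<subseteq> ?X" "F \<subseteq> ?X" by (auto simp: L_def F_def)
 have L_sw: "sw x~:L" if "x:L" for x
  using that by (auto simp: L_def sw_def bxX)
 have disj: "L \<inter> (sw ` L \<union> F)={}" "sw ` L \<inter> F={}"
 proof -
  show "L \<inter> (sw ` L \<union> F)={}"
  using L_sw by (auto simp: F_def) (auto simp: L_def)
  have "sw x~:F" if "x:L" for x
  using that by (auto simp: L_def F_def sw_def bxX)
  then show "sw ` L \<inter> F={}" by blast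
 qed
 have finL: "finite L" "finite F" using finX LX finite_subset by auto
 have injsw: "inj_on sw L" using swX(2) LX(1) by (intro inj_on_inverseI[of _ sw]) auto
 have "card ?X = card L+(card L + card F)"
  unfolding XU using disj finL by (simp add: card_Un_disjoint card_image[OF injsw])
 moreover have "card ?X=(SUM d<=e. fv.dim (N d) * fv.dim (N (e-d)))"
  unfolding bx_def[OF ctx] using A(1) cA by (simp add: card_cartesian_product)
 moreover have "card F=(if even e then fv.dim (N (e div 2)) else 0)"
 proof (cases "even e")
  case True
  have half: "d<=e&e-d=d \<longleftrightarrow> d=e div 2" for d using True by presburger
  have "F=(%n. (e div 2, n, n)) ` A (e div 2)"
  proof (rule set_eqI)
  fix x :: "nat \<times> 'b vf \<times> 'b vf"
  obtain d n n' where "x=(d, n, n')" by (cases x) auto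
  then show "x:F \<longleftrightarrow> x:(%n. (e div 2, n, n)) ` A (e div 2)"
  using half[of d] by (auto simp: F_def bxX)
  qed
  moreover have "inj_on (%n. (e div 2, n, n)) (A (e div 2))" by (auto simp: inj_on_def)
  ultimately show ?thesis using True cA by (simp add: card_image)
 next
  case False
  then have "F={}" by (auto simp: F_def bxX) presburger
  then show ?thesis using False by simp
 qed
 moreover have "fv.dim (skew e) = card L"
 proof -
  let ?T = "%x. x-twist_swap m x"
  have g_sw: "twist_swap m (?g x)=?g (sw x)" if "x : ?X" for x
  proof -
  obtain d n n' where x: "x=(d, n, n')" by (cases x) auto
  have "n:N d" "n':N (e-d)" using that A_N[OF ctx] by (auto simp: x bxX)
  then show ?thesis by (simp add: x sw_def swap_tns)
  qed
  have "skew e=fv.span (?T ` ?g ` ?X)"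
  unfolding skew_image[symmetric] box_span[OF ctx]
  by (rule module_hom.span_image[symmetric]) (use lin_antisym in \<open>simp add: linear_iff_module_hom\<close>)
  also have "... = fv.span ((%x. ?T (?g x)) ` L)"
  proof (rule antisym)
  show "fv.span ((%x. ?T (?g x)) ` L) \<subseteq> fv.span (?T ` ?g ` ?X)"
  proof (rule fv.span_mono, rule image_subsetI)
  fix x assume "x:L"
  then have "x : ?X" using LX by blast
  then show "?T (?g x) : ?T ` ?g ` ?X" by (intro imageI)
  qed
  show "fv.span (?T ` ?g ` ?X) \<subseteq> fv.span ((%x. ?T (?g x)) ` L)"
  proof (rule fv.span_minimal[OF _ fv.subspace_span], safe)
  fix d n n' assume "(d, n, n') : ?X"
  define x where "x=(d, n, n')"
  have x: "x : ?X" using \<open>(d, n, n') : ?X\<close> by (simp add: x_def)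
  have eq: "tns m n n'-twist_swap m (tns m n n')=?T (?g x)" by (simp add: x_def)
  have "x:L \<or> sw x:L \<or> x:F" using x XU swX by auto
  then show "tns m n n'-twist_swap m (tns m n n'):fv.span ((%x. ?T (?g x)) ` L)"
  unfolding eq
  proof (elim disjE)
  assume "x:L" then show "?T (?g x):fv.span ((%x. ?T (?g x)) ` L)" by (intro fv.span_base imageI)
  next
  assume *: "sw x:L"
  have "?T (?g x) = - ?T (?g (sw x))"
  using g_sw[OF x] g_sw[OF swX(1)[OF x]] swX(2)[OF x] by simp
  moreover have "?T (?g (sw x)):fv.span ((%x. ?T (?g x)) ` L)" by (rule fv.span_base[OF imageI[OF *]])
  ultimately show "?T (?g x):fv.span ((%x. ?T (?g x)) ` L)" by (simp only: fv.span_neg)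
  next
  assume "x:F"
  then have "sw x=x" by (auto simp: F_def sw_def)
  then have "?T (?g x)=0" using g_sw[OF x] by simp
  then show "?T (?g x):fv.span ((%x. ?T (?g x)) ` L)" by (simp only: fv.span_zero)
  qed
  qed
  qed
  also have "fv.dim ... = card L"
  proof (rule dim_span_family[OF finL(1)])
  fix c assume 0: "(SUM x:L. scl (c x) (?T (?g x)))=0"
  define c' where "c'=(%x. if x:L then c x else if sw x:L then - c (sw x) else 0)"
  have "(SUM x:?X. scl (c' x) (?g x))=(SUM x:L. scl (c' x) (?g x))+((SUM x:sw ` L. scl (c' x) (?g x))+(SUM x:F. scl (c' x) (?g x)))"
  unfolding XU using disj finL by (simp add: sum.union_disjoint)
  also have "(SUM x:F. scl (c' x) (?g x))=0"
  proof (rule sum.neutral, intro ballI)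
  fix x assume x: "x:F"
  then have "sw x=x" by (auto simp: F_def sw_def)
  moreover have "x~:L" using x disj by blast
  ultimately have "c' x=0" by (simp add: c'_def)
  then show "scl (c' x) (?g x)=0" by (simp only: fv.scale_zero_left)
  qed
  also have "(SUM x:sw ` L. scl (c' x) (?g x))=(SUM x:L. - scl (c x) (twist_swap m (?g x)))"
  unfolding sum.reindex[OF injsw] o_def
  proof (rule sum.cong[OF refl])
  fix x assume x: "x:L"
  then have xX: "x : ?X" using LX by blast
  show "scl (c' (sw x)) (?g (sw x)) = - scl (c x) (twist_swap m (?g x))"
  using L_sw[OF x] swX(2)[OF xX] x g_sw[OF xX] by (simp add: c'_def fv.scale_minus_left)
  qed
  also have "(SUM x:L. scl (c' x) (?g x))=(SUM x:L. scl (c x) (?g x))"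
  by (intro sum.cong refl) (simp add: c'_def)
  finally have "(SUM x:?X. scl (c' x) (?g x))=(SUM x:L. scl (c x) (?T (?g x)))"
  by (simp only: fv.scale_right_diff_distrib sum_subtractf sum_negf add_0_right add_uminus_conv_diff)
  then have "(SUM x:?X. scl (c' x) (?g x))=0" using 0 by (simp only:)
  from bx_indep[OF ctx this] LX(1) show "ALL x:L. c x=0" by (fastforce simp: c'_def)
  qed
  finally show ?thesis .
 qed
 ultimately show 1: "2 * fv.dim (skew e)+(if even e then fv.dim (N (e div 2)) else 0)=(SUM d<=e. fv.dim (N d) * fv.dim (N (e-d)))"
  by simp
 have "findim (box m N N e)" by (rule gsub_findim[OF gsub_box[OF N N]]) (use finB in simp)
 from rank_nullity[OF lin_antisym this gsub_subspace[OF gsub_box[OF N N]]]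
 have "fv.dim (box m N N e)=fv.dim (symm e)+fv.dim (skew e)" unfolding symm_kernel skew_image .
 then show "fv.dim (symm e)=fv.dim (skew e)+(if even e then fv.dim (N (e div 2)) else 0)"
  using 1 dim_box[OF ctx, of e] cA by simp
qed

end

section \<open>Products and exterior squares as restrictions to the diagonal\<close>

definition pw :: "'b vf=>'c vf=>'b \<times> 'c=>vec=>complex" where
 "pw n n'=(%(b, b') v. n b v * n' b' v)"

definition wdg :: "'b vf=>'b vf=>'b \<times> 'b=>vec=>complex" where
 "wdg n n'=(%(b, b') v. n b v * n' b' v-n' b v * n b' v)"

definition spanof :: "('a=>'b=>'c vf)=>(nat=>'a set)=>(nat=>'b set)=>nat=>'c vf set" where
 "spanof be N N' e=fv.span {be n n' | n n' d. d<=e&n:N d&n':N' (e-d)}"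

text \<open>The image of the tensor product over the polynomial ring in the product of the free
  modules, so that torsion is divided out. \<open>wedge\<close> is the analogous image of the
  exterior square.\<close>

abbreviation "prodm \<equiv> spanof pw"
abbreviation "wedge N \<equiv> spanof wdg N N"

lemma spanof_base: "n:N d==>n':N' d'==>d+d'=e==>be n n':spanof be N N' e"
 unfolding spanof_def by (rule fv.span_base) (intro CollectI exI[of _ n] exI[of _ n'] exI[of _ d], auto)

lemma spanof_map:
 assumes T: "lin T" and Y: "fv.subspace Y"
  and gen: "!!n n' d d'. n:N d==>n':N' d'==>d+d'=e==>T (be n n'):Y"
  and "x:spanof be N N' e"
 shows "T x:Y"
proof -
 have "T ` {be n n' | n n' d. d<=e&n:N d&n':N' (e-d)} \<subseteq> Y"
  using gen by (auto simp: image_subset_iff)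
 then have "T ` spanof be N N' e \<subseteq> fv.span Y" unfolding spanof_def by (rule lin_span_mono[OF T])
 moreover have "fv.span Y=Y" using Y by (simp add: fv.span_eq_iff)
 ultimately show ?thesis using assms(4) by blast
qed

lemma gsub_spanof:
 assumes N: "gsub m B N"
  and VF: "!!n n' d d'. n:N d==>n':N' d'==>be n n':VF m C (d+d')"
  and mult: "!!i n n'. smul (%v. v i) (be n n')=be (smul (%v. v i) n) n'"
 shows "gsub m C (spanof be N N')"
 unfolding gsub_def
proof (intro conjI allI impI)
 fix e
 show "spanof be N N' e \<subseteq> VF m C e"
 proof
  fix x assume x: "x:spanof be N N' e"
  show "x:VF m C e" by (rule spanof_map[OF lin_id subspace_VF _ x]) (use VF in auto)
 qed
 show sub: "fv.subspace (spanof be N N' e)" for e by (simp add: spanof_def)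
 fix i w assume i: "i<m" and w: "w:spanof be N N' e"
 show "smul (%v. v i) w:spanof be N N' (Suc e)"
 proof (rule spanof_map[OF lin_smul sub _ w])
  fix n n' d d' assume n: "n:N d" "n':N' d'" "d+d'=e"
  show "smul (%v. v i) (be n n'):spanof be N N' (Suc e)"
  unfolding mult using n by (intro spanof_base[where N = N and N' = N', OF gsub_var[OF N i n(1)] n(2)]) simp
 qed
qed

lemma pw_VF: "n:VF m B d==>n':VF m B' d'==>pw n n':VF m (B \<times> B') (d+d')"
 by (auto simp: VF_def pw_def intro!: hform_mult)

lemma wdg_VF:
 assumes "n:VF m B d" "n':VF m B d'" shows "wdg n n':VF m (B \<times> B) (d+d')"
proof -
 have "hform m (d+d') (%v. n b v * n' b' v-n' b v * n b' v)" for b b'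
  using hform_diff[OF hform_mult[OF VF_hform[OF assms(1), of b] VF_hform[OF assms(2), of b']]
  hform_mult[OF VF_hform[OF assms(2), of b] VF_hform[OF assms(1), of b'], unfolded add.commute[of d' d]]] .
 moreover have "n b v * n' b' v-n' b v * n b' v=0" if "(b, b')~:B \<times> B" for b b' v
  using that assms by (auto simp: VF_def)
 ultimately show ?thesis by (auto simp: VF_def wdg_def)
qed

lemma gsub_prodm: "gsub m B N==>gsub m B' N'==>gsub m (B \<times> B') (prodm N N')"
 by (rule gsub_spanof, assumption, rule pw_VF[OF gsub_VF gsub_VF]) (auto simp: pw_def smul_def fun_eq_iff)

lemma gsub_wedge: "gsub m B N==>gsub m (B \<times> B) (wedge N)"
 by (rule gsub_spanof, assumption, rule wdg_VF[OF gsub_VF gsub_VF]) (auto simp: wdg_def smul_def fun_eq_iff algebra_simps)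

lemma spanof_image:
 assumes "lin T" shows "T ` spanof be N N' e = spanof (%n n'. T (be n n')) N N' e"
proof -
 have "T ` {be n n' | n n' d. d<=e&n:N d&n':N' (e-d)} =
  {T (be n n') | n n' d. d<=e&n:N d&n':N' (e-d)}" by blast
 then show ?thesis unfolding spanof_def
  using module_hom.span_image[of scl scl T "{be n n' | n n' d. d<=e&n:N d&n':N' (e-d)}"] assms
  by (simp add: linear_iff_module_hom)
qed

lemma spanof_cong:
 assumes "!!n n' d d'. n:N d==>n':N' d'==>be n n'=ga n n'"
 shows "spanof be N N' e = spanof ga N N' e"
 unfolding spanof_def using assms by (intro arg_cong[of _ _ fv.span]) (metis (no_types, lifting))

lemma box_spanof: "box m N N' e = spanof (tns m) N N' e"
 unfolding box_def spanof_def ..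

lemma dg_tns:
 assumes "n:VF m B d" "n':VF m B' d'" shows "dg m (tns m n n')=pw n n'"
proof -
 have "n b (dbl m v)=n b v" "n' b' (yv m (dbl m v))=n' b' v" for b b' v
  by (rule hform_cong[OF VF_hform[OF assms(1)]], simp add: dbl_def,
  rule hform_cong[OF VF_hform[OF assms(2)]], simp add: dbl_def yv_def)
 then show ?thesis by (auto simp: subst_def tns_def pw_def fun_eq_iff)
qed

lemma dg_box: "gsub m B N==>gsub m B' N'==>dg m ` box m N N' e=prodm N N' e"
 unfolding box_spanof spanof_image[OF lin_subst]
 by (rule spanof_cong) (rule dg_tns[OF gsub_VF gsub_VF])

lemma dg_skew:
 assumes N: "gsub m B N" and B: "finite B" shows "dg m ` skew m N e=wedge N e"
proof -
 have "dg m ` skew m N e=(%x. dg m (x-twist_swap m x)) ` box m N N e"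
  unfolding skew_image[OF N B, symmetric] image_image ..
 also have "... = spanof (%n n'. dg m (tns m n n'-twist_swap m (tns m n n'))) N N e"
  unfolding box_spanof by (rule spanof_image[OF lin_comp[OF lin_subst lin_antisym[OF N B]]])
 also have "... = wedge N e"
 proof (rule spanof_cong)
  fix n n' d d' assume n: "n:N d" "n':N d'"
  show "dg m (tns m n n'-twist_swap m (tns m n n'))=wdg n n'"
  unfolding swap_tns[OF N B n] lin_diff[OF lin_subst] dg_tns[OF gsub_VF[OF N n(1)] gsub_VF[OF N n(2)]]
  dg_tns[OF gsub_VF[OF N n(2)] gsub_VF[OF N n(1)]]
  by (auto simp: pw_def wdg_def fun_eq_iff)
 qed
 finally show ?thesis .
qed

lemma regular_kills:
 assumes N: "gsub m B N" and N': "gsub m B' N'" and lf: "locfree m N" and j: "j<m" and p: "EX i<m. p i~=0"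
 shows "EX d f. hform (2 * m) d f&f p~=0 &
  kills d f (%e. {y:box m N N' e. smul (df m j) y:comb (df m) j (box m N N' e)}) (%e. comb (df m) j (tm (box m N N') e))"
proof -
 obtain e f r s c where *: "locbasis m N e f r s c" "f p~=0"
  using lf[unfolded locfree_def, rule_format, OF p] by (elim exE conjE) (rule that)
 have "hform (2 * m) e f" by (rule hform_mono[of m]) (use *(1) in \<open>simp_all add: locbasis_def\<close>)
 then show ?thesis unfolding kills_def using regular_local[OF N N' * j] *(2)
  by (intro exI[of _ e] exI[of _ f]) simp
qed

text \<open>Regularity of the equations of the diagonal is local. At a point \<open>(x, y)\<close> with \<open>x \<noteq> 0\<close> it follows from the freeness
  of \<open>N\<close> near \<open>x\<close>, otherwise \<open>y \<noteq> 0\<close> and the two factors change roles.\<close>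

lemma box_regular:
 assumes N: "gsub m B N" and N': "gsub m B' N'" and fin: "finite B" "finite B'" and lf: "locfree m N" "locfree m N'" and j: "j<m"
 shows "EX D. ALL d>=D. {y:box m N N' d. smul (df m j) y:comb (df m) j (box m N N' d)} = comb (df m) j (tm (box m N N') d)"
proof -
 let ?T = "box m N N'" and ?T' = "box m N' N" and ?t = "twist_swap m"
 note gT = gsub_box[OF N N'] and gT' = gsub_box[OF N' N]
 note stm = subspace_tm[OF gsub_subspace[OF gT]]
 have u: "hform (2 * m) 1 (df m i)" if "i<j" for i using hform_df[of i m] j that by simp
 note gU = gsub_comb[OF gT, of j "df m", OF u]
 show ?thesis
 proof (rule gsub_eventually_eq[OF _ gU(2)])
  show "finite (B \<times> B')" using fin by simp
  show "gsub (2 * m) (B \<times> B') (%d. {y : ?T d. smul (df m j) y:comb (df m) j (?T d)})"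
  using gsub_comap[OF gT gU(2) hform_df[OF j]] by simp
  show "comb (df m) j (tm ?T d) \<subseteq> {y : ?T d. smul (df m j) y:comb (df m) j (?T d)}" for d
  proof
  fix y assume y: "y:comb (df m) j (tm ?T d)"
  have "y : ?T d" using gU(1) y by blast
  moreover have "smul (df m j) y:comb (df m) j (?T d)" by (rule comb_smul[OF tm_smul[OF gT hform_df[OF j]] y])
  ultimately show "y:{y : ?T d. smul (df m j) y:comb (df m) j (?T d)}" by blast
  qed
  fix p assume p: "EX i<2 * m. p i~=(0 :: complex)"
  let ?g = "%d f. hform (2 * m) d f&f p~=0&kills d f (%e. {y : ?T e. smul (df m j) y:comb (df m) j (?T e)}) (%e. comb (df m) j (tm ?T e))"
  show "EX d f. ?g d f"
  proof (cases "EX i<m. p i~=0")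
  case False
  obtain k where k: "k<2 * m" "p k~=0" using p by blast
  have "~k<m" using False k by blast
  then have "EX i<m. swv m p i~=0" using k by (intro exI[of _ "k-m"]) (simp add: swv_def)
  from regular_kills[OF N' N lf(2) j this] obtain d f where f: "hform (2 * m) d f" "f (swv m p)~=0"
  and kf: "kills d f (%e. {y : ?T' e. smul (df m j) y:comb (df m) j (?T' e)}) (%e. comb (df m) j (tm ?T' e))"
  by (elim exE conjE) (rule that)
  have "hform (2 * m) d (%v. f (swv m v))"
  proof (rule hform_compose[OF f(1)])
  fix i assume "i<2 * m"
  then show "hform (2 * m) 1 (%v. swv m v i)" using hform_var1[of "m+i" "2 * m"] hform_var1[of "i-m" "2 * m"]
  by (cases "i<m") (simp_all add: swv_def)
  qed
  moreover have "smul (%v. f (swv m v)) y:comb (df m) j (tm ?T (d+e))"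
  if y: "y : ?T e" "smul (df m j) y:comb (df m) j (?T e)" for e y
  proof -
  have jm: "j<=m" using j by simp
  have "?t (smul (df m j) y):comb (df m) j (?T' e)"
  by (rule twist_swap_comb[OF y(2) jm gsub_subspace[OF gT'] twist_swap_box(1)[OF N N']])
  then have "smul (df m j) (?t y):comb (df m) j (?T' e)"
  using fv.subspace_neg[OF subspace_comb[OF gsub_subspace[OF gT']]] unfolding swap_df[OF j] by fastforce
  then have f': "smul f (?t y):comb (df m) j (tm ?T' (d+e))"
  using kf twist_swap_box(1)[OF N N' y(1)] unfolding kills_def by simp
  have "?t (smul f (?t y)):comb (df m) j (tm ?T (d+e))"
  proof (rule twist_swap_comb[OF f' jm stm])
  fix x assume "x:tm ?T' (d+e)"
  then show "?t x:tm ?T (d+e)" using twist_swap_box(1)[OF N' N, of x] lin_0[OF lin_swap, of m] by (cases "d+e") simp_all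
  qed
  moreover have "?t (smul f (?t y)) = smul (%v. f (swv m v)) (?t (?t y))"
  by (auto simp: twist_swap_def smul_def fun_eq_iff)
  ultimately show ?thesis unfolding twist_swap_box(2)[OF N N' y(1)] by simp
  qed
  ultimately have "?g d (%v. f (swv m v))" using f(2) unfolding kills_def by blast
  then show ?thesis by (intro exI)
  qed (rule regular_kills[OF N N' lf(1) j])
 qed
qed

text \<open>Away from the diagonal some \<open>df m j\<close> is nonzero and the ideal is
  everything; at a point of the diagonal \<open>kills_diag\<close> applies. Hence kernel and ideal
  differ in finitely many degrees only.\<close>

lemma diagonal_kernel:
 assumes N: "gsub m B N" and N': "gsub m B' N'" and fin: "finite B" "finite B'" and lf: "locfree m N"
 shows "EX D. ALL d>=D. {x:box m N N' d. dg m x=0} = comb (df m) m (tm (box m N N') d)"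
proof -
 let ?T = "box m N N'"
 note gT = gsub_box[OF N N']
 note gU = gsub_comb[OF gT, of m "df m", OF hform_df]
 note sT = gsub_subspace[OF gT]
 show ?thesis
 proof (rule gsub_eventually_eq[OF _ gU(2)])
  show "finite (B \<times> B')" using fin by simp
  show "gsub (2 * m) (B \<times> B') (%d. {x : ?T d. dg m x=0})"
  unfolding gsub_def
  proof (intro conjI allI impI)
  fix d show "{x : ?T d. dg m x=0} \<subseteq> VF (2 * m) (B \<times> B') d" using gsub_VF[OF gT] by blast
  show "fv.subspace {x : ?T d. dg m x=0}" by (rule lin_subspace_kernel[OF lin_subst sT])
  show "smul (%v. v i) w:{x : ?T (Suc d). dg m x=0}" if "i<2 * m" "w:{x : ?T d. dg m x=0}" for i w
  using gsub_var[OF gT that(1), of w d] that(2) by (simp add: subst_smul)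
  qed
  show "comb (df m) m (tm ?T d) \<subseteq> {x : ?T d. dg m x=0}" for d
  proof
  fix x assume x: "x:comb (df m) m (tm ?T d)"
  then obtain t where t: "x=(SUM i<m. smul (df m i) (t i))" unfolding comb_def by blast
  have "dg m x=0" unfolding t lin_sum[OF lin_subst] subst_smul by (intro sum.neutral) (simp add: df_dbl)
  then show "x:{x : ?T d. dg m x=0}" using x gU(1) by blast
  qed
  fix p assume p: "EX i<2 * m. p i~=(0 :: complex)"
  let ?g = "%e f. hform (2 * m) e f&f p~=0&kills e f (%d. {x : ?T d. dg m x=0}) (%d. comb (df m) m (tm ?T d))"
  show "EX e f. ?g e f"
  proof (cases "ALL j<m. df m j p=0")
  case True
  obtain e f r s c where *: "locbasis m N e f r s c" "f p~=0"
  using lf[unfolded locfree_def, rule_format, OF dbl_point[OF p True]] by (elim exE conjE) (rule that)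
  have "hform (2 * m) e f" by (rule hform_mono[of m]) (use *(1) in \<open>simp_all add: locbasis_def\<close>)
  then have "?g e f" unfolding kills_def using kills_diag[OF N N' *] *(2) by simp
  then show ?thesis by (intro exI)
  next
  case False
  then obtain j where j: "j<m" "df m j p~=0" by blast
  have "?g 1 (df m j)" unfolding kills_def using j hform_df[OF j(1)] comb_base[OF sT j(1)] by simp
  then show ?thesis by (intro exI)
  qed
 qed
qed

section \<open>Hilbert series and K-polynomials\<close>

definition hs :: "(nat=>'b vf set)=>complex fps" where
 "hs N=Abs_fps (%d. of_nat (fv.dim (N d)))"

definition kpoly :: "nat=>(nat=>'b vf set)=>complex poly=>bool" where
 "kpoly m N K \<longleftrightarrow> (1-fps_X) ^ m * hs N=fps_of_poly K"

text \<open>Hilbert series that agree in almost all degrees differ by such a series. Multiplied by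
  (1-X)^m the difference becomes a multiple of (1-X)^m, which explains the modulus in the results on
  K-polynomials.\<close>

definition ispoly :: "complex fps=>bool" where
 "ispoly F \<longleftrightarrow> (EX K. F=fps_of_poly K)"

lemma ispoly_add: "ispoly F==>ispoly G==>ispoly (F+G)"
 and ispoly_diff: "ispoly F==>ispoly G==>ispoly (F-G)"
 and ispoly_mult: "ispoly F==>ispoly G==>ispoly (F * G)"
 unfolding ispoly_def by (metis fps_of_poly_add, metis fps_of_poly_diff, metis fps_of_poly_mult)

lemma ispoly_1: "ispoly 1" and ispoly_X: "ispoly fps_X" and ispoly_0: "ispoly 0"
 unfolding ispoly_def by (metis fps_of_poly_1, metis fps_of_poly_fps_X, metis fps_of_poly_0)

lemma eventually_zero_poly:
 fixes F :: "complex fps" assumes "!!d. d >= D==>fps_nth F d=0" shows "ispoly F"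
proof -
 have "F=fps_of_poly (SUM i<D. monom (fps_nth F i) i)"
 proof (rule fps_ext)
  fix k
  show "fps_nth F k=fps_nth (fps_of_poly (SUM i<D. monom (fps_nth F i) i)) k"
  using assms[of k] by (cases "k<D") (simp_all add: coeff_sum)
 qed
 then show ?thesis unfolding ispoly_def by blast
qed

lemma hs_nth [simp]: "fps_nth (hs N) d = of_nat (fv.dim (N d))"
 by (simp add: hs_def)

lemma vanishing_divisible:
 assumes w: "w:VF (Suc m) B d" and 0: "subst (%v. v(m := 0)) w=0"
 shows "EX y. w = smul (%v. v m) y&(if d=0 then y=0 else y:VF (Suc m) B (d-1))"
proof -
 obtain C where C: "!!l. l<=d==>C l:VF m B (d-l)" "w=horner m (Suc d) C" using VF_expand[OF w] by blast
 have C0: "C 0=0"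
 proof (intro ext)
  fix b v
  have "C 0 b v=C 0 b (v(m := 0))" by (rule hform_cong[OF VF_hform[OF C(1)]]) simp_all
  also have "... = w b (v(m := 0))"
  unfolding C(2) horner_def by (simp add: sum.lessThan_Suc_shift del: sum.lessThan_Suc)
  also have "... = 0" using fun_cong[OF fun_cong[OF 0, of b], of v] by (simp add: subst_def)
  finally show "C 0 b v=0 b v" by simp
 qed
 let ?C = "%l. C (Suc l)"
 have "w=horner m (Suc d) (%l. if l=0 then 0 else ?C (l-1))"
  unfolding C(2) by (rule arg_cong[of _ _ "horner m (Suc d)"]) (auto simp: C0)
 then have "w = smul (%v. v m) (horner m d ?C)" unfolding horner_shift[of m d ?C] .
 moreover have "horner m d ?C=0" if "d=0" using that by (auto simp: horner_def fun_eq_iff)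
 moreover have "horner m d ?C:VF (Suc m) B (d-1)"
 proof -
  have "horner m d ?C=(SUM l<d. smul (%v. v m ^ l) (?C l))"
  by (auto simp: horner_def smul_def sum_apply2 fun_eq_iff mult.commute)
  moreover have "smul (%v. v m ^ l) (?C l):VF (Suc m) B (d-1)" if "l<d" for l
  proof -
  have "?C l:VF (Suc m) B (d-Suc l)" using C(1)[of "Suc l"] that hform_mono[of m _ _ "Suc m"] by (auto simp: VF_def)
  from smul_VF[OF hform_pow1[OF hform_var] this, of m l] show ?thesis using that by simp
  qed
  ultimately show ?thesis by (simp only:) (rule fv.subspace_sum[OF subspace_VF], simp)
 qed
 ultimately show ?thesis
  by (intro exI[of _ "horner m d ?C"]) simp
qed

text \<open>Rank-nullity for setting the last variable to 0. An element that vanishes there is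
  divisible by that variable, so the kernel is the variable times the module of all w with v m * w
  in \<open>N\<close>, shifted by one degree.\<close>

lemma hs_restrict:
 assumes N: "gsub (Suc m) B N" and B: "finite B"
 shows "gsub m B (%d. subst (%v. v(m := 0)) ` N d)"
  "hs N=hs (%d. subst (%v. v(m := 0)) ` N d)+fps_X * hs (%d. {w:VF (Suc m) B d. smul (%v. v m) w:N (Suc d)})"
proof -
 let ?r = "subst (%v. v(m := 0)) :: 'a vf=>_" and ?x = "%v :: vec. v m"
 let ?W = "%d. {w:VF (Suc m) B d. smul ?x w:N (Suc d)}"
 note sN = gsub_subspace[OF N]
 have rVF: "?r w:VF m B d" if "w:VF (Suc m) B d" for w d
 proof (rule subst_VF[OF _ that])
  fix i assume "i<Suc m"
  then show "hform m 1 (%v. (v(m := 0)) i)" using hform_var1[of i m] by (cases "i=m") (simp_all add: hform.zero)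
 qed
 show "gsub m B (%d. ?r ` N d)"
  unfolding gsub_def
 proof (intro conjI allI impI)
  show "?r ` N d \<subseteq> VF m B d" for d using rVF gsub_VF[OF N] by blast
  show "fv.subspace (?r ` N d)" for d by (rule lin_subspace_image[OF lin_subst sN])
  fix d i w assume i: "i<m" and "w : ?r ` N d"
  then obtain n where n: "n:N d" "w=?r n" by blast
  have "smul (%v. v i) w=?r (smul (%v. v i) n)" unfolding n(2) subst_smul using i by simp
  moreover have "smul (%v. v i) n:N (Suc d)" by (rule gsub_var[OF N _ n(1)]) (use i in simp)
  ultimately show "smul (%v. v i) w : ?r ` N (Suc d)" by (rule image_eqI)
 qed
 have ker: "fv.dim {w:N d. ?r w=0}=(if d=0 then 0 else fv.dim (?W (d-1)))" for d
 proof (cases d)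
  case 0
  have "w=0" if "w:N 0" "?r w=0" for w using vanishing_divisible[OF gsub_VF[OF N that(1)] that(2)] by auto
  then have "{w:N d. ?r w=0}={0}" using gsub_0[OF N, of 0] lin_0[OF lin_subst] 0 by blast
  then show ?thesis by (simp only: dim_0 0 refl if_True)
 next
  case (Suc d')
  have "{w:N d. ?r w=0} = smul ?x ` ?W d'"
  proof (intro equalityI subsetI)
  fix w assume w: "w:{w:N d. ?r w=0}"
  then obtain y where "w = smul ?x y" "y:VF (Suc m) B d'"
  using vanishing_divisible[of w m B d] gsub_VF[OF N, of w d] Suc by auto
  then show "w:smul ?x ` ?W d'" using w Suc by blast
  next
  fix w assume "w:smul ?x ` ?W d'"
  then obtain y where y: "w = smul ?x y" "smul ?x y:N d" using Suc by blast
  have "?r w=0" unfolding y(1) subst_smul by simp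
  then show "w:{w:N d. ?r w=0}" using y by simp
  qed
  moreover have "fv.dim (smul ?x ` ?W d')=fv.dim (?W d')"
  proof (rule dim_image_inj[OF lin_smul findim_subset[OF findim_VF[OF B]]])
  show "fv.subspace (?W d')"
  using subspace_VF[of "Suc m" B d'] sN[of "Suc d'"] unfolding fv.subspace_def by (simp add: smul_scl)
  show "w=0" if "w : ?W d'" "smul ?x w=0" for w
  by (rule VF_smul_eq_0[where f = ?x and p = "%_. 1" and k = "Suc m" and e = 1]) (use that hform_var1[of m "Suc m"] in auto)
  qed blast
  ultimately show ?thesis using Suc by simp
 qed
 show "hs N=hs (%d. ?r ` N d)+fps_X * hs ?W"
  by (rule fps_ext) (simp add: rank_nullity[OF lin_subst[of "%v. v(m := 0)"] gsub_findim[OF N B] sN] ker)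
qed

text \<open>The colon modules \<open>W k\<close> of the powers of the last variable increase and are
  constant from some \<open>J\<close> on. There the recursion of \<open>hs_restrict\<close> becomes
  (1-X) hs (W J) = ?b J, where ?b J belongs to one variable less; the recursion then leads back from
  \<open>J\<close> to \<open>W 0\<close> = \<open>N\<close>.\<close>

lemma kpoly_exists:
 assumes N: "gsub m B N" and B: "finite B" shows "EX K. kpoly m N K"
proof -
 have "ispoly ((1-fps_X) ^ m * hs N)" using N
 proof (induction m arbitrary: N)
  case 0
  have "fv.dim (N d)=0" if "1<=d" for d
  proof -
  have "w=0" if "w:N d" for w
  using hform_0_pos[OF VF_hform[OF gsub_VF[OF 0 that]]] \<open>1 <= d\<close> by (auto simp: fun_eq_iff)
  then have "N d={0}" using gsub_0[OF 0, of d] by blast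
  then show ?thesis by (simp only: dim_0)
  qed
  then show ?case by (intro eventually_zero_poly[of 1]) simp
 next
  case (Suc m)
  define W where "W k d={w:VF (Suc m) B d. smul (%v. v m ^ k) w:N (k+d)}" for k d
  have gW: "gsub (Suc m) B (W k)" for k
  using gsub_comap[OF gsub_full Suc.prems hform_pow1[OF hform_var]] unfolding W_def[abs_def] by blast
  have shift: "smul (%v. v m ^ Suc k) w = smul (%v. v m) (smul (%v. v m ^ k) w)" for k and w :: "'a vf"
  by (simp add: smul_smul)
  have "W k d \<subseteq> W (Suc k) d" for k d
  using gsub_var[OF Suc.prems, of m] unfolding W_def shift by auto
  from gsub_chain[of B "Suc m" W, OF B gW this] obtain J where "ALL j>=J. W j=W J" by (elim exE) (rule that)
  note J = this[rule_format, OF le_SucI[OF order_refl]]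
  let ?b = "%k. hs (%d. subst (%v. v(m := 0)) ` W k d)"
  have "{w:VF (Suc m) B d. smul (%v. v m) w:W k (Suc d)}=W (Suc k) d" for k d
  unfolding W_def shift using smul_VF[OF hform_var1[of m "Suc m"]] by (auto simp: smul_commute)
  then have rec: "hs (W k)=?b k+fps_X * hs (W (Suc k))" for k using hs_restrict(2)[OF gW B, of k] by simp
  have IH: "ispoly ((1-fps_X) ^ m * ?b k)" for k by (rule Suc.IH[OF hs_restrict(1)[OF gW B]])
  have "ispoly ((1-fps_X) ^ Suc m * hs (W k))" if "k<=J" for k
  using that
  proof (induction rule: inc_induct)
  case base
  have "(1-fps_X) * hs (W J)=?b J" using rec[of J] unfolding J by (simp add: algebra_simps)
  moreover have "(1-fps_X) ^ Suc m * hs (W J)=(1-fps_X) ^ m * ((1-fps_X) * hs (W J))"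
  by (simp only: power_Suc mult_ac)
  ultimately show ?case using IH[of J] by (simp only:)
  next
  case (step k)
  have "(1-fps_X) ^ Suc m * hs (W k)=(1-fps_X) * ((1-fps_X) ^ m * ?b k)+fps_X * ((1-fps_X) ^ Suc m * hs (W (Suc k)))"
  by (subst rec) (simp add: algebra_simps)
  then show ?case by (simp only:) (intro ispoly_add ispoly_mult ispoly_diff ispoly_1 ispoly_X IH step.IH)
  qed
  from this[of 0] have "ispoly ((1-fps_X) ^ Suc m * hs (W 0))" by simp
  moreover have "W 0=N" using gsub_VF[OF Suc.prems] by (auto simp: W_def fun_eq_iff)
  ultimately show ?case by simp
 qed
 then show ?thesis unfolding kpoly_def ispoly_def .
qed

section \<open>Dividing a tensor product by the equations of the diagonal\<close>

context
 fixes m :: nat and N :: "nat=>'b vf set" and N' :: "nat=>'c vf set"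
  and B :: "'b set" and B' :: "'c set" and P :: "bool=>nat=>('b \<times> 'c=>vec=>complex) set"
 assumes N: "gsub m B N" and N': "gsub m B' N'" and fin: "finite B" "finite B'" and lf: "locfree m N" "locfree m N'"
  and P: "!!s e. P s e \<subseteq> box m N N' e" "!!s e. fv.subspace (P s e)"
  and flip: "!!j s e y. j<m==>y:P s e==>smul (df m j) y:P (~s) (Suc e)"
  and split: "!!j s e x. j<m==>x:P s (Suc e)==>x:comb (df m) (Suc j) (box m N N' e) ==>
  EX a y. a:comb (df m) j (box m N N' e)&a:P s (Suc e)&y:P (~s) e&x=a + smul (df m j) y"
begin

abbreviation "cb j d \<equiv> comb (df m) j (tm (box m N N') d)"

lemma subspace_cbP: "fv.subspace (cb j d \<inter> P s d)"
 by (intro fv.subspace_inter subspace_comb subspace_tm gsub_subspace[OF gsub_box[OF N N']] P)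

lemma findim_P: "findim (P s d)"
 by (rule findim_subset[OF gsub_findim[OF gsub_box[OF N N']] P(1)]) (use fin in simp)

text \<open>\<open>dim_sum_image\<close> for multiplication by \<open>df m j\<close>: its correction
  term counts the elements multiplied into the ideal of the earlier equations, and by
  \<open>box_regular\<close> these are the elements of that ideal once the degree is large.\<close>

lemma cb_step:
 assumes j: "j<m"
 shows "EX D. ALL d>=D. ALL s. fv.dim (cb (Suc j) (Suc d) \<inter> P s (Suc d))+fv.dim (cb j d \<inter> P (~s) d) =
  fv.dim (cb j (Suc d) \<inter> P s (Suc d))+fv.dim (P (~s) d)"
proof -
 obtain D where D: "!!d. d >= D==>{y:box m N N' d. smul (df m j) y:comb (df m) j (box m N N' d)} = cb j d"
  using box_regular[OF N N' fin lf j] by blast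
 show ?thesis
 proof (intro exI[of _ D] allI impI)
  fix d s assume d: "D<=d"
  let ?U = "cb j (Suc d) \<inter> P s (Suc d)"
  have "{u + smul (df m j) y | u y. u : ?U&y:P (~s) d} = cb (Suc j) (Suc d) \<inter> P s (Suc d)"
  proof (intro equalityI subsetI)
  fix x assume "x:{u + smul (df m j) y | u y. u : ?U&y:P (~s) d}"
  then obtain u y where x: "x=u + smul (df m j) y" "u : ?U" "y:P (~s) d" by blast
  have "x:P s (Suc d)" unfolding x(1) using flip[OF j x(3)] x(2) by (intro fv.subspace_add[OF P(2)]) simp_all
  moreover have "x:cb (Suc j) (Suc d)" unfolding comb_Suc using x P(1) by fastforce
  ultimately show "x:cb (Suc j) (Suc d) \<inter> P s (Suc d)" by blast
  next
  fix x assume "x:cb (Suc j) (Suc d) \<inter> P s (Suc d)"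
  then show "x:{u + smul (df m j) y | u y. u : ?U&y:P (~s) d}"
  using split[OF j, of x s d] by auto
  qed
  moreover have "{y:P (~s) d. smul (df m j) y : ?U} = cb j d \<inter> P (~s) d"
  unfolding D[OF d, symmetric] using flip[OF j, of _ "~s" d] P(1)[of "~s" d] by auto
  moreover have "findim ?U" by (rule findim_subset[OF findim_P]) blast
  ultimately show "fv.dim (cb (Suc j) (Suc d) \<inter> P s (Suc d))+fv.dim (cb j d \<inter> P (~s) d)=fv.dim ?U+fv.dim (P (~s) d)"
  using dim_sum_image[OF _ subspace_cbP[of j "Suc d" s] findim_P[of "~s" d] P(2)[of "~s" d] lin_smul[of "df m j"]] by simp
 qed
qed

text \<open>Dividing by one equation of the diagonal multiplies the Hilbert series by \<open>1 - X\<close>, up to a polynomial, but it also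
  interchanges the two families: their sum acquires the factor \<open>1 - X\<close> and their difference the factor \<open>1 + X\<close>.\<close>

lemma diagonal_series:
 "ispoly (2 * hs (%d. dg m ` P s d)-((1-fps_X) ^ m * (hs (P True)+hs (P False)) +
  (if s then 1 else -1) * ((1+fps_X) ^ m * (hs (P True)-hs (P False)))))"
proof -
 \<comment> \<open>The Hilbert series of \<open>P s\<close> modulo the first \<open>j\<close>
   diagonal equations.\<close>
 define q where "q s j=hs (P s)-hs (%d. cb j d \<inter> P s d)" for s j
 have step: "ispoly (q s (Suc j)-(q s j-fps_X * q (~s) j))" if j: "j<m" for s j
 proof -
  obtain D where D: "!!d s. d >= D==>fv.dim (cb (Suc j) (Suc d) \<inter> P s (Suc d))+fv.dim (cb j d \<inter> P (~s) d) =
  fv.dim (cb j (Suc d) \<inter> P s (Suc d))+fv.dim (P (~s) d)" using cb_step[OF j] by blast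
  show ?thesis
  proof (rule eventually_zero_poly[of "Suc D"])
  fix d assume "Suc D<=d"
  then obtain d' where d: "d=Suc d'" "D<=d'" by (cases d) auto
  have "of_nat (fv.dim (cb (Suc j) d \<inter> P s d)) + of_nat (fv.dim (cb j d' \<inter> P (~s) d')) =
  (of_nat (fv.dim (cb j d \<inter> P s d)) + of_nat (fv.dim (P (~s) d')) :: complex)"
  unfolding of_nat_add[symmetric] d(1) D[OF d(2)] ..
  then show "fps_nth (q s (Suc j)-(q s j-fps_X * q (~s) j)) d=0"
  using d(1) by (simp add: q_def algebra_simps del: tm_simps)
  qed
 qed
 let ?S = "hs (P True)+hs (P False)" and ?D = "hs (P True)-hs (P False)"
 have "ispoly (q True j+q False j-(1-fps_X) ^ j * ?S)&ispoly (q True j-q False j-(1+fps_X) ^ j * ?D)" if "j<=m" for j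
  using that
 proof (induction j)
  case 0
  have "cb 0 d \<inter> P s d={0}" for s d using fv.subspace_0[OF P(2)] by (auto simp: comb_def)
  then have "q s 0=hs (P s)" for s unfolding q_def by (intro fps_ext) (simp add: dim_0 del: tm_simps)
  then show ?case by (simp add: ispoly_0)
 next
  case (Suc j)
  define A where "A=q True j+q False j-(1-fps_X) ^ j * ?S"
  define A' where "A'=q True j-q False j-(1+fps_X) ^ j * ?D"
  define E where "E s=q s (Suc j)-(q s j-fps_X * q (~s) j)" for s
  have E: "ispoly (E s)" for s unfolding E_def using Suc.prems by (intro step) simp
  have A: "ispoly A" "ispoly A'" using Suc unfolding A_def A'_def by simp_all
  have "q True (Suc j)+q False (Suc j)-(1-fps_X) ^ Suc j * ?S=E True+E False+(1-fps_X) * A"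
  "q True (Suc j)-q False (Suc j)-(1+fps_X) ^ Suc j * ?D=E True-E False+(1+fps_X) * A'"
  unfolding E_def A_def A'_def by (simp_all add: algebra_simps)
  then show ?case by (simp only:) (intro conjI ispoly_add ispoly_diff ispoly_mult ispoly_1 ispoly_X E A)
 qed
 then have AB: "ispoly (q True m+q False m-(1-fps_X) ^ m * ?S)" "ispoly (q True m-q False m-(1+fps_X) ^ m * ?D)"
  by simp_all
 obtain D where D: "!!d. d >= D==>{x:box m N N' d. dg m x=0} = cb m d"
  using diagonal_kernel[OF N N' fin lf(1)] by blast
 have F: "ispoly (hs (%d. dg m ` P s d)-q s m)"
 proof (rule eventually_zero_poly[of D])
  fix d assume "D<=d"
  then have "{x:P s d. dg m x=0} = cb m d \<inter> P s d" using D P(1)[of s d] by blast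
  then show "fps_nth (hs (%d. dg m ` P s d)-q s m) d=0"
  using rank_nullity[OF lin_subst[of "dbl m"] findim_P[of s d] P(2)[of s d]] by (simp add: q_def)
 qed
 define F' A A' where "F'=hs (%d. dg m ` P s d)-q s m"
  and "A=q True m+q False m-(1-fps_X) ^ m * ?S" and "A'=q True m-q False m-(1+fps_X) ^ m * ?D"
 note defs = this
 have "2 * hs (%d. dg m ` P s d)-((1-fps_X) ^ m * ?S+(if s then 1 else -1) * ((1+fps_X) ^ m * ?D)) =
  (if s then F'+F'+A+A' else F'+F'+A-A')"
  by (cases s) (simp_all add: defs algebra_simps)
 moreover have "ispoly F'" "ispoly A" "ispoly A'" unfolding defs by (rule F, (rule AB)+)
 ultimately show ?thesis by (simp only: split: if_split) (intro conjI impI ispoly_add ispoly_diff; assumption)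
qed

end

lemma hs_box:
 assumes N: "gsub m B N" and N': "gsub m B' N'" and fin: "finite B" "finite B'"
 shows "hs (box m N N')=hs N * hs N'"
proof -
 have "ALL d. EX A. finite A&fv.independent A&fv.span A=N d&card A=fv.dim (N d)"
  by (metis findim_basis[OF gsub_findim[OF N fin(1)] gsub_subspace[OF N]])
 from choice[OF this] obtain A where A: "!!d. finite (A d)" "!!d. fv.independent (A d)" "!!d. fv.span (A d)=N d"
  and cA: "!!d. card (A d)=fv.dim (N d)" by blast
 have "ALL d. EX A. finite A&fv.independent A&fv.span A=N' d&card A=fv.dim (N' d)"
  by (metis findim_basis[OF gsub_findim[OF N' fin(2)] gsub_subspace[OF N']])
 from choice[OF this] obtain A' where A': "!!d. finite (A' d)" "!!d. fv.independent (A' d)" "!!d. fv.span (A' d)=N' d"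
  and cA': "!!d. card (A' d)=fv.dim (N' d)" by blast
 show ?thesis
  by (rule fps_ext) (simp add: hs_def fps_mult_nth dim_box[OF N N' A A'] cA cA' atLeast0AtMost)
qed

lemma one_minus_X: "fps_of_poly ([:1, -1:] ^ m)=(1-fps_X :: complex fps) ^ m"
 by (simp add: fps_of_poly_power fps_of_poly_linear')

text \<open>Both families are taken to be the whole box, so their difference is zero and only the
  factor (1-X)^m survives. The series of the box is the product of the two Hilbert series.\<close>

theorem kpoly_prod:
 assumes N: "gsub m B N" and N': "gsub m B' N'" and fin: "finite B" "finite B'" and lf: "locfree m N" "locfree m N'"
  and K: "kpoly m N K" "kpoly m N' K'" "kpoly m (prodm N N') L"
 shows "[:1, -1:] ^ m dvd K * K'-L"
proof -
 let ?b = "box m N N'"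
 have "ispoly (2 * hs (%d. dg m ` ?b d)-((1-fps_X) ^ m * (hs ?b+hs ?b)+(if True then 1 else -1) * ((1+fps_X) ^ m * (hs ?b-hs ?b))))"
 proof (rule diagonal_series[OF N N' fin lf, of "%s. ?b"])
  fix j e x assume j: "j<m"
  show "smul (df m j) y : ?b (Suc e)" if "y : ?b e" for y
  using gsub_smul[OF gsub_box[OF N N'] hform_df[OF j] that] by simp
  assume "x:comb (df m) (Suc j) (?b e)"
  then obtain a y where "a:comb (df m) j (?b e)" "y : ?b e" "x=a + smul (df m j) y" unfolding comb_Suc by blast
  moreover have "a : ?b (Suc e)" if "a:comb (df m) j (?b e)" for a
  using gsub_comb(1)[OF gsub_box[OF N N'], of j "df m" "Suc e", OF hform_df] that j by auto
  ultimately show "EX a y. a:comb (df m) j (?b e)&a : ?b (Suc e)&y : ?b e&x=a + smul (df m j) y"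
  by (intro exI[of _ a] exI[of _ y]) simp
 qed (simp_all add: gsub_subspace[OF gsub_box[OF N N']])
 then obtain R where R: "2 * hs (prodm N N')-(1-fps_X) ^ m * (hs N * hs N'+hs N * hs N')=fps_of_poly R"
  unfolding ispoly_def dg_box[OF N N'] hs_box[OF N N' fin] by auto
 define F where "F=(1-fps_X) ^ m * (hs N * hs N')"
 have "F-hs (prodm N N')=fps_const (-1/2) * (2 * hs (prodm N N')-(F+F))"
  by (rule fps_ext, simp) (simp only: diff_divide_distrib, simp)
 then have "(1-fps_X) ^ m * (hs N * hs N')-hs (prodm N N')=fps_of_poly (smult (-1/2) R)"
  unfolding fps_of_poly_smult R[symmetric] F_def by (simp only: distrib_left)
 then obtain R where "(1-fps_X) ^ m * (hs N * hs N')-hs (prodm N N')=fps_of_poly R" by blast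
 then have "(1-fps_X) ^ m * ((1-fps_X) ^ m * (hs N * hs N')-hs (prodm N N'))=fps_of_poly ([:1, -1:] ^ m * R)"
  by (simp only: fps_of_poly_mult one_minus_X)
 moreover have "(1-fps_X) ^ m * ((1-fps_X) ^ m * (hs N * hs N')-hs (prodm N N')) =
  ((1-fps_X) ^ m * hs N) * ((1-fps_X) ^ m * hs N')-(1-fps_X) ^ m * hs (prodm N N')"
  by (simp add: algebra_simps)
 moreover have "... = fps_of_poly (K * K'-L)"
  using K unfolding kpoly_def by (simp add: fps_of_poly_mult fps_of_poly_diff)
 ultimately have "K * K'-L=[:1, -1:] ^ m * R" by (metis fps_of_poly_eq_iff)
 then show ?thesis by simp
qed

text \<open>The familiar formula 2 L = K^2 - psi K with the Adams operation psi K (z) = K (z^2). The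
  second term arises as the trace of the flip: on the degree \<open>e\<close> part of the tensor
  square it is the dimension of \<open>N (e div 2)\<close> for even \<open>e\<close> and 0 for odd
  \<open>e\<close>, with generating series hs N (X^2).\<close>

theorem kpoly_wedge:
 assumes N: "gsub m B N" and B: "finite B" and lf: "locfree m N"
  and K: "kpoly m N K" "kpoly m (wedge N) L"
 shows "[:1, -1:] ^ m dvd K ^ 2-pcompose K [:0, 0, 1:]-2 * L"
proof -
 define S where "S=hs N oo fps_X ^ 2"
 have S: "fps_nth S e=(if even e then of_nat (fv.dim (N (e div 2))) else 0)" for e
  by (simp add: S_def fps_nth_compose_X_power)
 let ?b = "box m N N" and ?t = "twist_swap m"
 note gb = gsub_box[OF N N]
 define \<epsilon> :: "bool=>complex" where "\<epsilon> s=(if s then 1 else -1)" for s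
 have \<epsilon>: "\<epsilon> s * \<epsilon> s=1" "\<epsilon> (~s) = - \<epsilon> s" for s by (simp_all add: \<epsilon>_def)
 define P where "P s e=(if s then symm m N e else skew m N e)" for s e
 have Pt: "x:P s e \<longleftrightarrow> x : ?b e&?t x = scl (\<epsilon> s) x" for x s e
  by (auto simp: P_def \<epsilon>_def skew_def[OF N B] symm_def[OF N B] fv.scale_minus_left)
 \<comment> \<open>The projection to the eigenspace of the flip. Since multiplication by
   \<open>df m j\<close> exchanges the two projections, any representation in the ideal can be
   projected to one with the required symmetry.\<close>
 define F where "F s x = scl (1/2) (x + scl (\<epsilon> s) (?t x))" for s and x :: "'a \<times> 'a=>vec=>complex"
 have FP: "F s x:P s e" if x: "x : ?b e" for s x e
  unfolding Pt
 proof
  show "F s x : ?b e" unfolding F_def using x swap_box[OF N B x] gsub_add[OF gb] gsub_scl[OF gb] by blast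
  show "?t (F s x) = scl (\<epsilon> s) (F s x)"
  unfolding F_def lin_scl[OF lin_swap] lin_add[OF lin_swap] swap_swap[OF N B x]
  by (simp add: fv.scale_right_distrib \<epsilon> add.commute mult.commute mult.left_commute)
 qed
 have Fu: "F s (smul (df m j) y) = smul (df m j) (F (~s) y)" if "j<m" for s j y
  unfolding F_def by (simp add: swap_df[OF that] \<epsilon> smul_scl fv.scale_minus_left fv.scale_minus_right)
 have Fadd: "F s (x+y)=F s x+F s y" for s x y
  unfolding F_def by (simp add: lin_add[OF lin_swap] fv.scale_right_distrib)
 have Ffix: "F s x=x" if "x:P s e" for s x e
 proof -
  have "?t x = scl (\<epsilon> s) x" using that unfolding Pt by (rule conjunct2)
  then have "F s x = scl (1/2) (x+x)" unfolding F_def by (simp add: \<epsilon>)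
  then show ?thesis by (auto simp: scl_def fun_eq_iff)
 qed
 have "ispoly (2 * hs (%d. dg m ` P False d)-((1-fps_X) ^ m * (hs (P True)+hs (P False)) +
  (if False then 1 else -1) * ((1+fps_X) ^ m * (hs (P True)-hs (P False)))))"
 proof (rule diagonal_series[OF N N B B lf lf, of P])
  show "P s e \<subseteq> ?b e" for s e using Pt by blast
  show "fv.subspace (P s e)" for s e using subspace_symm[OF N B] subspace_skew[OF N B] by (simp add: P_def)
  fix j s e assume j: "j<m"
  show "smul (df m j) y:P (~s) (Suc e)" if y: "y:P s e" for y
  proof -
  have "smul (df m j) y : ?b (Suc e)" using gsub_smul[OF gb hform_df[OF j]] y unfolding Pt by fastforce
  from FP[OF this, of "~s"] show ?thesis using Fu[OF j] Ffix[OF y] by simp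
  qed
  fix x assume x: "x:P s (Suc e)" "x:comb (df m) (Suc j) (?b e)"
  obtain a y where a: "a:comb (df m) j (?b e)" and y: "y : ?b e" "x=a + smul (df m j) y"
  using x(2) unfolding comb_Suc by blast
  have "?t a:comb (df m) j (?b e)" by (rule twist_swap_comb[OF a _ gsub_subspace[OF gb] swap_box[OF N B]]) (use j in simp)
  then have 1: "F s a:comb (df m) j (?b e)" unfolding F_def
  by (intro fv.subspace_scale fv.subspace_add subspace_comb gsub_subspace[OF gb] a)
  have "a : ?b (Suc e)"
  using gsub_comb(1)[OF gb, of j "df m" "Suc e", OF hform_df] a j by auto
  then have 2: "F s a:P s (Suc e)" by (rule FP)
  have "x=F s a + smul (df m j) (F (~s) y)"
  using Ffix[OF x(1)] unfolding y(2) Fadd Fu[OF j] by (rule sym)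
  then show "EX a y. a:comb (df m) j (?b e)&a:P s (Suc e)&y:P (~s) e&x=a + smul (df m j) y"
  using 1 2 FP[OF y(1), of "~s"] by (intro exI[of _ "F s a"] exI[of _ "F (~s) y"]) simp
 qed
 then obtain R where R: "2 * hs (%d. dg m ` P False d)-((1-fps_X) ^ m * (hs (P True)+hs (P False)) +
  (if False then 1 else -1) * ((1+fps_X) ^ m * (hs (P True)-hs (P False))))=fps_of_poly R" unfolding ispoly_def by blast
 have "fps_nth (hs N * hs N) e = of_nat (2 * fv.dim (skew m N e)+(if even e then fv.dim (N (e div 2)) else 0))" for e
  unfolding dim_skew_symm(1)[OF N B] by (simp add: fps_mult_nth atLeast0AtMost)
 then have hP: "hs (P True)+hs (P False)=hs N * hs N" "hs (P True)-hs (P False)=S"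
  by (auto intro!: fps_ext simp: P_def dim_skew_symm(2)[OF N B] S)
 have "hs (%d. dg m ` P False d)=hs (wedge N)" by (simp add: P_def dg_skew[OF N B])
 then have "(1-fps_X) ^ m * (hs N * hs N)-(1+fps_X) ^ m * S-2 * hs (wedge N) = - fps_of_poly R"
  unfolding R[symmetric] hP by simp
 then obtain R where
  R: "(1-fps_X) ^ m * (hs N * hs N)-(1+fps_X) ^ m * S-2 * hs (wedge N)=fps_of_poly R"
  by (metis fps_of_poly_uminus)
 have KX: "(1-fps_X ^ 2) ^ m * S=fps_of_poly (pcompose K [:0, 0, 1:])"
 proof -
  have X: "fps_of_poly [:0, 0, 1:]=(fps_X ^ 2 :: complex fps)"
  by (simp add: fps_of_poly_pCons power2_eq_square)
  have 0: "fps_nth (fps_X ^ 2 :: complex fps) 0=0" by simp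
  have "fps_of_poly (pcompose K [:0, 0, 1:])=fps_of_poly K oo fps_X ^ 2"
  by (subst fps_of_poly_pcompose) (simp_all add: X)
  also have "... = ((1-fps_X) ^ m oo fps_X ^ 2) * S"
  using K(1) unfolding kpoly_def S_def by (metis fps_compose_mult_distrib[OF 0])
  also have "(1-fps_X) ^ m oo fps_X ^ 2=(1-fps_X ^ 2 :: complex fps) ^ m"
  by (simp only: fps_compose_power[OF 0, symmetric] fps_compose_sub_distrib fps_compose_1 fps_X_fps_compose_startby0[OF 0])
  finally show ?thesis by simp
 qed
 have "(1-fps_X) ^ m * (1+fps_X) ^ m=(1-fps_X ^ 2 :: complex fps) ^ m"
  by (simp add: power_mult_distrib[symmetric] power2_eq_square algebra_simps)
 then have "(1-fps_X) ^ m * ((1+fps_X) ^ m * S)=fps_of_poly (pcompose K [:0, 0, 1:])"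
  using KX by (simp only: mult.assoc[symmetric])
 then have "(1-fps_X) ^ m * ((1-fps_X) ^ m * (hs N * hs N)-(1+fps_X) ^ m * S-2 * hs (wedge N)) =
  ((1-fps_X) ^ m * hs N) ^ 2-fps_of_poly (pcompose K [:0, 0, 1:])-2 * ((1-fps_X) ^ m * hs (wedge N))"
  by (simp add: algebra_simps power2_eq_square)
 also have "... = fps_of_poly (K ^ 2-pcompose K [:0, 0, 1:]-2 * L)"
  using K unfolding kpoly_def
  by (simp add: fps_of_poly_mult fps_of_poly_diff fps_of_poly_power fps_of_poly_numeral)
 finally have "fps_of_poly (K ^ 2-pcompose K [:0, 0, 1:]-2 * L)=fps_of_poly ([:1, -1:] ^ m * R)"
  unfolding R by (simp only: fps_of_poly_mult one_minus_X)
 then show ?thesis by (metis dvd_triv_left fps_of_poly_eq_iff)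
qed

lemma kpoly_dims:
 assumes "!!d. fv.dim (N d)=fv.dim (M d)" shows "kpoly m N K \<longleftrightarrow> kpoly m M K"
 using assms by (simp add: kpoly_def hs_def)

section \<open>Local freeness of exterior squares\<close>

definition locfree_rank :: "nat=>nat=>(nat=>'b vf set)=>bool" where
 "locfree_rank m r N \<longleftrightarrow> (ALL p. (EX i<m. p i~=0)-->(EX e f s c. locbasis m N e f r s c&f p~=0))"

lemma locfree_rank_locfree: "locfree_rank m r N==>locfree m N"
 unfolding locfree_rank_def locfree_def by blast

lemma locbasisD:
 assumes "locbasis m N e f r s c"
 shows "hform m e f" "c<=e" "k<r==>s k:N c"
  "n:N d==>EX al. (ALL k<r. hform m (e+d - c) (al k))&smul f n=(SUM k<r. smul (al k) (s k))"
  "EX e' h q. hform m e' h&h q~=0&(ALL v a. h v~=0-->(ALL b. (SUM k<r. a k * s k b v)=0)-->(ALL k<r. a k=0))"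
 using assms by (simp_all add: locbasis_def)

lemma subspace_combination:
 fixes X :: "'k set" and s :: "'k=>'b vf"
 shows "fv.subspace {x. EX al. (ALL k:X. hform m d (al k))&smul f x=(SUM k:X. smul (al k) (s k))}"
 unfolding fv.subspace_def
proof (intro conjI ballI allI)
 show "0:{x. EX al. (ALL k:X. hform m d (al k))&smul f x=(SUM k:X. smul (al k) (s k))}"
 proof (intro CollectI exI conjI ballI)
  show "smul f 0=(SUM k:X. smul (%v. 0) (s k))" by simp
 qed (rule hform.zero)
next
 fix x y assume "x:{x. EX al. (ALL k:X. hform m d (al k))&smul f x=(SUM k:X. smul (al k) (s k))}"
  "y:{x. EX al. (ALL k:X. hform m d (al k))&smul f x=(SUM k:X. smul (al k) (s k))}"
 then obtain al be where *: "ALL k:X. hform m d (al k)" "smul f x=(SUM k:X. smul (al k) (s k))"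
  "ALL k:X. hform m d (be k)" "smul f y=(SUM k:X. smul (be k) (s k))" by blast
 show "x+y:{x. EX al. (ALL k:X. hform m d (al k))&smul f x=(SUM k:X. smul (al k) (s k))}"
 proof (intro CollectI exI conjI ballI)
  show "hform m d (%v. al k v+be k v)" if "k:X" for k using * that by (blast intro: hform.add)
  show "smul f (x+y)=(SUM k:X. smul (%v. al k v+be k v) (s k))"
  by (simp only: smul_add *(2,4) smul_plus sum.distrib)
 qed
next
 fix c x assume "x:{x. EX al. (ALL k:X. hform m d (al k))&smul f x=(SUM k:X. smul (al k) (s k))}"
 then obtain al where *: "ALL k:X. hform m d (al k)" "smul f x=(SUM k:X. smul (al k) (s k))" by blast
 show "scl c x:{x. EX al. (ALL k:X. hform m d (al k))&smul f x=(SUM k:X. smul (al k) (s k))}"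
 proof (intro CollectI exI conjI ballI)
  show "hform m d (%v. c * al k v)" if "k:X" for k using * that hform_scale by blast
  have "smul (%v. c * al k v) (s k) = scl c (smul (al k) (s k))" for k by (auto simp: smul_def scl_def fun_eq_iff)
  then show "smul f (scl c x)=(SUM k:X. smul (%v. c * al k v) (s k))"
  by (simp only: smul_scl *(2) fv.scale_sum_right)
 qed
qed

lemma locbasis_reindex:
 assumes X: "finite X" and f: "hform m e f" "c<=e" and s: "!!k. k:X==>s k:N c"
  and ind: "EX e' h q. hform m e' h&h q~=0&(ALL v a. h v~=0-->(ALL b. (SUM k:X. a k * s k b v)=0)-->(ALL k:X. a k=0))"
  and gen: "!!d n. n:N d==>EX al. (ALL k:X. hform m (e+d - c) (al k))&smul f n=(SUM k:X. smul (al k) (s k))"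
 shows "EX s'. locbasis m N e f (card X) s' c"
proof -
 obtain \<pi> where \<pi>: "bij_betw \<pi> {..<card X} X" using ex_bij_betw_nat_finite[OF X] by (auto simp: atLeast0LessThan)
 have sumX: "(SUM k:X. F k)=(SUM k<card X. F (\<pi> k))" for F :: "'a=>'x::comm_monoid_add"
  using sum.reindex_bij_betw[OF \<pi>, of F] by simp
 have \<pi>X: "\<pi> k:X" if "k < card X" for k using bij_betwE[OF \<pi>] that by simp
 have "locbasis m N e f (card X) (%k. s (\<pi> k)) c"
  unfolding locbasis_def
 proof (intro conjI allI impI ballI f)
  show "s (\<pi> k):N c" if "k < card X" for k using s \<pi>X that by blast
  show "EX al. (ALL k<card X. hform m (e+d - c) (al k))&smul f n=(SUM k<card X. smul (al k) (s (\<pi> k)))" if n: "n:N d" for d n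
  proof -
  obtain al where al: "ALL k:X. hform m (e+d - c) (al k)" "smul f n=(SUM k:X. smul (al k) (s k))" using gen[OF n] by blast
  show ?thesis
  by (rule exI[of _ "%k. al (\<pi> k)"]) (use al \<pi>X in \<open>simp add: sumX\<close>)
  qed
  from ind show "EX e' h q. hform m e' h&h q~=0&(ALL v a. h v~=0-->(ALL b. (SUM k<card X. a k * s (\<pi> k) b v)=0)-->(ALL k<card X. a k=0))"
  proof (elim exE conjE, intro exI conjI allI impI)
  fix e' h q assume h: "hform m e' h" "h q~=0"
  and i: "ALL v a. h v~=0-->(ALL b. (SUM k:X. a k * s k b v)=0)-->(ALL k:X. a k=0)"
  show "hform m e' h" "h q~=0" by (rule h)+
  fix v a k assume v: "h v~=0" and 0: "ALL b. (SUM k<card X. a k * s (\<pi> k) b v)=0" and k: "k < card X"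
  define a' where "a'=(%x. a (inv_into {..<card X} \<pi> x))"
  have a': "a' (\<pi> k)=a k" if "k < card X" for k
  using that \<pi> by (simp add: a'_def bij_betw_def inv_into_f_f)
  have "(SUM x:X. a' x * s x b v)=(SUM k<card X. a k * s (\<pi> k) b v)" for b
  unfolding sumX by (intro sum.cong refl) (simp add: a')
  with 0 have "ALL x:X. a' x=0" using i v by simp
  then show "a k=0" using a'[OF k] \<pi>X[OF k] by metis
  qed
 qed
 then show ?thesis by blast
qed

lemma antisym_sum:
 fixes w c :: "nat=>nat=>complex"
 assumes "!!k l. w k l = - w l k"
 shows "(SUM k<r. SUM l<r. c k l * w k l)=(SUM x:{(k, l). k<l&l<r}. (c (fst x) (snd x) - c (snd x) (fst x)) * w (fst x) (snd x))"
proof (induction r)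
 case 0 show ?case by simp
next
 case (Suc r)
 have 0: "w k k=0" for k using assms[of k k] by simp
 have X: "{(k, l). k<l&l<Suc r}={(k, l). k<l&l<r} \<union> (%k. (k, r)) ` {..<r}" by auto
 have fin: "finite {(k, l). k<l&l<r}"
  by (rule finite_subset[of _ "{..<r} \<times> {..<r}"]) auto
 have "(SUM x:{(k, l). k<l&l<Suc r}. (c (fst x) (snd x) - c (snd x) (fst x)) * w (fst x) (snd x)) =
  (SUM k<r. SUM l<r. c k l * w k l)+(SUM k<r. (c k r - c r k) * w k r)"
  unfolding X Suc.IH by (subst sum.union_disjoint) (auto simp: fin sum.reindex inj_on_def)
 also have "(SUM k<r. (c k r - c r k) * w k r)=(SUM k<r. c k r * w k r)+(SUM k<r. c r k * w r k)"
  unfolding sum.distrib[symmetric] by (intro sum.cong refl) (simp add: assms[of r] algebra_simps)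
 finally show ?case by (simp add: 0 sum.distrib algebra_simps)
qed

lemma smul_eqD: "smul f x=(SUM k:X. smul (al k) (s k))==>f v * x b v=(SUM k:X. al k v * s k b v)"
 by (drule fun_cong[of _ _ b], drule fun_cong[of _ _ v]) (simp add: sum_apply2 smul_def)

text \<open>The elements s k \<and> s l with k < l serve for f^2. For independence a relation is
  read as a skew coefficient matrix; generic independence of the \<open>s k\<close> is applied once
  to its rows and once to its columns.\<close>

lemma locbasis_wedge:
 assumes lb: "locbasis m N e f r s c"
 shows "EX s'. locbasis m (wedge N) (e+e) (%v. f v * f v) (card {(k, l). k<l&l<r}) s' (c + c)"
proof (rule locbasis_reindex[where s = "%x. wdg (s (fst x)) (s (snd x))"])
 let ?X = "{(k, l). k<l&l<r}"
 note D = locbasisD[OF lb]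
 show "finite ?X" by (rule finite_subset[of _ "{..<r} \<times> {..<r}"]) auto
 show "hform m (e+e) (%v. f v * f v)" by (rule hform_mult[OF D(1) D(1)])
 show "c + c<=e+e" using D(2) by simp
 show "wdg (s (fst x)) (s (snd x)):wedge N (c + c)" if "x : ?X" for x
  by (rule spanof_base[where N = N and N' = N and d = c and d' = c]; (rule D(3))?) (use that in auto)
 show "EX e' h q. hform m e' h&h q~=0&(ALL v a. h v~=0-->(ALL b. (SUM k:?X. a k * wdg (s (fst k)) (s (snd k)) b v)=0)-->(ALL k:?X. a k=0))"
  using D(5)
 proof (elim exE conjE, intro exI conjI allI impI ballI)
  fix e' h q assume h: "hform m e' h" "h q~=0"
  and i: "ALL v a. h v~=0-->(ALL b. (SUM k<r. a k * s k b v)=0)-->(ALL k<r. a k=0)"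
  show "hform m e' h" "h q~=0" by (rule h)+
  fix v a k assume v: "h v~=0" and 0: "ALL b. (SUM k:?X. a k * wdg (s (fst k)) (s (snd k)) b v)=0" and k: "k : ?X"
  define c where "c=(%k l. if k<l then a (k, l) else 0)"
  define A where "A=(%k l. c k l - c l k)"
  have "(SUM k<r. (SUM l<r. A k l * s l b' v) * s k b v)=0" for b b'
  proof -
  have "(SUM k<r. (SUM l<r. A k l * s l b' v) * s k b v)=(SUM k<r. SUM l<r. c k l * (s k b v * s l b' v))-(SUM k<r. SUM l<r. c l k * (s k b v * s l b' v))"
  unfolding A_def left_diff_distrib sum_subtractf sum_distrib_right by (simp only: mult_ac)
  also have "(SUM k<r. SUM l<r. c l k * (s k b v * s l b' v))=(SUM k<r. SUM l<r. c k l * (s l b v * s k b' v))"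
  by (rule sum.swap)
  also have "(SUM k<r. SUM l<r. c k l * (s k b v * s l b' v)) - ... = (SUM k<r. SUM l<r. c k l * wdg (s k) (s l) (b, b') v)"
  by (simp add: wdg_def sum_subtractf algebra_simps)
  also have "... = (SUM k:?X. a k * wdg (s (fst k)) (s (snd k)) (b, b') v)"
  by (subst antisym_sum) (auto simp: wdg_def c_def intro!: sum.cong)
  finally show ?thesis using 0 by simp
  qed
  with i[THEN spec[of _ v], THEN spec[of _ "%k. SUM l<r. A k l * s l _ v"]] v
  have "(SUM l<r. A k l * s l b' v)=0" if "k<r" for k b'
  using that by simp
  with i[THEN spec[of _ v], THEN spec[of _ "%l. A _ l"]] v
  have A: "A k l=0" if "k<r" "l<r" for k l using that by simp
  show "a k=0" using A[of "fst k" "snd k"] k by (auto simp: A_def c_def)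
 qed
 fix d x assume "x:wedge N d"
 let ?P = "%x. EX al. (ALL k:?X. hform m (e+e+d-(c + c)) (al k))&smul (%v. f v * f v) x=(SUM k:?X. smul (al k) (wdg (s (fst k)) (s (snd k))))"
 have "x:{x. ?P x}"
 proof (rule spanof_map[OF lin_id subspace_combination _ \<open>x:wedge N d\<close>])
  fix n n' d1 d2 assume n: "n:N d1" "n':N d2" "d1+d2=d"
  obtain al where al: "!!k. k<r==>hform m (e+d1 - c) (al k)" "smul f n=(SUM k<r. smul (al k) (s k))" using D(4)[OF n(1)] by blast
  obtain be where be: "!!k. k<r==>hform m (e+d2 - c) (be k)" "smul f n'=(SUM k<r. smul (be k) (s k))" using D(4)[OF n(2)] by blast
  show "wdg n n':{x. ?P x}"
  proof (intro CollectI exI[of _ "%x v. al (fst x) v * be (snd x) v-al (snd x) v * be (fst x) v"] conjI ballI)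
  fix k assume k: "k : ?X"
  have deg: "e+e+d-(c + c)=(e+d1 - c)+(e+d2 - c)" using D(2) n(3) by simp
  show "hform m (e+e+d-(c + c)) (%v. al (fst k) v * be (snd k) v-al (snd k) v * be (fst k) v)"
  unfolding deg by (rule hform_diff[OF hform_mult[OF al(1) be(1)] hform_mult[OF al(1) be(1)]]) (use k in auto)
  next
  show "smul (%v. f v * f v) (wdg n n')=(SUM k:?X. smul (%v. al (fst k) v * be (snd k) v-al (snd k) v * be (fst k) v) (wdg (s (fst k)) (s (snd k))))"
  proof (rule ext, rule ext)
  fix x :: "'a \<times> 'a" and v
  obtain b b' where x: "x=(b, b')" by (cases x)
  have "f v * f v * (n b v * n' b' v-n' b v * n b' v)=(f v * n b v) * (f v * n' b' v)-(f v * n' b v) * (f v * n b' v)"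
  by (simp add: algebra_simps)
  also have "... = (SUM k<r. SUM l<r. al k v * be l v * (s k b v * s l b' v))-(SUM l<r. SUM k<r. be l v * al k v * (s l b v * s k b' v))"
  unfolding smul_eqD[OF al(2)] smul_eqD[OF be(2)] sum_product by (simp add: mult_ac)
  also have "(SUM l<r. SUM k<r. be l v * al k v * (s l b v * s k b' v))=(SUM k<r. SUM l<r. be l v * al k v * (s l b v * s k b' v))"
  by (rule sum.swap)
  also have "(SUM k<r. SUM l<r. al k v * be l v * (s k b v * s l b' v)) - ... = (SUM k<r. SUM l<r. (al k v * be l v) * wdg (s k) (s l) x v)"
  unfolding sum_subtractf[symmetric] by (simp add: x wdg_def algebra_simps)
  also have "... = (SUM k:?X. (al (fst k) v * be (snd k) v-al (snd k) v * be (fst k) v) * wdg (s (fst k)) (s (snd k)) x v)"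
  by (rule antisym_sum) (simp add: x wdg_def)
  finally show "smul (%v. f v * f v) (wdg n n') x v=(SUM k:?X. smul (%v. al (fst k) v * be (snd k) v-al (snd k) v * be (fst k) v) (wdg (s (fst k)) (s (snd k)))) x v"
  unfolding sum_apply2 by (simp add: x smul_def wdg_def)
  qed
  qed
 qed
 then show "?P x" by simp
qed

lemma locfree_wedge: assumes "locfree m N" shows "locfree m (wedge N)"
 unfolding locfree_def
proof (intro allI impI)
 fix p :: vec assume "EX i<m. p i~=0"
 then obtain e f r s c where l: "locbasis m N e f r s c" "f p~=0" using assms unfolding locfree_def by blast
 obtain s' where "locbasis m (wedge N) (e+e) (%v. f v * f v) (card {(k, l). k<l&l<r}) s' (c + c)"
  using locbasis_wedge[OF l(1)] by blast
 moreover have "f p * f p~=0" using l(2) by simp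
 ultimately show "EX e f r s c. locbasis m (wedge N) e f r s c&f p~=0"
  by (intro exI[of _ "e+e"] exI[of _ "%v. f v * f v"] exI conjI)
qed

lemma locfree_map:
 assumes lf: "locfree m N" and T: "lin T" "!!f x. T (smul f x) = smul f (T x)"
  and inj: "!!d r (s :: nat=>'b vf) a v b. (!!k. k<r==>s k:N d)==>(!!c. (SUM k<r. a k * T (s k) c v)=0)==>(SUM k<(r::nat). a k * s k b v)=0"
 shows "locfree m (%d. T ` N d)"
 unfolding locfree_def
proof (intro allI impI)
 fix p :: vec assume "EX i<m. p i~=0"
 then obtain e f r s c where l: "locbasis m N e f r s c" "f p~=0" using lf unfolding locfree_def by blast
 note D = locbasisD[OF l(1)]
 have "locbasis m (%d. T ` N d) e f r (%k. T (s k)) c"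
  unfolding locbasis_def
 proof (intro conjI allI impI ballI)
  show "hform m e f" "c<=e" by (rule D)+
  show "T (s k):T ` N c" if "k<r" for k using D(3)[OF that] by blast
  fix d y assume "y:T ` N d"
  then obtain x where x: "x:N d" "y=T x" by blast
  obtain al where al: "ALL k<r. hform m (e+d - c) (al k)" "smul f x=(SUM k<r. smul (al k) (s k))" using D(4)[OF x(1)] by blast
  show "EX al. (ALL k<r. hform m (e+d - c) (al k))&smul f y=(SUM k<r. smul (al k) (T (s k)))"
  by (intro exI[of _ al] conjI al(1)) (simp only: x(2) T(2)[symmetric] al(2) lin_sum[OF T(1)])
 next
  show "EX e' h q. hform m e' h&h q~=0&(ALL v a. h v~=0-->(ALL b. (SUM k<r. a k * T (s k) b v)=0)-->(ALL k<r. a k=0))"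
  using D(5)
  proof (elim exE conjE, intro exI conjI allI impI ballI)
  fix e' h q assume h: "hform m e' h" "h q~=0"
  and i: "ALL v a. h v~=0-->(ALL b. (SUM k<r. a k * s k b v)=0)-->(ALL k<r. a k=0)"
  show "hform m e' h" "h q~=0" by (rule h)+
  fix v a k assume v: "h v~=0" and 0: "ALL b. (SUM k<r. a k * T (s k) b v)=0" and k: "k<r"
  have "(SUM k<r. a k * s k b v)=0" for b by (rule inj[OF D(3)]) (use 0 in auto)
  with i v k show "a k=0" by blast
  qed
 qed
 with l(2) show "EX e f r s c. locbasis m (%d. T ` N d) e f r s c&f p~=0" by (intro exI conjI)
qed

section \<open>The double exterior square in rank 3\<close>

text \<open>In rank 3 the cross product stands in for the exterior product. Its values are again
  vectors of length 3, so it can be iterated, and \<open>ctr x (crs y z)\<close> is the determinant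
  of x, y, z.\<close>

definition crs :: "(nat=>vec=>complex)=>(nat=>vec=>complex)=>nat=>vec=>complex" where
 "crs x y=(%b v. if b=0 then x 1 v * y 2 v-x 2 v * y 1 v
  else if b=1 then x 2 v * y 0 v-x 0 v * y 2 v
  else if b=2 then x 0 v * y 1 v-x 1 v * y 0 v else 0)"

definition ctr :: "(nat=>vec=>complex)=>(nat=>vec=>complex)=>unit=>vec=>complex" where
 "ctr x y=(%_ v. x 0 v * y 0 v+x 1 v * y 1 v+x 2 v * y 2 v)"

definition uncrs :: "(nat \<times> nat=>vec=>complex)=>nat=>vec=>complex" where
 "uncrs ph=(%b. if b=0 then ph (1, 2) else if b=1 then ph (2, 0) else if b=2 then ph (0, 1) else (%v. 0))"

lemma lin_uncrs: "lin uncrs"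
 by (rule linI) (auto simp: uncrs_def scl_def fun_eq_iff)

lemma uncrs_smul: "uncrs (smul f x) = smul f (uncrs x)"
 by (auto simp: uncrs_def smul_def fun_eq_iff)

lemma uncrs_wdg: "uncrs (wdg x y) = crs x y"
 by (auto simp: uncrs_def wdg_def crs_def fun_eq_iff)

lemma crs_wedge: "spanof crs N N d=uncrs ` wedge N d"
 unfolding spanof_image[OF lin_uncrs] uncrs_wdg ..

lemma wedge_antisym:
 assumes N: "gsub m B N" and "x:wedge N d"
 shows "x (b, b') v+x (b', b) v=0&(b~:B-->x (b, b') v=0)"
proof -
 let ?Y = "{x. ALL b b' v. x (b, b') v+x (b', b) v=0&(b~:B-->x (b, b') v=0)}"
 have "x : ?Y"
 proof (rule spanof_map[OF lin_id _ _ assms(2)])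
  show "fv.subspace ?Y"
  proof (unfold fv.subspace_def, intro conjI ballI allI)
  fix x y :: "'a \<times> 'a=>vec=>complex" assume "x : ?Y" "y : ?Y"
  then have *: "!!b b' v. x (b, b') v+x (b', b) v=0" "!!b b' v. y (b, b') v+y (b', b) v=0"
  "!!b b' v. b~:B==>x (b, b') v=0" "!!b b' v. b~:B==>y (b, b') v=0" by blast+
  have "(x+y) (b, b') v+(x+y) (b', b) v=(x (b, b') v+x (b', b) v)+(y (b, b') v+y (b', b) v)" for b b' v
  by simp
  then show "x+y : ?Y" using * by simp
  next
  fix c and x :: "'a \<times> 'a=>vec=>complex" assume "x : ?Y"
  then show "scl c x : ?Y" by (simp add: scl_def distrib_left[symmetric])
  qed simp
  fix n n' d d' assume "n:N d" "n':N d'"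
  with gsub_VF[OF N this(1)] gsub_VF[OF N this(2)] show "wdg n n' : ?Y"
  by (auto simp: wdg_def VF_def)
 qed
 then show ?thesis by blast
qed

lemma less_3: "{..<3::nat}={0, 1, 2}" by auto

lemma uncrs_inj:
 assumes N: "gsub m {..<3} N" and s: "!!k. k<r==>s k:wedge N d" and 0: "!!c. (SUM k<r. a k * uncrs (s k) c v)=0"
 shows "(SUM k<(r::nat). a k * s k bb v)=0"
proof -
 obtain b b' where bb: "bb=(b, b')" by (cases bb)
 define S where "S=(%b b'. SUM k<r. a k * s k (b, b') v)"
 have "S b b'+S b' b=0" for b b'
  unfolding S_def sum.distrib[symmetric] using wedge_antisym[OF N s] by (intro sum.neutral) (simp add: distrib_left[symmetric])
 then have anti: "S b b' = - S b' b" for b b' by (rule add_eq_0_iff2[THEN iffD1])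
 have out: "S b b'=0" if "b~:{..<3}" for b b'
  unfolding S_def using wedge_antisym[OF N s] that by (intro sum.neutral) simp
 have "S 1 2=0" "S 2 0=0" "S 0 1=0" using 0[of 0] 0[of 1] 0[of 2] by (simp_all add: S_def uncrs_def)
 moreover have "S 0 0=0" "S 1 1=0" "S 2 2=0" using anti[of 0 0] anti[of 1 1] anti[of 2 2] by simp_all
 ultimately have "S b b'=0" if "b:{..<3}" "b':{..<3}"
  using anti[of 2 1] anti[of 0 2] anti[of 1 0] that unfolding less_3 by (elim insertE emptyE) simp_all
 then have "S b b'=0" using out[of b b'] out[of b' b] anti[of b b'] by (cases "b:{..<3}&b':{..<3}") auto
 then show ?thesis by (simp add: S_def bb)
qed

lemma locfree_crs:
 assumes N: "gsub m {..<3} N" and "locfree m N" shows "locfree m (spanof crs N N)"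
proof -
 have "locfree m (%d. uncrs ` wedge N d)"
  by (rule locfree_map[OF locfree_wedge[OF assms(2)] lin_uncrs uncrs_smul]) (rule uncrs_inj[OF N], assumption+)
 then show ?thesis by (simp only: crs_wedge[symmetric])
qed

lemma dim_crs: assumes N: "gsub m {..<3} N" shows "fv.dim (spanof crs N N d)=fv.dim (wedge N d)"
 unfolding crs_wedge
proof (rule dim_image_inj[OF lin_uncrs gsub_findim[OF gsub_wedge[OF N]] gsub_subspace[OF gsub_wedge[OF N]]])
 show "finite ({..<3::nat} \<times> {..<3::nat})" by simp
 fix w assume w: "w:wedge N d" "uncrs w=0"
 have "w bb v=0" for bb v
  using uncrs_inj[OF N, of 1 "%_. w" d "%_. 1" v bb] w by simp
 then show "w=0" by (simp add: fun_eq_iff)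
qed

lemma crs_VF:
 assumes "n:VF m B d" "n':VF m B' d'" shows "crs n n':VF m {..<3} (d+d')"
proof -
 have "hform m (d+d') (%v. n b v * n' b' v-n b' v * n' b v)" for b b'
  using hform_diff[OF hform_mult[OF VF_hform[OF assms(1), of b] VF_hform[OF assms(2), of b']]
  hform_mult[OF VF_hform[OF assms(1), of b'] VF_hform[OF assms(2), of b]]] .
 then show ?thesis by (auto simp: VF_def crs_def less_3)
qed

lemma ctr_VF:
 assumes "n:VF m B d" "n':VF m B' d'" shows "ctr n n':VF m UNIV (d+d')"
 using assms by (auto simp: VF_def ctr_def intro!: hform.add hform_mult VF_hform[OF assms(1)] VF_hform[OF assms(2)])

lemma gsub_crs: "gsub m B N==>gsub m {..<3} (spanof crs N N)"
 by (rule gsub_spanof, assumption, rule crs_VF[OF gsub_VF gsub_VF]) (auto simp: crs_def smul_def fun_eq_iff algebra_simps)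

lemma gsub_ctr: "gsub m B N==>gsub m B' N'==>gsub m UNIV (spanof ctr N N')"
 by (rule gsub_spanof, assumption, rule ctr_VF[OF gsub_VF gsub_VF]) (auto simp: ctr_def smul_def fun_eq_iff algebra_simps)

lemma wedge_unit: "wedge (N :: nat=>(unit=>vec=>complex) set) d={0}"
proof -
 have "x:{0}" if "x:wedge N d" for x
  by (rule spanof_map[OF lin_id _ _ that]) (auto simp: fv.subspace_def scl_def wdg_def fun_eq_iff)
 moreover have "0:wedge N d" unfolding spanof_def by (rule fv.span_zero)
 ultimately show ?thesis by blast
qed

lemma lin_crs: "lin (crs x)" "lin (%x. crs x y)" and lin_ctr: "lin (ctr x)"
 by (rule linI; auto simp: crs_def ctr_def scl_def fun_eq_iff algebra_simps)+

text \<open>The vector triple product identity. The assumptions make \<open>z\<close> and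
  \<open>w\<close> vanish outside the three coordinates.\<close>

lemma crs_crs:
 assumes "!!b. b~:{..<3}==>z b=(%v. 0)" "!!b. b~:{..<3}==>w b=(%v. 0)"
 shows "crs x (crs z w) = smul (ctr w x ()) z - smul (ctr z x ()) w"
proof (rule ext, rule ext)
 fix b v
 show "crs x (crs z w) b v=(smul (ctr w x ()) z - smul (ctr z x ()) w) b v"
 proof (cases "b:{..<3}")
  case True then show ?thesis unfolding less_3 by (auto simp: crs_def ctr_def smul_def algebra_simps)
 next
  case False then show ?thesis using assms by (simp add: crs_def smul_def less_3)
 qed
qed

text \<open>With \<open>E(ij|kl) = (x\<^sub>i \<times> x\<^sub>j) \<times> (x\<^sub>k \<times> x\<^sub>l)\<close> this is \<open>2 det(x\<^sub>1, x\<^sub>2, x\<^sub>3) x\<^sub>4 = - E(12|34) + E(13|24) - E(23|14)\<close>.\<close>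

lemma ctr_crs_expand:
 assumes "!!b. b~:{..<3}==>w b=(%v. 0)"
 shows "scl 2 (smul (ctr x (crs y z) ()) w) = crs (crs x z) (crs y w) - crs (crs x y) (crs z w) - crs (crs y z) (crs x w)"
proof (rule ext, rule ext)
 fix b v
 show "scl 2 (smul (ctr x (crs y z) ()) w) b v=(crs (crs x z) (crs y w) - crs (crs x y) (crs z w) - crs (crs y z) (crs x w)) b v"
 proof (cases "b:{..<3}")
  case True then show ?thesis unfolding less_3 by (auto simp: crs_def ctr_def smul_def scl_def algebra_simps)
 next
  case False then show ?thesis using assms by (simp add: crs_def smul_def scl_def less_3)
 qed
qed

definition dropu :: "('b \<times> unit=>vec=>complex)=>'b vf" where
 "dropu ph=(%b. ph (b, ()))"

lemma lin_dropu: "lin dropu"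
 by (rule linI) (auto simp: dropu_def scl_def fun_eq_iff)

lemma dropu_pw: "dropu (pw x y) = smul (y ()) x"
 by (auto simp: dropu_def pw_def smul_def fun_eq_iff)

lemma subspace_spanof: "fv.subspace (spanof be N N' e)"
 unfolding spanof_def by (rule fv.subspace_span)

text \<open>The isomorphism between the exterior square of the exterior square and E tensor det E,
  as an equality of spans. \<open>crs_crs\<close> writes iterated cross products as determinants
  times elements of \<open>N\<close>; \<open>ctr_crs_expand\<close> recovers such products after
  division by 2.\<close>

theorem crs_crs_spanof:
 assumes N: "gsub m {..<3} N"
 shows "spanof crs (spanof crs N N) (spanof crs N N) e=dropu ` prodm N (spanof ctr N (spanof crs N N)) e"
proof -
 let ?C = "spanof crs N N" and ?D = "spanof ctr N (spanof crs N N)"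
 let ?Y = "dropu ` prodm N ?D e" and ?Z = "spanof crs ?C ?C e"
 have Y: "fv.subspace ?Y" by (rule lin_subspace_image[OF lin_dropu subspace_spanof])
 have out: "x b=(%v. 0)" if "x:N d" "b~:{..<3}" for x d b using gsub_VF[OF N that(1)] that(2) by (simp add: VF_def)
 have 1: "smul (ctr y w ()) z : ?Y" if "z:N d" "y:N d1" "w : ?C d2" "d+d1+d2=e" for z y w d d1 d2
  unfolding dropu_pw[symmetric]
  by (rule imageI, rule spanof_base[of z N d "ctr y w" ?D "d1+d2"], rule that(1), rule spanof_base[of y N d1 w ?C d2]) (use that in simp_all)
 have "x : ?Y" if "x : ?Z" for x
 proof (rule spanof_map[OF lin_id Y _ that])
  fix w w' d d' assume w: "w : ?C d" "w' : ?C d'" "d+d'=e"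
  show "crs w w' : ?Y"
  proof (rule spanof_map[OF lin_crs(1) Y _ w(2)])
  fix z y d1 d2 assume z: "z:N d1" "y:N d2" "d1+d2=d'"
  have "smul (ctr y w ()) z : ?Y" "smul (ctr z w ()) y : ?Y" using 1[OF z(1,2) w(1)] 1[OF z(2,1) w(1)] z(3) w(3) by simp_all
  then show "crs w (crs z y) : ?Y"
  by (subst crs_crs) (erule out[OF z(1)] out[OF z(2)] | rule fv.subspace_diff[OF Y])+
  qed
 qed
 moreover have "dropu x : ?Z" if "x:prodm N ?D e" for x
 proof (rule spanof_map[OF lin_dropu subspace_spanof _ that])
  fix z y d d' assume z: "z:N d" "y : ?D d'" "d+d'=e"
  show "dropu (pw z y) : ?Z"
  proof (rule spanof_map[OF _ subspace_spanof _ z(2)])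
  show "lin (%y. dropu (pw z y))" by (rule linI) (auto simp: dropu_def pw_def scl_def fun_eq_iff algebra_simps)
  fix x w d1 d2 assume x: "x:N d1" "w : ?C d2" "d1+d2=d'"
  show "dropu (pw z (ctr x w)) : ?Z"
  proof (rule spanof_map[OF _ subspace_spanof _ x(2)])
  show "lin (%w. dropu (pw z (ctr x w)))" by (rule linI) (auto simp: dropu_def pw_def ctr_def scl_def fun_eq_iff algebra_simps)
  fix y y' k k' assume y: "y:N k" "y':N k'" "k + k'=d2"
  have deg: "d1 + k'+(k+d)=e" "d1 + k+(k'+d)=e" "k + k'+(d1+d)=e" using z(3) x(3) y(3) by simp_all
  have "scl 2 (smul (ctr x (crs y y') ()) z) : ?Z"
  by (subst ctr_crs_expand, rule out[OF z(1)], assumption)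
  (intro fv.subspace_diff[OF subspace_spanof]
  spanof_base[of "crs x y'" ?C "d1 + k'" "crs y z" ?C "k+d"] spanof_base[of x N d1 y' N k'] spanof_base[of y N k z N d]
  spanof_base[of "crs x y" ?C "d1 + k" "crs y' z" ?C "k'+d"] spanof_base[of x N d1 y N k] spanof_base[of y' N k' z N d]
  spanof_base[of "crs y y'" ?C "k + k'" "crs x z" ?C "d1+d"] spanof_base[of y N k y' N k'] spanof_base[of x N d1 z N d]
  x(1) y(1,2) z(1) deg refl)
  from fv.subspace_scale[OF subspace_spanof this, of "1/2"]
  show "dropu (pw z (ctr x (crs y y'))) : ?Z" by (simp add: dropu_pw)
  qed
  qed
 qed
 ultimately show ?thesis by blast
qed

lemma dim_dropu: "findim W==>fv.subspace W==>fv.dim (dropu ` W)=fv.dim W"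
 by (rule dim_image_inj[OF lin_dropu]) (auto simp: dropu_def fun_eq_iff)

text \<open>Multiplicativity of the determinant: the vectors on the left are \<open>F\<close> times
  the given ones, expressed in x, y, z.\<close>

lemma det_product:
 fixes s n n1 n2 :: "nat=>vec=>complex"
 assumes "!!b. F * n b v=a0 * x b v+a1 * y b v+a2 * z b v" "!!b. F * n1 b v=b0 * x b v+b1 * y b v+b2 * z b v"
  "!!b. F * n2 b v = c0 * x b v + c1 * y b v + c2 * z b v"
 shows "F * F * F * ctr n (crs n1 n2) u v=(a0 * (b1 * c2-b2 * c1)+a1 * (b2 * c0-b0 * c2)+a2 * (b0 * c1-b1 * c0)) * ctr x (crs y z) u v"
proof -
 have "F * F * F * ctr n (crs n1 n2) u v=F * n 0 v * ((F * n1 1 v) * (F * n2 2 v)-(F * n1 2 v) * (F * n2 1 v))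
  + F * n 1 v * ((F * n1 2 v) * (F * n2 0 v)-(F * n1 0 v) * (F * n2 2 v))
  + F * n 2 v * ((F * n1 0 v) * (F * n2 1 v)-(F * n1 1 v) * (F * n2 0 v))"
  by (simp add: ctr_def crs_def algebra_simps)
 also have "... = (a0 * (b1 * c2-b2 * c1)+a1 * (b2 * c0-b0 * c2)+a2 * (b0 * c1-b1 * c0)) * ctr x (crs y z) u v"
  unfolding assms by (simp add: ctr_def crs_def) algebra
 finally show ?thesis .
qed

text \<open>By \<open>det_product\<close>, f^3 times any determinant is a form times the determinant
  \<open>de\<close> of the local basis, so \<open>de\<close> is a local basis with one element.
  Should \<open>de\<close> be identically zero, f^3 kills the module and the empty basis
  serves.\<close>

lemma locfree_ctr:
 assumes N: "gsub m {..<3} N" and lf: "locfree_rank m 3 N"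
 shows "locfree m (spanof ctr N (spanof crs N N))"
 unfolding locfree_def
proof (intro allI impI)
 fix p :: vec assume "EX i<m. p i~=0"
 then obtain e f s c where l: "locbasis m N e f 3 s c" "f p~=0" using lf unfolding locfree_rank_def by blast
 note D = locbasisD[OF l(1)]
 let ?C = "spanof crs N N" and ?D = "spanof ctr N (spanof crs N N)"
 let ?f = "%v. f v * f v * f v" and ?e = "e+e+e" and ?c = "c+(c + c)"
 define de where "de = ctr (s 0) (crs (s 1) (s 2))"
 have de: "de : ?D ?c" unfolding de_def
  by (rule spanof_base[where d = c and d' = "c + c"]; (rule spanof_base[where d = c and d' = c])?; (rule D(3))?) simp_all
 have f: "hform m ?e ?f" by (intro hform_mult D(1))
 have ce: "?c<=?e" using D(2) by simp
 have comb: "EX al. hform m (?e+d-?c) al&smul ?f x = smul al de" if "x : ?D d" for x d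
 proof -
  let ?Y = "{x. EX al. (ALL k:{0::nat}. hform m (?e+d-?c) (al k))&smul ?f x=(SUM k:{0}. smul (al k) de)}"
  have Y: "fv.subspace ?Y" by (rule subspace_combination)
  have "x : ?Y"
  proof (rule spanof_map[OF lin_id Y _ that])
  fix n w d1 d2 assume n: "n:N d1" "w : ?C d2" "d1+d2=d"
  show "ctr n w : ?Y"
  proof (rule spanof_map[OF lin_ctr Y _ n(2)])
  fix n1 n2 d3 d4 assume n12: "n1:N d3" "n2:N d4" "d3+d4=d2"
  obtain al where al: "!!k. k<3==>hform m (e+d1 - c) (al k)" "smul f n=(SUM k<3. smul (al k) (s k))" using D(4)[OF n(1)] by blast
  obtain be where be: "!!k. k<3==>hform m (e+d3 - c) (be k)" "smul f n1=(SUM k<3. smul (be k) (s k))" using D(4)[OF n12(1)] by blast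
  obtain ga where ga: "!!k. k<3==>hform m (e+d4 - c) (ga k)" "smul f n2=(SUM k<3. smul (ga k) (s k))" using D(4)[OF n12(2)] by blast
  let ?et = "%v. al 0 v * (be 1 v * ga 2 v-be 2 v * ga 1 v)+al 1 v * (be 2 v * ga 0 v-be 0 v * ga 2 v)
  + al 2 v * (be 0 v * ga 1 v-be 1 v * ga 0 v)"
  have deg: "?e+d-?c=(e+d1 - c)+((e+d3 - c)+(e+d4 - c))" using D(2) n(3) n12(3) by simp
  have "hform m (?e+d-?c) ?et" unfolding deg
  by (rule hform.add[OF hform.add]; rule hform_mult[OF al(1) hform_diff[OF hform_mult[OF be(1) ga(1)] hform_mult[OF be(1) ga(1)]]]; simp)
  moreover have "smul ?f (ctr n (crs n1 n2)) = smul ?et de"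
  proof (rule ext, rule ext)
  fix u v
  have "(SUM k<3. g k)=g 0+g 1+g 2" for g :: "nat=>complex" by (simp add: numeral_3_eq_3 numeral_2_eq_2)
  then have "f v * n b v=al 0 v * s 0 b v+al 1 v * s 1 b v+al 2 v * s 2 b v"
  "f v * n1 b v=be 0 v * s 0 b v+be 1 v * s 1 b v+be 2 v * s 2 b v"
  "f v * n2 b v=ga 0 v * s 0 b v+ga 1 v * s 1 b v+ga 2 v * s 2 b v" for b
  using smul_eqD[OF al(2), of v b] smul_eqD[OF be(2), of v b] smul_eqD[OF ga(2), of v b] by simp_all
  then show "smul ?f (ctr n (crs n1 n2)) u v = smul ?et de u v"
  unfolding smul_def de_def by (rule det_product)
  qed
  ultimately show "ctr n (crs n1 n2) : ?Y" by (intro CollectI exI[of _ "%_. ?et"]) simp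
  qed
  qed
  then show ?thesis by auto
 qed
 show "EX e f r s c. locbasis m ?D e f r s c&f p~=0"
 proof (cases "EX q. de () q~=0")
  case True
  then obtain q where q: "de () q~=0" by blast
  have h: "hform m ?c (de ())" by (rule VF_hform[OF gsub_VF[OF gsub_ctr[OF N gsub_crs[OF N]] de]])
  have "locbasis m ?D ?e ?f 1 (%_. de) ?c"
  unfolding locbasis_def
  proof (intro conjI allI impI ballI f ce de exI[of _ ?c] exI[of _ "de ()"] exI[of _ q] h q)
  fix d x assume "x : ?D d"
  then obtain al where al: "hform m (?e+d-?c) al" "smul ?f x = smul al de" using comb by blast
  show "EX al. (ALL k<1. hform m (?e+d-?c) (al k))&smul ?f x=(SUM k<(1::nat). smul (al k) de)"
  using al by (intro exI[of _ "%_. al"]) simp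
  next
  fix v and a :: "nat=>complex" and k :: nat assume "de () v~=0" "ALL b. (SUM k<1. a k * de b v)=0" "k<1"
  then show "a k=0" by simp
  qed
  moreover have "?f p~=0" using l(2) by simp
  ultimately show ?thesis by (intro exI[of _ ?e] exI[of _ ?f] exI conjI)
 next
  case False
  then have de0: "de=0" by (simp add: fun_eq_iff)
  have "locbasis m ?D ?e ?f 0 (%_. de) ?c"
  unfolding locbasis_def
  proof (intro conjI allI impI ballI f ce)
  show "EX e' h q. hform m e' h&h q~=0&(ALL v a. h v~=0-->(ALL b. (SUM k<(0::nat). a k * de b v)=0)-->(ALL k<0. a k=(0::complex)))"
  by (rule exI[of _ 0], rule exI[of _ "%_. 1"]) (simp add: hform.const)
  fix d x assume "x : ?D d"
  then obtain al where "smul ?f x = smul al de" using comb by blast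
  then show "EX al. (ALL k<0. hform m (?e+d-?c) (al k))&smul ?f x=(SUM k<(0::nat). smul (al k) de)"
  unfolding de0 by simp
  qed simp_all
  moreover have "?f p~=0" using l(2) by simp
  ultimately show ?thesis by (intro exI[of _ ?e] exI[of _ ?f] exI conjI)
 qed
qed

section \<open>From K-polynomials to power series in h\<close>

text \<open>The substitution of 2h for h, which is the Adams operation on Chern characters.\<close>

definition dil :: "complex fps=>complex fps" where
 "dil F=F oo (fps_const 2 * fps_X)"

lemma dil_nth: "fps_nth (dil F) i=2 ^ i * fps_nth F i"
 by (simp add: dil_def fps_compose_linear)

lemma dil_mult: "dil (F * G)=dil F * dil G" and dil_diff: "dil (F-G)=dil F-dil G"
 by (simp_all add: dil_def fps_compose_mult_distrib fps_compose_sub_distrib)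

lemma dil_exp: "dil (fps_exp c)=fps_exp (2 * c)"
 by (rule fps_ext) (simp add: dil_nth power_mult_distrib)

text \<open>This is p(e^h). Since e^h has constant term 1, the polynomial is expanded about 1 before
  e^h - 1 is inserted.\<close>

definition expo :: "complex poly=>complex fps" where
 "expo p=fps_of_poly (pcompose p [:1, 1:]) oo (fps_exp 1-1)"

lemma exp0: "fps_nth (fps_exp 1-1 :: complex fps) 0=0" by simp

lemma expo_mult: "expo (p * q)=expo p * expo q"
 and expo_diff: "expo (p-q)=expo p-expo q" and expo_add: "expo (p+q)=expo p+expo q"
 by (simp_all add: expo_def pcompose_mult pcompose_diff pcompose_add fps_of_poly_mult fps_of_poly_diff fps_of_poly_add
  fps_compose_mult_distrib[OF exp0] fps_compose_sub_distrib fps_compose_add_distrib)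

lemma expo_const: "expo [:c:]=fps_const c"
 by (simp add: expo_def fps_of_poly_const)

lemma expo_X: "expo [:0, 1:]=fps_exp 1"
proof -
 have 1: "fps_of_poly [:1, 1:]=(1+fps_X :: complex fps)" by (simp add: fps_of_poly_pCons)
 have 2: "pcompose [:0, 1:] [:1, 1 :: complex:]=[:1, 1:]" by (simp add: pcompose_pCons)
 show ?thesis
  unfolding expo_def 2 1 fps_compose_add_distrib fps_compose_1 fps_X_fps_compose_startby0[OF exp0] by simp
qed

lemma expo_pCons: "expo (pCons c p)=fps_const c+fps_exp 1 * expo p"
proof -
 have "pCons c p=[:c:]+[:0, 1:] * p" by simp
 then show ?thesis by (simp only: expo_add expo_mult expo_const expo_X)
qed

lemma expo_0: "expo 0=0" by (simp add: expo_def)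
lemma expo_1: "expo 1=1" using expo_const[of 1] by (simp add: one_pCons)

lemma expo_power: "expo (p ^ k)=expo p ^ k"
 by (induction k) (simp_all add: expo_1 expo_mult)

lemma expo_sum: "expo (SUM i:I. p i)=(SUM i:I. expo (p i))"
 by (induction I rule: infinite_finite_induct) (simp_all add: expo_0 expo_add)

lemma expo_monom: "expo (monom c k)=fps_const c * fps_exp (of_nat k)"
proof (induction k)
 case 0 then show ?case by (simp add: monom_0 expo_const)
next
 case (Suc k)
 then show ?case
  by (simp add: monom_Suc expo_pCons fps_exp_add_mult algebra_simps)
qed

lemma expo_square: "expo (pcompose p [:0, 0, 1:])=dil (expo p)"
proof (induction p rule: pCons_induct)
 case 0 show ?case by (simp add: expo_0 dil_def)
next
 case (pCons c p)
 have "dil (expo (pCons c p))=fps_const c+fps_exp 2 * dil (expo p)"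
  by (simp add: expo_pCons dil_def fps_compose_add_distrib fps_compose_mult_distrib)
 also have "... = expo (pcompose (pCons c p) [:0, 0, 1:])"
  using fps_exp_add_mult[of "1::complex" 1]
  by (simp add: pcompose_pCons expo_add expo_mult expo_const expo_pCons pCons.IH expo_0 mult.assoc[symmetric])
 finally show ?case ..
qed

text \<open>1 - e^h has order 1 in h, so multiples of (1-z)^m are invisible below order
  \<open>m\<close>, hence below order 5. The factor \<open>F\<close> leaves room for
  centring.\<close>

lemma expo_dvd:
 assumes "[:1, -1:] ^ m dvd p" "5<=m" "i<5" shows "fps_nth (expo p * F) i=0"
proof -
 obtain q where "p=[:1, -1:] ^ m * q" using assms(1) by (elim dvdE)
 have s: "subdegree (1-fps_exp 1 :: complex fps)=1"
  by (rule subdegreeI) auto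
 have "expo [:1, -1:]=1-fps_exp 1"
  using expo_pCons[of 1 "[:-1:]"] by (simp add: expo_const fps_const_neg[symmetric] del: fps_const_neg)
 then have e: "expo p * F=(1-fps_exp 1) ^ m * (expo q * F)"
  by (simp only: \<open>p = _\<close> expo_mult expo_power mult.assoc)
 show ?thesis
 proof (cases "expo q * F=0")
  case False
  have "(1-fps_exp 1 :: complex fps) ^ m~=0" using s by (metis power_eq_0_iff subdegree_0 zero_neq_one)
  then have "subdegree (expo p * F) >= m"
  unfolding e using subdegree_mult[OF _ False, of "(1-fps_exp 1) ^ m"] by (simp add: subdegree_power s)
  then show ?thesis using assms(2,3) by (intro nth_less_subdegree_zero) simp
 next
  case True then show ?thesis unfolding e by (simp only: mult_zero_right fps_zero_nth)
 qed
qed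

section \<open>The comparison of coefficients up to order 4\<close>

text \<open>Below \<open>Y\<close>, \<open>L\<close>, \<open>D\<close> are the (centred) Chern characters of a bundle, of its exterior square and of
  its determinant; the equations say that the latter have the ranks they should have.\<close>

lemma sum_upto4:
 "(SUM i=0..1. f i)=f 0+f (Suc 0)" "(SUM i=0..Suc 0. f i)=f 0+f (Suc 0)" "(SUM i=0..2. f i)=f 0+f (Suc 0)+f 2"
 "(SUM i=0..3. f i)=f 0+f (Suc 0)+f 2+f 3" "(SUM i=0..4. f i)=f 0+f (Suc 0)+f 2+f 3+f 4" for f :: "nat=>complex"
 by (simp_all add: eval_nat_numeral add.assoc)

text \<open>Order 0 forces p = 1, and then order 2 reads 2A = 4A.\<close>

lemma no_line:
 assumes Y: "fps_nth Y 0=p" "fps_nth Y 1=0" "fps_nth Y 2=p * A" and "p~=0" "A~=0"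
  and eq: "!!i. i<5==>fps_nth (Y * Y) i=fps_nth (dil Y) i"
 shows False
proof -
 have "p * p=p" using eq[of 0] Y by (simp add: dil_nth)
 then have "p=1" using \<open>p ~= 0\<close> by simp
 moreover have "2 * (p * (p * A))=4 * (p * A)" using eq[of 2] Y by (auto simp: dil_nth fps_mult_nth sum_upto4)
 ultimately show False using \<open>A ~= 0\<close> by simp
qed

text \<open>\<open>D\<close> is the character of the determinant, or 0 in rank 2. Its constant term
  e is 0 or 1, its coefficients in orders 1, 2 and 4 vanish, and the relation between
  \<open>Y\<close>, \<open>D\<close> and \<open>L\<close> is compared in orders 0, 2 and 4. If e =
  0, then p = 1 gives A = 0, while p = 2 gives C = A^2/6. If e = 1, then p = 3 is the only nonzero
  real solution and C = A^2/4. All of this contradicts A nonzero and C \<ge> A^2/2.\<close>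

lemma no_rank_3:
 assumes Y: "fps_nth Y 0 = of_real p" "fps_nth Y 1=0" "fps_nth Y 2 = of_real (p * A)" "fps_nth Y 3=0" "fps_nth Y 4 = of_real (p * C)"
  and nz: "p~=0" "A~=0" and C: "C >= A\<^sup>2 / 2"
  and L: "!!i. i<5==>2 * fps_nth L i=fps_nth (Y * Y-dil Y) i"
  and D: "!!i. i<5==>fps_nth (D * D) i=fps_nth (dil D) i"
  and YD: "!!i. i<5==>2 * fps_nth (Y * D) i=fps_nth (L * L-dil L) i"
 shows False
proof -
 define l0 l2 l4 where "l0=(p\<^sup>2-p) / 2" and "l2=p * (p-2) * A" and "l4=(p\<^sup>2 * (2 * C+A\<^sup>2)-16 * (p * C)) / 2"
 have Li: "fps_nth L i=fps_nth (Y * Y-dil Y) i / 2" if "i<5" for i using L[OF that] by (simp add: mult.commute)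
 have Ls: "fps_nth L 0 = of_real l0" "fps_nth L 1=0" "fps_nth L 2 = of_real l2" "fps_nth L 3=0" "fps_nth L 4 = of_real l4"
  using Y by (simp_all add: Li dil_nth fps_mult_nth sum_upto4 l0_def l2_def l4_def power2_eq_square field_simps)
 define d where "d=fps_nth D"
 have "d 1=0"
  using YD[of 1] Y Ls nz by (simp add: dil_nth fps_mult_nth sum_upto4 d_def)
 have "d 0 * d 0=d 0" using D[of 0] by (simp add: dil_nth d_def)
 then have d0: "d 0=0 \<or> d 0=1" by (metis mult_cancel_right1)
 have "2 * d 0 * d 2=4 * d 2" using D[of 2] \<open>d 1 = 0\<close> by (simp add: dil_nth fps_mult_nth sum_upto4 d_def algebra_simps)
 then have "d 2=0" using d0 by auto
 have "2 * d 0 * d 4=16 * d 4" using D[of 4] \<open>d 1 = 0\<close> \<open>d 2 = 0\<close> by (simp add: dil_nth fps_mult_nth sum_upto4 d_def algebra_simps)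
 then have "d 4=0" using d0 by auto
 obtain e :: real where e: "d 0 = of_real e" "e=0 \<or> e=1" using d0 by (metis of_real_0 of_real_1)
 have "of_real (2 * (p * e))=(of_real (l0 * l0-l0) :: complex)"
  using YD[of 0] Y Ls e(1) by (simp add: dil_nth d_def)
 then have e0: "2 * (p * e)=l0 * l0-l0" unfolding of_real_eq_iff .
 have "of_real (2 * (p * A * e))=(of_real (2 * l0 * l2-4 * l2) :: complex)"
  using YD[of 2] Y Ls e(1) \<open>d 1 = 0\<close> \<open>d 2 = 0\<close> by (simp add: dil_nth d_def fps_mult_nth sum_upto4)
 then have e2: "2 * (p * A * e)=2 * l0 * l2-4 * l2" unfolding of_real_eq_iff .
 have "of_real (2 * (p * C * e))=(of_real (2 * l0 * l4+l2 * l2-16 * l4) :: complex)"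
  using YD[of 4] Y Ls e(1) \<open>d 1 = 0\<close> \<open>d 2 = 0\<close> \<open>d 4 = 0\<close> by (simp add: dil_nth d_def fps_mult_nth sum_upto4)
 then have e4: "2 * (p * C * e)=2 * l0 * l4+l2 * l2-16 * l4" unfolding of_real_eq_iff .
 have A2: "A\<^sup>2 > 0" using nz by simp
 from e(2) show False
 proof
  assume "e=0"
  then have "l0 * (l0-1)=0" using e0 by (simp add: algebra_simps)
  then consider "l0=0" | "l0=1" by auto
  then show False
  proof cases
  case 1
  then have "p * (p-1)=0" by (simp add: l0_def power2_eq_square algebra_simps)
  then have "p=1" using nz by simp
  moreover have "l2=0" using e2 1 \<open>e = 0\<close> by simp
  ultimately show False using nz by (simp add: l2_def)
  next
  case 2
  then have "l2=0" using e2 \<open>e = 0\<close> by simp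
  then have p: "p=2" using nz by (simp add: l2_def)
  have "l4=0" using e4 2 \<open>l2 = 0\<close> \<open>e = 0\<close> by simp
  then have "12 * C=2 * A\<^sup>2" by (simp add: l4_def p)
  then show False using C A2 by simp
  qed
 next
  assume "e=1"
  then have "8 * p=(p\<^sup>2-p) * (p\<^sup>2-p-2)" using e0 by (simp add: l0_def power2_eq_square field_simps)
  then have "p * ((p-3) * (p\<^sup>2+p+2))=0" by (simp add: power2_eq_square algebra_simps)
  moreover have "p\<^sup>2+p+2 > 0"
  proof -
  have "p\<^sup>2+p+2=(p+1/2)\<^sup>2+7/4" by (simp add: power2_eq_square field_simps)
  then show ?thesis by (smt (verit) zero_le_power2 divide_pos_pos)
  qed
  ultimately have p: "p=3" using nz by auto
  have "6 * C=6 * l4+9 * A\<^sup>2-16 * l4" using e4 \<open>e = 1\<close> by (simp add: p l0_def l2_def power2_eq_square)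
  moreover have "l4=(9 * (2 * C+A\<^sup>2)-48 * C) / 2" by (simp add: l4_def p)
  ultimately have "144 * C=36 * A\<^sup>2" by argo
  then show False using C A2 by simp
 qed
qed

lemma power_coeffs:
 fixes U :: "complex fps"
 assumes "fps_nth U 0=1" "fps_nth U 1=0" "fps_nth U 2=u" "fps_nth U 3=0" "fps_nth U 4=w"
 shows "fps_nth (U ^ m) 0=1&fps_nth (U ^ m) 1=0&fps_nth (U ^ m) 2 = of_nat m * u&fps_nth (U ^ m) 3=0 &
  fps_nth (U ^ m) 4 = of_nat m * w + of_nat m * (of_nat m-1) / 2 * u\<^sup>2"
proof (induction m)
 case 0 show ?case by (simp add: fps_one_nth)
next
 case (Suc m)
 then show ?case using assms
  by (simp add: fps_mult_nth sum_upto4 field_simps power2_eq_square)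
qed

lemma power_sums:
 "(SUM i<a. real i)=real a * (real a-1) / 2"
 "(SUM i<a. real i ^ 2)=real a * (real a-1) * (2 * real a-1) / 6"
 "(SUM i<a. real i ^ 3)=(real a * (real a-1) / 2)\<^sup>2"
 "(SUM i<a. real i ^ 4)=real a * (real a-1) * (2 * real a-1) * (3 * (real a)\<^sup>2-3 * real a-1) / 30"
 by (induction a) (auto simp: field_simps power2_eq_square power3_eq_cube power4_eq_xxxx)

text \<open>The centre \<open>ta\<close> is the midpoint of 0, ..., a-1, so odd moments cancel; the
  even ones give the coefficients of the centred series in \<open>centred_solution\<close>.\<close>

lemma centred_sums:
 fixes a :: nat defines "ta \<equiv> (real a-1) / 2"
 shows "(SUM i<a. real i-ta)=0" "(SUM i<a. (real i-ta) ^ 2)=real a * ((real a)\<^sup>2-1) / 12" "(SUM i<a. (real i-ta) ^ 3)=0"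
 "(SUM i<a. (real i-ta) ^ 4)=real a * ((real a)\<^sup>2-1) * (3 * (real a)\<^sup>2-7) / 240"
proof -
 show "(SUM i<a. real i-ta)=0" by (simp add: sum_subtractf power_sums ta_def)
 have "(SUM i<a. (real i-ta) ^ 2)=(SUM i<a. real i ^ 2)-2 * ta * (SUM i<a. real i)+real a * ta\<^sup>2"
  by (simp add: power2_diff sum.distrib sum_subtractf sum_distrib_left mult_ac)
 then show "(SUM i<a. (real i-ta) ^ 2)=real a * ((real a)\<^sup>2-1) / 12"
  unfolding power_sums by (simp add: ta_def field_simps power2_eq_square)
 have "(real i-ta) ^ 3=real i ^ 3-3 * ta * real i ^ 2+3 * ta\<^sup>2 * real i-ta ^ 3" for i
  by (simp add: power2_eq_square power3_eq_cube algebra_simps)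
 then have "(SUM i<a. (real i-ta) ^ 3)=(SUM i<a. real i ^ 3)-3 * ta * (SUM i<a. real i ^ 2)+3 * ta\<^sup>2 * (SUM i<a. real i)-real a * ta ^ 3"
  by (simp add: sum.distrib sum_subtractf sum_distrib_left)
 then show "(SUM i<a. (real i-ta) ^ 3)=0"
  unfolding power_sums by (simp add: ta_def field_simps power2_eq_square power3_eq_cube)
 have "(real i-ta) ^ 4=real i ^ 4-4 * ta * real i ^ 3+6 * ta\<^sup>2 * real i ^ 2-4 * ta ^ 3 * real i+ta ^ 4" for i
  by (simp add: power2_eq_square power3_eq_cube power4_eq_xxxx algebra_simps)
 then have "(SUM i<a. (real i-ta) ^ 4)=(SUM i<a. real i ^ 4)-4 * ta * (SUM i<a. real i ^ 3)+6 * ta\<^sup>2 * (SUM i<a. real i ^ 2)-4 * ta ^ 3 * (SUM i<a. real i)+real a * ta ^ 4"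
  by (simp add: sum.distrib sum_subtractf sum_distrib_left)
 then show "(SUM i<a. (real i-ta) ^ 4)=real a * ((real a)\<^sup>2-1) * (3 * (real a)\<^sup>2-7) / 240"
  unfolding power_sums by (simp add: ta_def field_simps power2_eq_square power3_eq_cube power4_eq_xxxx)
qed

text \<open>Up to order 4, \<open>Y\<close> is a constant divided by S^m, where S is the centred sum
  of exponentials. With S/a = 1 + u h^2 + w h^4 + ... one gets A = - m u, nonzero since a > 1, and C
  - A^2/2 = m (u^2/2 - w). The inequality for C therefore amounts to w \<le> u^2/2.\<close>

lemma centred_solution:
 fixes Y :: "complex fps" and a m :: nat and M :: real
 assumes a: "a >= 2" and m: "m > 0" and M: "M~=0"
  and eq: "!!i. i<5==>fps_nth (Y * (SUM i<a. fps_exp (of_real (real i-(real a-1) / 2))) ^ m) i=(if i=0 then of_real M else 0)"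
 shows "EX p A C. fps_nth Y 0 = of_real p&fps_nth Y 1=0&fps_nth Y 2 = of_real (p * A)&fps_nth Y 3=0 &
  fps_nth Y 4 = of_real (p * C)&p~=0&A~=0&C >= A\<^sup>2 / 2"
proof -
 define ta where "ta=(real a-1) / 2"
 define S :: "complex fps" where "S=(SUM i<a. fps_exp (of_real (real i-ta)))"
 have S: "fps_nth S k = of_real ((SUM i<a. (real i-ta) ^ k) / fact k)" for k
  by (simp add: S_def fps_sum_nth sum_divide_distrib)
 note cs = centred_sums[of a, folded ta_def]
 define u where "u=((real a)\<^sup>2-1) / 24"
 define w where "w=((real a)\<^sup>2-1) * (3 * (real a)\<^sup>2-7) / 5760"
 define U where "U=fps_const (1 / of_nat a) * S"
 have a0: "of_nat a~=(0::complex)" "real a~=0" using a by auto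
 have U: "fps_nth U 0=1" "fps_nth U 1=0" "fps_nth U 2 = of_real u" "fps_nth U 3=0" "fps_nth U 4 = of_real w"
 proof -
  have nth: "fps_nth U k = of_real ((SUM i<a. (real i-ta) ^ k) / (real a * fact k))" for k
  unfolding U_def fps_mult_left_const_nth S using a0 by (simp del: of_real_sum)
  have "(SUM i<a. (real i-ta) ^ 0) / (real a * fact 0)=1" "(SUM i<a. (real i-ta) ^ 1) / (real a * fact 1)=0"
  "(SUM i<a. (real i-ta) ^ 2) / (real a * fact 2)=u" "(SUM i<a. (real i-ta) ^ 3) / (real a * fact 3)=0"
  "(SUM i<a. (real i-ta) ^ 4) / (real a * fact 4)=w"
  unfolding cs using a0 cs(1) by (simp_all add: u_def w_def fact_numeral field_simps)
  then show "fps_nth U 0=1" "fps_nth U 1=0" "fps_nth U 2 = of_real u" "fps_nth U 3=0" "fps_nth U 4 = of_real w"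
  unfolding nth by (simp_all only: of_real_1 of_real_0)
 qed
 define g2 where "g2=real m * u"
 define g4 where "g4=real m * w+real m * (real m-1) / 2 * u\<^sup>2"
 have G: "fps_nth (U ^ m) 0=1" "fps_nth (U ^ m) (Suc 0)=0" "fps_nth (U ^ m) 2 = of_real g2" "fps_nth (U ^ m) 3=0" "fps_nth (U ^ m) 4 = of_real g4"
  using power_coeffs[OF U, of m] by (simp_all add: g2_def g4_def)
 define p where "p=M / real a ^ m"
 have "S=fps_const (of_nat a) * U" using a0 by (simp add: U_def mult.assoc[symmetric])
 then have "Y * S ^ m=fps_const (of_nat a ^ m) * (Y * U ^ m)"
  by (simp add: power_mult_distrib fps_const_power mult_ac)
 then have YS: "fps_nth (Y * S ^ m) i = of_nat a ^ m * fps_nth (Y * U ^ m) i" for i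
  by (simp only: fps_mult_left_const_nth)
 have eq': "fps_nth (Y * U ^ m) i=(if i=0 then of_real p else 0)" if "i<5" for i
  using eq[OF that, folded ta_def, folded S_def] a0 by (simp add: YS p_def field_simps split: if_splits)
 have Y0: "fps_nth Y 0 = of_real p" using eq'[of 0] G by simp
 moreover have Y1: "fps_nth Y (Suc 0)=0" using eq'[of 1] G by (simp add: fps_mult_nth sum_upto4)
 moreover have Y2: "fps_nth Y 2 = of_real (p * (- g2))" using eq'[of 2] G Y0 Y1 by (simp add: fps_mult_nth sum_upto4 add_eq_0_iff2)
 moreover have Y3: "fps_nth Y 3=0" using eq'[of 3] G Y0 Y1 by (simp add: fps_mult_nth sum_upto4)
 moreover have Y4: "fps_nth Y 4 = of_real (p * (g2\<^sup>2-g4))"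
  using eq'[of 4] G Y0 Y1 Y2 Y3 by (simp add: fps_mult_nth sum_upto4 add_eq_0_iff2 power2_eq_square algebra_simps)
 moreover have "p~=0" using M a0 by (simp add: p_def)
 moreover have "real a ^ 2 >= 2 ^ 2" using a by (intro power_mono) auto
 then have a2: "(real a)\<^sup>2 > 1" by simp
 then have "- g2~=0" using m by (simp add: g2_def u_def)
 moreover have "g2\<^sup>2-g4 >= (- g2)\<^sup>2 / 2"
 proof -
  have "w<=u\<^sup>2 / 2"
  proof -
  have "u\<^sup>2 / 2-w=((real a)\<^sup>2-1) * (2 * (real a)\<^sup>2+2) / 5760"
  by (simp add: u_def w_def power2_eq_square field_simps)
  moreover have "... >= 0" using a2 by simp
  ultimately show ?thesis by linarith
  qed
  then have "real m * w<=real m * (u\<^sup>2 / 2)" by (intro mult_left_mono) auto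
  then show ?thesis by (simp add: g2_def g4_def power2_eq_square field_simps)
 qed
 ultimately show ?thesis by (intro exI[of _ p] exI[of _ "- g2"] exI[of _ "g2\<^sup>2-g4"]) simp
qed

section \<open>Hilbert series known in one residue class of degrees\<close>

lemma fps_nth_one_minus_X_power_mult: "fps_nth ((1-fps_X ^ a) * F) d=fps_nth F d-(if d<a then 0 else fps_nth F (d-a))" for F :: "complex fps"
 by (simp add: left_diff_distrib fps_X_power_mult_nth)

text \<open>Multiplication by 1 - X^a preserves residue classes of degrees; on the class of
  \<open>c\<close>, reindexed by k, it is multiplication by 1 - X. The vanishing below
  \<open>c\<close> makes the reindexed series start at k = 0.\<close>

lemma residue_part:
 fixes H :: "complex fps" assumes a: "a > 0" and zero: "!!d. d < c==>d mod a = c mod a==>fps_nth H d=0"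
 shows "(ALL d<c. d mod a = c mod a-->fps_nth ((1-fps_X ^ a) ^ m * H) d=0) &
  Abs_fps (%k. fps_nth ((1-fps_X ^ a) ^ m * H) (c + k * a))=(1-fps_X) ^ m * Abs_fps (%k. fps_nth H (c + k * a))"
proof (induction m)
 case 0
 have "fps_nth ((1-fps_X ^ a) ^ 0 * H) d=0" if "d < c" "d mod a = c mod a" for d using zero[OF that] by simp
 then show ?case by simp
next
 case (Suc m)
 define F where "F=(1-fps_X ^ a) ^ m * H"
 define R where "R=Abs_fps (%k. fps_nth F (c + k * a))"
 have F0: "fps_nth F d=0" if "d < c" "d mod a = c mod a" for d using Suc that by (simp add: F_def)
 have R: "R=(1-fps_X) ^ m * Abs_fps (%k. fps_nth H (c + k * a))" using Suc by (simp only: F_def R_def)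
 have "fps_nth ((1-fps_X ^ a) * F) d=0" if "d < c" "d mod a = c mod a" for d
  using F0[OF that] F0[of "d-a"] le_mod_geq[of a d] that by (cases "d<a") (simp_all add: fps_nth_one_minus_X_power_mult)
 moreover have "Abs_fps (%k. fps_nth ((1-fps_X ^ a) * F) (c + k * a))=(1-fps_X) * R"
 proof (rule fps_ext)
  fix k
  have "fps_nth ((1-fps_X) * R) k=fps_nth R k-(if k=0 then 0 else fps_nth R (k-1))"
  by (simp add: left_diff_distrib)
  also have "... = fps_nth ((1-fps_X ^ a) * F) (c + k * a)"
  proof (cases k)
  case 0
  then show ?thesis using F0[of "c-a"] a le_mod_geq[of a c] by (auto simp: fps_nth_one_minus_X_power_mult R_def)
  next
  case (Suc j)
  have "c+(a+j * a)-a = c+j * a" by simp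
  then show ?thesis using a by (simp add: Suc fps_nth_one_minus_X_power_mult R_def)
  qed
  finally show "fps_nth (Abs_fps (%k. fps_nth ((1-fps_X ^ a) * F) (c + k * a))) k=fps_nth ((1-fps_X) * R) k" by simp
 qed
 ultimately show ?case by (simp only: power_Suc mult.assoc F_def[symmetric] R[symmetric]) simp
qed

lemma binomial_series: "(1-fps_X) ^ Suc n * Abs_fps (%k. of_nat ((k+n) choose n))=(1 :: complex fps)"
proof (induction n)
 case 0
 show ?case by (rule fps_ext) (simp add: left_diff_distrib)
next
 case (Suc n)
 have "(1-fps_X) * Abs_fps (%k. of_nat ((k+Suc n) choose Suc n))=(Abs_fps (%k. of_nat ((k+n) choose n)) :: complex fps)"
 proof (rule fps_ext)
  fix k
  show "fps_nth ((1-fps_X) * Abs_fps (%k. of_nat ((k+Suc n) choose Suc n))) k=(fps_nth (Abs_fps (%k. of_nat ((k+n) choose n))) k :: complex)"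
  by (cases k) (simp_all add: left_diff_distrib)
 qed
 then show ?case using Suc by (simp add: power_Suc2 mult.assoc del: power_Suc)
qed

definition geo :: "nat=>complex poly" where
 "geo a=(SUM i<a. monom 1 i)"

lemma geo_mult: "(1-fps_X) * fps_of_poly (geo a)=1-fps_X ^ a"
proof -
 have "fps_of_poly (geo a)=(SUM i<a. fps_X ^ i)" by (simp add: geo_def fps_of_poly_sum fps_of_poly_monom)
 then show ?thesis using one_diff_power_eq[of "fps_X :: complex fps" a] by simp
qed

lemma root_of_unity_sum:
 assumes a: "a > 0" shows "(SUM k<a. exp (2 * pi * \<i> / of_nat a) ^ (k * j))=(if a dvd j then of_nat a else 0)"
proof -
 define w where "w=exp (2 * pi * \<i> / of_nat a) ^ j"
 have ex: "w=exp (2 * of_real pi * \<i> * of_nat j / of_nat a)"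
  by (simp add: w_def exp_of_nat_mult[symmetric] mult_ac)
 have wa: "w ^ a=1"
 proof -
  have "w ^ a=(exp (2 * pi * \<i> / of_nat a) ^ a) ^ j" by (simp add: w_def power_mult[symmetric] mult.commute)
  also have "exp (2 * pi * \<i> / of_nat a) ^ a=1" using a by (simp add: exp_of_nat_mult[symmetric])
  finally show ?thesis by simp
 qed
 have w1: "w=1 \<longleftrightarrow> a dvd j" using complex_root_unity_eq_1[of a j] a unfolding ex by simp
 have "(SUM k<a. exp (2 * pi * \<i> / of_nat a) ^ (k * j))=(SUM k<a. w ^ k)"
  by (simp add: w_def power_mult[symmetric] mult.commute)
 also have "... = (if w=1 then of_nat a else 0)" using geometric_sum[of w a] wa by simp
 finally show ?thesis using w1 by simp
qed

text \<open>Summing over the substitutions of w^k z for z, with w a primitive \<open>a\<close>-th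
  root of unity and suitable weights, isolates the residue class of \<open>c\<close>, where only the
  coefficient at \<open>c\<close> survives. The term k = 0 is the polynomial itself. In every other
  term \<open>geo a\<close> has acquired the root 1, so that term is divisible by (1-z)^m.\<close>

theorem residue_filter:
 fixes K :: "complex poly"
 assumes a: "a > 0" and Q: "!!d. d mod a = c mod a==>coeff (K * geo a ^ m) d=(if d = c then M else 0)"
 shows "[:1, -1:] ^ m dvd K * geo a ^ m-monom (of_nat a * M) c"
proof -
 define om where "om=exp (2 * pi * \<i> / of_nat a)"
 note sum = root_of_unity_sum[OF a, folded om_def]
 \<comment> \<open>A natural number congruent to - \<open>c\<close> modulo \<open>a\<close>, used as
   the exponent of the weights.\<close>
 define c' where "c' = c * (a-1)"
 have c': "a dvd c'+d \<longleftrightarrow> d mod a = c mod a" for d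
 proof -
  have "c' + c = c * a" using a by (cases a) (auto simp: c'_def)
  then have "(c' + c) mod a=0" by simp
  have "a dvd x-y" if "a dvd c'+x" "a dvd c'+y" for x y using dvd_diff_nat[OF that] by simp
  with \<open>(c' + c) mod a = 0\<close> have "a dvd c'+d==>d mod a = c mod a"
  using mod_eq_dvd_iff_nat[of c d a] mod_eq_dvd_iff_nat[of d c a] by (metis mod_0_imp_dvd nat_le_linear)
  moreover have "d mod a = c mod a==>(c'+d) mod a=(c' + c) mod a" by (rule mod_add_cong) simp
  ultimately show ?thesis using \<open>(c' + c) mod a = 0\<close> by (metis mod_0_imp_dvd)
 qed
 let ?F = "%k. smult (om ^ (k * c')) (pcompose (K * geo a ^ m) [:0, om ^ k:])"
 have co: "coeff (pcompose p [:0, w:]) d=w ^ d * coeff p d" for p :: "complex poly" and w d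
  by (rule coeff_pcompose_linear)
 have "(SUM k<a. ?F k)=monom (of_nat a * M) c"
 proof (rule poly_eqI)
  fix d
  have "coeff (SUM k<a. ?F k) d = coeff (K * geo a ^ m) d * (SUM k<a. om ^ (k * (c'+d)))"
  by (simp add: coeff_sum co sum_distrib_left power_add power_mult algebra_simps)
  also have "... = coeff (monom (of_nat a * M) c) d"
  unfolding sum c' using Q[of d] by auto
  finally show "coeff (SUM k<a. ?F k) d = coeff (monom (of_nat a * M) c) d" .
 qed
 moreover have "(SUM k<a. ?F k)=?F 0+(SUM k:{..<a}-{0}. ?F k)" using a by (simp add: sum.remove)
 moreover have "?F 0=K * geo a ^ m" by simp
 ultimately have eq: "K * geo a ^ m-monom (of_nat a * M) c = - (SUM k:{..<a}-{0}. ?F k)" by (simp add: algebra_simps)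
 have "[:1, -1:] ^ m dvd ?F k" if k: "k:{..<a}-{0}" for k
 proof -
  have "~a dvd k" using k by (auto dest: nat_dvd_not_less)
  then have "poly (pcompose (geo a) [:0, om ^ k:]) 1=0"
  using sum[of k] by (simp add: geo_def poly_pcompose poly_sum poly_monom power_mult[symmetric] mult.commute)
  then have "[:-1, 1:] dvd pcompose (geo a) [:0, om ^ k:]" by (simp add: poly_eq_0_iff_dvd)
  then have "- [:1, -1:] dvd pcompose (geo a) [:0, om ^ k:]" by simp
  then have "[:1, -1:] dvd pcompose (geo a) [:0, om ^ k:]" by (simp only: minus_dvd_iff)
  have pow: "pcompose (q ^ j) p=pcompose q p ^ j" for q p :: "complex poly" and j
  by (induction j) (simp_all add: pcompose_mult pcompose_1)
  from dvd_power_same[OF \<open>[:1, -1:] dvd _\<close>, of m] show ?thesis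
  by (simp add: pcompose_mult pow dvd_smult)
 qed
 then show ?thesis unfolding eq by (simp only: dvd_minus_iff) (rule dvd_sum)
qed

section \<open>Excluding modules of rank at most 3\<close>

lemma hs_zero: "(!!d. N d={0})==>kpoly m N 0"
 by (simp add: kpoly_def hs_def dim_0 fps_zero_def[symmetric])

lemma wedge_1: assumes "gsub m {..<1::nat} N" shows "wedge N d={0}"
proof -
 have "x=0" if x: "x:wedge N d" for x
 proof (rule ext, rule ext)
  fix bb :: "nat \<times> nat" and v
  obtain b b' where bb: "bb=(b, b')" by (cases bb)
  show "x bb v=0 bb v"
  using wedge_antisym[OF assms x, of b b' v] wedge_antisym[OF assms x, of b' b v]
  by (cases "b=0&b'=0") (auto simp: bb)
 qed
 moreover have "0:wedge N d" by (rule fv.subspace_0[OF subspace_spanof])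
 ultimately show ?thesis by blast
qed

text \<open>A skew matrix of size 2 is determined by its entry at (0, 1), so any two elements of
  \<open>wedge N\<close> are proportional at each point.\<close>

lemma wedge_wedge_2: assumes "gsub m {..<2::nat} N" shows "wedge (wedge N) d={0}"
proof -
 have \<epsilon>: "EX \<epsilon>. ALL x d. x:wedge N d-->x bb v = \<epsilon> * x (0, 1) v" for bb v
 proof -
  obtain b b' where bb: "bb=(b, b')" by (cases bb)
  have w: "x (b, b') v+x (b', b) v=0&(b~:{..<2}-->x (b, b') v=0)"
  "x (b', b) v+x (b, b') v=0&(b'~:{..<2}-->x (b', b) v=0)" if "x:wedge N d" for x d
  using wedge_antisym[OF assms that] by blast+
  consider "b=b' \<or> b >= 2 \<or> b' >= 2" | "b=0" "b'=1" | "b=1" "b'=0" by force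
  then show ?thesis
  proof cases
  case 1
  have "x bb v=0 * x (0, 1) v" if "x:wedge N d" for x d using w[OF that] 1 by (auto simp: bb)
  then show ?thesis by blast
  next
  case 2
  have "x bb v=1 * x (0, 1) v" if "x:wedge N d" for x d by (simp add: bb 2)
  then show ?thesis by blast
  next
  case 3
  have "x bb v = - 1 * x (0, 1) v" if "x:wedge N d" for x d using w[OF that] 3 by (simp add: bb add_eq_0_iff2)
  then show ?thesis by blast
  qed
 qed
 have z: "wdg x y=0" if x: "x:wedge N d1" and y: "y:wedge N d2" for x y d1 d2
 proof (rule ext, rule ext)
  fix cc :: "(nat \<times> nat) \<times> nat \<times> nat" and v
  obtain b b' where cc: "cc=(b, b')" by (cases cc)
  obtain \<epsilon> where e: "ALL x d. x:wedge N d-->x b v = \<epsilon> * x (0, 1) v" using \<epsilon> by blast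
  obtain \<epsilon>' where e': "ALL x d. x:wedge N d-->x b' v = \<epsilon>' * x (0, 1) v" using \<epsilon> by blast
  have "x b v = \<epsilon> * x (0, 1) v" "y b v = \<epsilon> * y (0, 1) v" "x b' v = \<epsilon>' * x (0, 1) v" "y b' v = \<epsilon>' * y (0, 1) v"
  using e e' x y by blast+
  then show "wdg x y cc v=0 cc v" by (simp add: wdg_def cc)
 qed
 have "x:{0}" if "x:wedge (wedge N) d" for x
  by (rule spanof_map[OF lin_id fv.subspace_single_0 _ that]) (simp add: z)
 moreover have "0:wedge (wedge N) d" by (rule fv.subspace_0[OF subspace_spanof])
 ultimately show ?thesis by blast
qed

text \<open>The numerical heart: the exponential of the K-polynomial of \<open>N\<close>, suitably centred, is known
  up to order 4, and cannot satisfy the relations imposed by a rank of at most 3.\<close>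

theorem no_low_rank_module:
 fixes n a c r M :: nat
 assumes n: "n >= 4" and a: "a >= 2" and r: "1<=r" "r<=3" and N: "gsub (Suc n) {..<r} N" and lf: "locfree_rank (Suc n) r N"
  and M: "M > 0" and dim: "!!k. fv.dim (N (c + k * a))=M * ((k+n) choose n)" and low: "!!d. d < c==>N d={0}"
 shows False
proof -
 let ?m = "Suc n"
 have m5: "5<=?m" using n by simp
 have fin: "finite {..<r}" by simp
 obtain K where K: "kpoly ?m N K" using kpoly_exists[OF N fin] by blast
 define X where "X=expo K"
 define ta where "ta=(real a-1) / 2"
 \<comment> \<open>The summand with \<open>ta\<close> centres the power of \<open>geo a\<close>, and
   - \<open>c\<close> cancels the monomial z^c produced by \<open>residue_filter\<close>.\<close>
 define t :: complex where "t = of_real (?m * ta - c)"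
 define Y where "Y=X * fps_exp t"
 have rat: "EX p A C. fps_nth Y 0 = of_real p&fps_nth Y 1=0&fps_nth Y 2 = of_real (p * A)&fps_nth Y 3=0 &
  fps_nth Y 4 = of_real (p * C)&p~=0&A~=0&C >= A\<^sup>2 / 2"
 proof (rule centred_solution[of a ?m "real (a * M)"])
  show "a >= 2" "?m > 0" "real (a * M)~=0" using a M by auto
  have Q: "fps_of_poly (K * geo a ^ ?m)=(1-fps_X ^ a) ^ ?m * hs N"
  using K by (simp add: kpoly_def fps_of_poly_mult fps_of_poly_power geo_mult[symmetric] power_mult_distrib mult_ac del: power_Suc)
  have H0: "fps_nth (hs N) d=0" if "d < c" for d using low[OF that] by (simp add: hs_def dim_0)
  have "Abs_fps (%k. fps_nth (hs N) (c + k * a))=fps_const (of_nat M) * Abs_fps (%k. of_nat ((k+n) choose n))"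
  by (rule fps_ext) (simp add: hs_def dim)
  then have R: "(1-fps_X) ^ ?m * Abs_fps (%k. fps_nth (hs N) (c + k * a))=fps_const (of_nat M)"
  using binomial_series[of n] by (simp add: mult.left_commute del: power_Suc)
  have a0: "0<a" using a by simp
  note rp = residue_part[OF a0, of c "hs N" ?m, OF H0, unfolded Q[symmetric] R]
  have "[:1, -1:] ^ ?m dvd K * geo a ^ ?m-monom (of_nat a * of_nat M) c"
  proof (rule residue_filter[OF a0])
  fix d assume d: "d mod a = c mod a"
  show "coeff (K * geo a ^ ?m) d=(if d = c then of_nat M else 0)"
  proof (cases "d < c")
  case True then show ?thesis using rp d by simp
  next
  case False
  then obtain k where k: "d = c + k * a" using d mod_eq_dvd_iff_nat[of c d a] by (metis dvd_def le_add_diff_inverse mult.commute not_less)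
  have "fps_nth (Abs_fps (%k. fps_nth (fps_of_poly (K * geo a ^ ?m)) (c + k * a))) k=fps_nth (fps_const (of_nat M)) k"
  using rp by simp
  then show ?thesis using a0 by (simp add: k)
  qed
  qed
  from expo_dvd[OF this m5, of _ "fps_exp (- of_nat c)"]
  have z: "fps_nth (expo (K * geo a ^ ?m-monom (of_nat a * of_nat M) c) * fps_exp (- of_nat c)) i=0" if "i<5" for i using that by blast
  fix i :: nat assume i: "i<5"
  have e0: "fps_exp (of_nat c) * fps_exp (- of_nat c)=(1 :: complex fps)" by (simp add: fps_exp_add_mult[symmetric])
  have "expo (geo a)=(SUM i<a. fps_exp (of_nat i))" by (simp add: geo_def expo_sum expo_monom)
  also have "... = fps_exp (of_real ta) * (SUM i<a. fps_exp (of_real (real i-ta)))"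
  by (simp add: sum_distrib_left fps_exp_add_mult[symmetric])
  finally have "expo (geo a) ^ ?m=fps_exp (of_real (?m * ta)) * (SUM i<a. fps_exp (of_real (real i-ta))) ^ ?m"
  by (simp add: power_mult_distrib fps_exp_power_mult del: power_Suc)
  moreover have "fps_exp t=fps_exp (of_real (?m * ta)) * fps_exp (- of_nat c)"
  by (simp add: t_def fps_exp_add_mult[symmetric])
  moreover have "(F1 * (F2 * F3)-F4 * F5) * F6=(F1 * (F2 * F6)) * F3-F4 * (F5 * F6)" for F1 F2 F3 F4 F5 F6 :: "complex fps"
  by (simp add: algebra_simps)
  ultimately have "expo (K * geo a ^ ?m-monom (of_nat a * of_nat M) c) * fps_exp (- of_nat c) =
  Y * (SUM i<a. fps_exp (of_real (real i-ta))) ^ ?m-fps_const (of_nat a * of_nat M)"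
  by (simp only: expo_diff expo_mult expo_power expo_monom Y_def X_def e0 mult_1_right)
  with z[OF i] show "fps_nth (Y * (SUM i<a. fps_exp (of_real (real i-(real a-1) / 2))) ^ ?m) i=(if i=0 then of_real (real (a * M)) else 0)"
  unfolding ta_def by (simp del: power_Suc)
 qed
 then obtain p A C where Y: "fps_nth Y 0 = of_real p" "fps_nth Y 1=0" "fps_nth Y 2 = of_real (p * A)" "fps_nth Y 3=0"
  "fps_nth Y 4 = of_real (p * C)" and nz: "p~=0" "A~=0" and C: "C >= A\<^sup>2 / 2" by blast
 have sq: "dil (F * fps_exp u)=dil F * fps_exp (2 * u)" "(F * fps_exp u) * (F * fps_exp u)=F * F * fps_exp (2 * u)" for F u
 proof -
  show "dil (F * fps_exp u)=dil F * fps_exp (2 * u)" by (simp add: dil_mult dil_exp)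
  have "(F * fps_exp u) * (F * fps_exp u)=F * F * (fps_exp u * fps_exp u)" by (simp only: mult_ac)
  also have "fps_exp u * fps_exp u=fps_exp (2 * u)" by (simp only: fps_exp_add_mult[symmetric] mult_2)
  finally show "(F * fps_exp u) * (F * fps_exp u)=F * F * fps_exp (2 * u)" .
 qed
 \<comment> \<open>The relation of \<open>kpoly_wedge\<close> between power series. Centring by u
   for a module means centring by 2u for its exterior square, because squaring and
   \<open>dil\<close> both double the exponent.\<close>
 have wedge_eq: "2 * fps_nth (expo L * fps_exp (2 * u)) i=fps_nth ((expo P * fps_exp u) * (expo P * fps_exp u)-dil (expo P * fps_exp u)) i"
  if "gsub ?m B W" "finite B" "locfree ?m W" "kpoly ?m W P" "kpoly ?m (wedge W) L" "i<5"
  for B :: "'z set" and W P L u i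
 proof -
  have "[:1, -1:] ^ ?m dvd P\<^sup>2-pcompose P [:0, 0, 1:]-2 * L" by (rule kpoly_wedge[OF that(1-5)])
  from expo_dvd[OF this m5 that(6), of "fps_exp (2 * u)"]
  have "fps_nth (expo (P\<^sup>2-pcompose P [:0, 0, 1:]-2 * L) * fps_exp (2 * u)) i=0" .
  also have "expo (P\<^sup>2-pcompose P [:0, 0, 1:]-2 * L) * fps_exp (2 * u) =
  (expo P * fps_exp u) * (expo P * fps_exp u)-dil (expo P * fps_exp u)-(expo L * fps_exp (2 * u)+expo L * fps_exp (2 * u))"
  unfolding sq expo_diff expo_square power2_eq_square mult_2[of L] expo_add expo_mult by (simp only: algebra_simps)
  finally show ?thesis by simp
 qed
 have lfN: "locfree ?m N" by (rule locfree_rank_locfree[OF lf])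
 obtain L where L: "kpoly ?m (wedge N) L" using kpoly_exists[OF gsub_wedge[OF N]] by auto
 have YL: "2 * fps_nth (expo L * fps_exp (2 * t)) i=fps_nth (Y * Y-dil Y) i" if "i<5" for i
  using wedge_eq[OF N fin lfN K L that, of t] by (simp only: Y_def X_def)
 consider "r=1" | "r=2" | "r=3" using r by force
 then show False
 proof cases
  case 1
  have "kpoly ?m (wedge N) 0" by (rule hs_zero, rule wedge_1) (use N 1 in simp)
  then have "L=0" using L by (simp add: kpoly_def)
  then have "fps_nth (Y * Y) i=fps_nth (dil Y) i" if "i<5" for i using YL[OF that] by (simp add: expo_0)
  with no_line[of Y "of_real p" "of_real A"] Y nz show False by simp
 next
  case 2
  have "kpoly ?m (wedge (wedge N)) 0" by (rule hs_zero, rule wedge_wedge_2) (use N 2 in simp)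
  \<comment> \<open>The exterior square of the rank 2 module has exterior square zero; this is the
    relation of \<open>no_rank_3\<close> with \<open>D\<close> = 0.\<close>
  from wedge_eq[OF gsub_wedge[OF N] _ locfree_wedge[OF lfN] L this, of _ "2 * t"]
  have LL: "fps_nth ((expo L * fps_exp (2 * t)) * (expo L * fps_exp (2 * t))-dil (expo L * fps_exp (2 * t))) i=0" if "i<5" for i
  using that by (simp add: expo_0)
  show False
  by (rule no_rank_3[OF Y nz C, of "expo L * fps_exp (2 * t)" 0]) (simp_all only: YL LL mult_zero_right fps_zero_nth, simp_all add: dil_def)
 next
  case 3
  note N3 = N[unfolded 3]
  let ?C = "spanof crs N N"
  let ?D = "spanof ctr N ?C"
  have gC: "gsub ?m {..<3} ?C" by (rule gsub_crs[OF N])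
  have gD: "gsub ?m UNIV ?D" by (rule gsub_ctr[OF N gC])
  have LC: "kpoly ?m ?C L" using kpoly_dims[of ?C "wedge N", OF dim_crs[OF N3]] L by blast
  obtain W where W: "kpoly ?m (wedge ?C) W" using kpoly_exists[OF gsub_wedge[OF gC]] by auto
  obtain E where E: "kpoly ?m ?D E" using kpoly_exists[OF gD] by auto
  have "fv.dim (prodm N ?D d)=fv.dim (wedge ?C d)" for d
  unfolding dim_crs[OF gC, symmetric] crs_crs_spanof[OF N3]
  by (rule dim_dropu[symmetric, OF gsub_findim[OF gsub_prodm[OF N gD]] subspace_spanof]) simp
  then have W': "kpoly ?m (prodm N ?D) W" using kpoly_dims[of "prodm N ?D" "wedge ?C"] W by blast
  have lD: "locfree ?m ?D" by (rule locfree_ctr[OF N3 lf[unfolded 3]])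
  have "[:1, -1:] ^ ?m dvd K * E-W" by (rule kpoly_prod[OF N gD fin _ lfN lD K E W']) simp
  from expo_dvd[OF this m5] have YE: "fps_nth (expo (K * E-W) * fps_exp (4 * t)) i=0" if "i<5" for i using that by blast
  \<comment> \<open>The determinant module consists of scalar functions, which have no exterior
    square. This gives \<open>D\<close> the relation of a line bundle without any statement about
    its rank. The centring 3t is matched by t + 3t = 2 (2t).\<close>
  have "kpoly ?m (wedge ?D) 0" by (rule hs_zero) (rule wedge_unit)
  from wedge_eq[OF gD _ lD E this, of _ "3 * t"]
  have EE: "fps_nth ((expo E * fps_exp (3 * t)) * (expo E * fps_exp (3 * t))) i=fps_nth (dil (expo E * fps_exp (3 * t))) i" if "i<5" for i
  using that by (simp add: expo_0)
  have WW: "2 * fps_nth (expo W * fps_exp (4 * t)) i=fps_nth ((expo L * fps_exp (2 * t)) * (expo L * fps_exp (2 * t))-dil (expo L * fps_exp (2 * t))) i" if "i<5" for i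
  using wedge_eq[OF gC _ locfree_crs[OF N3 lfN] LC W that, of "2 * t"] by simp
  have "fps_exp t * fps_exp (3 * t)=fps_exp (4 * t)" by (simp add: fps_exp_add_mult[symmetric])
  then have "Y * (expo E * fps_exp (3 * t))=expo (K * E) * fps_exp (4 * t)"
  by (simp add: Y_def X_def expo_mult mult_ac)
  then have "fps_nth (Y * (expo E * fps_exp (3 * t))) i=fps_nth (expo W * fps_exp (4 * t)) i" if "i<5" for i
  using YE[OF that] by (simp add: expo_diff left_diff_distrib)
  with WW have YW: "2 * fps_nth (Y * (expo E * fps_exp (3 * t))) i=fps_nth ((expo L * fps_exp (2 * t)) * (expo L * fps_exp (2 * t))-dil (expo L * fps_exp (2 * t))) i" if "i<5" for i
  using that by simp
  show False by (rule no_rank_3[OF Y nz C YL EE YW])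
 qed
qed

section \<open>Projective space seen from its affine cone\<close>

text \<open>Forms of an integer degree; in negative degree only zero is left.\<close>

definition hz :: "nat=>int=>(vec=>complex)=>bool" where
 "hz m k f \<longleftrightarrow> (EX d. int d = k&hform m d f) \<or> f=(%v. 0)"

lemma hz_zero: "hz m k (%v. 0)" by (simp add: hz_def)
lemma hz_hform: "hform m d f==>hz m (int d) f" by (auto simp: hz_def)

lemma hz_int_iff: "hz m (int d) f \<longleftrightarrow> hform m d f"
 by (auto simp: hz_def hform.zero)

lemma hz_add: "hz m k f==>hz m k g==>hz m k (%v. f v+g v)"
 unfolding hz_def by (auto intro: hform.add)

lemma hz_mult: "hz m k f==>hz m l g==>hz m (k+l) (%v. f v * g v)"
 unfolding hz_def by (auto intro: hform_mult) (metis hform_mult of_nat_add)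

lemma hz_mult': "hz m k f==>hz m l g==>j = k+l==>hz m j (%v. f v * g v)"
 using hz_mult by blast

lemma hz_const: "hz m 0 (%v. c)"
 using hz_hform[OF hform.const[of m c]] by simp

lemma hz_sum: "(!!i. i:I==>hz m k (f i))==>hz m k (%v. SUM i:I. f i v)"
 by (induction I rule: infinite_finite_induct) (auto intro: hz_zero hz_add)

lemma hz_cases:
 assumes "hz m k f" obtains d where "int d = k" "hform m d f" | "f=(%v. 0)"
 using assms by (auto simp: hz_def)

text \<open>The cone without its vertex. A form does not see the coordinates beyond
  \<open>n\<close>, whereas a point requires them to be 0; \<open>trunc\<close> mediates between the
  two.\<close>

definition pcone :: "nat=>vec set" where
 "pcone n={v. (ALL i>n. v i=0)&(EX i<=n. v i~=0)}"

definition pt :: "vec=>point" where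
 "pt v={%i. c * v i | c. c~=0}"

lemma proj_space_pt: "proj_space n=pt ` pcone n"
 by (auto simp: proj_space_def pt_def pcone_def image_def)

lemma pt_self: "v:pt v"
proof -
 have "v=(%i. 1 * v i)" by simp
 then show ?thesis unfolding pt_def by (intro CollectI exI[of _ 1]) simp
qed

lemma pt_scale: assumes "c~=0" shows "pt (%i. c * v i)=pt v"
proof -
 have "w:pt v" if "w:pt (%i. c * v i)" for w
  using that assms by (auto simp: pt_def mult.assoc[symmetric])
 moreover have "w:pt (%i. c * v i)" if w: "w:pt v" for w
 proof -
  obtain d where d: "d~=0" "w=(%i. d * v i)" using w unfolding pt_def by blast
  have "w=(%i. (d / c) * (c * v i))" using assms d by (auto simp: fun_eq_iff)
  then show ?thesis unfolding pt_def using d assms by (intro CollectI exI[of _ "d / c"]) simp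
 qed
 ultimately show ?thesis by blast
qed

lemma in_proj:
 assumes "P:proj_space n" "v:P" shows "v:pcone n" "P=pt v"
proof -
 obtain u where u: "u:pcone n" "P=pt u" using assms(1) by (auto simp: proj_space_pt)
 then obtain c where c: "c~=0" "v=(%i. c * u i)" using assms(2) by (auto simp: pt_def)
 show "v:pcone n" using u(1) c by (auto simp: pcone_def)
 show "P=pt v" using u(2) c pt_scale by simp
qed

lemma pt_in: "v:pcone n==>pt v:proj_space n"
 by (auto simp: proj_space_pt)

lemma open_sub: "openin (zariski n) U==>U \<subseteq> proj_space n"
 using openin_subset topspace_zariski by metis

lemma in_Union_iff: "U \<subseteq> proj_space n==>v:\<Union>U \<longleftrightarrow> v:pcone n&pt v:U"
 using in_proj pt_self by blast

definition bas :: "nat=>(vec=>complex)=>point set" where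
 "bas n g={P:proj_space n. ALL v:P. g v~=0}"

lemma pt_in_bas: assumes "hform (Suc n) d g" shows "pt v:bas n g \<longleftrightarrow> pt v:proj_space n&g v~=0"
proof -
 have "g w~=0" if "g v~=0" "w:pt v" for w
  using that hform_homogeneous[OF assms] by (auto simp: pt_def)
 then show ?thesis using pt_self by (auto simp: bas_def)
qed

lemma Union_bas: assumes "hform (Suc n) d g" shows "v:\<Union>(bas n g) \<longleftrightarrow> v:pcone n&g v~=0"
proof -
 have "bas n g \<subseteq> proj_space n" by (auto simp: bas_def)
 then show ?thesis using in_Union_iff pt_in_bas[OF assms] pt_in by metis
qed

lemma open_bas: assumes "hform (Suc n) d g" shows "openin (zariski n) (bas n g)"
 unfolding openin_zariski
proof (intro exI[of _ "{g}"] conjI)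
 show "ALL f:{g}. EX d. form n d f" using assms by (auto simp: form_iff_hform)
 have "P:bas n g \<longleftrightarrow> P~:zero_locus n {g}" if P: "P:proj_space n" for P
 proof -
  obtain v where "P=pt v" using P unfolding proj_space_pt by blast
  then show ?thesis using pt_in_bas[OF assms] P pt_self form_zero_on_point[of n d g P] assms
  by (auto simp: zero_locus_def form_iff_hform)
 qed
 then show "bas n g=proj_space n-zero_locus n {g}" by (auto simp: bas_def)
qed

lemma open_basis:
 assumes "openin (zariski n) W" "P:W" shows "EX d h. hform (Suc n) d h&P:bas n h&bas n h \<subseteq> W"
proof -
 obtain T where T: "ALL f:T. EX d. form n d f" "W=proj_space n-zero_locus n T" using assms(1) by (auto simp: openin_zariski)
 obtain f v where f: "f:T" "v:P" "f v~=0" using assms(2) T(2) by (auto simp: zero_locus_def)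
 obtain d where d: "hform (Suc n) d f" using T(1) f(1) by (auto simp: form_iff_hform)
 have P: "P:proj_space n" using assms(2) T(2) by blast
 have "P:bas n f" using pt_in_bas[OF d, of v] in_proj(2)[OF P f(2)] P f(3) by simp
 moreover have "bas n f \<subseteq> W" unfolding T(2) bas_def zero_locus_def using f(1) proj_space_nonempty by fastforce
 ultimately show ?thesis using d by blast
qed

lemma bas_mult: "bas n (%v. f v * g v)=bas n f \<inter> bas n g"
 by (auto simp: bas_def)

definition trunc :: "nat=>vec=>vec" where "trunc n v=(%i. if i<=n then v i else 0)"

lemma hform_trunc: "hform (Suc n) d f==>f (trunc n v)=f v"
 by (erule hform_cong) (simp add: trunc_def)

lemma trunc_cone: "EX i<Suc n. v i~=0==>trunc n v:pcone n"
 by (auto simp: trunc_def pcone_def less_Suc_eq_le)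

lemma hform_nonzero_pos: assumes "hform m d f" "0<d" "f v~=0" shows "EX i<m. v i~=0"
proof (rule ccontr)
 assume "~?thesis"
 then have "f v=f (%i. 0 * v i)" by (intro hform_cong[OF assms(1)]) auto
 then show False using hform_homogeneous[OF assms(1), of 0 v] assms(2,3) by (simp add: power_0_left)
qed

lemma cone_nonzero: "v:pcone n==>EX i<Suc n. v i~=0"
 by (auto simp: pcone_def less_Suc_eq_le)

text \<open>An open set contains some nonempty basic set, given by a form \<open>h\<close>. The
  product of \<open>F\<close> with \<open>h\<close> and a coordinate vanishes everywhere, and the
  second factor is not identically zero.\<close>

lemma hform_identity:
 assumes F: "hform (Suc n) d F" and W: "openin (zariski n) W" "W~={}" and 0: "!!v. v:\<Union>W==>F v=0"
 shows "F v=0"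
proof -
 obtain P where "P:W" using W(2) by blast
 from open_basis[OF W(1) this] obtain e h where h: "hform (Suc n) e h" "P:bas n h" "bas n h \<subseteq> W" by blast
 obtain p where p: "p:pcone n" "P=pt p" using h(2) by (auto simp: bas_def proj_space_pt)
 have hp: "h p~=0" using h(2) p pt_in_bas[OF h(1)] by simp
 obtain l where l: "l<Suc n" "p l~=0" using cone_nonzero[OF p(1)] by blast
 \<comment> \<open>\<open>h\<close> may be a constant; the extra coordinate ensures that where the
   product is nonzero the vector is not the vertex.\<close>
 have hl: "hform (Suc n) (e+1) (%v. h v * v l)" by (rule hform_mult[OF h(1) hform_var[OF l(1)]])
 show ?thesis
 proof (rule hform_mult_eq_0[OF F hl])
  show "h p * p l~=0" using hp l by simp
  fix v
  show "F v * (h v * v l)=0"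
  proof (cases "v l=0")
  case False
  have "trunc n v:pcone n" using False l by (intro trunc_cone) blast
  then have "h v~=0==>trunc n v:\<Union>(bas n h)" unfolding Union_bas[OF h(1)] by (simp add: hform_trunc[OF h(1)])
  then have "h v~=0==>F (trunc n v)=0" using h(3) 0 by blast
  then show ?thesis by (auto simp: hform_trunc[OF F])
  qed simp
 qed
qed

text \<open>Irreducibility of projective space: a form defining a basic set inside \<open>U\<close>
  would vanish on \<open>V\<close>, hence everywhere.\<close>

lemma open_Int_nonempty:
 assumes "openin (zariski n) U" "openin (zariski n) V" "U~={}" "V~={}" shows "U \<inter> V~={}"
proof
 assume e: "U \<inter> V={}"
 obtain P where "P:U" using assms(3) by blast
 from open_basis[OF assms(1) this] obtain e h where h: "hform (Suc n) e h" "P:bas n h" "bas n h \<subseteq> U" by blast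
 have "h v=0" if "v:\<Union>V" for v
 proof (rule ccontr)
  assume "h v~=0"
  have v: "v:pcone n" "pt v:V" using that in_Union_iff[OF open_sub[OF assms(2)]] by blast+
  then have "pt v:U" using h(3) pt_in_bas[OF h(1)] \<open>h v ~= 0\<close> pt_in by blast
  with v e show False by blast
 qed
 then have "h v=0" for v by (rule hform_identity[OF h(1) assms(2,4)])
 moreover obtain p where "P=pt p" using h(2) unfolding bas_def proj_space_pt by blast
 ultimately show False using h(2) pt_in_bas[OF h(1), of p] by simp
qed

section \<open>Locally regular functions of a given degree\<close>

text \<open>The degree \<open>k\<close> functions on the cone that near \<open>P\<close> are
  fractions of forms. The denominator has natural degree \<open>d\<close>, while the numerator has
  the integer degree \<open>d + k\<close> because \<open>k\<close> may be negative.\<close>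

definition lreg :: "nat=>int=>point=>(vec=>complex)=>bool" where
 "lreg n k P ph \<longleftrightarrow> (EX W d F G. openin (zariski n) W&P:W&hz (Suc n) (int d + k) F&hform (Suc n) d G &
  (ALL Q:W. ALL v:Q. G v~=0&ph v * G v=F v))"

lemma lregI:
 assumes "openin (zariski n) W" "P:W" "hz (Suc n) (int d + k) F" "hform (Suc n) d G"
  "!!Q v. Q:W==>v:Q==>G v~=0&ph v * G v=F v"
 shows "lreg n k P ph"
 unfolding lreg_def using assms by blast

lemma lreg_cong:
 assumes "lreg n k P ph" "openin (zariski n) W" "P:W" "!!v. v:\<Union>W==>ps v=ph v"
 shows "lreg n k P ps"
proof -
 obtain V d F G where *: "openin (zariski n) V" "P:V" "hz (Suc n) (int d + k) F" "hform (Suc n) d G"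
  "!!Q v. Q:V==>v:Q==>G v~=0&ph v * G v=F v" using assms(1) unfolding lreg_def by blast
 show ?thesis
 proof (rule lregI[OF openin_Int[OF *(1) assms(2)] _ *(3,4)])
  show "P:V \<inter> W" using * assms by blast
  fix Q v assume "Q:V \<inter> W" "v:Q"
  then have "v:\<Union>W" by blast
  from assms(4)[OF this] show "G v~=0&ps v * G v=F v" using *(5)[of Q v] \<open>Q:V \<inter> W\<close> \<open>v:Q\<close> by simp
 qed
qed

lemma lreg_hz: assumes "P:proj_space n" "hz (Suc n) k F" shows "lreg n k P F"
 by (rule lregI[where W = "proj_space n" and d = 0 and G = "%_. 1" and F = F])
  (use assms openin_topspace[of "zariski n"] in \<open>auto simp: topspace_zariski intro: hform.const\<close>)

lemma lreg_add: assumes "lreg n k P ph" "lreg n k P ps" shows "lreg n k P (%v. ph v+ps v)"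
proof -
 obtain V d F G where *: "openin (zariski n) V" "P:V" "hz (Suc n) (int d + k) F" "hform (Suc n) d G"
  "!!Q v. Q:V==>v:Q==>G v~=0&ph v * G v=F v" using assms(1) unfolding lreg_def by blast
 obtain V' d' F' G' where **: "openin (zariski n) V'" "P:V'" "hz (Suc n) (int d' + k) F'" "hform (Suc n) d' G'"
  "!!Q v. Q:V'==>v:Q==>G' v~=0&ps v * G' v=F' v" using assms(2) unfolding lreg_def by blast
 show ?thesis
 proof (rule lregI[OF openin_Int[OF *(1) **(1)] _ _ hform_mult[OF *(4) **(4)]])
  show "P:V \<inter> V'" using * ** by blast
  show "hz (Suc n) (int (d+d') + k) (%v. F v * G' v+F' v * G v)"
  by (intro hz_add; rule hz_mult'[OF _ hz_hform]; (rule * **)?) simp_all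
  fix Q v assume "Q:V \<inter> V'" "v:Q"
  then show "G v * G' v~=0&(ph v+ps v) * (G v * G' v)=F v * G' v+F' v * G v"
  using *(5)[of Q v] **(5)[of Q v] by (auto simp: algebra_simps)
 qed
qed

lemma lreg_mult: assumes "lreg n k P ph" "lreg n l P ps" shows "lreg n (k+l) P (%v. ph v * ps v)"
proof -
 obtain V d F G where *: "openin (zariski n) V" "P:V" "hz (Suc n) (int d + k) F" "hform (Suc n) d G"
  "!!Q v. Q:V==>v:Q==>G v~=0&ph v * G v=F v" using assms(1) unfolding lreg_def by blast
 obtain V' d' F' G' where **: "openin (zariski n) V'" "P:V'" "hz (Suc n) (int d'+l) F'" "hform (Suc n) d' G'"
  "!!Q v. Q:V'==>v:Q==>G' v~=0&ps v * G' v=F' v" using assms(2) unfolding lreg_def by blast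
 show ?thesis
 proof (rule lregI[OF openin_Int[OF *(1) **(1)] _ hz_mult'[OF *(3) **(3)] hform_mult[OF *(4) **(4)]])
  show "P:V \<inter> V'" using * ** by blast
  fix Q v assume "Q:V \<inter> V'" "v:Q"
  then have "G v~=0" "G' v~=0" and e: "F v=ph v * G v" "F' v=ps v * G' v" using *(5)[of Q v] **(5)[of Q v] by auto
  then show "G v * G' v~=0&(ph v * ps v) * (G v * G' v)=F v * F' v" unfolding e by simp
 qed simp
qed

lemma lreg_mult': "lreg n k P ph==>lreg n l P ps==>j = k+l==>lreg n j P (%v. ph v * ps v)"
 using lreg_mult by blast

lemma lreg_zero: "P:proj_space n==>lreg n k P (%v. 0)"
 by (rule lreg_hz[OF _ hz_zero])

lemma lreg_scale: "P:proj_space n==>lreg n k P ph==>lreg n k P (%v. c * ph v)"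
 using lreg_mult[OF lreg_hz[OF _ hz_const], of P n k ph c] by simp

lemma lreg_sum: "P:proj_space n==>(!!i. i:I==>lreg n k P (f i))==>lreg n k P (%v. SUM i:I. f i v)"
 by (induction I rule: infinite_finite_induct) (auto intro: lreg_zero lreg_add)

lemma lreg_inverse:
 assumes "P:proj_space n" "hform (Suc n) d g" "P:bas n g" shows "lreg n (- int d) P (%v. 1 / g v)"
 by (rule lregI[OF open_bas[OF assms(2)] assms(3) _ assms(2)], simp, rule hz_const) (simp add: bas_def)

lemma regular_lreg:
 assumes "regular n U f" "P:U" shows "lreg n 0 P (%v. f (pt v))"
proof -
 obtain W d F G where *: "openin (zariski n) W" "P:W" "form n d F" "form n d G" "ALL Q:W. ALL v:Q. G v~=0&f Q=F v / G v"
  using assms unfolding regular_def by metis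
 show ?thesis
 proof (rule lregI[OF *(1,2)])
  show "hform (Suc n) d G" "hz (Suc n) (int d+0) F" using * by (auto simp: form_iff_hform hz_hform)
  fix Q v assume Q: "Q:W" "v:Q"
  then have "Q=pt v" using in_proj(2) open_sub[OF *(1)] by blast
  with * Q show "G v~=0&f (pt v) * G v=F v" by auto
 qed
qed

text \<open>Regular functions of degree \<open>k\<close> on a basic open set are fractions with denominator a power of the
  defining form; this is the graded Nullstellensatz applied to the ideal of denominators.\<close>

theorem lreg_bas:
 assumes g: "hform (Suc n) e g" "0<e" and ph: "!!P. P:bas n g==>lreg n k P ph"
 shows "EX N F. hz (Suc n) (int (N * e) + k) F&(ALL v:\<Union>(bas n g). ph v * g v ^ N=F v)"
proof -
 let ?m = "Suc n"
 define V where "V=(%d. VF ?m (UNIV :: unit set) d)"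
 define U where "U=(%d. {x:V d. EX F. hz ?m (int d + k) F&(ALL v:\<Union>(bas n g). ph v * x () v=F v)})"
 have gV: "gsub ?m UNIV V"
  unfolding gsub_def V_def using subspace_VF smul_VF[OF hform_var] by (metis (no_types, lifting) One_nat_def order_refl plus_1_eq_Suc)
 have gU: "gsub ?m UNIV U"
  unfolding gsub_def
 proof (intro conjI allI impI)
  fix d
  show "U d \<subseteq> VF ?m UNIV d" by (auto simp: U_def V_def)
  show "fv.subspace (U d)"
  unfolding fv.subspace_def
  proof (intro conjI ballI allI)
  show "0:U d" using gsub_0[OF gV] by (auto simp: U_def intro!: exI[of _ "%v. 0"] hz_zero)
  fix x assume "x:U d"
  then obtain F where F: "x:V d" "hz ?m (int d + k) F" "ALL v:\<Union>(bas n g). ph v * x () v=F v" by (auto simp: U_def)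
  show "scl c x:U d" for c
  unfolding U_def using gsub_scl[OF gV F(1), of c] hz_mult[OF hz_const[of ?m c] F(2)] F(3)
  by (intro CollectI conjI exI[of _ "%v. c * F v"]) (auto simp: scl_def algebra_simps)
  fix y assume "y:U d"
  then obtain F' where F': "y:V d" "hz ?m (int d + k) F'" "ALL v:\<Union>(bas n g). ph v * y () v=F' v" by (auto simp: U_def)
  show "x+y:U d"
  unfolding U_def using gsub_add[OF gV F(1) F'(1)] hz_add[OF F(2) F'(2)] F(3) F'(3)
  by (intro CollectI conjI exI[of _ "%v. F v+F' v"]) (auto simp: algebra_simps)
  qed
 next
  fix d i x assume i: "i<?m" and "x:U d"
  then obtain F where F: "x:V d" "hz ?m (int d + k) F" "ALL v:\<Union>(bas n g). ph v * x () v=F v" by (auto simp: U_def)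
  show "smul (%v. v i) x:U (Suc d)"
  unfolding U_def using gsub_var[OF gV i F(1)] hz_mult'[OF hz_hform[OF hform_var[OF i]] F(2), of "int (Suc d) + k"] F(3)
  by (intro CollectI conjI exI[of _ "%v. v i * F v"]) (auto simp: smul_def algebra_simps)
 qed
 have loc: "EX d f. hform ?m d f&f p~=0&kills d f V U" if p: "g p~=0" for p
 proof -
  have tp: "trunc n p:pcone n" using hform_nonzero_pos[OF g p] trunc_cone by blast
  have P: "pt (trunc n p):bas n g" using pt_in_bas[OF g(1)] pt_in[OF tp] p hform_trunc[OF g(1)] by simp
  obtain W d F G where W: "openin (zariski n) W" "pt (trunc n p):W" "hz ?m (int d + k) F" "hform ?m d G"
  "!!Q v. Q:W==>v:Q==>G v~=0&ph v * G v=F v" using ph[OF P] unfolding lreg_def by blast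
  obtain e' h where h: "hform ?m e' h" "pt (trunc n p):bas n h" "bas n h \<subseteq> W" using open_basis[OF W(1,2)] by blast
  have hp: "h p~=0" using h(2) pt_in_bas[OF h(1)] hform_trunc[OF h(1)] by simp
  have Gp: "G p~=0" using W(5)[OF W(2) pt_self] hform_trunc[OF W(4)] by simp
  have eq: "ph v * (h v * G v)=h v * F v" if "v:\<Union>(bas n g)" for v
  proof (cases "h v=0")
  case False
  have "v:pcone n" using that Union_bas[OF g(1)] by blast
  then have "v:\<Union>(bas n h)" using False Union_bas[OF h(1)] by blast
  then show ?thesis using W(5) h(3) by fastforce
  qed simp
  have "kills (e'+d) (%v. h v * G v) V U"
  unfolding kills_def
  proof (intro allI ballI)
  fix c x assume x: "x:V c"
  have hx: "hform ?m c (x ())" using x by (auto simp: V_def VF_def)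
  have "smul (%v. h v * G v) x:V (e'+d + c)" by (rule gsub_smul[OF gV hform_mult[OF h(1) W(4)] x])
  moreover have "hz ?m (int (e'+d + c) + k) (%v. (h v * F v) * x () v)"
  by (rule hz_mult'[OF hz_mult[OF hz_hform[OF h(1)] W(3)] hz_hform[OF hx]]) simp
  ultimately show "smul (%v. h v * G v) x:U (e'+d + c)"
  unfolding U_def using eq
  by (intro CollectI conjI exI[of _ "%v. (h v * F v) * x () v"]) (auto simp: smul_def mult.assoc[symmetric])
  qed
  with hp Gp show ?thesis by (intro exI[of _ "e'+d"] exI[of _ "%v. h v * G v"] conjI hform_mult[OF h(1) W(4)]) auto
 qed
 have UV: "U d \<subseteq> V d" for d by (auto simp: U_def)
 have "EX N. kills (N * e) (%v. g v ^ N) V U"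
  by (rule graded_nullstellensatz[OF _ gU gV UV g]; (rule loc)?) simp_all
 then obtain N where N: "kills (N * e) (%v. g v ^ N) V U" by blast
 have "(%_ _. 1):V 0" by (auto simp: V_def VF_def intro: hform.const)
 with N have "smul (%v. g v ^ N) (%_ _. 1):U (N * e+0)" unfolding kills_def by blast
 then show ?thesis by (auto simp: U_def smul_def)
qed

section \<open>Powers of linear forms are a regular sequence\<close>

lemma hform_expand_var:
 assumes "hform m d f"
 shows "EX c. (ALL k<=d. hform m (d - k) (c k))&(ALL k v t. c k (v(j := t)) = c k v)&(ALL v. f v=(SUM k<=d. c k v * v j ^ k))"
 using assms
proof (induction rule: hform.induct)
 case (zero d)
 show ?case by (rule exI[of _ "%k v. 0"]) (auto intro: hform.zero)
next
 case (const c)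
 show ?case by (rule exI[of _ "%k v. c"]) (auto intro: hform.const)
next
 case (mult_var d f i)
 then obtain c where c: "!!k. k<=d==>hform m (d - k) (c k)" "!!k v t. c k (v(j := t)) = c k v" "!!v. f v=(SUM k<=d. c k v * v j ^ k)" by blast
 show ?case
 proof (cases "i=j")
  case True
  let ?c = "%k v. case k of 0=>0 | Suc k=>c k v"
  have "hform m (Suc d - k) (?c k)" if "k<=Suc d" for k using that c(1) by (cases k) (auto intro: hform.zero)
  moreover have "?c k (v(j := t))=?c k v" for k v t using c(2) by (cases k) simp_all
  moreover have "v i * f v=(SUM k<=Suc d. ?c k v * v j ^ k)" for v
  unfolding sum.atMost_Suc_shift c(3) by (simp add: True sum_distrib_left algebra_simps)
  ultimately show ?thesis by (intro exI[of _ ?c]) blast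
 next
  case False
  let ?c = "%k v. if k<=d then v i * c k v else 0"
  have "hform m (Suc d - k) (?c k)" if "k<=Suc d" for k
  proof (cases "k<=d")
  case True
  then show ?thesis using hform.mult_var[OF c(1)[OF True] mult_var.hyps(2)] by (simp add: Suc_diff_le)
  qed (simp add: hform.zero)
  moreover have "?c k (v(j := t))=?c k v" for k v t using c(2) False by simp
  moreover have "v i * f v=(SUM k<=Suc d. ?c k v * v j ^ k)" for v
  by (simp add: c(3) sum_distrib_left mult.assoc)
  ultimately show ?thesis by (intro exI[of _ ?c]) blast
 qed
next
 case (add d f g)
 then obtain c c' where c: "!!k. k<=d==>hform m (d - k) (c k)" "!!k v t. c k (v(j := t)) = c k v" "!!v. f v=(SUM k<=d. c k v * v j ^ k)"
  and c': "!!k. k<=d==>hform m (d - k) (c' k)" "!!k v t. c' k (v(j := t)) = c' k v" "!!v. g v=(SUM k<=d. c' k v * v j ^ k)" by blast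
 show ?case
 proof (intro exI[of _ "%k v. c k v + c' k v"] conjI allI impI)
  show "hform m (d - k) (%v. c k v + c' k v)" if "k<=d" for k by (rule hform.add[OF c(1)[OF that] c'(1)[OF that]])
  show "c k (v(j := t)) + c' k (v(j := t)) = c k v + c' k v" for k v t by (simp only: c(2) c'(2))
  show "f v+g v=(SUM k<=d. (c k v + c' k v) * v j ^ k)" for v by (simp add: c(3) c'(3) sum.distrib distrib_right)
 qed
qed

text \<open>Compare coefficients of powers of v j. As j is not in \<open>J\<close>, the coefficient
  of \<open>F\<close> at k is expressed through those of the \<open>G i\<close> at
  \<open>k + a\<close>, so dividing the relevant part of each \<open>G i\<close> by the
  \<open>a\<close>-th power of v j gives the \<open>H i\<close>.\<close>

lemma coordinate_powers_regular:
 assumes j: "j~:J" "j<m" and F: "hz m K F" "!!i. i:J==>hz m K (G i)"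
  and eq: "!!v. v j ^ a * F v=(SUM i:J. v i ^ a * G i v)"
 shows "EX H. (ALL i:J. hz m (K-int a) (H i))&(ALL v. F v=(SUM i:J. v i ^ a * H i v))"
 using F(1)
proof (cases rule: hz_cases)
 case 2
 then show ?thesis by (intro exI[of _ "%i v. 0"]) (auto intro: hz_zero)
next
 case (1 d)
 obtain c where c: "!!k. k<=d==>hform m (d - k) (c k)" "!!k v t. c k (v(j := t)) = c k v" "!!v. F v=(SUM k<=d. c k v * v j ^ k)"
  using hform_expand_var[OF 1(2), of j] by blast
 have "ALL i:J. EX c. (ALL k<=d. hform m (d - k) (c k))&(ALL k v t. c k (v(j := t)) = c k v)&(ALL v. G i v=(SUM k<=d. c k v * v j ^ k))"
  using F(2) hform_expand_var 1(1) hz_int_iff by blast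
 from bchoice[OF this] obtain e where e: "!!i k. i:J==>k<=d==>hform m (d - k) (e i k)"
  "!!i k v t. i:J==>e i k (v(j := t))=e i k v" "!!i v. i:J==>G i v=(SUM k<=d. e i k v * v j ^ k)" by blast
 define A where "A={k. k+a<=d}"
 have key: "c k v=(if k:A then SUM i:J. v i ^ a * e i (k+a) v else 0)" if k: "k<=d" for k v
 proof -
  define L where "L=(%s. if a <= s then c (s-a) v else 0)"
  define R where "R=(%s. if s<=d then SUM i:J. v i ^ a * e i s v else 0)"
  have "(SUM s<=d+a. L s * t ^ s)=(SUM s<=d+a. R s * t ^ s)" for t
  proof -
  let ?v = "v(j := t)"
  have "(SUM s<=d+a. L s * t ^ s)=(SUM s:{0+a..d+a}. L s * t ^ s)"
  by (rule sum.mono_neutral_right) (auto simp: L_def)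
  also have "... = (SUM k<=d. c k v * t ^ (k+a))"
  unfolding sum.shift_bounds_cl_nat_ivl by (simp add: L_def atLeast0AtMost)
  also have "... = ?v j ^ a * F ?v"
  by (simp add: c(2,3) sum_distrib_left power_add mult_ac)
  also have "... = (SUM i:J. ?v i ^ a * G i ?v)" by (rule eq)
  also have "... = (SUM i:J. SUM s<=d. v i ^ a * e i s v * t ^ s)"
  using j by (intro sum.cong refl) (auto simp: e(2,3) sum_distrib_left mult.assoc)
  also have "... = (SUM s<=d. R s * t ^ s)"
  by (subst sum.swap) (simp add: R_def sum_distrib_right)
  also have "... = (SUM s<=d+a. R s * t ^ s)"
  by (rule sum.mono_neutral_left) (auto simp: R_def)
  finally show ?thesis .
  qed
  then have "ALL s<=d+a. L s=R s" using polyfun_eq_coeffs[of L "d+a" R] by blast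
  then have "L (k+a)=R (k+a)" using k by simp
  then show ?thesis by (simp add: L_def R_def A_def)
 qed
 have finA: "finite A" "A \<subseteq> {..d}" by (auto simp: A_def intro: finite_subset[of _ "{..d}"])
 let ?H = "%i v. SUM k:A. e i (k+a) v * v j ^ k"
 have "hz m (K-int a) (?H i)" if i: "i:J" for i
 proof (rule hz_sum)
  fix k assume "k:A"
  then have k: "k+a<=d" by (simp add: A_def)
  show "hz m (K-int a) (%v. e i (k+a) v * v j ^ k)"
  proof -
  have "hform m (d-(k+a) + k * 1) (%v. e i (k+a) v * v j ^ k)"
  by (rule hform_mult[OF e(1)[OF i k] hform_power[OF hform_var[OF j(2)]]])
  then have "hz m (int (d-(k+a) + k * 1)) (%v. e i (k+a) v * v j ^ k)" by (rule hz_hform)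
  then show ?thesis using k 1(1) by (simp add: of_nat_diff)
  qed
 qed
 moreover have "F v=(SUM i:J. v i ^ a * ?H i v)" for v
 proof -
  have "F v=(SUM k:A. (SUM i:J. v i ^ a * e i (k+a) v) * v j ^ k)"
  unfolding c(3) using finA by (intro sum.mono_neutral_cong_right) (auto simp: key)
  also have "... = (SUM i:J. v i ^ a * ?H i v)"
  by (simp add: sum_distrib_left sum_distrib_right mult.assoc) (rule sum.swap)
  finally show ?thesis .
 qed
 ultimately show ?thesis by (intro exI[of _ ?H]) blast
qed

text \<open>A linear change of coordinates that carries the point with v i = c i * v l for all i
  other than \<open>l\<close> to a coordinate point; negating \<open>c\<close> inverts it.\<close>

definition shear :: "nat=>(nat=>complex)=>vec=>vec" where
 "shear l c v=(%i. if i=l then v l else v i - c i * v l)"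

lemma shear_shear: "shear l c (shear l (%i. - c i) v) = v" "shear l (%i. - c i) (shear l c v) = v"
 by (auto simp: shear_def fun_eq_iff)

lemma hform_shear: assumes "l<m" "i<m" shows "hform m 1 (%v. shear l c v i)"
 using hform_var[OF assms(1)] hform_diff[OF hform_var[OF assms(2)] hform_scale[OF hform_var[OF assms(1)], of "c i"]]
 by (cases "i=l") (simp_all add: shear_def)

lemma hz_shear: assumes "l<m" "hz m k f" shows "hz m k (%v. f (shear l c v))"
 using assms(2)
proof (cases rule: hz_cases)
 case (1 d)
 then show ?thesis using hz_hform[OF hform_compose[OF 1(2) hform_shear[OF assms(1)]]] by simp
qed (simp add: hz_zero)

lemma sheared_powers_regular:
 assumes l: "l<m" and j: "j~:J" "j<m" and F: "hz m K F" "!!i. i:J==>hz m K (G i)"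
  and eq: "!!v. shear l c v j ^ a * F v=(SUM i:J. shear l c v i ^ a * G i v)"
 shows "EX H. (ALL i:J. hz m (K-int a) (H i))&(ALL v. F v=(SUM i:J. shear l c v i ^ a * H i v))"
proof -
 let ?B = "shear l (%i. - c i)"
 have "EX H. (ALL i:J. hz m (K-int a) (H i))&(ALL v. F (?B v)=(SUM i:J. v i ^ a * H i v))"
  by (rule coordinate_powers_regular[where G = "%i v. G i (?B v)" and F = "%v. F (?B v)"])
  (use j F eq[of "?B _"] hz_shear[OF l] in \<open>simp_all add: shear_shear\<close>)
 then obtain H where H: "!!i. i:J==>hz m (K-int a) (H i)" "!!v. F (?B v)=(SUM i:J. v i ^ a * H i v)" by blast
 have "F v=(SUM i:J. shear l c v i ^ a * H i (shear l c v))" for v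
  using H(2)[of "shear l c v"] by (simp add: shear_shear)
 then show ?thesis using hz_shear[OF l H(1)] by (intro exI[of _ "%i v. H i (shear l c v)"]) blast
qed

lemma lreg_bas_uniform:
 assumes g: "hform (Suc n) e g" "0<e" and X: "finite X" and ph: "!!x P. x:X==>P:bas n g==>lreg n k P (ph x)"
 shows "EX N F. ALL x:X. hz (Suc n) (int (N * e) + k) (F x)&(ALL v:\<Union>(bas n g). ph x v * g v ^ N=F x v)"
proof -
 have "ALL x:X. EX N F. hz (Suc n) (int (N * e) + k) F&(ALL v:\<Union>(bas n g). ph x v * g v ^ N=F v)"
  by (rule ballI, rule lreg_bas[OF g]) (rule ph)
 from bchoice[OF this] obtain N where "ALL x:X. EX F. hz (Suc n) (int (N x * e) + k) F&(ALL v:\<Union>(bas n g). ph x v * g v ^ N x=F v)" by (elim exE)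
 from bchoice[OF this] obtain F where FF: "ALL x:X. hz (Suc n) (int (N x * e) + k) (F x)&(ALL v:\<Union>(bas n g). ph x v * g v ^ N x=F x v)" by (elim exE)
 have F: "hz (Suc n) (int (N x * e) + k) (F x)" if "x:X" for x by (rule conjunct1[OF bspec[OF FF that]])
 have F2: "ph x v * g v ^ N x=F x v" if "x:X" "v:\<Union>(bas n g)" for x v
  by (rule bspec[OF conjunct2[OF bspec[OF FF that(1)]] that(2)])
 let ?N = "SUM x:X. N x"
 show ?thesis
 proof (intro exI[of _ ?N] exI[of _ "%x v. F x v * g v ^ (?N-N x)"] ballI conjI)
  fix x assume x: "x:X"
  have le: "N x<=?N" using x X by (intro member_le_sum) auto
  have "int ((?N-N x) * e)=int (?N * e)-int (N x * e)" using le by (simp add: diff_mult_distrib of_nat_diff)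
  then have "int (?N * e) + k=int (N x * e) + k+int ((?N-N x) * e)" by linarith
  then show "hz (Suc n) (int (?N * e) + k) (%v. F x v * g v ^ (?N-N x))"
  by (rule hz_mult'[OF F[OF x] hz_hform[OF hform_power[OF g(1)]]])
  fix v assume "v:\<Union>(bas n g)"
  from F2[OF x this] have "ph x v * g v ^ ?N=ph x v * (g v ^ N x * g v ^ (?N-N x))"
  using le by (simp only: power_add[symmetric] le_add_diff_inverse)
  then show "ph x v * g v ^ ?N=F x v * g v ^ (?N-N x)"
  using \<open>ph x v * g v ^ N x = F x v\<close> by (simp only: mult.assoc[symmetric])
 qed
qed

section \<open>Sections of twisted bundles as functions on the cone\<close>

definition rs :: "point set=>'b vf=>'b vf" where
 "rs V sg=(%x v. if v:\<Union>V then sg x v else 0)"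

lemma rs_rs: "V \<subseteq> W==>rs V (rs W sg)=rs V sg"
 by (auto simp: rs_def fun_eq_iff)

lemma lin_rs: "lin (rs V)"
 by (rule linI) (auto simp: rs_def scl_def fun_eq_iff)

lemma rs_smul: "rs V (smul f sg) = smul f (rs V sg)"
 by (auto simp: rs_def smul_def fun_eq_iff)

locale algebraic_bundle =
 fixes n :: nat and E :: "'i vbundle"
 assumes vb: "vector_bundle n E"
begin

abbreviation "rk \<equiv> bundle_rank E"

lemma chart_open: "i:charts E==>openin (zariski n) (chart E i)"
 and chart_cover: "P:proj_space n==>EX i:charts E. P:chart E i"
 using vb unfolding vector_bundle_def by blast+

lemma transition_lreg:
 assumes "i:charts E" "j:charts E" "b<rk" "c<rk" "P:chart E i \<inter> chart E j"
 shows "lreg n 0 P (%v. transition E i j (pt v) b c)"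
 using vb assms regular_lreg unfolding vector_bundle_def by blast

lemma transition_self: "i:charts E==>P:chart E i==>b<rk==>c<rk==>transition E i i P b c=(if b = c then 1 else 0)"
 using vb unfolding vector_bundle_def by blast

lemma transition_cocycle:
 assumes "i:charts E" "j:charts E" "k:charts E" "P:chart E i \<inter> chart E j \<inter> chart E k" "b<rk" "c<rk"
 shows "transition E i k P b c=(SUM d<rk. transition E i j P b d * transition E j k P d c)"
 using vb assms unfolding vector_bundle_def by blast

text \<open>Sections of E(k). The twist is absorbed by letting local coordinates be functions of
  degree \<open>k\<close> on the cone, so multiplication by forms is pointwise and needs no charts
  of O(k). Irrelevant values are zero, so sections are equal iff they are equal as
  functions.\<close>

definition Sec :: "int=>point set=>('i \<times> nat=>vec=>complex) set" where
 "Sec k U={sg. (ALL i:charts E. ALL b<rk. ALL P:U \<inter> chart E i. lreg n k P (sg (i, b))) &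
  (ALL i:charts E. ALL j:charts E. ALL P:U \<inter> chart E i \<inter> chart E j. ALL v:P. ALL b<rk.
  sg (i, b) v=(SUM c<rk. transition E i j P b c * sg (j, c) v)) &
  (ALL i b v. ~(i:charts E&b<rk&v:\<Union>(U \<inter> chart E i))-->sg (i, b) v=0)}"

lemma SecI:
 assumes "!!i b P. i:charts E==>b<rk==>P:U==>P:chart E i==>lreg n k P (sg (i, b))"
  "!!i j P v b. i:charts E==>j:charts E==>P:U==>P:chart E i==>P:chart E j==>v:P==>b<rk ==>
  sg (i, b) v=(SUM c<rk. transition E i j P b c * sg (j, c) v)"
  "!!i b v. ~(i:charts E&b<rk&v:\<Union>(U \<inter> chart E i))==>sg (i, b) v=0"
 shows "sg : Sec k U"
 unfolding Sec_def using assms by blast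

lemma SecD:
 assumes "sg : Sec k U"
 shows "i:charts E==>b<rk==>P:U==>P:chart E i==>lreg n k P (sg (i, b))"
  "i:charts E==>j:charts E==>P:U==>P:chart E i==>P:chart E j==>v:P==>b<rk ==>
  sg (i, b) v=(SUM c<rk. transition E i j P b c * sg (j, c) v)"
  "~(i:charts E&b<rk&v:\<Union>(U \<inter> chart E i))==>sg (i, b) v=0"
 using assms unfolding Sec_def by blast+

lemma subspace_Sec: assumes U: "openin (zariski n) U" shows "fv.subspace (Sec k U)"
 unfolding fv.subspace_def
proof (intro conjI ballI allI)
 have P: "P:proj_space n" if "P:U" for P using that open_sub[OF U] by blast
 show "0:Sec k U" by (rule SecI) (simp_all add: zero_fun_def lreg_zero P)
 fix sg assume sg: "sg : Sec k U"
 show "scl c sg : Sec k U" for c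
 proof (rule SecI)
  fix i j P v b assume "i:charts E" "j:charts E" "P:U" "P:chart E i" "P:chart E j" "v:P" "b<rk"
  from SecD(2)[OF sg this] show "scl c sg (i, b) v=(SUM d<rk. transition E i j P b d * scl c sg (j, d) v)"
  by (simp add: scl_def sum_distrib_left mult_ac)
 next
  fix i b P' assume *: "i:charts E" "b<rk" "P':U" "P':chart E i"
  show "lreg n k P' (scl c sg (i, b))"
  unfolding scl_def by (rule lreg_scale[OF P[OF *(3)] SecD(1)[OF sg *]])
 next
  fix i b v assume "~(i:charts E&b<rk&v:\<Union>(U \<inter> chart E i))"
  from SecD(3)[OF sg this] show "scl c sg (i, b) v=0" by (simp add: scl_def)
 qed
 fix ta assume ta: "ta : Sec k U"
 show "sg+ta : Sec k U"
 proof (rule SecI)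
  fix i j P v b assume *: "i:charts E" "j:charts E" "P:U" "P:chart E i" "P:chart E j" "v:P" "b<rk"
  show "(sg+ta) (i, b) v=(SUM d<rk. transition E i j P b d * (sg+ta) (j, d) v)"
  using SecD(2)[OF sg *] SecD(2)[OF ta *] by (simp add: sum.distrib algebra_simps)
 next
  fix i b P assume *: "i:charts E" "b<rk" "P:U" "P:chart E i"
  show "lreg n k P ((sg+ta) (i, b))"
  unfolding plus_fun_def by (rule lreg_add[OF SecD(1)[OF sg *] SecD(1)[OF ta *]])
 next
  fix i b v assume "~(i:charts E&b<rk&v:\<Union>(U \<inter> chart E i))"
  from SecD(3)[OF sg this] SecD(3)[OF ta this] show "(sg+ta) (i, b) v=0" by simp
 qed
qed

lemma Sec_mult:
 assumes sg: "sg : Sec k U" and ps: "!!P. P:U==>lreg n l P ps" and j: "j = k+l" shows "smul ps sg : Sec j U"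
proof (rule SecI)
 fix i j P v b assume *: "i:charts E" "j:charts E" "P:U" "P:chart E i" "P:chart E j" "v:P" "b<rk"
 show "smul ps sg (i, b) v=(SUM d<rk. transition E i j P b d * smul ps sg (j, d) v)"
  using SecD(2)[OF sg *] by (simp add: smul_def sum_distrib_left mult_ac)
next
 fix i b P assume *: "i:charts E" "b<rk" "P:U" "P:chart E i"
 show "lreg n j P (smul ps sg (i, b))" unfolding smul_def
  by (rule lreg_mult'[OF ps[OF *(3)] SecD(1)[OF sg *]]) (simp add: j)
next
 fix i b v assume "~(i:charts E&b<rk&v:\<Union>(U \<inter> chart E i))"
 from SecD(3)[OF sg this] show "smul ps sg (i, b) v=0" by (simp add: smul_def)
qed

lemma Sec_smul: "openin (zariski n) U==>hform (Suc n) e f==>sg : Sec k U==>j = k+int e==>smul f sg : Sec j U"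
 by (rule Sec_mult, assumption, rule lreg_hz[OF _ hz_hform]) (use open_sub in blast)+

lemma Sec_rs:
 assumes V: "openin (zariski n) V" "V \<subseteq> U" and sg: "sg : Sec k U" shows "rs V sg : Sec k V"
proof (rule SecI)
 fix i b P assume *: "i:charts E" "b<rk" "P:V" "P:chart E i"
 have "lreg n k P (sg (i, b))" by (rule SecD(1)[OF sg]) (use * V in auto)
 then show "lreg n k P (rs V sg (i, b))" by (rule lreg_cong[OF _ V(1) *(3)]) (auto simp: rs_def)
next
 fix i j P v b assume *: "i:charts E" "j:charts E" "P:V" "P:chart E i" "P:chart E j" "v:P" "b<rk"
 have "v:\<Union>V" using * by blast
 then show "rs V sg (i, b) v=(SUM c<rk. transition E i j P b c * rs V sg (j, c) v)"
  using SecD(2)[OF sg *(1,2) _ *(4-7)] V *(3) by (auto simp: rs_def)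
next
 fix i b v assume *: "~(i:charts E&b<rk&v:\<Union>(V \<inter> chart E i))"
 show "rs V sg (i, b) v=0"
 proof (cases "i:charts E&b<rk&v:\<Union>(U \<inter> chart E i)")
  case True
  then obtain Q where Q: "Q:chart E i" "v:Q" by blast
  have "v~:\<Union>V"
  proof
  assume "v:\<Union>V"
  then obtain P where P: "P:V" "v:P" by blast
  have "P=pt v" "Q=pt v" using in_proj(2) P Q open_sub[OF V(1)] open_sub[OF chart_open] True by blast+
  with * True P Q show False by blast
  qed
  then show ?thesis by (simp add: rs_def)
 next
  case False then show ?thesis using SecD(3)[OF sg] by (simp add: rs_def)
 qed
qed

lemma rs_Sec: assumes "sg : Sec k U" "U \<subseteq> V" shows "rs V sg = sg"
proof (rule ext, rule ext)
 fix x :: "'i \<times> nat" and v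
 obtain i b where x: "x=(i, b)" by (cases x)
 show "rs V sg x v = sg x v" using SecD(3)[OF assms(1), of i b v] assms(2) by (auto simp: rs_def x)
qed

lemma Sec_eqI:
 assumes sg: "sg : Sec k U" and ta: "ta : Sec l U" and i: "i:charts E" "U \<subseteq> chart E i" and U: "openin (zariski n) U"
  and eq: "!!b v. b<rk==>v:\<Union>U==>sg (i, b) v=ta (i, b) v"
 shows "sg=ta"
proof (rule ext, rule ext)
 fix x :: "'i \<times> nat" and v
 obtain j b where x: "x=(j, b)" by (cases x)
 show "sg x v=ta x v"
 proof (cases "j:charts E&b<rk&v:\<Union>(U \<inter> chart E j)")
  case True
  then obtain P where P: "P:U" "P:chart E j" "v:P" by blast
  have "sg (i, c) v=ta (i, c) v" if "c<rk" for c using eq[OF that] P by blast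
  then show ?thesis
  using SecD(2)[OF sg, of j i P v b] SecD(2)[OF ta, of j i P v b] True i P unfolding x by (auto intro!: sum.cong)
 qed (simp add: x SecD(3)[OF sg] SecD(3)[OF ta])
qed

lemma Sec_mk:
 assumes i: "i:charts E" "U \<subseteq> chart E i" and U: "openin (zariski n) U"
  and ph: "!!b P. b<rk==>P:U==>lreg n k P (ph b)"
 shows "EX sg:Sec k U. ALL b<rk. ALL v:\<Union>U. sg (i, b) v=ph b v"
proof -
 define sg where "sg=(%(j, b) v. if j:charts E&b<rk&v:\<Union>(U \<inter> chart E j) then SUM c<rk. transition E j i (pt v) b c * ph c v else 0)"
 have sg: "sg (j, b) v=(SUM c<rk. transition E j i P b c * ph c v)"
  if "j:charts E" "b<rk" "P:U" "P:chart E j" "v:P" for j b P v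
 proof -
  have "P=pt v" using that in_proj(2) open_sub[OF U] by blast
  moreover have "v:\<Union>(U \<inter> chart E j)" using that by blast
  ultimately show ?thesis using that by (simp add: sg_def)
 qed
 have "sg : Sec k U"
 proof (rule SecI)
  fix j b P assume *: "j:charts E" "b<rk" "P:U" "P:chart E j"
  have Pi: "P:chart E i" and Pp: "P:proj_space n" using * i open_sub[OF U] by blast+
  have "lreg n k P (%v. SUM c<rk. transition E j i (pt v) b c * ph c v)"
  by (rule lreg_sum[OF Pp], rule lreg_mult'[OF transition_lreg ph]) (use * Pi i in auto)
  then show "lreg n k P (sg (j, b))"
  proof (rule lreg_cong[OF _ openin_Int[OF U chart_open[OF *(1)]]])
  show "P:U \<inter> chart E j" using * by blast
  fix v assume "v:\<Union>(U \<inter> chart E j)"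
  then show "sg (j, b) v=(SUM c<rk. transition E j i (pt v) b c * ph c v)" using * by (simp add: sg_def)
  qed
 next
  fix j j' P v b assume *: "j:charts E" "j':charts E" "P:U" "P:chart E j" "P:chart E j'" "v:P" "b<rk"
  have Pi: "P:chart E i" using * i by blast
  have "sg (j, b) v=(SUM c<rk. (SUM d<rk. transition E j j' P b d * transition E j' i P d c) * ph c v)"
  unfolding sg[OF *(1,7,3,4,6)] by (intro sum.cong refl) (subst transition_cocycle[OF *(1,2) i(1)]; use * Pi in simp)
  also have "... = (SUM d<rk. transition E j j' P b d * (SUM c<rk. transition E j' i P d c * ph c v))"
  unfolding sum_distrib_right sum_distrib_left by (subst sum.swap) (simp add: mult.assoc)
  also have "... = (SUM c<rk. transition E j j' P b c * sg (j', c) v)"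
  by (intro sum.cong refl) (use sg[OF *(2) _ *(3,5,6)] in simp)
  finally show "sg (j, b) v=(SUM c<rk. transition E j j' P b c * sg (j', c) v)" .
 qed (simp only: sg_def split_conv if_False)
 moreover have "sg (i, b) v=ph b v" if b: "b<rk" and v: "v:\<Union>U" for b v
 proof -
  obtain P where P: "P:U" "v:P" using v by blast
  have "sg (i, b) v=(SUM c<rk. (if b = c then 1 else 0) * ph c v)"
  unfolding sg[OF i(1) b P(1) subsetD[OF i(2) P(1)] P(2)]
  by (intro sum.cong refl) (use transition_self[OF i(1) subsetD[OF i(2) P(1)] b] in simp)
  then show ?thesis using b by (simp add: sum.delta if_distrib[of "%x. x * _"] cong: if_cong)
 qed
 ultimately show ?thesis by blast
qed

lemma Sec_divide:
 assumes f: "hform (Suc n) e f" "U \<subseteq> bas n f" and sg: "sg : Sec k U"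
 shows "EX ta:Sec (k-int e) U. smul f ta = sg"
proof (intro bexI)
 show "smul (%v. 1 / f v) sg : Sec (k-int e) U"
  by (rule Sec_mult[OF sg lreg_inverse[OF _ f(1)]]) (use f(2) in \<open>auto simp: bas_def\<close>)
 show "smul f (smul (%v. 1 / f v) sg) = sg"
 proof (rule ext, rule ext)
  fix x :: "'i \<times> nat" and v
  obtain i b where x: "x=(i, b)" by (cases x)
  show "smul f (smul (%v. 1 / f v) sg) x v = sg x v"
  using SecD(3)[OF sg, of i b v] f(2) by (cases "f v=0") (auto simp: smul_def x bas_def)
 qed
qed

lemma Sec_glue:
 assumes cov: "!!U. U:\<U> ==> openin (zariski n) U" "\<Union>\<U> = proj_space n" and c: "!!U. U:\<U> ==> c U:Sec k U"
  and eq: "!!U V. U:\<U> ==> V:\<U> ==> rs (U \<inter> V) (c U)=rs (U \<inter> V) (c V)"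
 shows "EX s:Sec k (proj_space n). ALL U:\<U>. rs U s = c U"
proof -
 define s where "s=(%x v. if v:pcone n then c (SOME U. U:\<U> & v:\<Union>U) x v else 0)"
 have sU: "s x v = c U x v" if U: "U:\<U>" "v:\<Union>U" for U x v
 proof -
  have v: "v:pcone n" "pt v:U" using U in_Union_iff[OF open_sub[OF cov(1)]] by blast+
  let ?V = "SOME U. U:\<U> & v:\<Union>U"
  have V: "?V:\<U> & v:\<Union>?V" by (rule someI[of _ U]) (use U in blast)
  then have "pt v : ?V" using in_Union_iff[OF open_sub[OF cov(1)]] by blast
  then have "v:\<Union>(?V \<inter> U)" using v pt_self by blast
  then show ?thesis using fun_cong[OF fun_cong[OF eq[of ?V U]], of x v] V U v by (simp add: s_def rs_def)
 qed
 have "s:Sec k (proj_space n)"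
 proof (rule SecI)
  fix i b P assume *: "i:charts E" "b<rk" "P:proj_space n" "P:chart E i"
  then obtain U where U: "U:\<U>" "P:U" using cov(2) by blast
  have "lreg n k P (c U (i, b))" by (rule SecD(1)[OF c[OF U(1)]]) (use * U in auto)
  then show "lreg n k P (s (i, b))" by (rule lreg_cong[OF _ cov(1)[OF U(1)] U(2)]) (rule sU[OF U(1)])
 next
  fix i j P v b assume *: "i:charts E" "j:charts E" "P:proj_space n" "P:chart E i" "P:chart E j" "v:P" "b<rk"
  then obtain U where U: "U:\<U>" "P:U" using cov(2) by blast
  have "v:\<Union>U" using U * by blast
  then show "s (i, b) v=(SUM c<rk. transition E i j P b c * s (j, c) v)"
  unfolding sU[OF U(1) \<open>v:\<Union>U\<close>] by (intro SecD(2)[OF c[OF U(1)] *(1,2) U(2) *(4-7)])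
 next
  fix i b v assume *: "~(i:charts E&b<rk&v:\<Union>(proj_space n \<inter> chart E i))"
  show "s (i, b) v=0"
  proof (cases "v:pcone n")
  case True
  then have "v:\<Union>(\<Union>\<U>)" unfolding cov(2) using pt_in pt_self by blast
  then obtain U where U: "U:\<U>" "v:\<Union>U" by blast
  have "U \<inter> chart E i \<subseteq> proj_space n \<inter> chart E i" using open_sub[OF cov(1)[OF U(1)]] by blast
  then have "c U (i, b) v=0" using * by (intro SecD(3)[OF c[OF U(1)]]) blast
  then show ?thesis by (simp add: sU[OF U])
  qed (simp add: s_def)
 qed
 moreover have "rs U s = c U" if "U:\<U>" for U
 proof -
  have "rs U s=rs U (c U)" using sU[OF that] by (auto simp: rs_def fun_eq_iff)
  then show ?thesis using rs_Sec[OF c[OF that]] by simp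
 qed
 ultimately show ?thesis by blast
qed

end

section \<open>The Cech differential on lists of open sets\<close>

lemma nth_face: "j<length s==>k<length s-1==>face j s ! k = s ! (if k<j then k else Suc k)"
 by (auto simp: face_def nth_append)

lemma length_face: "j<length s==>length (face j s)=length s-1"
 by (auto simp: face_def)

lemma face_face: assumes "j<i" "i<length s" shows "face j (face i s)=face (i-1) (face j s)"
 using assms by (intro nth_equalityI) (auto simp: length_face nth_face)

lemma set_face: "set (face j s) \<subseteq> set s"
 by (auto simp: face_def dest: in_set_takeD in_set_dropD)

lemma supp_face: "supp s \<subseteq> supp (face j s)"
 unfolding supp_def by (rule Inter_anti_mono[OF set_face])

lemma face_map: "face j (map f s)=map f (face j s)"
 by (simp add: face_def take_map drop_map)

text \<open>The Cech differential without a degree argument, since the degree can be read off the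
  length of the list.\<close>

definition dl :: "(point set list=>'b vf)=>point set list=>'b vf" where
 "dl c s=(SUM j<length s. scl ((-1) ^ j) (rs (supp s) (c (face j s))))"

definition ref :: "(point set=>point set)=>(point set list=>'b vf)=>point set list=>'b vf" where
 "ref ta c s=rs (supp s) (c (map ta s))"

lemma dl_add: "dl (%s. c s + c' s) s=dl c s+dl c' s"
 and dl_diff: "dl (%s. c s - c' s) s=dl c s-dl c' s"
 and dl_smul: "dl (%s. smul f (c s)) s = smul f (dl c s)"
 by (simp_all only: dl_def lin_add[OF lin_rs] lin_diff[OF lin_rs] rs_smul fv.scale_right_distrib fv.scale_right_diff_distrib
  sum.distrib sum_subtractf smul_sum smul_scl)

lemma ref_add: "ref ta (%s. c s + c' s) s=ref ta c s+ref ta c' s"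
 and ref_diff: "ref ta (%s. c s - c' s) s=ref ta c s-ref ta c' s"
 and ref_smul: "ref ta (%s. smul f (c s)) s = smul f (ref ta c s)"
 by (simp_all only: ref_def lin_add[OF lin_rs] lin_diff[OF lin_rs] rs_smul)

text \<open>The term for (i, j) with j < i cancels the one for (j, i-1) by
  \<open>face_face\<close>.\<close>

lemma dl_dl: "dl (dl c) s=0"
proof -
 let ?N = "length s"
 define x where "x=(%(i, j). scl ((-1) ^ (i+j)) (rs (supp s) (c (face j (face i s)))))"
 have "dl (dl c) s=(SUM i<?N. SUM j<?N-1. x (i, j))"
  unfolding dl_def[of "dl c"]
 proof (intro sum.cong refl)
  fix i assume i: "i:{..<?N}"
  have "dl c (face i s)=(SUM j<?N-1. scl ((-1) ^ j) (rs (supp (face i s)) (c (face j (face i s)))))"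
  using i by (simp add: dl_def length_face)
  then show "scl ((-1) ^ i) (rs (supp s) (dl c (face i s)))=(SUM j<?N-1. x (i, j))"
  by (simp add: lin_sum[OF lin_rs] lin_scl[OF lin_rs] rs_rs[OF supp_face] fv.scale_sum_right x_def power_add)
 qed
 also have "... = (SUM y:{..<?N} \<times> {..<?N-1}. x y)" by (simp add: sum.cartesian_product)
 also have "{..<?N} \<times> {..<?N-1}={(i, j). j<i&i<?N} \<union> {(i, j). i<=j&j<?N-1}" (is "_=?A \<union> ?B") by auto
 also have "sum x (?A \<union> ?B) = sum x ?A + sum x ?B"
  by (rule sum.union_disjoint) (auto intro: finite_subset[of _ "{..<?N} \<times> {..<?N}"])
 also have "sum x ?A=(SUM y:?B. - x y)"
 proof (rule sum.reindex_bij_witness[where j = "%(i, j). (j, i-1)" and i = "%(i, j). (Suc j, i)"])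
  fix y assume "y : ?A"
  then obtain i j where y: "y=(i, j)" "j<i" "i<?N" by auto
  then obtain i' where i': "i=Suc i'" by (cases i) auto
  show "- x ((%(i, j). (j, i-1)) y)=x y"
  using face_face[OF y(2,3)] by (simp add: y(1) x_def i' add.commute)
 qed auto
 finally show ?thesis by (simp only: sum_negf left_minus)
qed

lemma supp_map: "ALL V:set s. V \<subseteq> ta V==>supp s \<subseteq> supp (map ta s)"
 by (auto simp: supp_def)

lemma dl_ref:
 assumes "ALL V:set s. V \<subseteq> ta V" shows "dl (ref ta c) s=ref ta (dl c) s"
 unfolding dl_def ref_def
 by (simp add: lin_sum[OF lin_rs] lin_scl[OF lin_rs] rs_rs[OF supp_face] rs_rs[OF supp_map[OF assms]] face_map)

lemma ref_ref:
 assumes "ALL V:set s. V \<subseteq> ta' V" shows "ref ta' (ref ta c) s=ref (ta \<circ> ta') c s"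
 unfolding ref_def by (simp add: rs_rs[OF supp_map[OF assms]])

section \<open>Bundles modulo powers of sheared coordinates\<close>

locale sheared_bundle = algebraic_bundle n E for n and E :: "'i vbundle" +
 fixes a l :: nat and lam :: "nat=>complex"
 assumes l: "l<=n" and a: "0<a"
begin

definition ff :: "nat=>vec=>complex" where
 "ff j=(%v. shear l lam v j ^ a)"

lemma hform_ff: "j<=n==>hform (Suc n) a (ff j)"
 using hform_power[OF hform_shear[of l "Suc n" j lam], of a] l by (simp add: ff_def less_Suc_eq_le)

text \<open>The sections that are combinations of the \<open>ff j\<close> with coefficients defined
  on all of \<open>U\<close>. This is only a presheaf of submodules; passing from locally to
  globally belonging to it is the subject of \<open>CC\<close>.\<close>

definition Idl :: "nat set=>int=>point set=>('i \<times> nat=>vec=>complex) set" where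
 "Idl J k U={sg : Sec k U. EX t. (ALL j:J. t j:Sec (k-int a) U)&sg=(SUM j:J. smul (ff j) (t j))}"

lemma Idl_Sec: "sg : Idl J k U==>sg : Sec k U" by (simp add: Idl_def)

lemma ff_Sec: "openin (zariski n) U==>j<=n==>sg : Sec (k-int a) U==>smul (ff j) sg : Sec k U"
 using Sec_smul[of U a "ff j" sg "k-int a" k] hform_ff[of j] by simp

lemma subspace_Idl: assumes U: "openin (zariski n) U" shows "fv.subspace (Idl J k U)"
 unfolding fv.subspace_def
proof (intro conjI ballI allI)
 note S = subspace_Sec[OF U]
 show "0:Idl J k U"
  unfolding Idl_def
 proof (intro CollectI conjI exI ballI)
  show "0=(SUM j:J. smul (ff j) 0)" by simp
 qed (rule fv.subspace_0[OF S])+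
 fix x assume "x:Idl J k U"
 then obtain t where t: "x:Sec k U" "!!j. j:J==>t j:Sec (k-int a) U" "x=(SUM j:J. smul (ff j) (t j))" by (auto simp: Idl_def)
 show "scl c x:Idl J k U" for c
  unfolding Idl_def
 proof (intro CollectI conjI exI ballI)
  show "scl c x=(SUM j:J. smul (ff j) (scl c (t j)))" by (simp only: smul_scl t(3) fv.scale_sum_right)
 qed (use t fv.subspace_scale[OF S] in blast)+
 fix y assume "y:Idl J k U"
 then obtain u where u: "y:Sec k U" "!!j. j:J==>u j:Sec (k-int a) U" "y=(SUM j:J. smul (ff j) (u j))" by (auto simp: Idl_def)
 show "x+y:Idl J k U"
  unfolding Idl_def
 proof (intro CollectI conjI exI ballI)
  show "x+y=(SUM j:J. smul (ff j) (t j+u j))" by (simp only: smul_add t(3) u(3) sum.distrib)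
 qed (use t u fv.subspace_add[OF S] in blast)+
qed

lemma Idl_rs:
 assumes V: "openin (zariski n) V" "V \<subseteq> U" and x: "x:Idl J k U" shows "rs V x:Idl J k V"
proof -
 obtain t where t: "x:Sec k U" "!!j. j:J==>t j:Sec (k-int a) U" "x=(SUM j:J. smul (ff j) (t j))" using x by (auto simp: Idl_def)
 show ?thesis
  unfolding Idl_def
 proof (intro CollectI conjI exI ballI)
  show "rs V x=(SUM j:J. smul (ff j) (rs V (t j)))" by (simp only: t(3) lin_sum[OF lin_rs] rs_smul)
 qed (use t Sec_rs[OF V] in blast)+
qed

lemma Idl_insert:
 assumes U: "openin (zariski n) U" and j: "j~:J" "j<=n" and fin: "finite J"
 shows "x:Idl (insert j J) k U \<longleftrightarrow> (EX y:Sec (k-int a) U. x - smul (ff j) y:Idl J k U)"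
proof
 assume "x:Idl (insert j J) k U"
 then obtain t where t: "x:Sec k U" "!!j'. j':insert j J==>t j':Sec (k-int a) U" "x=(SUM j:insert j J. smul (ff j) (t j))" by (auto simp: Idl_def)
 show "EX y:Sec (k-int a) U. x - smul (ff j) y:Idl J k U"
 proof (rule bexI)
  have "x - smul (ff j) (t j)=(SUM j:J. smul (ff j) (t j))" unfolding t(3) using j fin by simp
  moreover have "x - smul (ff j) (t j):Sec k U"
  by (rule fv.subspace_diff[OF subspace_Sec[OF U] t(1) ff_Sec[OF U j(2) t(2)]]) simp
  ultimately show "x - smul (ff j) (t j):Idl J k U" unfolding Idl_def using t(2) by blast
 qed (use t(2) in blast)
next
 assume "EX y:Sec (k-int a) U. x - smul (ff j) y:Idl J k U"
 then obtain y t where y: "y:Sec (k-int a) U" "x - smul (ff j) y:Sec k U" "!!j. j:J==>t j:Sec (k-int a) U"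
  "x - smul (ff j) y=(SUM j:J. smul (ff j) (t j))" by (auto simp: Idl_def)
 have "x=(x - smul (ff j) y) + smul (ff j) y" by simp
 then have "x:Sec k U" using fv.subspace_add[OF subspace_Sec[OF U] y(2) ff_Sec[OF U j(2) y(1)]] by simp
 moreover have "(SUM j':insert j J. smul (ff j') ((t(j := y)) j')) = smul (ff j) y+(SUM j:J. smul (ff j) (t j))"
  using j fin by (subst sum.insert) (auto intro!: sum.cong)
 then have "x=(SUM j':insert j J. smul (ff j') ((t(j := y)) j'))" using y(4) by (simp add: algebra_simps)
 ultimately show "x:Idl (insert j J) k U"
  unfolding Idl_def using y by (intro CollectI conjI exI[of _ "t(j := y)"]) auto
qed

lemma Idl_insert_mono:
 assumes U: "openin (zariski n) U" and j: "j~:J" "j<=n" and fin: "finite J" and x: "x:Idl J k U"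
 shows "x:Idl (insert j J) k U"
 unfolding Idl_insert[OF U j fin]
proof (rule bexI)
 show "x - smul (ff j) 0:Idl J k U" using x by simp
qed (rule fv.subspace_0[OF subspace_Sec[OF U]])

lemma Idl_smul:
 assumes U: "openin (zariski n) U" and x: "x:Idl J (k-int a) U" and j: "j<=n" shows "smul (ff j) x:Idl J k U"
proof -
 obtain t where t: "x:Sec (k-int a) U" "!!j. j:J==>t j:Sec (k-int a-int a) U" "x=(SUM j:J. smul (ff j) (t j))" using x by (auto simp: Idl_def)
 show ?thesis
  unfolding Idl_def
 proof (intro CollectI conjI exI ballI)
  show "smul (ff j) x=(SUM i:J. smul (ff i) (smul (ff j) (t i)))" by (simp only: t(3) smul_sum smul_commute[of "ff j"])
 qed (use t ff_Sec[OF U j] in blast)+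
qed

lemma Idl_unit:
 assumes U: "openin (zariski n) U" "U \<subseteq> bas n (ff j)" and j: "j:J" "j<=n" and fin: "finite J" and x: "x:Sec k U"
 shows "x:Idl J k U"
proof -
 obtain y where y: "y:Sec (k-int a) U" "smul (ff j) y=x" using Sec_divide[OF hform_ff[OF j(2)] U(2) x] by blast
 have "x=(SUM i:J. smul (ff i) (if i=j then y else 0))"
 proof -
  have "(SUM i:J. smul (ff i) (if i=j then y else 0))=(SUM i:J. if i=j then x else 0)" by (rule sum.cong) (auto simp: y(2))
  then show ?thesis using j fin by simp
 qed
 then show ?thesis unfolding Idl_def using x y(1) fv.subspace_0[OF subspace_Sec[OF U(1)]]
  by (intro CollectI conjI exI[of _ "%i. if i=j then y else 0"]) auto
qed

lemma Idl_empty: "openin (zariski n) U==>Idl {} k U={0}"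
 using fv.subspace_0[OF subspace_Sec] by (auto simp: Idl_def)

text \<open>Basic open sets inside a chart, given by a form of positive degree. On them E is trivial
  and sections are fractions whose denominators are powers of one form; moreover they are closed
  under intersection and form a basis of the topology.\<close>

definition good :: "point set=>bool" where
 "good U \<longleftrightarrow> (EX g e i. hform (Suc n) e g&0<e&i:charts E&U=bas n g&U \<subseteq> chart E i)"

lemma good_open: "good U==>openin (zariski n) U"
 unfolding good_def using open_bas by blast

lemma good_Int_bas: assumes "good U" "hform (Suc n) e f" shows "good (U \<inter> bas n f)"
proof -
 obtain g d i where g: "hform (Suc n) d g" "0<d" "i:charts E" "U=bas n g" "U \<subseteq> chart E i" using assms(1) unfolding good_def by blast
 have "U \<inter> bas n f=bas n (%v. g v * f v)" by (simp add: bas_mult g)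
 moreover have "U \<inter> bas n f \<subseteq> chart E i" using g by blast
 ultimately show ?thesis unfolding good_def using hform_mult[OF g(1) assms(2)] g(2,3)
  by (intro exI[of _ "%v. g v * f v"] exI[of _ "d+e"] exI[of _ i]) auto
qed

lemma good_Int: "good U==>good V==>good (U \<inter> V)"
 using good_Int_bas unfolding good_def[of V] by blast

lemma good_exists:
 assumes "openin (zariski n) W" "P:W" shows "EX U. good U&P:U&U \<subseteq> W"
proof -
 have P: "P:proj_space n" using assms open_sub by blast
 then obtain i where i: "i:charts E" "P:chart E i" using chart_cover by blast
 obtain d h where h: "hform (Suc n) d h" "P:bas n h" "bas n h \<subseteq> W \<inter> chart E i"
  using open_basis[OF openin_Int[OF assms(1) chart_open[OF i(1)]], of P] assms(2) i(2) by blast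
 obtain v where v: "v:pcone n" "P=pt v" using P by (auto simp: proj_space_pt)
 obtain j where j: "j<Suc n" "v j~=0" using cone_nonzero[OF v(1)] by blast
 have hj: "hform (Suc n) (d+1) (%v. h v * v j)" by (rule hform_mult[OF h(1) hform_var[OF j(1)]])
 have "P:bas n (%v. h v * v j)" unfolding v(2) pt_in_bas[OF hj] using h(2) j v pt_in_bas[OF h(1)] pt_in by simp
 moreover have "bas n (%v. h v * v j) \<subseteq> bas n h" by (auto simp: bas_mult)
 ultimately show ?thesis unfolding good_def using h(3) hj i(1)
  by (intro exI[of _ "bas n (%v. h v * v j)"] conjI exI[of _ "%v. h v * v j"] exI[of _ "d+1"] exI[of _ i]) auto
qed

lemma good_supp: "s~=[]==>ALL U:set s. good U==>good (supp s)"
proof (induction s)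
 case (Cons U s)
 then show ?case by (cases s) (auto simp: supp_def intro!: good_Int)
qed simp

lemma Idl_local:
 assumes g: "hform (Suc n) e g" "i:charts E" "U=bas n g" "U \<subseteq> chart E i" and J: "J \<subseteq> {..n}" and t: "t:Sec k U"
  and H: "!!b q. b<rk==>q:J==>hz (Suc n) (int (N * e) + k-int a) (H b q)"
  and eq: "!!b v. b<rk==>v:\<Union>U==>t (i, b) v * g v ^ N=(SUM q:J. ff q v * H b q v)"
 shows "t:Idl J k U"
proof -
 have oU: "openin (zariski n) U" using open_bas[OF g(1)] g(3) by simp
 have "ALL q:J. EX u. u:Sec (k-int a) U&(ALL b<rk. ALL v:\<Union>U. u (i, b) v=H b q v * (1 / (g v ^ N)))"
 proof
  fix q assume q: "q:J"
  have "EX u:Sec (k-int a) U. ALL b<rk. ALL v:\<Union>U. u (i, b) v=H b q v * (1 / (g v ^ N))"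
  proof (rule Sec_mk[OF g(2,4) oU])
  fix b P assume b: "b<rk" and P: "P:U"
  have Pp: "P:proj_space n" using P open_sub[OF oU] by blast
  have gN: "hform (Suc n) (N * e) (%v. g v ^ N)" by (rule hform_power[OF g(1)])
  have "P:bas n (%v. g v ^ N)" using P unfolding g(3) by (auto simp: bas_def)
  from lreg_mult'[OF lreg_hz[OF Pp H(1)[OF b q]] lreg_inverse[OF Pp gN this]]
  show "lreg n (k-int a) P (%v. H b q v * (1 / (g v ^ N)))" by simp
  qed
  then show "EX u. u:Sec (k-int a) U&(ALL b<rk. ALL v:\<Union>U. u (i, b) v=H b q v * (1 / (g v ^ N)))" by blast
 qed
 from bchoice[OF this] obtain u where uu: "ALL q:J. u q:Sec (k-int a) U&(ALL b<rk. ALL v:\<Union>U. u q (i, b) v=H b q v * (1 / (g v ^ N)))" by (elim exE)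
 have u: "u q:Sec (k-int a) U" if "q:J" for q by (rule conjunct1[OF bspec[OF uu that]])
 have u2: "u q (i, b) v=H b q v * (1 / (g v ^ N))" if "q:J" "b<rk" "v:\<Union>U" for q b v
  using bspec[OF uu that(1), THEN conjunct2, rule_format, OF that(2,3)] .
 have uS: "(SUM q:J. smul (ff q) (u q)):Sec k U"
  by (rule fv.subspace_sum[OF subspace_Sec[OF oU]], rule ff_Sec[OF oU]) (use J u in auto)
 have "t=(SUM q:J. smul (ff q) (u q))"
 proof (rule Sec_eqI[OF t uS g(2,4) oU])
  fix b v assume b: "b<rk" and v: "v:\<Union>U"
  have gv: "g v~=0" using v unfolding g(3) Union_bas[OF g(1)] by blast
  have "(SUM q:J. smul (ff q) (u q)) (i, b) v=(SUM q:J. ff q v * H b q v) * (1 / (g v ^ N))"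
  unfolding sum_apply2 sum_distrib_right by (intro sum.cong refl) (simp add: smul_def u2[OF _ b v])
  also have "... = t (i, b) v" using gv by (simp flip: eq[OF b v])
  finally show "t (i, b) v=(SUM q:J. smul (ff q) (u q)) (i, b) v" ..
 qed
 then show ?thesis unfolding Idl_def using t u by blast
qed

text \<open>A common power of \<open>g\<close> clears the denominators of all coordinates in the
  trivialising chart. One more factor \<open>g\<close> makes the resulting relation true also where
  \<open>g\<close> vanishes, so it becomes an identity of forms, to which
  \<open>sheared_powers_regular\<close> applies.\<close>

theorem Idl_regular:
 assumes U: "good U" and j: "j~:J" "j<=n" and J: "J \<subseteq> {..n}" and t: "t:Sec (k-int a) U" and x: "smul (ff j) t:Idl J k U"
 shows "t:Idl J (k-int a) U"
proof -
 obtain g e i where g: "hform (Suc n) e g" "0<e" "i:charts E" "U=bas n g" "U \<subseteq> chart E i" using U unfolding good_def by blast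
 note oU = good_open[OF U]
 have finJ: "finite J" using J finite_subset by blast
 obtain s where s: "!!i. i:J==>s i:Sec (k-int a) U" "smul (ff j) t=(SUM i:J. smul (ff i) (s i))" using x by (auto simp: Idl_def)
 let ?X = "insert None (Some ` J) \<times> {..<rk}"
 define ph where "ph=(%(y, b). case y of None=>t (i, b) | Some q=>s q (i, b))"
 have "EX N F. ALL x:?X. hz (Suc n) (int (N * e)+(k-int a)) (F x)&(ALL v:\<Union>(bas n g). ph x v * g v ^ N=F x v)"
 proof (rule lreg_bas_uniform[OF g(1,2)])
  show "finite ?X" using finJ by simp
  fix x P assume x: "x : ?X" and P: "P:bas n g"
  then have P': "P:U" "P:chart E i" using g by blast+
  show "lreg n (k-int a) P (ph x)"
  using x SecD(1)[OF t g(3) _ P'] SecD(1)[OF s(1) g(3) _ P'] by (auto simp: ph_def)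
 qed
 then obtain N F where F: "!!y b. y:insert None (Some ` J)==>b<rk==>hz (Suc n) (int (N * e)+(k-int a)) (F (y, b))"
  "!!y b v. y:insert None (Some ` J)==>b<rk==>v:\<Union>U==>ph (y, b) v * g v ^ N=F (y, b) v" unfolding g(4) by fastforce
 let ?K = "int (N * e)+(k-int a)+int e"
 have hzt: "F (y, b) (trunc n v)=F (y, b) v" if "y:insert None (Some ` J)" "b<rk" for y b v
  using F(1)[OF that] hform_trunc unfolding hz_def by fastforce
 have "EX H. (ALL q:J. hz (Suc n) (?K-int a) (H q))&(ALL v. F (None, b) v * g v=(SUM q:J. shear l lam v q ^ a * H q v))" if b: "b<rk" for b
 proof (rule sheared_powers_regular[where j = j and K = ?K])
  show "l<Suc n" "j~:J" "j<Suc n" using l j by auto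
  show "hz (Suc n) ?K (%v. F (None, b) v * g v)" by (rule hz_mult[OF F(1)[OF _ b] hz_hform[OF g(1)]]) simp
  show "hz (Suc n) ?K (%v. F (Some q, b) v * g v)" if "q:J" for q by (rule hz_mult[OF F(1)[OF _ b] hz_hform[OF g(1)]]) (use that in simp)
  fix v
  show "shear l lam v j ^ a * (F (None, b) v * g v)=(SUM q:J. shear l lam v q ^ a * (F (Some q, b) v * g v))"
  proof (cases "g v=0")
  case False
  let ?v = "trunc n v"
  have "?v:pcone n" using hform_nonzero_pos[OF g(1,2) False] trunc_cone by blast
  then have v: "?v:\<Union>U" unfolding g(4) Union_bas[OF g(1)] using False hform_trunc[OF g(1)] by simp
  have ffv: "shear l lam ?v q ^ a = shear l lam v q ^ a" if "q<=n" for q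
  using hform_trunc[OF hform_ff[OF that], of v] by (simp add: ff_def)
  have "ff j ?v * F (None, b) ?v=(ff j ?v * t (i, b) ?v) * g ?v ^ N"
  using F(2)[OF _ b v, of None] by (simp add: ph_def)
  also have "ff j ?v * t (i, b) ?v=(SUM q:J. ff q ?v * s q (i, b) ?v)"
  using fun_cong[OF fun_cong[OF s(2), of "(i, b)"], of ?v] by (simp add: smul_def sum_apply2)
  also have "(SUM q:J. ff q ?v * s q (i, b) ?v) * g ?v ^ N=(SUM q:J. ff q ?v * F (Some q, b) ?v)"
  proof -
  have "s q (i, b) ?v * g ?v ^ N=F (Some q, b) ?v" if "q:J" for q
  using F(2)[of "Some q" b ?v] that b v by (simp add: ph_def)
  then show ?thesis unfolding sum_distrib_right by (intro sum.cong refl) (simp only: mult.assoc)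
  qed
  finally have "shear l lam v j ^ a * F (None, b) v=(SUM q:J. shear l lam v q ^ a * F (Some q, b) v)"
  using ffv[OF j(2)] ffv J hzt[OF _ b] by (simp add: ff_def subset_eq)
  then show ?thesis by (simp add: mult.assoc[symmetric] sum_distrib_right)
  qed simp
 qed
 then have "ALL b:{..<rk}. EX H. (ALL q:J. hz (Suc n) (?K-int a) (H q))&(ALL v. F (None, b) v * g v=(SUM q:J. shear l lam v q ^ a * H q v))"
  by blast
 from bchoice[OF this] obtain H where H: "!!b q. b<rk==>q:J==>hz (Suc n) (?K-int a) (H b q)"
  "!!b v. b<rk==>F (None, b) v * g v=(SUM q:J. ff q v * H b q v)" unfolding ff_def by blast
 show ?thesis
 proof (rule Idl_local[OF g(1,3-5) J t])
  show "hz (Suc n) (int (Suc N * e)+(k-int a)-int a) (H b q)" if "b<rk" "q:J" for b q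
  using H(1)[OF that] by (simp add: algebra_simps)
  show "t (i, b) v * g v ^ Suc N=(SUM q:J. ff q v * H b q v)" if "b<rk" "v:\<Union>U" for b v
  using F(2)[OF _ that, of None] H(2)[OF that(1), of v] by (simp add: ph_def mult_ac)
 qed
qed

end

section \<open>Exact sequences for the successive quotients\<close>

context sheared_bundle
begin

definition gcov :: "point set set=>bool" where
 "gcov \<U> \<longleftrightarrow> (ALL U:\<U>. good U) & \<Union>\<U> = proj_space n"

definition lists_of :: "nat=>point set set=>point set list set" where
 "lists_of m \<U> = {s. set s \<subseteq> \<U> & length s=m}"

text \<open>Cochains are indexed by the length of their lists, so degree q means m = q + 1. At m = 0
  only the zero value is allowed, which makes coboundaries in degree 0 trivial.\<close>

definition CH :: "nat=>point set set=>int=>(point set list=>'i \<times> nat=>vec=>complex)=>bool" where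
 "CH m \<U> k c \<longleftrightarrow> (ALL s:lists_of m \<U>. if m=0 then c s=0 else c s:Sec k (supp s))"

text \<open>\<open>VV J (Suc q) k\<close> is the vanishing of \<open>H\<^sup>q\<close> of the quotient of \<open>E(k)\<close> by the sections \<open>ff j\<close>, \<open>j \<in> J\<close>.\<close>

definition VV :: "nat set=>nat=>int=>bool" where
 "VV J m k \<longleftrightarrow> (ALL \<U> c. gcov \<U> --> CH m \<U> k c-->(ALL s:lists_of (Suc m) \<U>. dl c s:Idl J k (supp s)) -->
  (EX \<V> ta b. gcov \<V> & refinement \<V> \<U> ta&CH (m-1) \<V> k b&(ALL s:lists_of m \<V>. ref ta c s-dl b s:Idl J k (supp s))))"

text \<open>Surjectivity of global sections: every section of the quotient sheaf comes, after
  refinement, from a global section of E(k).\<close>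

definition AA :: "nat set=>int=>bool" where
 "AA J k \<longleftrightarrow> (ALL \<U> c. gcov \<U> --> CH 1 \<U> k c-->(ALL s:lists_of 2 \<U>. dl c s:Idl J k (supp s)) -->
  (EX \<V> ta x. gcov \<V> & refinement \<V> \<U> ta&x:Sec k (proj_space n)&(ALL V:\<V>. rs V x-rs V (c [ta V]):Idl J k V)))"

text \<open>A global section that lies locally in the ideal is a combination with globally defined
  coefficients.\<close>

definition CC :: "nat set=>int=>bool" where
 "CC J k \<longleftrightarrow> (ALL \<U> x. gcov \<U> --> x:Sec k (proj_space n)-->(ALL U:\<U>. rs U x:Idl J k U)-->x:Idl J k (proj_space n))"

lemma gcov_supp: "gcov \<U> ==> s:lists_of m \<U> ==> 0<m==>good (supp s)"
 by (rule good_supp) (auto simp: gcov_def lists_of_def)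

lemma gcov_open: "gcov \<U> ==> s:lists_of m \<U> ==> 0<m==>openin (zariski n) (supp s)"
 using gcov_supp good_open by blast

lemma lists_of_face: "s:lists_of (Suc m) \<U> ==> j<Suc m==>face j s:lists_of m \<U>"
 using set_face[of j s] by (auto simp: lists_of_def length_face)

lemma CHD: "CH m \<U> k c==>s:lists_of m \<U> ==> 0<m==>c s:Sec k (supp s)"
 by (simp add: CH_def)

lemma CHI: "0<m==>(!!s. s:lists_of m \<U> ==> c s:Sec k (supp s))==>CH m \<U> k c"
 by (simp add: CH_def)

lemma dl_closed:
 assumes S: "fv.subspace S" and s: "s:lists_of (Suc m) \<U>"
  and c: "!!s'. s':lists_of m \<U> ==> supp s \<subseteq> supp s'==>rs (supp s) (c s'):S"
 shows "dl c s:S"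
 unfolding dl_def
proof (intro fv.subspace_sum[OF S] fv.subspace_scale[OF S])
 fix j assume "j:{..<length s}"
 then have "face j s:lists_of m \<U>" using s by (intro lists_of_face) (auto simp: lists_of_def)
 then show "rs (supp s) (c (face j s)):S" by (rule c[OF _ supp_face])
qed

lemma CH_dl: assumes U: "gcov \<U>" and c: "CH m \<U> k c" shows "CH (Suc m) \<U> k (dl c)"
proof (rule CHI)
 fix s assume s: "s:lists_of (Suc m) \<U>"
 note o = gcov_open[OF U s zero_less_Suc]
 show "dl c s:Sec k (supp s)"
 proof (rule dl_closed[OF subspace_Sec[OF o] s])
  fix s' assume s': "s':lists_of m \<U>" "supp s \<subseteq> supp s'"
  show "rs (supp s) (c s'):Sec k (supp s)"
  proof (cases "m=0")
  case True then show ?thesis using c s' fv.subspace_0[OF subspace_Sec[OF o]] by (simp add: CH_def lin_0[OF lin_rs])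
  next
  case False then show ?thesis using Sec_rs[OF o s'(2) CHD[OF c s'(1)]] by simp
  qed
 qed
qed simp

lemma Idl_dl:
 assumes U: "gcov \<U>" and m: "0<m" and c: "!!s. s:lists_of m \<U> ==> c s:Idl J k (supp s)" and s: "s:lists_of (Suc m) \<U>"
 shows "dl c s:Idl J k (supp s)"
proof -
 note o = gcov_open[OF U s zero_less_Suc]
 show ?thesis by (rule dl_closed[OF subspace_Idl[OF o] s]) (rule Idl_rs[OF o _ c])
qed

lemma refinement_sub: "refinement \<V> \<U> ta==>s:lists_of m \<V> ==> ALL V:set s. V \<subseteq> ta V"
 by (auto simp: refinement_def lists_of_def)

lemma refinement_lists: "refinement \<V> \<U> ta==>s:lists_of m \<V> ==> map ta s:lists_of m \<U>"
 by (auto simp: refinement_def lists_of_def)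

lemma refinement_comp: "refinement \<V> \<U> ta==>refinement \<W> \<V> ta'==>refinement \<W> \<U> (ta \<circ> ta')"
 unfolding refinement_def by fastforce

lemma Sec_ref:
 assumes "gcov \<V>" "refinement \<V> \<U> ta" "0<m" "s:lists_of m \<V>" "!!s. s:lists_of m \<U> ==> c s:Sec k (supp s)"
 shows "ref ta c s:Sec k (supp s)"
 unfolding ref_def
 by (rule Sec_rs[OF gcov_open[OF assms(1,4,3)] supp_map[OF refinement_sub[OF assms(2,4)]] assms(5)[OF refinement_lists[OF assms(2,4)]]])

lemma Idl_ref:
 assumes "gcov \<V>" "refinement \<V> \<U> ta" "0<m" "s:lists_of m \<V>" "!!s. s:lists_of m \<U> ==> c s:Idl J k (supp s)"
 shows "ref ta c s:Idl J k (supp s)"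
 unfolding ref_def
 by (rule Idl_rs[OF gcov_open[OF assms(1,4,3)] supp_map[OF refinement_sub[OF assms(2,4)]] assms(5)[OF refinement_lists[OF assms(2,4)]]])

lemma CH_ref: "gcov \<V> ==> refinement \<V> \<U> ta==>0<m==>CH m \<U> k c==>CH m \<V> k (ref ta c)"
 by (rule CHI, assumption, rule Sec_ref) (auto intro: CHD)

lemma CH_diff_ff:
 assumes U: "gcov \<U>" and m: "0<m" and c: "CH m \<U> k c" and t: "CH m \<U> (k-int a) t" and j: "j<=n"
 shows "CH m \<U> k (%s. c s - smul (ff j) (t s))"
proof (rule CHI[OF m])
 fix s assume s: "s:lists_of m \<U>"
 note o = gcov_open[OF U s m]
 show "c s - smul (ff j) (t s):Sec k (supp s)"
  by (rule fv.subspace_diff[OF subspace_Sec[OF o] CHD[OF c s m] ff_Sec[OF o j CHD[OF t s m]]])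
qed

text \<open>Write Q for the quotient by \<open>J\<close> and Q' for the quotient by
  \<open>insert j J\<close>. Exactness of 0 \<rightarrow> Q(-a) \<rightarrow> Q \<rightarrow> Q'
  \<rightarrow> 0 at the cochain level: what vanishes in Q' is \<open>ff j\<close> times some
  \<open>t\<close>, and regularity of \<open>ff j\<close> makes \<open>t\<close> a cocycle of Q(-a)
  when \<open>x\<close> is one of Q.\<close>

lemma lift:
 assumes U: "gcov \<U>" and m: "0<m" and J: "j~:J" "j<=n" "J \<subseteq> {..n}"
  and x: "!!s. s:lists_of m \<U> ==> x s:Idl (insert j J) k (supp s)"
  and dx: "!!s. s:lists_of (Suc m) \<U> ==> dl x s:Idl J k (supp s)"
 shows "EX t. CH m \<U> (k-int a) t&(ALL s:lists_of m \<U>. x s - smul (ff j) (t s):Idl J k (supp s)) &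
  (ALL s:lists_of (Suc m) \<U>. dl t s:Idl J (k-int a) (supp s))"
proof -
 have finJ: "finite J" using J(3) finite_subset by blast
 have "ALL s:lists_of m \<U>. EX y. y:Sec (k-int a) (supp s)&x s - smul (ff j) y:Idl J k (supp s)"
  using x Idl_insert[OF gcov_open[OF U _ m] J(1,2) finJ] by blast
 from bchoice[OF this] obtain t where t: "!!s. s:lists_of m \<U> ==> t s:Sec (k-int a) (supp s)"
  "!!s. s:lists_of m \<U> ==> x s - smul (ff j) (t s):Idl J k (supp s)" by blast
 have T: "CH m \<U> (k-int a) t" by (rule CHI[OF m t(1)])
 have "dl t s:Idl J (k-int a) (supp s)" if s: "s:lists_of (Suc m) \<U>" for s
 proof (rule Idl_regular[OF gcov_supp[OF U s] J])
  note o = gcov_open[OF U s zero_less_Suc]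
  show "dl t s:Sec (k-int a) (supp s)" by (rule CHD[OF CH_dl[OF U T] s]) simp
  have "dl x s - smul (ff j) (dl t s):Idl J k (supp s)"
  unfolding dl_smul[symmetric] dl_diff[symmetric] by (rule Idl_dl[OF U m t(2) s])
  from fv.subspace_diff[OF subspace_Idl[OF o] dx[OF s] this]
  show "smul (ff j) (dl t s):Idl J k (supp s)" by simp
 qed simp
 with T t(2) show ?thesis by blast
qed

lemma lift_boundary:
 assumes U: "gcov \<U>" and J: "j~:J" "j<=n" "J \<subseteq> {..n}"
  and c: "!!s. s:lists_of (Suc m) \<U> ==> dl c s:Idl (insert j J) k (supp s)"
 shows "EX t. CH (Suc m) \<U> (k-int a) t&(ALL s:lists_of (Suc m) \<U>. dl c s - smul (ff j) (t s):Idl J k (supp s)) &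
  (ALL s:lists_of (Suc (Suc m)) \<U>. dl t s:Idl J (k-int a) (supp s))"
proof (rule lift[OF U _ J c])
 show "dl (dl c) s:Idl J k (supp s)" if "s:lists_of (Suc (Suc m)) \<U>" for s
  unfolding dl_dl by (rule fv.subspace_0[OF subspace_Idl[OF gcov_open[OF U that]]]) simp
qed simp

text \<open>The obstruction to lifting a cocycle from the quotient by \<open>insert j J\<close> to
  the quotient by \<open>J\<close> is a class of the latter in the next degree, twisted down by
  \<open>a\<close>; after refinement it is a coboundary, and subtracting \<open>ff j\<close> times
  its primitive corrects the lift.\<close>

lemma correct:
 assumes U: "gcov \<U>" and m: "0<m" and J: "j~:J" "j<=n" "J \<subseteq> {..n}" and V: "VV J (Suc m) (k-int a)"
  and C: "CH m \<U> k c" and c: "ALL s:lists_of (Suc m) \<U>. dl c s:Idl (insert j J) k (supp s)"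
 shows "EX \<V> ta b. gcov \<V> & refinement \<V> \<U> ta&CH m \<V> (k-int a) b &
  CH m \<V> k (%s. ref ta c s - smul (ff j) (b s)) &
  (ALL s:lists_of (Suc m) \<V>. dl (%s. ref ta c s - smul (ff j) (b s)) s:Idl J k (supp s))"
proof -
 obtain t where t: "CH (Suc m) \<U> (k-int a) t" "!!s. s:lists_of (Suc m) \<U> ==> dl c s - smul (ff j) (t s):Idl J k (supp s)"
  "ALL s:lists_of (Suc (Suc m)) \<U>. dl t s:Idl J (k-int a) (supp s)" using lift_boundary[OF U J, of m c k] c by blast
 obtain \<V> ta b where b: "gcov \<V>" "refinement \<V> \<U> ta" "CH m \<V> (k-int a) b"
  "!!s. s:lists_of (Suc m) \<V> ==> ref ta t s-dl b s:Idl J (k-int a) (supp s)"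
  using V[unfolded VV_def, rule_format, OF U t(1)] t(3) by auto
 have "dl (%s. ref ta c s - smul (ff j) (b s)) s:Idl J k (supp s)" if s: "s:lists_of (Suc m) \<V>" for s
 proof -
  note o = gcov_open[OF b(1) s zero_less_Suc]
  have "dl (%s. ref ta c s - smul (ff j) (b s)) s =
  ref ta (%s. dl c s - smul (ff j) (t s)) s + smul (ff j) (ref ta t s-dl b s)"
  unfolding dl_diff dl_smul dl_ref[OF refinement_sub[OF b(2) s]] ref_diff ref_smul smul_diff by simp
  then show ?thesis
  using fv.subspace_add[OF subspace_Idl[OF o] Idl_ref[OF b(1,2) zero_less_Suc s t(2)] Idl_smul[OF o b(4)[OF s] J(2)]] by simp
 qed
 with b CH_diff_ff[OF b(1) m CH_ref[OF b(1,2) m C] b(3) J(2)] show ?thesis by blast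
qed

text \<open>In the long exact sequence the cohomology for \<open>insert j J\<close> lies between
  that for \<open>J\<close> in the same degree and that for \<open>J\<close> in the next degree,
  twisted down by \<open>a\<close>.\<close>

theorem VV_insert:
 assumes m: "0<m" and J: "j~:J" "j<=n" "J \<subseteq> {..n}" and V: "VV J m k" "VV J (Suc m) (k-int a)"
 shows "VV (insert j J) m k"
 unfolding VV_def
proof (intro allI impI)
 fix \<U> c assume U: "gcov \<U>" and C: "CH m \<U> k c" and c: "ALL s:lists_of (Suc m) \<U>. dl c s:Idl (insert j J) k (supp s)"
 have finJ: "finite J" using J(3) finite_subset by blast
 obtain \<V> ta b where b: "gcov \<V>" "refinement \<V> \<U> ta" "CH m \<V> (k-int a) b" "CH m \<V> k (%s. ref ta c s - smul (ff j) (b s))"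
  "ALL s:lists_of (Suc m) \<V>. dl (%s. ref ta c s - smul (ff j) (b s)) s:Idl J k (supp s)"
  using correct[OF U m J V(2) C c] by blast
 obtain \<W> ta' b' where b': "gcov \<W>" "refinement \<W> \<V> ta'" "CH (m-1) \<W> k b'"
  "!!s. s:lists_of m \<W> ==> ref ta' (%s. ref ta c s - smul (ff j) (b s)) s-dl b' s:Idl J k (supp s)"
  using V(1)[unfolded VV_def, rule_format, OF b(1,4)] b(5) by auto
 have "ref (ta \<circ> ta') c s-dl b' s:Idl (insert j J) k (supp s)" if s: "s:lists_of m \<W>" for s
  unfolding Idl_insert[OF gcov_open[OF b'(1) s m] J(1,2) finJ]
 proof (rule bexI)
  have "ref (ta \<circ> ta') c s-dl b' s - smul (ff j) (ref ta' b s)=ref ta' (%s. ref ta c s - smul (ff j) (b s)) s-dl b' s"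
  unfolding ref_diff ref_smul ref_ref[OF refinement_sub[OF b'(2) s]] by simp
  then show "ref (ta \<circ> ta') c s-dl b' s - smul (ff j) (ref ta' b s):Idl J k (supp s)" using b'(4)[OF s] by (simp only:)
 qed (rule Sec_ref[OF b'(1,2) m s CHD[OF b(3) _ m]])
 with b'(1,3) refinement_comp[OF b(2) b'(2)]
 show "EX \<V> ta b. gcov \<V> & refinement \<V> \<U> ta&CH (m-1) \<V> k b&(ALL s:lists_of m \<V>. ref ta c s-dl b s:Idl (insert j J) k (supp s))" by blast
qed

lemma single_list: "V:\<V> ==> [V] : lists_of 1 \<V>" by (simp add: lists_of_def)

lemma supp_single [simp]: "supp [V]=V" by (simp add: supp_def)

text \<open>Vanishing of the first cohomology for \<open>J\<close>, twisted down by
  \<open>a\<close>, lifts a section to the quotient by \<open>J\<close>, where \<open>AA J k\<close>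
  extends it.\<close>

theorem AA_insert:
 assumes J: "j~:J" "j<=n" "J \<subseteq> {..n}" and V: "VV J 2 (k-int a)" and A: "AA J k"
 shows "AA (insert j J) k"
 unfolding AA_def
proof (intro allI impI)
 fix \<U> c assume U: "gcov \<U>" and C: "CH 1 \<U> k c" and c: "ALL s:lists_of 2 \<U>. dl c s:Idl (insert j J) k (supp s)"
 have finJ: "finite J" using J(3) finite_subset by blast
 obtain \<V> ta b where b: "gcov \<V>" "refinement \<V> \<U> ta" "CH 1 \<V> (k-int a) b" "CH 1 \<V> k (%s. ref ta c s - smul (ff j) (b s))"
  "ALL s:lists_of 2 \<V>. dl (%s. ref ta c s - smul (ff j) (b s)) s:Idl J k (supp s)"
  using correct[OF U zero_less_one J _ C] V c by (auto simp: numeral_2_eq_2)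
 obtain \<W> ta' x where x: "gcov \<W>" "refinement \<W> \<V> ta'" "x:Sec k (proj_space n)"
  "!!V. V:\<W> ==> rs V x-rs V (ref ta c [ta' V] - smul (ff j) (b [ta' V])):Idl J k V"
  using A[unfolded AA_def, rule_format, OF b(1,4)] b(5) by blast
 have "rs V x-rs V (c [(ta \<circ> ta') V]):Idl (insert j J) k V" if V: "V:\<W>" for V
 proof -
  have o: "openin (zariski n) V" using x(1) V good_open by (auto simp: gcov_def)
  have sub: "V \<subseteq> ta' V" "ta' V:\<V>" using x(2) V by (auto simp: refinement_def)
  show ?thesis
  unfolding Idl_insert[OF o J(1,2) finJ]
  proof (rule bexI)
  have "rs V (ref ta c [ta' V])=rs V (c [(ta \<circ> ta') V])" using rs_rs[OF sub(1)] by (simp add: ref_def)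
  then have "rs V x-rs V (c [(ta \<circ> ta') V]) - smul (ff j) (- rs V (b [ta' V])) =
  rs V x-rs V (ref ta c [ta' V] - smul (ff j) (b [ta' V]))"
  by (simp add: lin_diff[OF lin_rs] rs_smul)
  then show "rs V x-rs V (c [(ta \<circ> ta') V]) - smul (ff j) (- rs V (b [ta' V])):Idl J k V" using x(4)[OF V] by (simp only:)
  have "b [ta' V] : Sec (k-int a) (ta' V)" using CHD[OF b(3) single_list[OF sub(2)]] by simp
  from Sec_rs[OF o sub(1) this] show "- rs V (b [ta' V]):Sec (k-int a) V"
  by (rule fv.subspace_neg[OF subspace_Sec[OF o]])
  qed
 qed
 with x(1,3) refinement_comp[OF b(2) x(2)]
 show "EX \<V> ta x. gcov \<V> & refinement \<V> \<U> ta&x:Sec k (proj_space n)&(ALL V:\<V>. rs V x-rs V (c [ta V]):Idl (insert j J) k V)" by blast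
qed

lemma openX: "openin (zariski n) (proj_space n)"
 using openin_topspace[of "zariski n"] by (simp add: topspace_zariski)

text \<open>The local coefficients of \<open>ff j\<close> agree modulo the ideal of
  \<open>J\<close>, hence come from a global section \<open>y\<close> by \<open>AA\<close>. Then x -
  ff j * y lies locally, and by \<open>CC J k\<close> globally, in the ideal of
  \<open>J\<close>.\<close>

theorem CC_insert:
 assumes J: "j~:J" "j<=n" "J \<subseteq> {..n}" and A: "AA J (k-int a)" and C: "CC J k"
 shows "CC (insert j J) k"
 unfolding CC_def
proof (intro allI impI)
 fix \<U> x assume U: "gcov \<U>" and X: "x:Sec k (proj_space n)" and x: "ALL U:\<U>. rs U x:Idl (insert j J) k U"
 have finJ: "finite J" using J(3) finite_subset by blast
 define c where "c=(%s. rs (supp s) x)"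
 have c: "c s:Idl (insert j J) k (supp s)" if "s:lists_of 1 \<U>" for s
  using that x by (auto simp: c_def lists_of_def length_Suc_conv)
 have dc: "dl c s:Idl J k (supp s)" if s: "s:lists_of (Suc 1) \<U>" for s
 proof -
  obtain V W where s': "s=[V, W]" using s by (auto simp: lists_of_def length_Suc_conv)
  have "dl c s=0"
  unfolding dl_def s' by (simp add: numeral_2_eq_2 face_def c_def rs_rs supp_def)
  then show ?thesis using fv.subspace_0[OF subspace_Idl[OF gcov_open[OF U s zero_less_Suc]]] by simp
 qed
 obtain t where t: "CH 1 \<U> (k-int a) t" "!!s. s:lists_of 1 \<U> ==> c s - smul (ff j) (t s):Idl J k (supp s)"
  "ALL s:lists_of (Suc 1) \<U>. dl t s:Idl J (k-int a) (supp s)"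
  using lift[OF U zero_less_one J c dc] by blast
 obtain \<V> ta y where y: "gcov \<V>" "refinement \<V> \<U> ta" "y:Sec (k-int a) (proj_space n)"
  "!!V. V:\<V> ==> rs V y-rs V (t [ta V]):Idl J (k-int a) V"
  using A[unfolded AA_def, rule_format, OF U t(1)] t(3) by (auto simp: numeral_2_eq_2)
 have "x - smul (ff j) y:Idl J k (proj_space n)"
 proof (rule C[unfolded CC_def, rule_format, OF y(1)])
  show "x - smul (ff j) y:Sec k (proj_space n)"
  by (rule fv.subspace_diff[OF subspace_Sec[OF openX] X ff_Sec[OF openX J(2) y(3)]])
  fix V assume V: "V:\<V>"
  have o: "openin (zariski n) V" using y(1) V good_open by (auto simp: gcov_def)
  have sub: "V \<subseteq> ta V" "ta V:\<U>" using y(2) V by (auto simp: refinement_def)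
  have "rs V (x - smul (ff j) y)=rs V (c [ta V] - smul (ff j) (t [ta V])) - smul (ff j) (rs V y-rs V (t [ta V]))"
  by (simp add: lin_diff[OF lin_rs] rs_smul c_def rs_rs[OF sub(1)])
  moreover have "rs V (c [ta V] - smul (ff j) (t [ta V])):Idl J k V"
  using Idl_rs[OF o sub(1)] t(2)[OF single_list[OF sub(2)]] by simp
  ultimately show "rs V (x - smul (ff j) y):Idl J k V"
  using fv.subspace_diff[OF subspace_Idl[OF o] _ Idl_smul[OF o y(4)[OF V] J(2)]] by simp
 qed
 with y(3) show "x:Idl (insert j J) k (proj_space n)" unfolding Idl_insert[OF openX J(1,2) finJ] by blast
qed

text \<open>The long exact sequence read in the other direction: first cohomology for
  \<open>J\<close> lies between that for \<open>J\<close> twisted down by \<open>a\<close> and that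
  for \<open>insert j J\<close>. This raises the twist, while \<open>VV_insert\<close> enlarges
  \<open>J\<close>.\<close>

theorem VV_descend:
 assumes J: "j~:J" "j<=n" "J \<subseteq> {..n}" and V: "VV J 2 (k-int a)" "VV (insert j J) 2 k"
 shows "VV J 2 k"
 unfolding VV_def
proof (intro allI impI)
 fix \<U> c assume U: "gcov \<U>" and C: "CH 2 \<U> k c" and c: "ALL s:lists_of (Suc 2) \<U>. dl c s:Idl J k (supp s)"
 have finJ: "finite J" using J(3) finite_subset by blast
 have "ALL s:lists_of (Suc 2) \<U>. dl c s:Idl (insert j J) k (supp s)"
  using c Idl_insert_mono[OF gcov_open[OF U _ zero_less_Suc] J(1,2) finJ] by blast
 then obtain \<V> ta b where b: "gcov \<V>" "refinement \<V> \<U> ta" "CH 1 \<V> k b"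
  "!!s. s:lists_of 2 \<V> ==> ref ta c s-dl b s:Idl (insert j J) k (supp s)"
  using V(2)[unfolded VV_def, rule_format, OF U C] by auto
 let ?x = "%s. ref ta c s-dl b s"
 have dx: "dl ?x s:Idl J k (supp s)" if s: "s:lists_of (Suc 2) \<V>" for s
  unfolding dl_diff dl_dl dl_ref[OF refinement_sub[OF b(2) s]]
  using Idl_ref[OF b(1,2) zero_less_Suc s bspec[OF c]] by simp
 obtain t where t: "CH 2 \<V> (k-int a) t" "!!s. s:lists_of 2 \<V> ==> ?x s - smul (ff j) (t s):Idl J k (supp s)"
  "ALL s:lists_of (Suc 2) \<V>. dl t s:Idl J (k-int a) (supp s)"
  using lift[OF b(1) zero_less_numeral J b(4) dx] by blast
 obtain \<W> ta' b' where b': "gcov \<W>" "refinement \<W> \<V> ta'" "CH 1 \<W> (k-int a) b'"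
  "!!s. s:lists_of 2 \<W> ==> ref ta' t s-dl b' s:Idl J (k-int a) (supp s)"
  using V(1)[unfolded VV_def, rule_format, OF b(1) t(1)] t(3) by auto
 let ?b = "%s. ref ta' b s - smul (ff j) (- b' s)"
 have neg: "CH 1 \<W> (k-int a) (%s. - b' s)"
  by (rule CHI) (use CHD[OF b'(3)] gcov_open[OF b'(1)] fv.subspace_neg[OF subspace_Sec] in auto)
 have B: "CH 1 \<W> k ?b" by (rule CH_diff_ff[OF b'(1) zero_less_one CH_ref[OF b'(1,2) zero_less_one b(3)] neg J(2)])
 have "ref (ta \<circ> ta') c s-dl ?b s:Idl J k (supp s)" if s: "s:lists_of 2 \<W>" for s
 proof -
  note o = gcov_open[OF b'(1) s zero_less_numeral]
  have "dl (%s. - b' s) s = - dl b' s" using dl_diff[of "%_. 0" b' s] by (simp add: dl_def lin_0[OF lin_rs])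
  then have "ref (ta \<circ> ta') c s-dl ?b s=ref ta' (%s. ?x s - smul (ff j) (t s)) s + smul (ff j) (ref ta' t s-dl b' s)"
  unfolding dl_diff dl_smul dl_ref[OF refinement_sub[OF b'(2) s]] ref_diff ref_smul ref_ref[OF refinement_sub[OF b'(2) s]] smul_diff
  by simp
  then show ?thesis
  using fv.subspace_add[OF subspace_Idl[OF o] Idl_ref[OF b'(1,2) zero_less_numeral s t(2)] Idl_smul[OF o b'(4)[OF s] J(2)]] by simp
 qed
 with b'(1) B refinement_comp[OF b(2) b'(2)]
 show "EX \<V> ta b. gcov \<V> & refinement \<V> \<U> ta&CH (2-1) \<V> k b&(ALL s:lists_of 2 \<V>. ref ta c s-dl b s:Idl J k (supp s))"
  by (intro exI[of _ \<W>] exI[of _ "ta \<circ> ta'"] exI[of _ ?b]) simp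
qed

lemma AA_empty: "AA {} k"
 unfolding AA_def
proof (intro allI impI)
 fix \<U> c assume U: "gcov \<U>" and C: "CH 1 \<U> k c" and c: "ALL s:lists_of 2 \<U>. dl c s:Idl {} k (supp s)"
 have o: "openin (zariski n) V" if "V:\<U>" for V using U that good_open by (auto simp: gcov_def)
 have "EX s:Sec k (proj_space n). ALL V:\<U>. rs V s = c [V]"
 proof (rule Sec_glue)
  show "\<Union>\<U> = proj_space n" using U by (simp add: gcov_def)
  show "c [V] : Sec k V" if "V:\<U>" for V using CHD[OF C single_list[OF that]] by simp
  fix V W assume VW: "V:\<U>" "W:\<U>"
  then have s: "[W, V] : lists_of 2 \<U>" by (simp add: lists_of_def)
  have "dl c [W, V]=0" using c s Idl_empty[OF gcov_open[OF U s]] by auto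
  moreover have "supp [W, V]=V \<inter> W" by (auto simp: supp_def)
  ultimately show "rs (V \<inter> W) (c [V])=rs (V \<inter> W) (c [W])"
  unfolding dl_def by (simp add: numeral_2_eq_2 face_def)
 qed (rule o)
 then obtain x where x: "x:Sec k (proj_space n)" "!!V. V:\<U> ==> rs V x = c [V]" by blast
 have "rs V x-rs V (c [id V]):Idl {} k V" if V: "V:\<U>" for V
  using x(2)[OF V] rs_rs[of V V x] Idl_empty[OF o[OF V]] by simp
 moreover have "refinement \<U> \<U> id" by (simp add: refinement_def)
 ultimately show "EX \<V> ta x. gcov \<V> & refinement \<V> \<U> ta&x:Sec k (proj_space n)&(ALL V:\<V>. rs V x-rs V (c [ta V]):Idl {} k V)"
  using U x(1) by blast
qed

lemma CC_empty: "CC {} k"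
 unfolding CC_def
proof (intro allI impI)
 fix \<U> x assume U: "gcov \<U>" and X: "x:Sec k (proj_space n)" and x: "ALL U:\<U>. rs U x:Idl {} k U"
 have "x y v=0" for y v
 proof (cases "v:\<Union>(proj_space n)")
  case True
  then obtain V where V: "V:\<U>" "v:\<Union>V" using U unfolding gcov_def by blast
  have "rs V x=0" using x V(1) Idl_empty good_open U unfolding gcov_def by blast
  then have "rs V x y v=0" by simp
  then show ?thesis using V(2) by (auto simp: rs_def split: if_splits)
 next
  case False
  then show ?thesis using SecD(3)[OF X, of "fst y" "snd y" v] by simp
 qed
 then have "x=0" by (simp add: fun_eq_iff)
 then show "x:Idl {} k (proj_space n)" using Idl_empty[OF openX] by simp
qed

text \<open>If the quotient has no sections at all, the zero section is a lift.\<close>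

lemma AA_vanishing: assumes "VV J 1 k" shows "AA J k"
 unfolding AA_def
proof (intro allI impI)
 fix \<U> c assume U: "gcov \<U>" and C: "CH 1 \<U> k c" and c: "ALL s:lists_of 2 \<U>. dl c s:Idl J k (supp s)"
 obtain \<V> ta b where b: "gcov \<V>" "refinement \<V> \<U> ta" "CH 0 \<V> k b" "!!s. s:lists_of 1 \<V> ==> ref ta c s-dl b s:Idl J k (supp s)"
  using assms[unfolded VV_def, rule_format, OF U C] c by (auto simp: numeral_2_eq_2)
 have "rs V 0-rs V (c [ta V]):Idl J k V" if V: "V:\<V>" for V
 proof -
  have o: "openin (zariski n) V" using b(1) V good_open by (auto simp: gcov_def)
  have "b []=0" using b(3) by (simp add: CH_def lists_of_def)
  then have "dl b [V]=0" by (simp add: dl_def face_def lin_0[OF lin_rs])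
  then have "rs V (c [ta V]):Idl J k V" using b(4)[OF single_list[OF V]] by (simp add: ref_def)
  from fv.subspace_neg[OF subspace_Idl[OF o] this] show ?thesis by (simp add: lin_0[OF lin_rs])
 qed
 with b(1,2) fv.subspace_0[OF subspace_Sec[OF openX]]
 show "EX \<V> ta x. gcov \<V> & refinement \<V> \<U> ta&x:Sec k (proj_space n)&(ALL V:\<V>. rs V x-rs V (c [ta V]):Idl J k V)" by blast
qed

section \<open>Quotients supported at one point\<close>

text \<open>The forms \<open>ff j\<close>, \<open>j \<noteq> l\<close>, vanish together only at one point, so a cover can be refined to one in
  which all but one member avoid that point.\<close>

definition apex :: vec where "apex=(%i. if i=l then 1 else if i<=n then lam i else 0)"

lemma apex_cone: "apex:pcone n"
 using l by (auto simp: apex_def pcone_def)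

lemma ff_apex: "j<=n==>j~=l==>ff j apex=0"
 using a by (simp add: ff_def shear_def apex_def)

lemma ff_l_apex: "ff l apex=1"
 by (simp add: ff_def shear_def apex_def)

lemma ff_separates:
 assumes P: "P:proj_space n" "P~=pt apex" shows "EX j:{..n}-{l}. P:bas n (ff j)"
proof (rule ccontr)
 assume none: "~?thesis"
 obtain v where v: "v:pcone n" "P=pt v" using P(1) by (auto simp: proj_space_pt)
 have "v j=lam j * v l" if "j<=n" "j~=l" for j
 proof -
  have "ff j v=0" using none that v pt_in_bas[OF hform_ff[OF that(1)], of v] P(1) by blast
  then show ?thesis using that by (simp add: ff_def shear_def)
 qed
 then have "v i = v l * apex i" for i using v(1) by (cases "i=l"; cases "i<=n") (simp_all add: apex_def pcone_def)
 then have eq: "v=(%i. v l * apex i)" by (rule ext)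
 have "v l~=0"
 proof
  assume "v l=0"
  then have "v i=0" for i using fun_cong[OF eq, of i] by simp
  then show False using v(1) by (simp add: pcone_def)
 qed
 then have "pt v=pt apex" using pt_scale[of "v l" apex] eq by metis
 then show False using v(2) P(2) by simp
qed

lemma good_refine:
 assumes U: "gcov \<U>" and U0: "U0:\<U>" "pt apex:U0"
 shows "EX \<V> ta. gcov \<V> & refinement \<V> \<U> ta&U0:\<V> & ta U0=U0&(ALL V:\<V>. V~=U0-->(EX j:{..n}-{l}. V \<subseteq> bas n (ff j)))"
proof -
 define \<V> where "\<V> = insert U0 {U \<inter> bas n (ff j) | U j. U:\<U> & j:{..n}-{l}}"
 define ta where "ta=(%V. if V=U0 then U0 else SOME U. U:\<U> & V \<subseteq> U)"
 have goods: "!!U. U:\<U> ==> good U" using U by (simp add: gcov_def)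
 have "gcov \<V>"
  unfolding gcov_def
 proof (intro conjI ballI)
  show "good V" if "V:\<V>" for V
  using that goods U0 unfolding \<V>_def by (auto intro!: good_Int_bas[OF _ hform_ff])
  show "\<Union>\<V> = proj_space n"
  proof
  show "\<Union>\<V> \<subseteq> proj_space n" using U U0 unfolding \<V>_def gcov_def by blast
  show "proj_space n \<subseteq> \<Union>\<V>"
  proof
  fix P assume P: "P:proj_space n"
  show "P:\<Union>\<V>"
  proof (cases "P=pt apex")
  case True then show ?thesis using U0 by (auto simp: \<V>_def)
  next
  case False
  obtain j where "j:{..n}-{l}" "P:bas n (ff j)" using ff_separates[OF P False] by blast
  moreover obtain V where "V:\<U>" "P:V" using U P unfolding gcov_def by blast
  ultimately show ?thesis unfolding \<V>_def by blast
  qed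
  qed
  qed
 qed
 moreover have "refinement \<V> \<U> ta"
  unfolding refinement_def
 proof
  fix V assume V: "V:\<V>"
  show "ta V:\<U> & V \<subseteq> ta V"
  proof (cases "V=U0")
  case True then show ?thesis using U0 by (simp add: ta_def)
  next
  case False
  then have "EX U. U:\<U> & V \<subseteq> U" using V unfolding \<V>_def by blast
  from someI_ex[OF this] show ?thesis using False by (simp add: ta_def)
  qed
 qed
 moreover have "ALL V:\<V>. V~=U0-->(EX j:{..n}-{l}. V \<subseteq> bas n (ff j))" unfolding \<V>_def by blast
 ultimately show ?thesis by (intro exI[of _ \<V>] exI[of _ ta]) (simp add: \<V>_def ta_def)
qed

text \<open>On the refined cover only \<open>U0\<close> meets no \<open>bas n (ff j)\<close>
  condition. An intersection involving another member has some invertible \<open>ff j\<close>, so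
  the ideal is everything there and nothing has to be shown; the only remaining list is
  \<open>[U0, U0]\<close>.\<close>

theorem VV_point: "VV ({..n}-{l}) 2 k"
 unfolding VV_def
proof (intro allI impI)
 let ?J = "{..n}-{l}"
 fix \<U> c assume U: "gcov \<U>" and C: "CH 2 \<U> k c" and c: "ALL s:lists_of (Suc 2) \<U>. dl c s:Idl ?J k (supp s)"
 have finJ: "finite ?J" by simp
 obtain U0 where U0: "U0:\<U>" "pt apex:U0" using U pt_in[OF apex_cone] unfolding gcov_def by blast
 from good_refine[OF U U0] obtain \<V> ta where V: "gcov \<V>" "refinement \<V> \<U> ta" "U0:\<V>" "ta U0=U0"
  and sep: "ALL V:\<V>. V~=U0-->(EX j:?J. V \<subseteq> bas n (ff j))" by (elim exE conjE)
 have "ref ta c s-dl (%_. 0) s:Idl ?J k (supp s)" if s: "s:lists_of 2 \<V>" for s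
 proof -
  obtain V W where s': "s=[V, W]" "V:\<V>" "W:\<V>" using s by (auto simp: lists_of_def length_Suc_conv numeral_2_eq_2)
  note o = gcov_open[OF V(1) s zero_less_numeral]
  have z: "dl (%_. 0 :: 'i \<times> nat=>vec=>complex) s=0" by (simp add: dl_def lin_0[OF lin_rs])
  have "ref ta c s:Idl ?J k (supp s)"
  proof (cases "V=U0&W=U0")
  case True
  \<comment> \<open>Cochains need not be alternating, so the value on \<open>[U0, U0]\<close> has to
    be treated. Its three faces in this triple carry the signs +, -, +, and the cocycle condition
    puts the value itself into the ideal.\<close>
  let ?s = "[U0, U0, U0]"
  have s3: "?s:lists_of (Suc 2) \<U>" using U0 by (simp add: lists_of_def)
  have su: "supp ?s=U0" "supp [U0, U0]=U0" by (auto simp: supp_def)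
  have "dl c ?s=rs U0 (c [U0, U0])"
  unfolding dl_def su by (simp add: numeral_3_eq_3 numeral_2_eq_2 face_def)
  moreover have "ref ta c s=rs U0 (c [U0, U0])" using True V(4) s' su by (simp add: ref_def)
  ultimately show ?thesis using bspec[OF c s3] True su by (simp add: s')
  next
  case False
  have sub: "supp s \<subseteq> V" "supp s \<subseteq> W" unfolding s'(1) supp_def by auto
  have "EX j:?J. V \<subseteq> bas n (ff j) \<or> W \<subseteq> bas n (ff j)"
  proof (cases "V=U0")
  case True
  with False have "W~=U0" by simp
  with bspec[OF sep s'(3)] show ?thesis by blast
  next
  case False
  with bspec[OF sep s'(2)] show ?thesis by blast
  qed
  then obtain j where j: "j : ?J" "supp s \<subseteq> bas n (ff j)" using sub by (elim bexE disjE) (rule that, assumption, erule (1) subset_trans)+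
  show ?thesis
  proof (rule Idl_unit[OF o j(2,1) _ finJ])
  show "j<=n" using j(1) by simp
  show "ref ta c s:Sec k (supp s)" by (rule CHD[OF CH_ref[OF V(1,2) zero_less_numeral C] s]) simp
  qed
  qed
  then show ?thesis unfolding z by simp
 qed
 moreover have "CH (2-1) \<V> k (%_. 0)"
  by (rule CHI) (use fv.subspace_0[OF subspace_Sec] gcov_open[OF V(1)] in auto)
 ultimately show "EX \<V> ta b. gcov \<V> & refinement \<V> \<U> ta&CH (2-1) \<V> k b&(ALL s:lists_of 2 \<V>. ref ta c s-dl b s:Idl ?J k (supp s))"
  using V(1,2) by blast
qed

end

section \<open>Comparison with the cohomology of the twisted bundle\<close>

lemma lreg_homogeneous:
 assumes "lreg n k P ph" "v:P" "P:proj_space n" "c~=0" shows "ph (%i. c * v i) = c powi k * ph v"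
proof -
 obtain W d F G where *: "P:W" "hz (Suc n) (int d + k) F" "hform (Suc n) d G" "!!Q v. Q:W==>v:Q==>G v~=0&ph v * G v=F v"
  using assms(1) unfolding lreg_def by blast
 have "(%i. c * v i):pt v" using assms(4) unfolding pt_def by blast
 then have cv: "(%i. c * v i):P" using in_proj(2)[OF assms(3,2)] by simp
 have F: "F (%i. c * v i) = c powi (int d + k) * F v"
  using *(2)
 proof (cases rule: hz_cases)
  case (1 e)
  then show ?thesis using hform_homogeneous[OF 1(2)] by (simp flip: 1(1))
 qed simp
 have "ph (%i. c * v i) * (c ^ d * G v) = c powi (int d + k) * (ph v * G v)"
  using *(4)[OF *(1) cv] *(4)[OF *(1) assms(2)] F hform_homogeneous[OF *(3)] by simp
 then have "(ph (%i. c * v i) - c powi k * ph v) * (c ^ d * G v)=0"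
  using assms(4) by (simp add: power_int_add algebra_simps)
 then show ?thesis using *(4)[OF *(1) assms(2)] assms(4) by simp
qed

lemma regular_if_lreg:
 assumes U: "openin (zariski n) U" and ph: "!!P. P:U==>lreg n 0 P ph" and f: "!!P v. P:U==>v:P==>f P=ph v"
 shows "regular n U f"
 unfolding regular_def
proof
 fix P assume P: "P:U"
 obtain W d F G where *: "openin (zariski n) W" "P:W" "hz (Suc n) (int d+0) F" "hform (Suc n) d G" "!!Q v. Q:W==>v:Q==>G v~=0&ph v * G v=F v"
  using ph[OF P] unfolding lreg_def by blast
 have "ALL Q:W \<inter> U. ALL v:Q. G v~=0&f Q=F v / G v" using *(5) f by (force simp: field_simps)
 moreover have "form n d F" "form n d G" using *(3,4) by (simp_all add: form_iff_hform hz_int_iff)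
 ultimately show "EX W d F G. openin (zariski n) W&P:W&W \<subseteq> U&form n d F&form n d G&(ALL Q:W. ALL v:Q. G v~=0&f Q=F v / G v)"
  using openin_Int[OF *(1) U] P *(2) by (intro exI[of _ "W \<inter> U"] exI[of _ d] exI[of _ F] exI[of _ G]) auto
qed

lemma lreg_var_powi:
 assumes P: "P:bas n (%v. v l)" and l: "l<=n" shows "lreg n k P (%v. v l powi k)"
proof -
 have Pp: "P:proj_space n" using P by (simp add: bas_def)
 have h: "hform (Suc n) j (%v. v l ^ j)" for j using hform_power[OF hform_var[of l "Suc n"], of j] l by simp
 show ?thesis
 proof (cases "k >= 0")
  case True
  then have "(%v. v l powi k)=(%v :: vec. v l ^ nat k)" by (simp add: power_int_def)
  then show ?thesis using lreg_hz[OF Pp hz_hform[OF h[of "nat k"]]] True by simp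
 next
  case False
  then have "(%v. v l powi k)=(%v :: vec. 1 / v l ^ nat (- k))" by (simp add: power_int_def divide_inverse power_inverse)
  moreover have "P:bas n (%v. v l ^ nat (- k))" using P by (simp add: bas_def)
  ultimately show ?thesis using lreg_inverse[OF Pp h[of "nat (- k)"]] False by simp
 qed
qed

context algebraic_bundle
begin

definition rep :: "point=>vec" where "rep P=(SOME v. v:P)"

lemma rep_in: "P:proj_space n==>rep P:P"
 unfolding rep_def using proj_space_nonempty by (metis someI_ex)

text \<open>Dehomogenisation: on the chart where coordinate \<open>l\<close> is nonzero a section is
  divided by the \<open>k\<close>-th power of that coordinate. The representative \<open>rep\<close>
  is the one chosen in \<open>coord_ratio\<close>, so the transition functions match
  literally.\<close>

definition Th :: "int=>('i \<times> nat=>vec=>complex)=>'i \<times> nat=>point=>nat=>complex" where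
 "Th k sg=(%(i, l) P b. if i:charts E&l<=n&P:chart E i&b<rk&P:bas n (%v. v l)
  then sg (i, b) (rep P) / rep P l powi k else 0)"

text \<open>The inverse of \<open>Th\<close>. The least nonzero coordinate is only a definite choice
  of a chart of O(k); by the transition rule any other gives the same value
  (\<open>Ti_eq\<close>).\<close>

definition Ti :: "int=>('i \<times> nat=>point=>nat=>complex)=>'i \<times> nat=>vec=>complex" where
 "Ti k s=(%(i, b) v. if v:pcone n then s (i, LEAST l. v l~=0) (pt v) b * v (LEAST l. v l~=0) powi k else 0)"

abbreviation "TS k \<equiv> section_sheaf n (twist n E k)"

lemma twist_simps [simp]:
 "bundle_rank (twist n E k)=rk" "charts (twist n E k) = charts E \<times> {..n}"
 "chart (twist n E k) (i, l) = chart E i \<inter> bas n (%v. v l)"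
 "transition (twist n E k) (i, l) (i', l') P b c=transition E i i' P b c * (rep P l' / rep P l) powi k"
 by (simp_all add: twist_def tensor_bundle_def twisting_def bas_def coord_ratio_def rep_def Let_def)

lemma sec_TS [simp]: "sec (TS k) = sections n (twist n E k)" and res_TS [simp]: "res (TS k) U V s=(%i P a. if P:V then s i P a else 0)"
 by (simp_all add: section_sheaf_def)

lemma Th_eq:
 assumes sg: "sg : Sec k U" and U: "openin (zariski n) U" and *: "i:charts E" "l<=n" "P:U" "P:chart E i" "b<rk" "v:P" "v l~=0"
 shows "Th k sg (i, l) P b = sg (i, b) v / v l powi k"
proof -
 have P: "P:proj_space n" using *(3) open_sub[OF U] by blast
 have Pv: "P=pt v" by (rule in_proj(2)[OF P *(6)])
 obtain c where c: "c~=0" "rep P=(%i. c * v i)" using rep_in[OF P] unfolding Pv pt_def by auto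
 have "P:bas n (%v. v l)" using pt_in_bas[OF hform_var, of l n v] *(2,7) P Pv by simp
 then have "Th k sg (i, l) P b=(c powi k * sg (i, b) v) / (c powi k * v l powi k)"
  using * lreg_homogeneous[OF SecD(1)[OF sg *(1,5,3,4)] *(6) P c(1)]
  by (simp add: Th_def c(2) power_int_mult_distrib)
 then show ?thesis using c(1) by simp
qed

lemma Th_sections:
 assumes sg: "sg : Sec k U" and U: "openin (zariski n) U" shows "Th k sg : sections n (twist n E k) U"
proof -
 have 1: "regular n (U \<inter> (chart E i \<inter> bas n (%v. v l))) (%P. Th k sg (i, l) P b)" if "i:charts E" "l<=n" "b<rk" for i l b
 proof (rule regular_if_lreg)
  have hl: "hform (Suc n) 1 (%v. v l)" using that hform_var by simp
  show "openin (zariski n) (U \<inter> (chart E i \<inter> bas n (%v. v l)))"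
  by (intro openin_Int U chart_open that open_bas[OF hl])
  fix P assume P: "P:U \<inter> (chart E i \<inter> bas n (%v. v l))"
  show "lreg n 0 P (%v. sg (i, b) v * v l powi (- k))"
  by (rule lreg_mult'[OF SecD(1)[OF sg] lreg_var_powi]) (use that P in auto)
  fix v assume v: "v:P"
  then have "v l~=0" using P by (auto simp: bas_def)
  then show "Th k sg (i, l) P b = sg (i, b) v * v l powi (- k)"
  using Th_eq[OF sg U that(1,2) _ _ that(3) v] P by (simp add: power_int_minus divide_inverse)
 qed
 have 2: "Th k sg (i, l) P b=(SUM c<rk. transition E i j P b c * (rep P l' / rep P l) powi k * Th k sg (j, l') P c)"
  if *: "i:charts E" "l<=n" "j:charts E" "l'<=n" "b<rk" "P:U" "P:chart E i" "P:bas n (%v. v l)" "P:chart E j" "P:bas n (%v. v l')" for i j l l' P b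
 proof -
  have r: "rep P:P" using rep_in open_sub[OF U] *(6) by blast
  have nz: "rep P l~=0" "rep P l'~=0" using r *(8,10) by (auto simp: bas_def)
  have "Th k sg (i, l) P b=(SUM c<rk. transition E i j P b c * sg (j, c) (rep P)) / rep P l powi k"
  unfolding Th_eq[OF sg U *(1,2,6,7,5) r nz(1)] using SecD(2)[OF sg *(1,3,6,7,9) r *(5)] by simp
  also have "... = (SUM c<rk. transition E i j P b c * (rep P l' / rep P l) powi k * (sg (j, c) (rep P) / rep P l' powi k))"
  unfolding sum_divide_distrib using nz by (intro sum.cong refl) (simp add: power_int_divide_distrib)
  also have "... = (SUM c<rk. transition E i j P b c * (rep P l' / rep P l) powi k * Th k sg (j, l') P c)"
  by (intro sum.cong refl) (use Th_eq[OF sg U *(3,4,6,9) _ r nz(2)] in simp)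
  finally show ?thesis .
 qed
 have 3: "Th k sg (i, l) P b=0" if "~(i:charts E&l<=n&P:U&P:chart E i&P:bas n (%v. v l)&b<rk)" for i l P b
 proof (cases "i:charts E&l<=n&P:chart E i&b<rk&P:bas n (%v. v l)")
  case True
  then have PU: "P~:U" using that by blast
  have P: "P:proj_space n" using True by (simp add: bas_def)
  have "rep P~:\<Union>(U \<inter> chart E i)"
  proof
  assume "rep P:\<Union>(U \<inter> chart E i)"
  then obtain Q where Q: "Q:U" "rep P:Q" by blast
  then have "Q=P" using in_proj(2) rep_in[OF P] P open_sub[OF U] by blast
  with Q PU show False by simp
  qed
  then show ?thesis using SecD(3)[OF sg, of i b "rep P"] by (simp add: Th_def)
 qed (auto simp: Th_def)
 show ?thesis
  unfolding sections_def
 proof (intro CollectI conjI ballI allI impI)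
  fix x b assume "x:charts (twist n E k)" "b<bundle_rank (twist n E k)"
  then show "regular n (U \<inter> chart (twist n E k) x) (%P. Th k sg x P b)"
  using 1[of "fst x" "snd x" b] by (cases x) simp
 next
  fix x y P b assume "x:charts (twist n E k)" "y:charts (twist n E k)" "P:U \<inter> chart (twist n E k) x \<inter> chart (twist n E k) y" "b<bundle_rank (twist n E k)"
  then show "Th k sg x P b=(SUM c<bundle_rank (twist n E k). transition (twist n E k) x y P b c * Th k sg y P c)"
  using 2[of "fst x" "snd x" "fst y" "snd y" b P] by (cases x; cases y) simp
 next
  fix x P b assume "~(x:charts (twist n E k)&P:U \<inter> chart (twist n E k) x&b<bundle_rank (twist n E k))"
  then show "Th k sg x P b=0" using 3[of "fst x" "snd x" P b] by (cases x) auto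
 qed
qed

lemma sectionsD:
 assumes s: "s:sections n (twist n E k) U"
 shows "i:charts E==>l<=n==>b<rk==>regular n (U \<inter> (chart E i \<inter> bas n (%v. v l))) (%P. s (i, l) P b)"
  "i:charts E==>l<=n==>j:charts E==>l'<=n==>P:U==>P:chart E i==>P:bas n (%v. v l)==>P:chart E j==>P:bas n (%v. v l')==>b<rk ==>
  s (i, l) P b=(SUM c<rk. transition E i j P b c * (rep P l' / rep P l) powi k * s (j, l') P c)"
  "~(i:charts E&l<=n&P:U&P:chart E i&P:bas n (%v. v l)&b<rk)==>s (i, l) P b=0"
proof -
 note ss = s[unfolded sections_def mem_Collect_eq twist_simps(1,2)]
 note A = conjunct1[OF ss] and B = conjunct1[OF conjunct2[OF ss]] and C = conjunct2[OF conjunct2[OF ss]]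
 show "regular n (U \<inter> (chart E i \<inter> bas n (%v. v l))) (%P. s (i, l) P b)" if "i:charts E" "l<=n" "b<rk"
  using bspec[OF A, of "(i, l)"] that by simp
 show "s (i, l) P b=(SUM c<rk. transition E i j P b c * (rep P l' / rep P l) powi k * s (j, l') P c)"
  if "i:charts E" "l<=n" "j:charts E" "l'<=n" "P:U" "P:chart E i" "P:bas n (%v. v l)" "P:chart E j" "P:bas n (%v. v l')" "b<rk"
  using bspec[OF bspec[OF B, of "(i, l)"], of "(j, l')"] that by simp
 show "s (i, l) P b=0" if "~(i:charts E&l<=n&P:U&P:chart E i&P:bas n (%v. v l)&b<rk)"
  using C[rule_format, of "(i, l)" P b] that by auto
qed

lemma Ti_eq:
 assumes s: "s:sections n (twist n E k) U" and U: "openin (zariski n) U"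
  and *: "i:charts E" "l<=n" "P:U" "P:chart E i" "b<rk" "v:P" "v l~=0"
 shows "Ti k s (i, b) v = s (i, l) P b * v l powi k"
proof -
 have P: "P:proj_space n" using *(3) open_sub[OF U] by blast
 have Pv: "P=pt v" "v:pcone n" using in_proj[OF P *(6)] by blast+
 obtain c where c: "c~=0" "rep P=(%i. c * v i)" using rep_in[OF P] unfolding Pv pt_def by auto
 let ?l = "LEAST l. v l~=0"
 have l': "v ?l~=0" by (rule LeastI[of "%l. v l~=0", OF *(7)])
 have "?l<=l" by (rule Least_le[of "%l. v l~=0", OF *(7)])
 then have ln: "?l<=n" using *(2) by simp
 have bas: "P:bas n (%v. v j)" if "j<=n" "v j~=0" for j
  using pt_in_bas[OF hform_var, of j n v] that P Pv by simp
 have "s (i, ?l) P b=(SUM d<rk. transition E i i P b d * (rep P l / rep P ?l) powi k * s (i, l) P d)"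
  by (rule sectionsD(2)[OF s *(1) ln *(1,2,3,4) bas[OF ln l'] *(4) bas[OF *(2,7)] *(5)])
 also have "... = (SUM d<rk. if d=b then (rep P l / rep P ?l) powi k * s (i, l) P b else 0)"
  by (intro sum.cong refl) (use transition_self[OF *(1,4,5)] in auto)
 also have "... = (v l / v ?l) powi k * s (i, l) P b" using *(5) c by simp
 finally show ?thesis using Pv l' by (simp add: Ti_def power_int_divide_distrib)
qed

lemma Ti_Sec:
 assumes s: "s:sections n (twist n E k) U" and U: "openin (zariski n) U" shows "Ti k s:Sec k U"
proof (rule SecI)
 fix i b P assume *: "i:charts E" "b<rk" "P:U" "P:chart E i"
 then have P: "P:proj_space n" using open_sub[OF U] by blast
 obtain v where v: "v:pcone n" "P=pt v" using P by (auto simp: proj_space_pt)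
 obtain l where l: "l<=n" "v l~=0" using v(1) by (auto simp: pcone_def)
 have hl: "hform (Suc n) 1 (%v. v l)" using l hform_var by simp
 have Pl: "P:bas n (%v. v l)" using pt_in_bas[OF hl, of v] l P v by simp
 let ?W = "U \<inter> (chart E i \<inter> bas n (%v. v l))"
 have W: "openin (zariski n) ?W" by (intro openin_Int U chart_open * open_bas[OF hl])
 have PW: "P : ?W" using * Pl by blast
 have "lreg n k P (%v. s (i, l) (pt v) b * v l powi k)"
  by (rule lreg_mult'[OF regular_lreg[OF sectionsD(1)[OF s *(1) l(1) *(2)] PW] lreg_var_powi[OF Pl l(1)]]) simp
 then show "lreg n k P (Ti k s (i, b))"
 proof (rule lreg_cong[OF _ W PW])
  fix w assume "w:\<Union>?W"
  then obtain Q where Q: "Q : ?W" "w:Q" by blast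
  then have "w l~=0" by (auto simp: bas_def)
  moreover have "Q=pt w" using in_proj(2) Q open_sub[OF U] by blast
  ultimately show "Ti k s (i, b) w = s (i, l) (pt w) b * w l powi k" using Ti_eq[OF s U *(1) l(1) _ _ *(2) Q(2)] Q by blast
 qed
next
 fix i j P v b assume *: "i:charts E" "j:charts E" "P:U" "P:chart E i" "P:chart E j" "v:P" "b<rk"
 have P: "P:proj_space n" using *(3) open_sub[OF U] by blast
 have Pv: "P=pt v" "v:pcone n" using in_proj[OF P *(6)] by blast+
 obtain l where l: "l<=n" "v l~=0" using Pv(2) by (auto simp: pcone_def)
 have Pl: "P:bas n (%v. v l)" using pt_in_bas[OF hform_var, of l n v] l P Pv by simp
 have rl: "rep P l~=0" using rep_in[OF P] Pl by (auto simp: bas_def)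
 have "Ti k s (i, b) v=(SUM c<rk. transition E i j P b c * (rep P l / rep P l) powi k * s (j, l) P c) * v l powi k"
  unfolding Ti_eq[OF s U *(1) l(1) *(3,4,7,6) l(2)] using sectionsD(2)[OF s *(1) l(1) *(2) l(1) *(3,4) Pl *(5) Pl *(7)] by simp
 also have "... = (SUM c<rk. transition E i j P b c * Ti k s (j, c) v)"
  unfolding sum_distrib_right by (intro sum.cong refl) (use rl Ti_eq[OF s U *(2) l(1) *(3,5) _ *(6) l(2)] in simp)
 finally show "Ti k s (i, b) v=(SUM c<rk. transition E i j P b c * Ti k s (j, c) v)" .
next
 fix i b v assume *: "~(i:charts E&b<rk&v:\<Union>(U \<inter> chart E i))"
 show "Ti k s (i, b) v=0"
 proof (cases "v:pcone n")
  case True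
  have "s (i, LEAST l. v l~=0) (pt v) b=0"
  by (rule sectionsD(3)[OF s]) (use * pt_self[of v] in blast)
  then show ?thesis by (simp add: Ti_def)
 qed (simp add: Ti_def)
qed

lemma Ti_Th: assumes sg: "sg : Sec k U" and U: "openin (zariski n) U" shows "Ti k (Th k sg) = sg"
proof (rule ext, rule ext)
 fix x :: "'i \<times> nat" and v
 obtain i b where x: "x=(i, b)" by (cases x)
 show "Ti k (Th k sg) x v = sg x v"
 proof (cases "i:charts E&b<rk&v:\<Union>(U \<inter> chart E i)")
  case True
  then obtain P where *: "i:charts E" "b<rk" "P:U" "P:chart E i" "v:P" by blast
  have P: "P:proj_space n" using *(3) open_sub[OF U] by blast
  obtain l where l: "l<=n" "v l~=0" using in_proj(1)[OF P *(5)] by (auto simp: pcone_def)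
  show ?thesis
  using Ti_eq[OF Th_sections[OF sg U] U *(1) l(1) *(3,4,2,5) l(2)] Th_eq[OF sg U *(1) l(1) *(3,4,2,5) l(2)] l(2) by (simp add: x)
 next
  case False
  then show ?thesis using SecD(3)[OF sg False] SecD(3)[OF Ti_Sec[OF Th_sections[OF sg U] U] False] by (simp add: x)
 qed
qed

lemma Th_sum: "Th k (SUM j:J. scl (c j) (sg j))=(%x P b. SUM j:J. c j * Th k (sg j) x P b)"
 by (rule ext, rule ext, rule ext) (auto simp: Th_def sum_apply2 scl_def sum_divide_distrib)

lemma Ti_sum: "Ti k (%x P b. SUM j:J. c j * s j x P b)=(SUM j:J. scl (c j) (Ti k (s j)))"
 by (rule ext, rule ext) (auto simp: Ti_def sum_apply2 scl_def sum_distrib_right mult.assoc)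

lemma Th_rs: assumes V: "openin (zariski n) V" shows "Th k (rs V sg)=(%x P b. if P:V then Th k sg x P b else 0)"
proof -
 have "rep P:\<Union>V \<longleftrightarrow> P:V" if "P:bas n f" for P f
 proof -
  have P: "P:proj_space n" using that by (simp add: bas_def)
  show ?thesis using in_Union_iff[OF open_sub[OF V]] in_proj[OF P rep_in[OF P]] by auto
 qed
 then have iff: "P:bas n f==>(rep P:\<Union>V)=(P:V)" for P f .
 show ?thesis
 proof (intro ext)
  fix x :: "'i \<times> nat" and P b
  obtain i l where x: "x=(i, l)" by (cases x)
  show "Th k (rs V sg) x P b=(if P:V then Th k sg x P b else 0)"
  unfolding x Th_def rs_def split_conv by (cases "P:bas n (%v. v l)") (simp_all add: iff del: Union_iff)
 qed
qed

lemma Ti_rs: assumes V: "openin (zariski n) V" shows "Ti k (%x P b. if P:V then s x P b else 0)=rs V (Ti k s)"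
 by (intro ext) (auto simp: Ti_def rs_def in_Union_iff[OF open_sub[OF V]] simp del: Union_iff)

lemma fun_sum: "(SUM j:J. (%x P b. F j x P b))=(%x P b. SUM j:J. (F j x P b :: complex))"
 by (induction J rule: infinite_finite_induct) (auto simp: fun_eq_iff)

lemma coboundary_TS:
 assumes s: "s:simplices \<U> (Suc q)"
 shows "coboundary (TS k) \<U> q c s=(%x P b. SUM j<length s. (-1) ^ j * (if P:supp s then c (face j s) x P b else 0))"
proof -
 have "length s=Suc (Suc q)" using s by (simp add: simplices_def)
 then have "{..Suc q}={..<length s}" by auto
 then have "coboundary (TS k) \<U> q c s=(SUM j<length s. (%x P b. (-1) ^ j * (if P:supp s then c (face j s) x P b else 0)))"
  unfolding coboundary_def using s by (simp add: Let_def) (intro sum.cong refl, auto simp: fun_eq_iff fun_Compl_def)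
 also have "... = (%x P b. SUM j<length s. (-1) ^ j * (if P:supp s then c (face j s) x P b else 0))"
  by (rule fun_sum)
 finally show ?thesis .
qed

lemma coboundary_Th:
 assumes s: "s:simplices \<U> (Suc q)" and U: "openin (zariski n) (supp s)" and c: "!!j. j<length s==>c (face j s)=Th k (c' (face j s))"
 shows "coboundary (TS k) \<U> q c s=Th k (dl c' s)"
 unfolding coboundary_TS[OF s] dl_def Th_sum Th_rs[OF U] using c by (intro ext sum.cong refl) simp

lemma Ti_coboundary:
 assumes s: "s:simplices \<U> (Suc q)" and U: "openin (zariski n) (supp s)"
 shows "Ti k (coboundary (TS k) \<U> q c s)=dl (%s. Ti k (c s)) s"
 unfolding coboundary_TS[OF s] dl_def Ti_rs[OF U, symmetric] by (rule Ti_sum)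

lemma supp_open:
 assumes "open_cover (zariski n) \<U>" "s:simplices \<U> q" shows "openin (zariski n) (supp s)"
proof -
 have "set s~={}" "finite (set s)" "ALL U:set s. openin (zariski n) U"
  using assms by (auto simp: simplices_def open_cover_def)
 then show ?thesis unfolding supp_def by (intro openin_Inter) auto
qed

lemma simplices_face: "s:simplices \<U> (Suc q)==>j<length s==>face j s:simplices \<U> q"
 using set_face[of j s] by (auto simp: simplices_def length_face)

text \<open>Unfolds the vanishing of the quotient group: the class of the transported cocycle must
  be the zero class, which supplies a refinement and a primitive. \<open>Ti\<close> carries both
  back to functions on the cone.\<close>

theorem cohomology_transfer:
 assumes van: "bundle_cohomology_vanishes n (twist n E k) q" and U: "open_cover (zariski n) \<U>"
  and c: "!!s. s:simplices \<U> q==>c s:Sec k (supp s)" and dc: "!!s. s:simplices \<U> (Suc q)==>dl c s=0"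
 shows "EX \<V> ta b. open_cover (zariski n) \<V> & refinement \<V> \<U> ta&b []=0&(ALL p. q=Suc p-->(ALL s:simplices \<V> p. b s:Sec k (supp s))) &
  (ALL s:simplices \<V> q. ref ta c s=dl b s)"
proof -
 let ?F = "TS k" and ?X = "zariski n"
 have Th0: "Th k 0=0" by (rule ext, rule ext, rule ext) (auto simp: Th_def)
 have res0: "(%i P a. if P:V then (0 :: 'i \<times> nat=>point=>nat=>complex) i P a else 0)=0" for V by (simp add: fun_eq_iff)
 define c' where "c'=(%s. if s:simplices \<U> q then Th k (c s) else 0)"
 have cc: "c':cochains ?F \<U> q"
  unfolding cochains_def using c Th_sections[OF _ supp_open[OF U]] by (auto simp: c'_def)
 have "coboundary ?F \<U> q c'=0"
 proof (rule ext)
  fix s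
  show "coboundary ?F \<U> q c' s=0 s"
  proof (cases "s:simplices \<U> (Suc q)")
  case True
  have "coboundary ?F \<U> q c' s=Th k (dl c s)"
  by (rule coboundary_Th[OF True supp_open[OF U True]]) (use simplices_face[OF True] in \<open>simp add: c'_def\<close>)
  then show ?thesis using dc[OF True] Th0 by simp
  qed (simp add: coboundary_def)
 qed
 with cc have cp: "(\<U>, c'):cocycle_pairs ?X ?F q" using U by (simp add: cocycle_pairs_def cocycles_def)
 have cb0: "0:coboundaries ?F \<V> q" if "open_cover ?X \<V>" for \<V>
 proof (cases q)
  case (Suc p)
  have "0:Sec k (supp s)" if "s:simplices \<V> p" for s
  by (rule fv.subspace_0[OF subspace_Sec[OF supp_open[OF \<open>open_cover ?X \<V>\<close> that]]])
  then have "0:sections n (twist n E k) (supp s)" if "s:simplices \<V> p" for s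
  using Th_sections[OF _ supp_open[OF \<open>open_cover ?X \<V>\<close> that]] that Th0 by metis
  then have "0:cochains ?F \<V> p" by (simp add: cochains_def)
  moreover have "coboundary ?F \<V> p 0=0"
  proof (rule ext)
  fix s
  show "coboundary ?F \<V> p 0 s=0 s"
  proof (cases "s:simplices \<V> (Suc p)")
  case True
  have "coboundary ?F \<V> p 0 s=Th k (dl (%_. 0) s)"
  by (rule coboundary_Th[OF True supp_open[OF \<open>open_cover ?X \<V>\<close> True]]) (simp add: Th0)
  also have "dl (%_. 0) s=(0 :: 'i \<times> nat=>vec=>complex)" by (simp add: dl_def lin_0[OF lin_rs])
  finally have e: "coboundary ?F \<V> p 0 s=Th k 0" .
  have "(0 :: point set list=>'i \<times> nat=>point=>nat=>complex) s=0" by simp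
  from trans[OF trans[OF e Th0] this[symmetric]] show ?thesis .
  qed (simp add: coboundary_def)
  qed
  ultimately show ?thesis unfolding coboundaries_def Suc by (simp add: image_iff) metis
 qed (simp add: coboundaries_def)
 have "open_cover ?X \<U> & refinement \<U> \<U> id&refinement \<U> \<U> id &
  refine_cochain ?F \<U> q id c'-refine_cochain ?F \<U> q id c':coboundaries ?F \<U> q"
  using U cb0[OF U] by (simp add: refinement_def)
 then have "((\<U>, c'), (\<U>, c')):cohomologous ?X ?F q"
  unfolding cohomologous_def mem_Collect_eq split_conv by (intro conjI cp) (rule exI, rule exI, rule exI, assumption)
 \<comment> \<open>The cocycle is cohomologous to itself through the identity refinement, so it
   belongs to its own class, which is the only class there is.\<close>
 then have "(\<U>, c'):cohomologous ?X ?F q `` {(\<U>, c')}" by blast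
 moreover have "cohomologous ?X ?F q `` {(\<U>, c')}:cohomology ?X ?F q"
  unfolding cohomology_def using cp by (rule quotientI)
 ultimately have "(\<U>, c'):cohomology_zero ?X ?F q"
  using van unfolding bundle_cohomology_vanishes_def by (metis singletonD)
 then have "(({topspace ?X}, (0 :: point set list=>'i \<times> nat=>point=>nat=>complex)), (\<U>, c')):cohomologous ?X ?F q" unfolding cohomology_zero_def by (rule Image_singleton_iff[THEN iffD1])
 then obtain \<V> ta0 ta where V: "open_cover ?X \<V>" "refinement \<V> \<U> ta"
  and d: "refine_cochain ?F \<V> q ta0 0-refine_cochain ?F \<V> q ta c':coboundaries ?F \<V> q"
  unfolding cohomologous_def mem_Collect_eq split_conv by (elim conjE exE)
 have "refine_cochain ?F \<V> q ta0 0=0" by (rule ext) (simp add: refine_cochain_def res0)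
 with d have d: "- refine_cochain ?F \<V> q ta c':coboundaries ?F \<V> q" by simp
 have sub: "ALL W:set s. W \<subseteq> ta W" "map ta s:simplices \<U> q" if "s:simplices \<V> q" for s
  using that V(2) by (auto simp: simplices_def refinement_def)
 have rc: "refine_cochain ?F \<V> q ta c' s=Th k (ref ta c s)" if s: "s:simplices \<V> q" for s
  unfolding ref_def Th_rs[OF supp_open[OF V(1) s]] using s sub(2)[OF s] by (simp add: refine_cochain_def c'_def)
 have rS: "ref ta c s:Sec k (supp s)" if s: "s:simplices \<V> q" for s
  unfolding ref_def by (rule Sec_rs[OF supp_open[OF V(1) s] supp_map[OF sub(1)[OF s]] c[OF sub(2)[OF s]]])
 have Ti_neg: "Ti k (- s) = - Ti k s" for s by (rule ext, rule ext) (auto simp: Ti_def)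
 have Tr: "Ti k (refine_cochain ?F \<V> q ta c' s)=ref ta c s" if s: "s:simplices \<V> q" for s
  unfolding rc[OF s] by (rule Ti_Th[OF rS[OF s] supp_open[OF V(1) s]])
 show ?thesis
 proof (cases q)
  case 0
  have "ref ta c s=dl (%_. 0) s" if s: "s:simplices \<V> q" for s
  proof -
  have "refine_cochain ?F \<V> q ta c'=0" using d by (simp add: coboundaries_def 0)
  then have "ref ta c s=Ti k 0" using Tr[OF s] by simp
  also have "... = 0" by (rule ext, rule ext) (auto simp: Ti_def)
  finally show ?thesis by (simp add: dl_def lin_0[OF lin_rs])
  qed
  with V 0 show ?thesis by (intro exI[of _ \<V>] exI[of _ ta] exI[of _ "%_. 0"]) simp
 next
  case (Suc p)
  then obtain b where b: "b:cochains ?F \<V> p" "- refine_cochain ?F \<V> q ta c' = coboundary ?F \<V> p b"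
  using d by (auto simp: coboundaries_def)
  define b' where "b'=(%s. if s=[] then 0 else-Ti k (b s))"
  have "ref ta c s=dl b' s" if s: "s:simplices \<V> q" for s
  proof -
  have len: "length s=Suc (Suc p)" using s Suc by (simp add: simplices_def)
  have "dl b' s=dl (%s. 0-Ti k (b s)) s"
  proof -
  have "face j s~=[]" if "j<length s" for j using length_face[OF that] len by (metis diff_Suc_1 list.size(3) nat.distinct(1))
  then show ?thesis unfolding dl_def by (intro sum.cong refl) (simp add: b'_def)
  qed
  also have "... = - dl (%s. Ti k (b s)) s"
  unfolding dl_diff by (simp add: dl_def lin_0[OF lin_rs])
  also have "dl (%s. Ti k (b s)) s=Ti k (coboundary ?F \<V> p b s)"
  by (rule Ti_coboundary[symmetric]) (use s Suc supp_open[OF V(1) s] in auto)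
  also have "- ... = Ti k (refine_cochain ?F \<V> q ta c' s)"
  unfolding b(2)[symmetric] by (simp add: Ti_neg)
  finally show ?thesis using Tr[OF s] by simp
  qed
  moreover have "b' s:Sec k (supp s)" if s: "s:simplices \<V> p" for s
  proof -
  have "b s:sections n (twist n E k) (supp s)" using b(1) s by (simp add: cochains_def)
  from fv.subspace_neg[OF subspace_Sec[OF supp_open[OF V(1) s]] Ti_Sec[OF this supp_open[OF V(1) s]]]
  show ?thesis using s by (auto simp: b'_def simplices_def)
  qed
  ultimately show ?thesis using V Suc
  by (intro exI[of _ \<V>] exI[of _ ta] exI[of _ b']) (auto simp: b'_def)
 qed
qed

end

context sheared_bundle
begin

text \<open>The cover supplied by cohomology is arbitrary, so it is refined once more, to all good
  sets contained in one of its members.\<close>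

theorem VV_empty:
 assumes "bundle_cohomology_vanishes n (twist n E k) q" shows "VV {} (Suc q) k"
 unfolding VV_def
proof (intro allI impI)
 fix \<U> c assume U: "gcov \<U>" and C: "CH (Suc q) \<U> k c" and c: "ALL s:lists_of (Suc (Suc q)) \<U>. dl c s:Idl {} k (supp s)"
 have sl: "simplices \<U> p=lists_of (Suc p) \<U>" for p \<U> by (auto simp: simplices_def lists_of_def)
 have oU: "open_cover (zariski n) \<U>" using U good_open by (auto simp: gcov_def open_cover_def topspace_zariski)
 have "dl c s=0" if "s:simplices \<U> (Suc q)" for s
  using c that Idl_empty[OF gcov_open[OF U, of s "Suc (Suc q)"]] unfolding sl by auto
 then obtain \<V> ta b where V: "open_cover (zariski n) \<V>" "refinement \<V> \<U> ta" "b []=0"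
  "!!p s. q=Suc p==>s:lists_of (Suc p) \<V> ==> b s:Sec k (supp s)" "!!s. s:lists_of (Suc q) \<V> ==> ref ta c s=dl b s"
  using cohomology_transfer[OF assms oU, of c] CHD[OF C] unfolding sl by (auto simp: Ball_def)
 define \<W> where "\<W> = {W. good W&(EX V:\<V>. W \<subseteq> V)}"
 define ta' where "ta'=(%W. SOME V. V:\<V> & W \<subseteq> V)"
 have W: "gcov \<W>"
  unfolding gcov_def
 proof
  show "ALL W:\<W>. good W" by (simp add: \<W>_def)
  show "\<Union>\<W> = proj_space n"
  proof
  show "\<Union>\<W> \<subseteq> proj_space n" unfolding \<W>_def using good_open open_sub by blast
  show "proj_space n \<subseteq> \<Union>\<W>"
  proof
  fix P assume "P:proj_space n"
  then obtain V where VP: "V:\<V>" "P:V" using V(1) by (auto simp: open_cover_def topspace_zariski)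
  then obtain W where "good W" "P:W" "W \<subseteq> V" using good_exists[of V P] V(1) by (auto simp: open_cover_def)
  then show "P:\<Union>\<W>" using VP unfolding \<W>_def by blast
  qed
  qed
 qed
 have ref': "refinement \<W> \<V> ta'"
  unfolding refinement_def
 proof
  fix W assume "W:\<W>"
  then have "EX V. V:\<V> & W \<subseteq> V" by (auto simp: \<W>_def)
  from someI_ex[OF this] show "ta' W:\<V> & W \<subseteq> ta' W" by (simp add: ta'_def)
 qed
 have "ref (ta \<circ> ta') c s-dl (ref ta' b) s:Idl {} k (supp s)" if s: "s:lists_of (Suc q) \<W>" for s
 proof -
  note sub = refinement_sub[OF ref' s]
  have "ref (ta \<circ> ta') c s=dl (ref ta' b) s"
  unfolding dl_ref[OF sub] ref_ref[OF sub, symmetric] using V(5)[OF refinement_lists[OF ref' s]] by (simp add: ref_def)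
  then show ?thesis using Idl_empty[OF gcov_open[OF W s]] by simp
 qed
 moreover have "CH (Suc q-1) \<W> k (ref ta' b)"
 proof (cases q)
  case 0
  then show ?thesis using V(3) by (simp add: CH_def lists_of_def ref_def lin_0[OF lin_rs])
 next
  case (Suc p)
  have "ref ta' b s:Sec k (supp s)" if "s:lists_of (Suc p) \<W>" for s
  by (rule Sec_ref[OF W ref' zero_less_Suc that V(4)[OF Suc]])
  then show ?thesis by (intro CHI) (simp_all add: Suc)
 qed
 ultimately show "EX \<V> ta b. gcov \<V> & refinement \<V> \<U> ta&CH (Suc q-1) \<V> k b&(ALL s:lists_of (Suc q) \<V>. ref ta c s-dl b s:Idl {} k (supp s))"
  using W refinement_comp[OF V(2) ref'] by blast
qed

end

section \<open>Section spaces of Ulrich bundles\<close>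

lemma finite_dependent:
 assumes S: "finite S" and T: "finite T" "card T < card S" and ps: "!!s. s:S==>ps s:fv.span T"
 shows "EX c. (EX s:S. c s~=0)&(SUM s:S. scl (c s) (ps s))=0"
proof (cases "inj_on ps S")
 case False
 then obtain x y where xy: "x:S" "y:S" "x~=y" "ps x=ps y" unfolding inj_on_def by blast
 let ?c = "%t. if t=x then 1 else if t=y then -1 else 0 :: complex"
 have "(SUM s:S. scl (?c s) (ps s))=(SUM s:{x, y}. scl (?c s) (ps s))"
  using S xy by (intro sum.mono_neutral_right) auto
 also have "... = 0" using xy by simp
 finally show ?thesis using xy(1) by (intro exI[of _ ?c]) auto
next
 case True
 have "~fv.independent (ps ` S)"
  using fv.independent_span_bound[OF T(1), of "ps ` S"] ps card_image[OF True] T(2) by auto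
 then obtain u where u: "EX v:ps ` S. u v~=0" "(SUM v:ps ` S. scl (u v) v)=0"
  unfolding fv.dependent_finite[OF finite_imageI[OF S]] not_not by (elim exE conjE)
 have "(SUM s:S. scl (u (ps s)) (ps s))=0"
  using u(2) unfolding sum.reindex[OF True] by (simp only: o_def)
 moreover have "EX s:S. u (ps s)~=0" using u(1) by (simp only: bex_simps)
 ultimately show ?thesis by (intro exI[of _ "%s. u (ps s)"] conjI)
qed

lemma findim_bounded:
 assumes "!!S. finite S==>fv.independent S==>S \<subseteq> V==>card S<=B" shows "findim V"
proof -
 obtain A where A: "A \<subseteq> V" "fv.independent A" "V \<subseteq> fv.span A" by (rule fv.maximal_independent_subset)
 have "finite A"
 proof (rule ccontr)
  assume "infinite A"
  then obtain S where S: "S \<subseteq> A" "finite S" "card S=Suc B" using infinite_arbitrarily_large by metis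
  then have "card S<=B" by (intro assms[OF S(2) fv.independent_mono[OF A(2) S(1)]] order_trans[OF S(1) A(1)])
  then show False using S(3) by simp
 qed
 with A(3) show ?thesis unfolding findim_def by (intro exI conjI)
qed

text \<open>Modulo the \<open>a\<close>-th powers of the coordinates other than \<open>l\<close>, a
  form is a combination of monomials of bounded degree times powers of v l. The number of spanning
  elements does not depend on \<open>d\<close>, because high-degree coefficients lie in the ideal by
  pigeonhole.\<close>

lemma hform_line_split:
 assumes F: "hform (Suc n) d F" and l: "l<=n" and a: "0<a"
 shows "EX G H. (ALL j:{..n}-{l}. hz (Suc n) (int d-int a) (H j))&(ALL v. F v=G v+(SUM j:{..n}-{l}. v j ^ a * H j v)) &
  (ALL b. single b G:fv.span (UN e<=Suc n * a. (%f. single b (%v. f v * v l ^ (d-e))) ` monomials (Suc n) e))"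
proof -
 let ?K = "{..n}-{l}" and ?L = "Suc n * a"
 obtain c where c: "!!k. k<=d==>hform (Suc n) (d - k) (c k)" "!!k v t. c k (v(l := t)) = c k v" "!!v. F v=(SUM k<=d. c k v * v l ^ k)"
  using hform_expand_var[OF F, of l] by blast
 define I where "I={k. k<=d&d - k<=?L}"
 define I' where "I'={k. k<=d&?L<d - k}"
 have fin: "finite I" "finite I'" and I: "{..d}=I \<union> I'" "I \<inter> I'={}" by (auto simp: I_def I'_def)
 have "ALL k:I'. EX g. (ALL j:?K. hz (Suc n) (int d-int k-int a) (g j))&(ALL v. c k v=(SUM j:?K. v j ^ a * g j v))"
 proof
  fix k assume k: "k:I'"
  then have kd: "k<=d" "Suc n * a<d - k" by (auto simp: I'_def)
  have ad: "a<=d - k" using kd(2) by simp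
  obtain g where g: "!!i. i<Suc n==>hform (Suc n) (d - k-a) (g i)" "!!v. c k v=(SUM i<Suc n. g i v * v i ^ a)"
  using hform_split_powers[OF c(1)[OF kd(1)] kd(2)] by blast
  have sub: "hform (Suc n) 1 (%v. (v(l := 0)) i)" if "i<Suc n" for i
  using that hform_var[OF that] by (cases "i=l") (simp_all add: hform.zero)
  show "EX g. (ALL j:?K. hz (Suc n) (int d-int k-int a) (g j))&(ALL v. c k v=(SUM j:?K. v j ^ a * g j v))"
  proof (intro exI[of _ "%j v. g j (v(l := 0))"] conjI ballI allI)
  fix j assume "j : ?K"
  then have "hform (Suc n) (d - k-a) (%v. g j (v(l := 0)))" by (intro hform_compose[OF g(1) sub]) auto
  from hz_hform[OF this] show "hz (Suc n) (int d-int k-int a) (%v. g j (v(l := 0)))"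
  using ad kd by (simp add: of_nat_diff algebra_simps)
  next
  fix v :: vec
  have "c k v=(SUM i<Suc n. g i (v(l := 0)) * (v(l := 0)) i ^ a)" using g(2)[of "v(l := 0)"] c(2) by simp
  also have "... = (SUM i:?K. g i (v(l := 0)) * (v(l := 0)) i ^ a)"
  using l a by (intro sum.mono_neutral_right) (auto simp: power_0_left)
  also have "... = (SUM j:?K. v j ^ a * g j (v(l := 0)))" by (intro sum.cong refl) auto
  finally show "c k v=(SUM j:?K. v j ^ a * g j (v(l := 0)))" .
  qed
 qed
 from bchoice[OF this] obtain g where gg: "ALL k:I'. (ALL j:?K. hz (Suc n) (int d-int k-int a) (g k j))&(ALL v. c k v=(SUM j:?K. v j ^ a * g k j v))" by (elim exE)
 let ?G = "%v. SUM k:I. c k v * v l ^ k" and ?H = "%j v. SUM k:I'. g k j v * v l ^ k"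
 have vl: "hform (Suc n) k (%v. v l ^ k)" for k using hform_power[OF hform_var[of l "Suc n"], of k] l by simp
 show ?thesis
 proof (intro exI[of _ ?G] exI[of _ ?H] conjI ballI allI)
  show "hz (Suc n) (int d-int a) (?H j)" if j: "j : ?K" for j
  by (rule hz_sum, rule hz_mult'[OF bspec[OF conjunct1[OF bspec[OF gg]] j] hz_hform[OF vl]]) simp_all
  show "F v=?G v+(SUM j:?K. v j ^ a * ?H j v)" for v
  proof -
  have "F v=?G v+(SUM k:I'. c k v * v l ^ k)" unfolding c(3) I(1) by (rule sum.union_disjoint[OF fin I(2)])
  also have "(SUM k:I'. c k v * v l ^ k)=(SUM k:I'. (SUM j:?K. v j ^ a * g k j v) * v l ^ k)"
  using gg by (intro sum.cong refl) simp
  also have "... = (SUM j:?K. v j ^ a * ?H j v)"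
  unfolding sum_distrib_right sum_distrib_left by (subst sum.swap) (simp only: mult.assoc)
  finally show ?thesis .
  qed
  fix b
  show "single b ?G:fv.span (UN e<=?L. (%f. single b (%v. f v * v l ^ (d-e))) ` monomials (Suc n) e)"
  unfolding single_sum
  proof (rule fv.span_sum)
  fix k assume k: "k:I"
  then have kd: "k<=d" "d - k<=?L" by (auto simp: I_def)
  have "(%f. single b (%v. f v * v l ^ (d-(d - k)))) ` monomials (Suc n) (d - k) \<subseteq> (UN e<=?L. (%f. single b (%v. f v * v l ^ (d-e))) ` monomials (Suc n) e)"
  using kd(2) by blast
  from subsetD[OF fv.span_mono[OF this]] single_span_monomials[OF c(1)[OF kd(1)], of b "%v. v l ^ (d-(d - k))"]
  have "single b (%v. c k v * v l ^ (d-(d - k))):fv.span (UN e<=?L. (%f. single b (%v. f v * v l ^ (d-e))) ` monomials (Suc n) e)" .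
  moreover have "d-(d - k) = k" using kd by simp
  ultimately show "single b (%v. c k v * v l ^ k):fv.span (UN e<=?L. (%f. single b (%v. f v * v l ^ (d-e))) ` monomials (Suc n) e)"
  by (simp only:)
  qed
 qed
qed

locale ulrich_sheared = sheared_bundle n E a l lam for n and E :: "'i vbundle" and a l lam +
 assumes hyp: "!!q p. p:{1..n}==>bundle_cohomology_vanishes n (twist n E (- int p * int a)) q"
  and n1: "1<=n"
begin

abbreviation "KK \<equiv> {..n}-{l}"
abbreviation "XX \<equiv> proj_space n"

lemma card_KK: "card KK=n" using l by simp

text \<open>Each element of \<open>J\<close> costs one more twist by - \<open>a\<close>, so the
  twists from p to p + card J are used; they must all lie in the range 1, ..., n of the
  hypothesis.\<close>

lemma VV_negative:
 assumes "J \<subseteq> KK" "1<=p" "p + card J<=n" shows "VV J (Suc q) (- int p * int a)"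
proof -
 have "finite J" using assms(1) finite_subset by blast
 then show ?thesis using assms
 proof (induction J arbitrary: p q)
  case empty
  then show ?case by (intro VV_empty hyp) auto
 next
  case (insert j J)
  have s: "- int (Suc p) * int a = - int p * int a-int a" by (simp add: algebra_simps)
  show ?case
  proof (rule VV_insert)
  show "VV J (Suc (Suc q)) (- int p * int a-int a)" unfolding s[symmetric] by (rule insert.IH) (use insert in auto)
  show "VV J (Suc q) (- int p * int a)" by (rule insert.IH) (use insert in auto)
  qed (use insert in auto)
 qed
qed

text \<open>First cohomology vanishes in all twists by multiples of \<open>a\<close> from -
  \<open>a\<close> on. Induction on the twist, and for each twist downward induction on
  \<open>J\<close> from the full set, where the quotient is supported at one point, by
  \<open>VV_descend\<close>.\<close>

lemma VV_2: "J \<subseteq> KK==>VV J 2 (int t * int a-int a)"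
proof (induction t arbitrary: J)
 case 0
 show ?case
 proof (cases "J=KK")
  case True then show ?thesis using VV_point by simp
 next
  case False
  then have "card J<n" using 0 card_KK psubset_card_mono[of KK J] by auto
  then show ?thesis using VV_negative[OF 0, of 1 1] by (simp add: numeral_2_eq_2)
 qed
next
 case (Suc t)
 have s: "int (Suc t) * int a-int a-int a=int t * int a-int a" by (simp add: algebra_simps)
 from Suc.prems show ?case
 proof (induction "card (KK-J)" arbitrary: J)
  case 0
  then have "J=KK" by auto
  then show ?case using VV_point by simp
 next
  case (Suc c)
  then have "KK-J~={}" by (metis card.empty nat.distinct(1))
  then obtain j where j: "j:KK" "j~:J" by blast
  have IH: "VV J 2 (int (Suc t) * int a-int a-int a)" unfolding s by (rule Suc.IH) (rule Suc.prems)
  have "card (KK-insert j J) = c"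
  proof -
  have "KK-insert j J=(KK-J)-{j}" by blast
  then show ?thesis using Suc.hyps(2) j by (simp add: card_Diff_singleton)
  qed
  then have "VV (insert j J) 2 (int (Suc t) * int a-int a)" using Suc.hyps(1)[of "insert j J"] Suc.prems j by blast
  from VV_descend[OF j(2) _ _ IH this] show ?case using j Suc.prems by auto
 qed
qed

lemma AA_nonneg: "J \<subseteq> KK==>AA J (int t * int a)"
proof -
 assume J: "J \<subseteq> KK"
 then have "finite J" using finite_subset by blast
 then show ?thesis using J
 proof induction
  case empty show ?case by (rule AA_empty)
 next
  case (insert j J)
  show ?case by (rule AA_insert[OF _ _ _ VV_2]) (use insert in auto)
 qed
qed

lemma AA_minus: assumes J: "J \<subseteq> KK" "J~=KK" shows "AA J (- int a)"
proof -
 have "card J<n" using J card_KK psubset_card_mono[of KK J] by auto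
 then show ?thesis using VV_negative[OF J(1), of 1 0] AA_vanishing[of J "- int a"] by simp
qed

lemma CC_nonneg: "J \<subseteq> KK==>CC J (int t * int a)"
proof -
 assume J: "J \<subseteq> KK"
 then have "finite J" using finite_subset by blast
 then show ?thesis using J
 proof induction
  case empty show ?case by (rule CC_empty)
 next
  case (insert j J)
  have "AA J (int t * int a-int a)"
  proof (cases t)
  case 0
  \<comment> \<open>In twist 0 a lift in twist - \<open>a\<close> is needed. It is available because
    an element is still to be inserted, so \<open>J\<close> is proper and the quotient has no
    sections in that twist.\<close>
  have "J~=KK" using insert by auto
  then show ?thesis using AA_minus[of J] insert 0 by simp
  next
  case (Suc t')
  then show ?thesis using AA_nonneg[of J t'] insert by (simp add: algebra_simps)
  qed
  then show ?case by (intro CC_insert) (use insert in auto)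
 qed
qed

definition GG :: "point set set" where "GG={U. good U}"

lemma gcov_GG: "gcov GG"
 unfolding gcov_def GG_def
proof
 show "\<Union>{U. good U}=proj_space n"
 proof
  show "\<Union>{U. good U} \<subseteq> proj_space n" using good_open open_sub by blast
  show "proj_space n \<subseteq> \<Union>{U. good U}" using good_exists[OF openX] by blast
 qed
qed simp

lemma Sec_minus: assumes x: "x:Sec (- int a) XX" shows "x=0"
proof -
 have V: "VV {} (Suc 0) (- int a)" using VV_negative[of "{}" 1 0] n1 by simp
 define c where "c=(%s. rs (supp s) x)"
 have sub: "supp s \<subseteq> XX" if "s:lists_of m GG" "0<m" for s m using gcov_open[OF gcov_GG that] open_sub by blast
 have C: "CH (Suc 0) GG (- int a) c"
  by (rule CHI) (use sub gcov_open[OF gcov_GG] Sec_rs[OF _ _ x] in \<open>auto simp: c_def\<close>)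
 have "dl c s:Idl {} (- int a) (supp s)" if s: "s:lists_of (Suc (Suc 0)) GG" for s
 proof -
  obtain U W where s': "s=[U, W]" using s by (auto simp: lists_of_def length_Suc_conv)
  have "dl c s=0" unfolding dl_def s' by (simp add: numeral_2_eq_2 face_def c_def rs_rs supp_def)
  then show ?thesis using Idl_empty[OF gcov_open[OF gcov_GG s]] by simp
 qed
 then obtain \<V> ta b where b: "gcov \<V>" "refinement \<V> GG ta" "CH 0 \<V> (- int a) b" "!!s. s:lists_of 1 \<V> ==> ref ta c s-dl b s:Idl {} (- int a) (supp s)"
  using V[unfolded VV_def, rule_format, OF gcov_GG C] by auto
 have "rs V x:Idl {} (- int a) V" if Vm: "V:\<V>" for V
 proof -
  have "b []=0" using b(3) by (simp add: CH_def lists_of_def)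
  then have "dl b [V]=0" by (simp add: dl_def face_def lin_0[OF lin_rs])
  moreover have "V \<subseteq> ta V" using b(2) Vm by (simp add: refinement_def)
  ultimately show ?thesis using b(4)[OF single_list[OF Vm]] by (simp add: ref_def c_def rs_rs)
 qed
 then have "x:Idl {} (- int a) XX" using CC_empty[of "- int a"] b(1) x unfolding CC_def by blast
 then show ?thesis using Idl_empty[OF openX] by simp
qed

text \<open>Modulo the ideal of \<open>KK\<close> a section near the apex can be extended by zero,
  since the ideal is everything elsewhere; \<open>AA\<close> for \<open>KK\<close> then turns it
  into a global section.\<close>

lemma local_lift:
 assumes U0: "good U0" "pt apex:U0" and sg: "sg : Sec (int t * int a) U0"
 shows "EX u:Sec (int t * int a) XX. EX \<W>. gcov \<W> & (ALL W:\<W>. (W \<subseteq> U0&rs W u-rs W sg : Idl KK (int t * int a) W) \<or> (EX j:KK. W \<subseteq> bas n (ff j)))"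
proof -
 let ?k = "int t * int a"
 have "U0:GG" using U0 by (simp add: GG_def)
 from good_refine[OF gcov_GG this U0(2)] obtain \<V> ta where V: "gcov \<V>" "U0:\<V>"
  and sep: "ALL V:\<V>. V~=U0-->(EX j:KK. V \<subseteq> bas n (ff j))" by (elim exE conjE)
 define c where "c s=(if s=[U0] then sg else 0)" for s
 have C: "CH 1 \<V> ?k c"
  by (rule CHI) (use sg fv.subspace_0[OF subspace_Sec] gcov_open[OF V(1)] in \<open>auto simp: c_def\<close>)
 have "dl c s:Idl KK ?k (supp s)" if s: "s:lists_of 2 \<V>" for s
 proof -
  obtain U W where s': "s=[U, W]" "U:\<V>" "W:\<V>" using s by (auto simp: lists_of_def length_Suc_conv numeral_2_eq_2)
  note o = gcov_open[OF V(1) s zero_less_numeral]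
  show ?thesis
  proof (cases "U=U0&W=U0")
  case True
  have "dl c s=0" unfolding dl_def s'(1) using True by (simp add: numeral_2_eq_2 face_def c_def)
  then show ?thesis using fv.subspace_0[OF subspace_Idl[OF o]] by simp
  next
  case False
  have sub: "supp s \<subseteq> U" "supp s \<subseteq> W" unfolding s'(1) supp_def by auto
  obtain j where j: "j:KK" "U \<subseteq> bas n (ff j) \<or> W \<subseteq> bas n (ff j)"
  using False bspec[OF sep s'(2)] bspec[OF sep s'(3)] by (cases "U=U0") auto
  have S: "dl c s:Sec ?k (supp s)" using CHD[OF CH_dl[OF V(1) C]] s by (simp add: numeral_2_eq_2)
  show ?thesis
  proof (rule Idl_unit[OF o _ j(1) _ _ S])
  show "supp s \<subseteq> bas n (ff j)" using j(2) sub by (elim disjE) (erule order_trans[rotated], assumption)+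
  qed (use j in auto)
  qed
 qed
 then obtain \<W> ta' u where u: "gcov \<W>" "refinement \<W> \<V> ta'" "u:Sec ?k XX" "!!W. W:\<W> ==> rs W u-rs W (c [ta' W]):Idl KK ?k W"
  using AA_nonneg[OF order_refl, unfolded AA_def, rule_format, OF V(1) C] by blast
 have "(W \<subseteq> U0&rs W u-rs W sg : Idl KK ?k W) \<or> (EX j:KK. W \<subseteq> bas n (ff j))" if W: "W:\<W>" for W
 proof -
  have ta': "ta' W:\<V>" "W \<subseteq> ta' W" using u(2) W by (auto simp: refinement_def)
  show ?thesis
  proof (cases "ta' W=U0")
  case True
  then show ?thesis using u(4)[OF W] ta'(2) by (simp add: c_def)
  next
  case False
  then obtain j where "j:KK" "ta' W \<subseteq> bas n (ff j)" using bspec[OF sep ta'(1)] by blast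
  with ta'(2) show ?thesis by blast
  qed
 qed
 with u(1,3) show ?thesis by blast
qed

lemma apex_notin: "j:KK==>pt apex~:bas n (ff j)"
 using ff_apex[of j] pt_in_bas[OF hform_ff[of j], of apex] by simp

text \<open>Lift the section with constant coordinates \<open>y\<close> near the apex. Congruence
  modulo the ideal does not affect the value there, because the forms \<open>ff j\<close> with j in
  \<open>KK\<close> vanish at the apex.\<close>

theorem generated_at_apex:
 assumes i: "i:charts E" "pt apex:chart E i"
 shows "EX s:Sec 0 XX. ALL b<rk. s (i, b) apex=y b"
proof -
 obtain U0 where U0: "good U0" "pt apex:U0" "U0 \<subseteq> chart E i" using good_exists[OF chart_open[OF i(1)] i(2)] by blast
 note o0 = good_open[OF U0(1)]
 have "lreg n 0 P (%v. y b)" if "P:U0" for P b using that open_sub[OF o0] by (intro lreg_hz hz_const) blast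
 then obtain sg where sg: "sg : Sec (int 0 * int a) U0" "!!b v. b<rk==>v:\<Union>U0==>sg (i, b) v=y b"
  using Sec_mk[OF i(1) U0(3) o0, of "int 0 * int a" "%b v. y b"] by (simp del: Union_iff) blast
 from local_lift[OF U0(1,2) sg(1)] obtain u \<W> where u: "u:Sec 0 XX" "gcov \<W>"
  and W: "ALL W:\<W>. (W \<subseteq> U0&rs W u-rs W sg : Idl KK (int 0 * int a) W) \<or> (EX j:KK. W \<subseteq> bas n (ff j))" by auto
 obtain W0 where W0: "W0:\<W>" "pt apex:W0" using u(2) pt_in[OF apex_cone] unfolding gcov_def by blast
 then have "W0 \<subseteq> U0" "rs W0 u-rs W0 sg : Idl KK 0 W0" using bspec[OF W W0(1)] apex_notin by auto
 then obtain t where t: "rs W0 u-rs W0 sg=(SUM j:KK. smul (ff j) (t j))" by (auto simp: Idl_def)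
 have "u (i, b) apex=y b" if b: "b<rk" for b
 proof -
  have "apex:\<Union>W0" "apex:\<Union>U0" using W0(2) U0(2) pt_self by blast+
  then have "u (i, b) apex-y b=(rs W0 u-rs W0 sg) (i, b) apex" using sg(2)[OF b] by (simp add: rs_def del: Union_iff)
  also have "... = 0" unfolding t sum_apply2 using ff_apex by (intro sum.neutral) (simp add: smul_def)
  finally show ?thesis by simp
 qed
 with u(1) show ?thesis by blast
qed

text \<open>Near the apex \<open>ff l\<close> is invertible, so x / ff l is a local section; let u
  be its global lift from \<open>local_lift\<close>. Then x - ff l * u lies locally in the ideal of
  \<open>KK\<close>, hence globally by \<open>CC\<close>.\<close>

theorem Sec_Suc: assumes x: "x:Sec (int (Suc t) * int a) XX" shows "x:Idl {..n} (int (Suc t) * int a) XX"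
proof -
 let ?k = "int (Suc t) * int a"
 have k: "?k-int a=int t * int a" by (simp add: algebra_simps)
 have "pt apex:bas n (ff l)" using pt_in_bas[OF hform_ff[OF l]] pt_in[OF apex_cone] ff_l_apex by simp
 then obtain U0 where U0: "good U0" "pt apex:U0" "U0 \<subseteq> bas n (ff l)" using good_exists[OF open_bas[OF hform_ff[OF l]]] by blast
 have "U0 \<subseteq> XX" using open_sub[OF good_open[OF U0(1)]] .
 then obtain y where y: "y:Sec (int t * int a) U0" "smul (ff l) y=rs U0 x"
  using Sec_divide[OF hform_ff[OF l] U0(3) Sec_rs[OF good_open[OF U0(1)] _ x]] k by auto
 from local_lift[OF U0(1,2) y(1)] obtain u \<W> where u: "u:Sec (int t * int a) XX" "gcov \<W>"
  and W: "ALL W:\<W>. (W \<subseteq> U0&rs W u-rs W y:Idl KK (int t * int a) W) \<or> (EX j:KK. W \<subseteq> bas n (ff j))" by auto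
 have S: "x - smul (ff l) u:Sec ?k XX"
  by (rule fv.subspace_diff[OF subspace_Sec[OF openX] x ff_Sec[OF openX l]]) (use u(1) k in simp)
 have "x - smul (ff l) u:Idl KK ?k XX"
 proof (rule CC_nonneg[OF order_refl, unfolded CC_def, rule_format, OF u(2) S])
  fix V assume V: "V:\<W>"
  have o: "openin (zariski n) V" using u(2) V good_open by (auto simp: gcov_def)
  from bspec[OF W V] show "rs V (x - smul (ff l) u):Idl KK ?k V"
  proof (elim disjE bexE conjE)
  assume sub: "V \<subseteq> U0" and *: "rs V u-rs V y:Idl KK (int t * int a) V"
  have "rs V x = smul (ff l) (rs V y)" unfolding rs_smul[symmetric] y(2) rs_rs[OF sub] ..
  then have eq: "rs V (x - smul (ff l) u) = - smul (ff l) (rs V u-rs V y)" by (simp add: lin_diff[OF lin_rs] rs_smul)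
  have "smul (ff l) (rs V u-rs V y):Idl KK ?k V" by (rule Idl_smul[OF o _ l]) (use * k in simp)
  then show ?thesis unfolding eq by (rule fv.subspace_neg[OF subspace_Idl[OF o]])
  next
  fix j assume "j:KK" "V \<subseteq> bas n (ff j)"
  then show ?thesis by (intro Idl_unit[OF o _ _ _ _ Sec_rs[OF o open_sub[OF o] S]]) auto
  qed
 qed
 moreover have lK: "l~:KK" "finite KK" by auto
 ultimately have "x:Idl (insert l KK) ?k XX"
  unfolding Idl_insert[OF openX lK(1) l lK(2)] k using u(1) by blast
 moreover have "insert l KK={..n}" using l by auto
 ultimately show ?thesis by simp
qed

theorem Sec_regular:
 assumes J: "J \<subseteq> KK" "j~:J" "j<=n" and y: "y:Sec (int t * int a) XX" and x: "smul (ff j) y:Idl J (int (Suc t) * int a) XX"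
 shows "y:Idl J (int t * int a) XX"
proof (rule CC_nonneg[OF J(1), unfolded CC_def, rule_format, OF gcov_GG y])
 let ?k = "int (Suc t) * int a"
 have k: "?k-int a=int t * int a" by (simp add: algebra_simps)
 fix U assume "U:GG"
 then have U: "good U" by (simp add: GG_def)
 note o = good_open[OF U]
 have "rs U y:Idl J (?k-int a) U"
 proof (rule Idl_regular[OF U J(2,3)])
  show "J \<subseteq> {..n}" using J by blast
  show "rs U y:Sec (?k-int a) U" unfolding k by (rule Sec_rs[OF o open_sub[OF o] y])
  show "smul (ff j) (rs U y):Idl J ?k U" unfolding rs_smul[symmetric] by (rule Idl_rs[OF o open_sub[OF o] x])
 qed
 then show "rs U y:Idl J (int t * int a) U" unfolding k .
qed

lemma lin_smul': "lin (smul f)" by (rule linI) (simp_all add: smul_scl)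

text \<open>Among more than \<open>B\<close> independent global sections some nontrivial combination
  lies, near the apex, in the ideal of \<open>KK\<close>, by \<open>hform_line_split\<close> applied
  to numerators. Elsewhere this is automatic, so it holds globally; but the coefficients are then
  sections of E(-a), and these are zero.\<close>

theorem findim_Sec_0: "findim (Sec 0 XX)"
proof -
 obtain i where i: "i:charts E" "pt apex:chart E i" using chart_cover[OF pt_in[OF apex_cone]] by blast
 obtain U0 where U0: "good U0" "pt apex:U0" "U0 \<subseteq> chart E i" using good_exists[OF chart_open[OF i(1)] i(2)] by blast
 note o0 = good_open[OF U0(1)]
 obtain g e where g: "hform (Suc n) e g" "0<e" "U0=bas n g" using U0(1) unfolding good_def by blast
 define L where "L=Suc n * a"
 \<comment> \<open>The number of spanning elements left modulo the ideal, for \<open>rk\<close>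
   coordinates at once; it does not involve the unknown exponent of the common denominator.\<close>
 define B where "B=rk * (SUM e<=L. card (monomials (Suc n) e))"
 show ?thesis
 proof (rule findim_bounded)
  fix S :: "('i \<times> nat=>vec=>complex) set" assume S: "finite S" "fv.independent S" "S \<subseteq> Sec 0 XX"
  show "card S<=B"
  proof (rule ccontr)
  assume less: "~card S<=B"
  have "EX N F. ALL x:S \<times> {..<rk}. hz (Suc n) (int (N * e)+0) (F x)&(ALL v:\<Union>(bas n g). (case x of (s, b)=>s (i, b)) v * g v ^ N=F x v)"
  proof (rule lreg_bas_uniform[OF g(1,2)])
  fix x P assume x: "x:S \<times> {..<rk}" and P: "P:bas n g"
  then have "P:XX" "P:chart E i" using g(3) U0(3) open_sub[OF o0] by blast+
  then show "lreg n 0 P (case x of (s, b)=>s (i, b))" using x S(3) SecD(1)[of _ 0 XX i _ P] i(1) by auto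
  qed (use S in simp)
  then obtain N F where "ALL x:S \<times> {..<rk}. hz (Suc n) (int (N * e)+0) (F x)&(ALL v:\<Union>(bas n g). (case x of (s, b)=>s (i, b)) v * g v ^ N=F x v)" by (elim exE)
  then have F: "hform (Suc n) (N * e) (F (s, b))" "v:\<Union>U0==>s (i, b) v * g v ^ N=F (s, b) v" if "s:S" "b<rk" for s b v
  using that unfolding g(3) by (auto simp: hz_int_iff[of _ "N * e", simplified] simp del: Union_iff)
  let ?d = "N * e" and ?B = "shear l (%i. - lam i)" and ?A = "shear l lam"
  define T where "T b=(UN e<=L. (%f. single b (%v. f v * v l ^ (?d-e))) ` monomials (Suc n) e)" for b :: nat
  have ls: "l<Suc n" using l by simp
  have "ALL x:S \<times> {..<rk}. EX GH. (ALL j:KK. hz (Suc n) (int ?d-int a) (snd GH j))&(ALL v. F x (?B v)=fst GH v+(SUM j:KK. v j ^ a * snd GH j v)) &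
  (ALL b. single b (fst GH):fv.span (T b))"
  proof
  fix x assume x: "x:S \<times> {..<rk}"
  have "hz (Suc n) (int ?d) (F x)" using F(1)[of "fst x" "snd x"] x hz_hform by (auto simp del: of_nat_mult)
  then have "hform (Suc n) ?d (%v. F x (?B v))" using hz_shear[OF ls] hz_int_iff by blast
  from hform_line_split[OF this l a] obtain G H where "(ALL j:KK. hz (Suc n) (int ?d-int a) (H j))&(ALL v. F x (?B v)=G v+(SUM j:KK. v j ^ a * H j v)) &
  (ALL b. single b G:fv.span (T b))" unfolding T_def L_def by (elim exE)
  then show "EX GH. (ALL j:KK. hz (Suc n) (int ?d-int a) (snd GH j))&(ALL v. F x (?B v)=fst GH v+(SUM j:KK. v j ^ a * snd GH j v)) &
  (ALL b. single b (fst GH):fv.span (T b))" by (intro exI[of _ "(G, H)"]) simp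
  qed
  from bchoice[OF this] obtain GH where GH: "ALL x:S \<times> {..<rk}. (ALL j:KK. hz (Suc n) (int ?d-int a) (snd (GH x) j)) &
  (ALL v. F x (?B v)=fst (GH x) v+(SUM j:KK. v j ^ a * snd (GH x) j v))&(ALL b. single b (fst (GH x)):fv.span (T b))" by (elim exE)
  define G where "G x=fst (GH x)" for x
  define H where "H x = snd (GH x)" for x
  have H1: "hz (Suc n) (int ?d-int a) (H x j)" if "x:S \<times> {..<rk}" "j:KK" for x j using bspec[OF conjunct1[OF bspec[OF GH that(1)]] that(2)] by (simp add: H_def)
  have H2: "F x (?B v)=G x v+(SUM j:KK. v j ^ a * H x j v)" if "x:S \<times> {..<rk}" for x v using bspec[OF GH that] by (simp add: H_def G_def)
  have H3: "single b (G x):fv.span (T b)" if "x:S \<times> {..<rk}" for x b using bspec[OF GH that] by (simp add: G_def)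
  have "EX c. (EX s:S. c s~=0)&(SUM s:S. scl (c s) (SUM b<rk. single b (G (s, b))))=0"
  proof (rule finite_dependent[OF S(1)])
  show "finite (UN b<rk. T b)" unfolding T_def by (intro finite_UN_I finite_imageI finite_monomials) auto
  have "card (T b)<=(SUM e<=L. card (monomials (Suc n) e))" for b
  unfolding T_def by (rule order_trans[OF card_UN_le]) (auto intro!: sum_mono card_image_le finite_monomials)
  then have "(SUM b<rk. card (T b))<=(SUM b<rk. SUM e<=L. card (monomials (Suc n) e))" by (intro sum_mono)
  then have "card (UN b<rk. T b)<=B" unfolding B_def using card_UN_le[of "{..<rk}" T] by simp
  then show "card (UN b<rk. T b) < card S" using less by simp
  fix s assume s: "s:S"
  show "(SUM b<rk. single b (G (s, b))):fv.span (UN b<rk. T b)"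
  proof (rule fv.span_sum)
  fix b assume b: "b:{..<rk}"
  then have "fv.span (T b) \<subseteq> fv.span (UN b<rk. T b)" by (intro fv.span_mono) blast
  then show "single b (G (s, b)):fv.span (UN b<rk. T b)" using H3[of "(s, b)" b] s b by blast
  qed
  qed
  then obtain c where c: "EX s:S. c s~=0" "(SUM s:S. scl (c s) (SUM b<rk. single b (G (s, b))))=0" by (elim exE conjE)
  have Gc: "(SUM s:S. c s * G (s, b) v)=0" if b: "b<rk" for b v
  proof -
  have "(SUM s:S. scl (c s) (SUM b<rk. single b (G (s, b)))) b v=(SUM s:S. c s * G (s, b) v)"
  unfolding sum_apply2 scl_def using b by (intro sum.cong refl) (simp add: single_def sum.delta)
  then show ?thesis using c(2) by simp
  qed
  define x where "x=(SUM s:S. scl (c s) s)"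
  have x: "x:Sec (int 0 * int a) XX"
  unfolding x_def using S(3) by (intro fv.subspace_sum[OF subspace_Sec[OF openX]] fv.subspace_scale[OF subspace_Sec[OF openX]]) auto
  have "rs U0 x:Idl KK (int 0 * int a) U0"
  proof (rule Idl_local[OF g(1) i(1) g(3) U0(3) _ Sec_rs[OF o0 open_sub[OF o0] x]])
  let ?H = "%b j v. SUM s:S. c s * H (s, b) j (?A v)"
  show "hz (Suc n) (int (N * e)+int 0 * int a-int a) (?H b j)" if "b<rk" "j:KK" for b j
  proof (rule hz_sum)
  fix s assume "s:S"
  then have "hz (Suc n) (int ?d-int a) (%v. H (s, b) j (?A v))" using that by (intro hz_shear[OF ls H1]) auto
  from hz_mult[OF hz_const this] show "hz (Suc n) (int (N * e)+int 0 * int a-int a) (%v. c s * H (s, b) j (?A v))" by simp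
  qed
  fix b v assume b: "b<rk" and v: "v:\<Union>U0"
  have "rs U0 x (i, b) v * g v ^ N=(SUM s:S. c s * (s (i, b) v * g v ^ N))"
  using v unfolding rs_def x_def by (simp add: sum_apply2 scl_def sum_distrib_right mult.assoc del: Union_iff)
  also have "... = (SUM s:S. c s * F (s, b) v)" using F(2)[OF _ b v] by (intro sum.cong refl) simp
  also have "... = (SUM s:S. c s * (G (s, b) (?A v)+(SUM j:KK. ff j v * H (s, b) j (?A v))))"
  proof (intro sum.cong refl)
  fix s assume "s:S"
  then show "c s * F (s, b) v = c s * (G (s, b) (?A v)+(SUM j:KK. ff j v * H (s, b) j (?A v)))"
  using H2[of "(s, b)" "?A v"] b by (simp add: shear_shear ff_def)
  qed
  also have "... = (SUM s:S. c s * (SUM j:KK. ff j v * H (s, b) j (?A v)))"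
  using Gc[OF b, of "?A v"] by (simp only: distrib_left sum.distrib add_0)
  also have "... = (SUM j:KK. ff j v * ?H b j v)"
  unfolding sum_distrib_left by (subst sum.swap) (simp only: mult.left_commute)
  finally show "rs U0 x (i, b) v * g v ^ N=(SUM j:KK. ff j v * ?H b j v)" .
  qed blast
  moreover have "U0:GG" using U0 by (simp add: GG_def)
  from good_refine[OF gcov_GG this U0(2)] obtain \<V> ta where V: "gcov \<V>" and sep: "ALL V:\<V>. V~=U0-->(EX j:KK. V \<subseteq> bas n (ff j))" by (elim exE conjE)
  have "rs V x:Idl KK (int 0 * int a) V" if Vm: "V:\<V>" "V~=U0" for V
  proof -
  have o: "openin (zariski n) V" using V Vm good_open by (auto simp: gcov_def)
  obtain j where "j:KK" "V \<subseteq> bas n (ff j)" using bspec[OF sep Vm(1)] Vm(2) by blast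
  then show ?thesis by (intro Idl_unit[OF o _ _ _ _ Sec_rs[OF o open_sub[OF o] x]]) auto
  qed
  ultimately have "x:Idl KK (int 0 * int a) XX"
  using CC_nonneg[OF order_refl, of 0, unfolded CC_def, rule_format, OF V x] by blast
  then obtain t where t: "!!j. j:KK==>t j:Sec (- int a) XX" "x=(SUM j:KK. smul (ff j) (t j))" by (auto simp: Idl_def)
  have "x=0" unfolding t(2) using Sec_minus[OF t(1)] by (intro sum.neutral) simp
  then have "c s=0" if "s:S" for s using independent_family[OF S(2,1) _ that, of c] by (simp add: x_def)
  with c(1) show False by blast
  qed
 qed
qed

lemma findim_Sec: "findim (Sec (int t * int a) XX)"
proof (induction t)
 case 0 then show ?case using findim_Sec_0 by simp
next
 case (Suc t)
 then obtain A where A: "finite A" "Sec (int t * int a) XX \<subseteq> fv.span A" by (auto simp: findim_def)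
 have "x:fv.span (UN j<=n. smul (ff j) ` A)" if x: "x:Sec (int (Suc t) * int a) XX" for x
 proof -
  have k: "int (Suc t) * int a-int a=int t * int a" by (simp add: algebra_simps)
  obtain y where y: "!!j. j<=n==>y j:Sec (int t * int a) XX" "x=(SUM j<=n. smul (ff j) (y j))"
  using Sec_Suc[OF x] unfolding Idl_def k by auto
  show ?thesis
  unfolding y(2)
  proof (rule fv.span_sum)
  fix j assume j: "j:{..n}"
  have "smul (ff j) ` fv.span A \<subseteq> fv.span (UN j<=n. smul (ff j) ` A)"
  by (rule lin_span_mono[OF lin_smul']) (use j in blast)
  then show "smul (ff j) (y j):fv.span (UN j<=n. smul (ff j) ` A)" using y(1)[of j] A(2) j by blast
  qed
 qed
 then show ?case unfolding findim_def using A(1) by (intro exI[of _ "UN j<=n. smul (ff j) ` A"]) auto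
qed

text \<open>The Hilbert function, in steps of \<open>a\<close>, of the section module modulo the
  forms \<open>ff j\<close> with j in \<open>J\<close>.\<close>

definition HF :: "nat set=>nat=>int" where
 "HF J t=int (fv.dim (Sec (int t * int a) XX))-int (fv.dim (Idl J (int t * int a) XX))"

lemma findim_Idl: "findim (Idl J (int t * int a) XX)"
 by (rule findim_subset[OF findim_Sec]) (auto simp: Idl_def)

lemma HF_0: "HF J 0=int (fv.dim (Sec 0 XX))"
proof -
 have "x:{0}" if x: "x:Idl J 0 XX" for x
 proof -
  obtain t where t: "!!j. j:J==>t j:Sec (- int a) XX" "x=(SUM j:J. smul (ff j) (t j))" using x by (auto simp: Idl_def)
  have "x=0" unfolding t(2) using Sec_minus[OF t(1)] by (intro sum.neutral) simp
  then show ?thesis by simp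
 qed
 then have "Idl J 0 XX={0}" using fv.subspace_0[OF subspace_Idl[OF openX]] by blast
 then show ?thesis by (simp add: HF_def dim_0)
qed

lemma HF_Suc:
 assumes J: "J \<subseteq> KK" "j~:J" "j<=n" shows "HF (insert j J) (Suc t)=HF J (Suc t)-HF J t"
proof -
 let ?k = "int (Suc t) * int a" and ?k' = "int t * int a"
 have k: "?k-int a=?k'" by (simp add: algebra_simps)
 have fJ: "finite J" using J(1) finite_subset by blast
 have 1: "Idl (insert j J) ?k XX={u + smul (ff j) y | u y. u:Idl J ?k XX&y:Sec ?k' XX}"
 proof (intro set_eqI iffI)
  fix x assume "x:Idl (insert j J) ?k XX"
  then obtain y where "y:Sec ?k' XX" "x - smul (ff j) y:Idl J ?k XX" unfolding Idl_insert[OF openX J(2,3) fJ] k by blast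
  then show "x:{u + smul (ff j) y | u y. u:Idl J ?k XX&y:Sec ?k' XX}"
  by (intro CollectI exI[of _ "x - smul (ff j) y"] exI[of _ y]) simp
 next
  fix x assume "x:{u + smul (ff j) y | u y. u:Idl J ?k XX&y:Sec ?k' XX}"
  then obtain u y where "x=u + smul (ff j) y" "u:Idl J ?k XX" "y:Sec ?k' XX" by blast
  then show "x:Idl (insert j J) ?k XX" unfolding Idl_insert[OF openX J(2,3) fJ] k by (intro bexI[of _ y]) simp_all
 qed
 have 2: "{y:Sec ?k' XX. smul (ff j) y:Idl J ?k XX}=Idl J ?k' XX"
 proof (intro set_eqI iffI)
  fix y assume "y:{y:Sec ?k' XX. smul (ff j) y:Idl J ?k XX}"
  then show "y:Idl J ?k' XX" using Sec_regular[OF J] by blast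
 next
  fix y assume y: "y:Idl J ?k' XX"
  then have "smul (ff j) y:Idl J ?k XX" by (intro Idl_smul[OF openX _ J(3)]) (simp only: k)
  then show "y:{y:Sec ?k' XX. smul (ff j) y:Idl J ?k XX}" using Idl_Sec[OF y] by blast
 qed
 show ?thesis
  using dim_sum_image[OF findim_Idl[of J "Suc t"] subspace_Idl[OF openX] findim_Sec[of t] subspace_Sec[OF openX] lin_smul'[of "ff j"]]
  unfolding 1[symmetric] 2 by (simp add: HF_def)
qed

text \<open>For \<open>J\<close> = \<open>KK\<close> the function is constant, since dividing by
  \<open>ff l\<close> as well leaves nothing in positive degree. Removing one form from
  \<open>J\<close> means summing over t, by \<open>HF_Suc\<close>, and each summation raises the
  binomial coefficient by one.\<close>

lemma HF_formula: "J \<subseteq> KK==>HF J t=int (fv.dim (Sec 0 XX)) * int ((t+(n - card J)) choose (n - card J))"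
proof (induction "n - card J" arbitrary: J t)
 case 0
 have "card J<=n" using card_mono[OF _ 0(2)] card_KK by simp
 then have "J=KK" using 0 card_KK card_seteq[OF _ 0(2)] by simp
 have ins: "insert l KK={..n}" using l by auto
 have z: "HF {..n} (Suc t)=0" for t
 proof -
  have "Idl {..n} (int (Suc t) * int a) XX=Sec (int (Suc t) * int a) XX" using Sec_Suc Idl_Sec by blast
  then show ?thesis by (simp add: HF_def)
 qed
 have "HF KK t=int (fv.dim (Sec 0 XX))"
 proof (induction t)
  case 0 show ?case by (rule HF_0)
 next
  case (Suc t)
  then show ?case using HF_Suc[OF order_refl, of l t] z[of t] l unfolding ins by simp
 qed
 then show ?case using \<open>J = KK\<close> card_KK by simp
next
 case (Suc c)
 then have "J~=KK" using card_KK by auto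
 then obtain j where j: "j:KK" "j~:J" using Suc.prems by blast
 have "card (insert j J)=Suc (card J)" using j(2) finite_subset[OF Suc.prems] by simp
 then have c: "c=n - card (insert j J)" using Suc.hyps(2) by simp
 have IH: "HF (insert j J) t=int (fv.dim (Sec 0 XX)) * int ((t + c) choose c)" for t
  using Suc.hyps(1)[OF c] Suc.prems j unfolding c[symmetric] by blast
 have "HF J t=int (fv.dim (Sec 0 XX)) * int ((t+Suc c) choose Suc c)"
 proof (induction t)
  case 0 then show ?case by (simp add: HF_0)
 next
  case (Suc t)
  have "HF J (Suc t)=HF (insert j J) (Suc t)+HF J t" using HF_Suc[OF \<open>J \<subseteq> KK\<close> j(2), of t] j(1) by simp
  then show ?case unfolding IH Suc by (simp add: algebra_simps)
 qed
 then show ?case using Suc.hyps(2) by simp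
qed

theorem dim_Sec: "fv.dim (Sec (int t * int a) XX)=fv.dim (Sec 0 XX) * ((t+n) choose n)"
proof -
 have "Idl {} (int t * int a) XX={0}" by (rule Idl_empty[OF openX])
 then have "int (fv.dim (Sec (int t * int a) XX))=int (fv.dim (Sec 0 XX)) * int ((t+n) choose n)"
  using HF_formula[of "{}" t] by (simp add: HF_def dim_0)
 then show ?thesis by (metis of_nat_eq_iff of_nat_mult)
qed

end

section \<open>Frames of global sections and the identity principle\<close>

lemma lreg_uniform:
 assumes X: "finite X" and P: "P:proj_space n" and ph: "!!x. x:X==>lreg n 0 P (ph x)"
 shows "EX W d G A. openin (zariski n) W&P:W&hform (Suc n) d G&(ALL v:\<Union>W. G v~=0) &
  (ALL x:X. hform (Suc n) d (A x)&(ALL v:\<Union>W. ph x v * G v=A x v))"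
 using X ph
proof induction
 case empty
 show ?case
  by (rule exI[of _ "proj_space n"], rule exI[of _ 0], rule exI[of _ "%_. 1"])
  (use P openin_topspace[of "zariski n"] in \<open>auto simp: topspace_zariski intro: hform.const\<close>)
next
 case (insert x X)
 then have "EX W d G A. openin (zariski n) W&P:W&hform (Suc n) d G&(ALL v:\<Union>W. G v~=0) &
  (ALL x:X. hform (Suc n) d (A x)&(ALL v:\<Union>W. ph x v * G v=A x v))" by blast
 then obtain W d G A where *: "openin (zariski n) W" "P:W" "hform (Suc n) d G" "ALL v:\<Union>W. G v~=0"
  "ALL x:X. hform (Suc n) d (A x)&(ALL v:\<Union>W. ph x v * G v=A x v)" by (elim exE conjE)
 obtain W' d' F' G' where **: "openin (zariski n) W'" "P:W'" "hform (Suc n) d' F'" "hform (Suc n) d' G'"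
  "!!Q v. Q:W'==>v:Q==>G' v~=0&ph x v * G' v=F' v"
  using insert.prems[of x] unfolding lreg_def by (auto simp: hz_int_iff)
 let ?G = "%v. G v * G' v" and ?A = "%y v. if y=x then G v * F' v else A y v * G' v"
 show ?case
 proof (intro exI[of _ "W \<inter> W'"] exI[of _ "d+d'"] exI[of _ ?G] exI[of _ ?A] conjI ballI)
  show "openin (zariski n) (W \<inter> W')" "P:W \<inter> W'" using * ** by auto
  show "hform (Suc n) (d+d') ?G" by (rule hform_mult[OF *(3) **(4)])
  fix v assume v: "v:\<Union>(W \<inter> W')"
  then show "?G v~=0" using *(4) **(5) by auto
 next
  fix y assume y: "y:insert x X"
  show "hform (Suc n) (d+d') (?A y)"
  using hform_mult[OF *(3) **(3)] hform_mult[OF conjunct1[OF bspec[OF *(5), of y]] **(4)] y by (cases "y=x") simp_all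
  fix v assume "v:\<Union>(W \<inter> W')"
  then have v: "v:\<Union>W" "v:\<Union>W'" by blast+
  show "ph y v * ?G v=?A y v"
  proof (cases "y=x")
  case True
  then show ?thesis using **(5) v(2) by auto
  next
  case False
  then have "ph y v * G v=A y v" using *(5) y v(1) by blast
  then show ?thesis using False by simp
  qed
 qed
qed

lemma lreg_diff: "P:proj_space n==>lreg n k P ph==>lreg n k P ps==>lreg n k P (%v. ph v-ps v)"
 using lreg_add[OF _ lreg_scale[of P n k ps "-1"]] by fastforce

lemma lreg_mult_0: "lreg n 0 P ph==>lreg n 0 P ps==>lreg n 0 P (%v. ph v * ps v)"
 using lreg_mult'[of n 0 P ph 0 ps 0] by simp

lemma sum_3: "(SUM k<3. g k)=g 0+g 1+g (2::nat)" for g :: "nat=>complex"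
 by (simp add: numeral_3_eq_3 numeral_2_eq_2)

text \<open>The adjugate matrix. With cyclic indices \<open>nx\<close> each cofactor is a 2 by 2
  minor without an explicit sign. The determinant is 1 at \<open>v0\<close>, where the matrix is the
  identity.\<close>

lemma cofactors_3:
 fixes T :: "nat=>nat=>vec=>complex"
 assumes P: "P:proj_space n" and T: "!!k b. lreg n 0 P (T k b)" and v0: "!!k b. T k b v0=(if k=b then 1 else 0)"
 shows "EX C de. (ALL k b. lreg n 0 P (C k b))&lreg n 0 P de&de v0=1 &
  (ALL v. ALL k<3. ALL k'<3. (SUM b<3. C k b v * T k' b v)=(if k = k' then de v else 0)) &
  (ALL v. ALL b<3. ALL b'<3. (SUM k<3. T k b v * C k b' v)=(if b=b' then de v else 0))"
proof -
 define nx :: "nat=>nat" where "nx k=(if k=0 then 1 else if k=1 then 2 else 0)" for k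
 define C where "C k b=(%v. T (nx k) (nx b) v * T (nx (nx k)) (nx (nx b)) v-T (nx k) (nx (nx b)) v * T (nx (nx k)) (nx b) v)" for k b
 define de where "de=(%v. C 0 0 v * T 0 0 v+C 0 1 v * T 0 1 v+C 0 2 v * T 0 2 v)"
 have lC: "lreg n 0 P (C k b)" for k b
  unfolding C_def by (intro lreg_diff[OF P] lreg_mult_0 T)
 then have "lreg n 0 P de" unfolding de_def by (intro lreg_add lreg_mult_0 T)
 moreover have "de v0=1" by (simp add: de_def C_def v0 nx_def)
 moreover have "(SUM b<3. C k b v * T k' b v)=(if k = k' then de v else 0)" if "k<3" "k'<3" for v k k'
 proof -
  have "k:{0, 1, 2}" "k':{0, 1, 2}" using that by auto
  then show ?thesis unfolding sum_3 de_def C_def nx_def by (elim insertE emptyE) (simp_all add: algebra_simps)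
 qed
 moreover have "(SUM k<3. T k b v * C k b' v)=(if b=b' then de v else 0)" if "b<3" "b'<3" for v b b'
 proof -
  have "b:{0, 1, 2}" "b':{0, 1, 2}" using that by auto
  then show ?thesis unfolding sum_3 de_def C_def nx_def by (elim insertE emptyE) (simp_all add: algebra_simps)
 qed
 ultimately show ?thesis using lC by (intro exI[of _ C] exI[of _ de]) blast
qed

text \<open>A smaller matrix is padded with the identity to size 3.\<close>

lemma cofactors:
 fixes T :: "nat=>nat=>vec=>complex" and r :: nat
 assumes P: "P:proj_space n" and r: "r<=3" and T: "!!k b. k<r==>b<r==>lreg n 0 P (T k b)"
  and v0: "!!k b. k<r==>b<r==>T k b v0=(if k=b then 1 else 0)"
 shows "EX C de. (ALL k b. lreg n 0 P (C k b))&lreg n 0 P de&de v0=1 &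
  (ALL v. ALL k<r. ALL k'<r. (SUM b<r. C k b v * T k' b v)=(if k = k' then de v else 0)) &
  (ALL v. ALL b<r. ALL b'<r. (SUM k<r. T k b v * C k b' v)=(if b=b' then de v else 0))"
proof -
 define T' where "T' k b=(if k<r&b<r then T k b else (%v. if k=b then 1 else 0))" for k b
 have T': "lreg n 0 P (T' k b)" for k b
  unfolding T'_def using T lreg_hz[OF P hz_const] by simp
 have v0': "T' k b v0=(if k=b then 1 else 0)" for k b unfolding T'_def using v0 by simp
 obtain C de where C: "ALL k b. lreg n 0 P (C k b)" "lreg n 0 P de" "de v0=1"
  "ALL v. ALL k<3. ALL k'<3. (SUM b<3. C k b v * T' k' b v)=(if k = k' then de v else 0)"
  "ALL v. ALL b<3. ALL b'<3. (SUM k<3. T' k b v * C k b' v)=(if b=b' then de v else 0)"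
  using cofactors_3[where T = T', OF P T' v0'] by (elim exE conjE)
 have 1: "(SUM b<r. C k b v * T k' b v)=(if k = k' then de v else 0)" if "k<r" "k'<r" for v k k'
 proof -
  have "(SUM b<r. C k b v * T k' b v)=(SUM b<3. C k b v * T' k' b v)"
  by (rule sum.mono_neutral_cong_left) (use r that in \<open>auto simp: T'_def\<close>)
  then show ?thesis using C(4) that r by simp
 qed
 have 2: "(SUM k<r. T k b v * C k b' v)=(if b=b' then de v else 0)" if "b<r" "b'<r" for v b b'
 proof -
  have "(SUM k<r. T k b v * C k b' v)=(SUM k<3. T' k b v * C k b' v)"
  by (rule sum.mono_neutral_cong_left) (use r that in \<open>auto simp: T'_def\<close>)
  then show ?thesis using C(5) that r by simp
 qed
 show ?thesis
  by (intro exI[of _ C] exI[of _ de] conjI allI impI) (use C(1-3) 1 2 in simp_all)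
qed

context algebraic_bundle
begin

text \<open>Around any point a coordinate is a fraction whose numerator vanishes where that
  neighbourhood meets \<open>U\<close>; the intersection is nonempty by irreducibility, so the
  numerator is zero.\<close>

lemma Sec_vanish:
 assumes sg: "sg : Sec k (proj_space n)" and i: "i:charts E" and U: "openin (zariski n) U" "U~={}" "U \<subseteq> chart E i"
  and 0: "!!b v. b<rk==>v:\<Union>U==>sg (i, b) v=0"
 shows "sg=0"
proof (rule ext, rule ext)
 fix x :: "'i \<times> nat" and v
 obtain j b where x: "x=(j, b)" by (cases x)
 show "sg x v=0 x v"
 proof (cases "j:charts E&b<rk&v:\<Union>(proj_space n \<inter> chart E j)")
  case True
  then obtain P where j: "j:charts E" "b<rk" and P: "P:proj_space n" "P:chart E j" "v:P" by blast
  obtain W d F G where W: "openin (zariski n) W" "P:W" "hz (Suc n) (int d + k) F" "!!Q v. Q:W==>v:Q==>G v~=0&sg (j, b) v * G v=F v"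
  using SecD(1)[OF sg j P(1,2)] unfolding lreg_def by blast
  let ?V = "(W \<inter> chart E j) \<inter> U"
  have oW: "openin (zariski n) (W \<inter> chart E j)" using W(1) chart_open[OF j(1)] by (rule openin_Int)
  have oV: "openin (zariski n) ?V" by (rule openin_Int[OF oW U(1)])
  have nV: "?V~={}" by (rule open_Int_nonempty[OF oW U(1) _ U(2)]) (use W(2) P(2) in blast)
  have F0: "F w=0" if w: "w:\<Union>?V" for w
  proof -
  obtain Q where Q: "Q:W" "Q:chart E j" "Q:U" "w:Q" using w by blast
  have "Q:proj_space n" using open_sub[OF U(1)] Q(3) by blast
  then have "sg (j, b) w=(SUM c<rk. transition E j i Q b c * sg (i, c) w)"
  by (intro SecD(2)[OF sg]) (use j i Q U(3) in auto)
  also have "... = 0" by (intro sum.neutral) (use 0[of _ w] Q in auto)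
  finally show ?thesis using W(4)[OF Q(1,4)] by simp
  qed
  have "F v=0"
  using W(3)
  proof (cases rule: hz_cases)
  case (1 e)
  show ?thesis by (rule hform_identity[OF 1(2) oV nV F0])
  qed simp
  then show ?thesis using W(4)[OF W(2) P(3)] by (auto simp: x)
 qed (simp add: x SecD(3)[OF sg])
qed

end

section \<open>The graded module of an Ulrich bundle\<close>

locale ulrich = algebraic_bundle n E for n and E :: "'i vbundle" +
 fixes a :: nat
 assumes hyp: "!!q p. p:{1..n}==>bundle_cohomology_vanishes n (twist n E (- int p * int a)) q"
  and n1: "1<=n" and a: "0<a"
begin

lemma sheared: "l<=n==>ulrich_sheared n E a l"
 by unfold_locales (use vb a n1 hyp in auto)

interpretation S: ulrich_sheared n E a 0 "%_. 0" by (rule sheared) simp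

abbreviation "XX \<equiv> proj_space n"

text \<open>Every point is the apex of a suitable shear: take \<open>l\<close> with p l nonzero and
  slopes p i / p l. Coordinates of degree 0 do not change when \<open>p\<close> is rescaled to the
  apex.\<close>

theorem generated:
 assumes i: "i:charts E" "pt p:chart E i" and p: "p:pcone n"
 shows "EX s:Sec 0 XX. ALL b<rk. s (i, b) p=y b"
proof -
 obtain l where l: "l<=n" "p l~=0" using p by (auto simp: pcone_def)
 interpret T: ulrich_sheared n E a l "%i. p i / p l" by (rule sheared[OF l(1)])
 have "p i=p l * T.apex i" for i using l p by (cases "i<=n") (simp_all add: T.apex_def pcone_def)
 then have eq: "p=(%i. p l * T.apex i)" by (rule ext)
 have pt: "pt T.apex=pt p" using pt_scale[OF l(2), of T.apex] by (simp flip: eq)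
 obtain s where s: "s:Sec 0 XX" "!!b. b<rk==>s (i, b) T.apex=y b" using T.generated_at_apex[OF i(1), of y] i(2) pt by metis
 have "s (i, b) p=y b" if b: "b<rk" for b
 proof -
  have "lreg n 0 (pt T.apex) (s (i, b))" using SecD(1)[OF s(1) i(1) b] i(2) pt pt_in[OF T.apex_cone] by simp
  from lreg_homogeneous[OF this pt_self pt_in[OF T.apex_cone] l(2)] show ?thesis using s(2)[OF b] by (simp flip: eq)
 qed
 with s(1) show ?thesis by blast
qed

lemma Sec_spanned:
 assumes B: "finite B" "fv.span B=Sec 0 XX"
 shows "x:Sec (int t * int a) XX==>EX p. (ALL s:B. hform (Suc n) (t * a) (p s))&x=(SUM s:B. smul (p s) s)"
proof (induction t arbitrary: x)
 case 0
 then have "x:fv.span B" using B by simp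
 then obtain c where "x=(SUM s:B. scl (c s) s)" using fv.span_finite[OF B(1)] by auto
 then show ?case by (intro exI[of _ "%s v. c s"]) (simp add: smul_const hform.const)
next
 case (Suc t)
 have k: "int (Suc t) * int a-int a=int t * int a" by (simp add: algebra_simps)
 obtain y where y: "!!j. j<=n==>y j:Sec (int t * int a) XX" "x=(SUM j<=n. smul (S.ff j) (y j))"
  using S.Sec_Suc[OF Suc.prems] unfolding S.Idl_def k by auto
 have "ALL j:{..n}. EX p. (ALL s:B. hform (Suc n) (t * a) (p s))&y j=(SUM s:B. smul (p s) s)" using Suc.IH y(1) by blast
 from bchoice[OF this] obtain p where p: "ALL j:{..n}. (ALL s:B. hform (Suc n) (t * a) (p j s))&y j=(SUM s:B. smul (p j s) s)" by (elim exE)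
 show ?case
 proof (intro exI[of _ "%s v. SUM j<=n. S.ff j v * p j s v"] conjI ballI)
  fix s assume s: "s:B"
  show "hform (Suc n) (Suc t * a) (%v. SUM j<=n. S.ff j v * p j s v)"
  by (rule hform_sum, rule hform_mult'[OF S.hform_ff]) (use p s in auto)
 next
  have "x=(SUM j<=n. SUM s:B. smul (%v. S.ff j v * p j s v) s)"
  unfolding y(2) using p by (intro sum.cong refl) (simp add: smul_sum smul_smul)
  also have "... = (SUM s:B. smul (%v. SUM j<=n. S.ff j v * p j s v) s)"
  unfolding smul_sum_left by (rule sum.swap)
  finally show "x=(SUM s:B. smul (%v. SUM j<=n. S.ff j v * p j s v) s)" .
 qed
qed

text \<open>The module \<open>NN\<close> is generated by a basis of the global sections of E,
  embedded into the free module of rank \<open>rk\<close> by a trivialisation over \<open>U0\<close>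
  and cleared of denominators. It agrees with the sections of E(ta) in degree
  \<open>c + t * a\<close>; other degrees are never computed. It is locally free of rank
  \<open>rk\<close> because E is globally generated.\<close>

theorem rank_bound:
 assumes n: "4<=n" and a2: "2<=a" and r: "1<=rk" "rk<=3" shows False
proof -
 let ?m = "Suc n"
 note fS = S.findim_Sec_0
 obtain B where B: "finite B" "fv.independent B" "fv.span B=Sec 0 XX" "B \<subseteq> Sec 0 XX" "card B=fv.dim (Sec 0 XX)"
  using findim_basis[OF fS subspace_Sec[OF S.openX]] by blast
 have p0: "pt S.apex:XX" by (rule pt_in[OF S.apex_cone])
 then obtain i0 where i0: "i0:charts E" "pt S.apex:chart E i0" using chart_cover by blast
 obtain U0 where U0: "S.good U0" "pt S.apex:U0" "U0 \<subseteq> chart E i0" using S.good_exists[OF chart_open[OF i0(1)] i0(2)] by blast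
 note o0 = S.good_open[OF U0(1)]
 have U0X: "U0 \<subseteq> XX" by (rule open_sub[OF o0])
 have ne: "U0~={}" using U0(2) by blast
 obtain g e0 where g: "hform ?m e0 g" "0<e0" "U0=bas n g" using U0(1) unfolding S.good_def by blast
 have g0: "g v~=0" if "v:\<Union>U0" for v using that unfolding g(3) Union_bas[OF g(1)] by blast
 have mu: "fv.dim (Sec 0 XX) > 0"
 proof (rule ccontr)
  assume "~fv.dim (Sec 0 XX) > 0"
  then have "B={}" using B(1,5) by simp
  then have "Sec 0 XX={0}" using B(3) by simp
  moreover obtain s where "s:Sec 0 XX" "ALL b<rk. s (i0, b) S.apex=1" using generated[OF i0 S.apex_cone, of "%_. 1"] by blast
  moreover have "0<rk" using r(1) by simp
  ultimately show False by auto
 qed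
 have "EX N F. ALL x:B \<times> {..<rk}. hz ?m (int (N * e0)+0) (F x)&(ALL v:\<Union>(bas n g). (case x of (s, b)=>s (i0, b)) v * g v ^ N=F x v)"
 proof (rule lreg_bas_uniform[OF g(1,2)])
  fix x P assume x: "x:B \<times> {..<rk}" and P: "P:bas n g"
  then have "P:XX" "P:chart E i0" using g(3) U0(3) U0X by blast+
  then show "lreg n 0 P (case x of (s, b)=>s (i0, b))" using x B(4) SecD(1)[of _ 0 XX i0 _ P] i0(1) by auto
 qed (use B in simp)
 then obtain N F where "ALL x:B \<times> {..<rk}. hz ?m (int (N * e0)+0) (F x)&(ALL v:\<Union>(bas n g). (case x of (s, b)=>s (i0, b)) v * g v ^ N=F x v)" by (elim exE)
 then have F: "hform ?m (N * e0) (F (s, b))" "v:\<Union>U0==>s (i0, b) v * g v ^ N=F (s, b) v" if "s:B" "b<rk" for s b v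
  using that unfolding g(3) by (auto simp: hz_int_iff[of _ "N * e0", simplified] simp del: Union_iff)
 \<comment> \<open>The degree acquired by clearing the denominator g^N; sections of E(k) correspond
   to degree \<open>c + k\<close>.\<close>
 define c where "c=N * e0"
 define Fv where "Fv s=(%b v. if b<rk then F (s, b) v else 0)" for s
 have FvV: "Fv s:VF ?m {..<rk} c" if "s:B" for s
  unfolding VF_def Fv_def c_def using F(1)[OF that] by auto
 define NN where "NN d=(if d < c then {0} else {x. EX p. (ALL s:B. hform ?m (d - c) (p s))&x=(SUM s:B. smul (p s) (Fv s))})" for d
 have NNI: "(SUM s:B. smul (p s) (Fv s)):NN d" if "c<=d" "!!s. s:B==>hform ?m (d - c) (p s)" for p d
  using that unfolding NN_def by auto
 have NND: "EX p. (ALL s:B. hform ?m (d - c) (p s))&x=(SUM s:B. smul (p s) (Fv s))" if "x:NN d" for x d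
 proof (cases "d < c")
  case True
  then show ?thesis using that unfolding NN_def by (intro exI[of _ "%_ _. 0"]) (simp add: hform.zero)
 qed (use that in \<open>simp add: NN_def\<close>)
 have gN: "gsub ?m {..<rk} NN"
  unfolding gsub_def
 proof (intro conjI allI impI subsetI)
  fix d x assume x: "x:NN d"
  show "x:VF ?m {..<rk} d"
  proof (cases "d < c")
  case True then show ?thesis using x fv.subspace_0[OF subspace_VF] by (simp add: NN_def)
  next
  case False
  obtain p where p: "ALL s:B. hform ?m (d - c) (p s)" "x=(SUM s:B. smul (p s) (Fv s))" using NND[OF x] by blast
  show ?thesis unfolding p(2)
  proof (rule fv.subspace_sum[OF subspace_VF])
  fix s assume s: "s:B"
  have "smul (p s) (Fv s):VF ?m {..<rk} (d - c + c)" by (rule smul_VF[OF bspec[OF p(1) s] FvV[OF s]])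
  then show "smul (p s) (Fv s):VF ?m {..<rk} d" using False by simp
  qed
  qed
 next
  fix d
  show "fv.subspace (NN d)"
  proof (cases "d < c")
  case False
  then have cd: "c<=d" by simp
  show ?thesis
  unfolding fv.subspace_def
  proof (intro conjI ballI allI)
  show "0:NN d" using NNI[OF cd, of "%_ _. 0"] by (simp add: hform.zero)
  fix x assume "x:NN d"
  then obtain p where p: "ALL s:B. hform ?m (d - c) (p s)" "x=(SUM s:B. smul (p s) (Fv s))" using NND by blast
  have sc: "smul (%v. z * p s v) (Fv s) = scl z (smul (p s) (Fv s))" for z s by (simp add: smul_def scl_def mult.assoc)
  show "scl z x:NN d" for z
  using NNI[OF cd, of "%s v. z * p s v"] p(1) hform_scale unfolding p(2) fv.scale_sum_right sc by blast
  fix y assume "y:NN d"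
  then obtain q where q: "ALL s:B. hform ?m (d - c) (q s)" "y=(SUM s:B. smul (q s) (Fv s))" using NND by blast
  have pl: "smul (%v. p s v+q s v) (Fv s) = smul (p s) (Fv s) + smul (q s) (Fv s)" for s by (rule smul_plus)
  show "x+y:NN d"
  using NNI[OF cd, of "%s v. p s v+q s v"] p(1) q(1) hform.add unfolding p(2) q(2) sum.distrib[symmetric] pl by blast
  qed
  qed (simp add: NN_def)
 next
  fix d i x assume i: "i<?m" and x: "x:NN d"
  show "smul (%v. v i) x:NN (Suc d)"
  proof (cases "d < c")
  case True
  then have x0: "x=0" using x by (simp add: NN_def)
  show ?thesis
  proof (cases "Suc d < c")
  case False
  then show ?thesis using NNI[of "Suc d" "%_ _. 0"] x0 by (simp add: hform.zero)
  qed (simp add: x0 NN_def)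
  next
  case False
  obtain p where p: "ALL s:B. hform ?m (d - c) (p s)" "x=(SUM s:B. smul (p s) (Fv s))" using NND[OF x] by blast
  have "(SUM s:B. smul (%v. v i * p s v) (Fv s)):NN (Suc d)"
  by (rule NNI, use False in simp, rule hform_mult'[OF hform_var[OF i] bspec[OF p(1)]]) (use False in auto)
  then show ?thesis unfolding p(2) smul_sum smul_smul .
  qed
 qed
 \<comment> \<open>Coordinates over \<open>U0\<close> times g^N: the image of a section and the
   corresponding element of \<open>NN\<close> agree on \<open>U0\<close>. Both restrictions are
   injective by the identity principle, so dimensions can be compared there.\<close>
 define rh :: "('i \<times> nat=>vec=>complex)=>nat=>vec=>complex"
  where "rh sg=(%b v. if b<rk&v:\<Union>U0 then sg (i0, b) v * g v ^ N else 0)" for sg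
 have lrh: "lin rh" by (rule linI) (auto simp: rh_def scl_def fun_eq_iff algebra_simps)
 have rh_smul: "rh (smul f sg) = smul f (rh sg)" for f sg by (auto simp: rh_def smul_def fun_eq_iff)
 have rhB: "rh s=rs U0 (Fv s)" if "s:B" for s
 proof (rule ext, rule ext)
  fix b v
  show "rh s b v=rs U0 (Fv s) b v" using F(2)[OF that, of b v] by (auto simp: rh_def rs_def Fv_def simp del: Union_iff)
 qed
 have rhp: "rh (SUM s:B. smul (p s) s)=rs U0 (SUM s:B. smul (p s) (Fv s))" for p
  unfolding lin_sum[OF lrh] lin_sum[OF lin_rs] rs_smul rh_smul by (intro sum.cong refl) (simp only: rhB)
 have dim: "fv.dim (NN (c+t * a))=fv.dim (Sec 0 XX) * ((t+n) choose n)" for t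
 proof -
  have "rh ` Sec (int t * int a) XX=rs U0 ` NN (c+t * a)"
  proof (intro set_eqI iffI)
  fix z assume "z:rh ` Sec (int t * int a) XX"
  then obtain x where x: "x:Sec (int t * int a) XX" "z=rh x" by blast
  obtain p where p: "ALL s:B. hform ?m (t * a) (p s)" "x=(SUM s:B. smul (p s) s)" using Sec_spanned[OF B(1,3) x(1)] by blast
  show "z:rs U0 ` NN (c+t * a)" unfolding x(2) p(2) rhp by (rule imageI, rule NNI) (use p(1) in auto)
  next
  fix z assume "z:rs U0 ` NN (c+t * a)"
  then obtain x where x: "x:NN (c+t * a)" "z=rs U0 x" by blast
  obtain p where p: "ALL s:B. hform ?m (c+t * a - c) (p s)" "x=(SUM s:B. smul (p s) (Fv s))" using NND[OF x(1)] by blast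
  show "z:rh ` Sec (int t * int a) XX"
  unfolding x(2) p(2) rhp[symmetric]
  proof (intro imageI fv.subspace_sum[OF subspace_Sec[OF S.openX]])
  fix s assume s: "s:B"
  show "smul (p s) s:Sec (int t * int a) XX"
  by (rule Sec_smul[OF S.openX bspec[OF p(1) s] subsetD[OF B(4) s]]) simp
  qed
  qed
  moreover have "fv.dim (rh ` Sec (int t * int a) XX)=fv.dim (Sec (int t * int a) XX)"
  proof (rule dim_image_inj[OF lrh S.findim_Sec subspace_Sec[OF S.openX]])
  fix w assume w: "w:Sec (int t * int a) XX" "rh w=0"
  show "w=0"
  proof (rule Sec_vanish[OF w(1) i0(1) o0 ne U0(3)])
  fix b v assume b: "b<rk" and v: "v:\<Union>U0"
  have "rh w b v=0" using w(2) by simp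
  then show "w (i0, b) v=0" using b v g0[OF v] by (simp add: rh_def del: Union_iff)
  qed
  qed
  moreover have "fv.dim (rs U0 ` NN (c+t * a))=fv.dim (NN (c+t * a))"
  proof (rule dim_image_inj[OF lin_rs gsub_findim[OF gN] gsub_subspace[OF gN]])
  fix w assume w: "w:NN (c+t * a)" "rs U0 w=0"
  show "w=0"
  proof (rule ext, rule ext)
  fix b v
  have "w b v'=0" if "v':\<Union>U0" for v'
  using fun_cong[OF fun_cong[OF w(2), of b], of v'] that by (simp add: rs_def del: Union_iff)
  from hform_identity[OF VF_hform[OF gsub_VF[OF gN w(1)]] o0 ne this] show "w b v=0 b v" by simp
  qed
  qed simp
  ultimately show ?thesis using S.dim_Sec[of t] by simp
 qed
 have "locfree_rank ?m rk NN"
  unfolding locfree_rank_def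
 proof (intro allI impI)
  fix p :: vec assume p: "EX i<?m. p i~=0"
  define v0 where "v0=trunc n p"
  have v0: "v0:pcone n" unfolding v0_def by (rule trunc_cone[OF p])
  let ?P = "pt v0"
  have P: "?P:XX" by (rule pt_in[OF v0])
  obtain i where i: "i:charts E" "?P:chart E i" using chart_cover[OF P] by blast
  have "ALL k. EX s. s:Sec 0 XX&(ALL b<rk. s (i, b) v0=(if k=b then 1 else 0))"
  proof
  fix k
  from generated[OF i v0, of "%b. if k=b then 1 else 0"]
  show "EX s. s:Sec 0 XX&(ALL b<rk. s (i, b) v0=(if k=b then 1 else 0))" by (elim bexE) (rule exI, rule conjI)
  qed
  \<comment> \<open>Global sections \<open>ta k\<close> whose values at \<open>v0\<close> are the
    standard basis in chart i. Near \<open>v0\<close> they are a frame, and Cramer's rule with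
    \<open>C\<close> and \<open>de\<close> expresses every section in it.\<close>
  from choice[OF this] obtain ta where ta0: "ALL k. ta k:Sec 0 XX&(ALL b<rk. ta k (i, b) v0=(if k=b then 1 else 0))" by (elim exE)
  have ta: "ta k:Sec 0 XX" "b<rk==>ta k (i, b) v0=(if k=b then 1 else 0)" for k b using spec[OF ta0, of k] by simp_all
  have "ALL k. EX ga. ta k=(SUM s:B. scl (ga s) s)"
  proof
  fix k
  have "ta k:range (%u. SUM s:B. scl (u s) s)" unfolding fv.span_finite[OF B(1), symmetric] B(3) by (rule ta(1))
  then show "EX ga. ta k=(SUM s:B. scl (ga s) s)" by (elim rangeE) (rule exI, assumption)
  qed
  from choice[OF this] obtain ga where "ALL k. ta k=(SUM s:B. scl (ga k s) s)" by (elim exE)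
  then have ga: "ta k=(SUM s:B. scl (ga k s) s)" for k by (rule spec)
  define th where "th k=(SUM s:B. smul (%_. ga k s) (Fv s))" for k
  have thN: "th k:NN c" for k unfolding th_def by (rule NNI) (simp_all add: hform.const)
  have th: "th k b v=ta k (i0, b) v * g v ^ N" if "b<rk" "v:\<Union>U0" for k b v
  proof -
  have "rh (ta k)=rs U0 (th k)" unfolding th_def rhp[symmetric] by (simp only: smul_const ga[of k])
  from fun_cong[OF fun_cong[OF this, of b], of v] that show ?thesis by (simp add: rh_def rs_def del: Union_iff)
  qed
  have lr: "lreg n 0 ?P (s (i, b))" if "s:Sec 0 XX" "b<rk" for s b by (rule SecD(1)[OF that(1) i(1) that(2) P i(2)])
  have "EX C de. (ALL k b. lreg n 0 ?P (C k b))&lreg n 0 ?P de&de v0=1 &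
  (ALL v. ALL k<rk. ALL k'<rk. (SUM b<rk. C k b v * ta k' (i, b) v)=(if k = k' then de v else 0)) &
  (ALL v. ALL b<rk. ALL b'<rk. (SUM k<rk. ta k (i, b) v * C k b' v)=(if b=b' then de v else 0))"
  by (rule cofactors[OF P r(2), where T = "%k b. ta k (i, b)"]) (use lr ta in auto)
  then obtain C de where C: "ALL k b. lreg n 0 ?P (C k b)" "lreg n 0 ?P de" "de v0=1"
  and C1: "ALL v. ALL k<rk. ALL k'<rk. (SUM b<rk. C k b v * ta k' (i, b) v)=(if k = k' then de v else 0)"
  and C2: "ALL v. ALL b<rk. ALL b'<rk. (SUM k<rk. ta k (i, b) v * C k b' v)=(if b=b' then de v else 0)" by (elim exE conjE)
  define be where "be x=(case x of None=>de | Some (s, k)=>(%v. SUM b<rk. C k b v * s (i, b) v))" for x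
  let ?X = "insert None (Some ` (B \<times> {..<rk}))"
  have lbe: "lreg n 0 ?P (be x)" if xX: "x : ?X" for x
  proof (cases x)
  case None then show ?thesis using C(2) by (simp add: be_def)
  next
  case (Some y)
  then obtain s k where y: "x=Some (s, k)" "s:B" using xX by auto
  have "lreg n 0 ?P (%v. SUM b<rk. C k b v * s (i, b) v)"
  by (rule lreg_sum[OF P], rule lreg_mult_0[OF _ lr[OF subsetD[OF B(4) y(2)]]]) (use C(1) in auto)
  then show ?thesis by (simp add: be_def y(1))
  qed
  have "EX W d G A. openin (zariski n) W&?P:W&hform ?m d G&(ALL v:\<Union>W. G v~=0) &
  (ALL x:?X. hform ?m d (A x)&(ALL v:\<Union>W. be x v * G v=A x v))"
  by (rule lreg_uniform[OF _ P lbe]) (use B in auto)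
  then obtain W d G A where W: "openin (zariski n) W" "?P:W" "hform ?m d G" "ALL v:\<Union>W. G v~=0"
  and A: "ALL x:?X. hform ?m d (A x)&(ALL v:\<Union>W. be x v * G v=A x v)" by (elim exE conjE)
  \<comment> \<open>The numerator of the determinant \<open>de\<close> over the common denominator
    \<open>G\<close>; it is nonzero at \<open>p\<close>, and multiplication by it turns the Cramer
    coefficients into forms.\<close>
  define f where "f=A None"
  have f: "hform ?m d f" "!!v. v:\<Union>W==>de v * G v=f v" using A by (auto simp: f_def be_def simp del: Union_iff)
  have As: "hform ?m d (A (Some (s, k)))" "v:\<Union>W==>(SUM b<rk. C k b v * s (i, b) v) * G v=A (Some (s, k)) v" if "s:B" "k<rk" for s k v
  using bspec[OF A, of "Some (s, k)"] that by (auto simp: be_def simp del: Union_iff)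
  have v0W: "v0:\<Union>W" using W(2) pt_self by blast
  have fv0: "f v0~=0" using f(2)[OF v0W] W(4) v0W C(3) by auto
  define V where "V=(W \<inter> chart E i \<inter> bas n f) \<inter> U0"
  have oV': "openin (zariski n) (W \<inter> chart E i \<inter> bas n f)" by (intro openin_Int W(1) chart_open[OF i(1)] open_bas[OF f(1)])
  have oV: "openin (zariski n) V" unfolding V_def by (rule openin_Int[OF oV' o0])
  have nV: "V~={}" unfolding V_def
  proof (rule open_Int_nonempty[OF oV' o0 _ ne])
  have "?P:bas n f" using pt_in_bas[OF f(1)] P fv0 by simp
  then show "W \<inter> chart E i \<inter> bas n f~={}" using W(2) i(2) by blast
  qed
  have VD: "EX Q. Q:XX&Q:W&Q:chart E i&Q:chart E i0&v:Q&v:\<Union>W&v:\<Union>U0&f v~=0" if "v:\<Union>V" for v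
  proof -
  obtain Q where Q: "Q:V" "v:Q" using \<open>v:\<Union>V\<close> by blast
  then have "Q:W" "Q:chart E i" "Q:bas n f" "Q:U0" by (auto simp: V_def)
  then show ?thesis using Q(2) U0X U0(3) by (intro exI[of _ Q]) (auto simp: bas_def)
  qed
  have tr: "sg (j, b) v=(SUM c<rk. transition E j j' Q b c * sg (j', c) v)"
  if "sg : Sec 0 XX" "j:charts E" "j':charts E" "Q:XX" "Q:chart E j" "Q:chart E j'" "v:Q" "b<rk" for sg j j' Q v b
  by (rule SecD(2)[OF that])
  \<comment> \<open>Cramer's rule holds in chart i near \<open>v0\<close>, while \<open>NN\<close>
    is written in chart \<open>i0\<close>. The identity is checked where the two meet and extends to
    all vectors because both sides are forms.\<close>
  have key: "f v * Fv s b v=(SUM k<rk. A (Some (s, k)) v * th k b v)" if s: "s:B" for s b v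
  proof (cases "b<rk")
  case False
  then show ?thesis by (simp add: th_def Fv_def sum_apply2 smul_def)
  next
  case b: True
  have sS: "s:Sec 0 XX" using s B(4) by blast
  let ?D = "%v. f v * Fv s b v-(SUM k<rk. A (Some (s, k)) v * th k b v)"
  have "?D v=0"
  proof (rule hform_identity[where F = ?D and v = v and d = "d + c", OF _ oV nV])
  have "hform ?m (d + c) (%v. A (Some (s, k)) v * th k b v)" if "k:{..<rk}" for k
  by (rule hform_mult[OF As(1)[OF s] VF_hform[OF gsub_VF[OF gN thN]]]) (use that in simp)
  from hform_diff[OF hform_mult[OF f(1) VF_hform[OF FvV[OF s]]] hform_sum[OF this]] show "hform ?m (d + c) ?D" .
  fix v assume "v:\<Union>V"
  from VD[OF this] obtain Q where Q: "Q:XX" "Q:W" "Q:chart E i" "Q:chart E i0" "v:Q" "v:\<Union>W" "v:\<Union>U0" by (elim exE conjE)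
  have 1: "f v * s (i, b') v=(SUM k<rk. A (Some (s, k)) v * ta k (i, b') v)" if b': "b'<rk" for b'
  proof -
  have "(SUM k<rk. (SUM b''<rk. C k b'' v * s (i, b'') v) * ta k (i, b') v)=(SUM b''<rk. (SUM k<rk. ta k (i, b') v * C k b'' v) * s (i, b'') v)"
  unfolding sum_distrib_right by (subst sum.swap) (simp only: mult_ac)
  also have "... = (SUM b''<rk. (if b'=b'' then de v else 0) * s (i, b'') v)" using C2 b' by (intro sum.cong refl) simp
  also have "... = de v * s (i, b') v" using b' by (simp add: if_distrib[of "%x. x * _"] cong: if_cong)
  finally have e: "(SUM k<rk. (SUM b''<rk. C k b'' v * s (i, b'') v) * ta k (i, b') v)=de v * s (i, b') v" .
  have "(de v * G v) * s (i, b') v=(SUM k<rk. ((SUM b''<rk. C k b'' v * s (i, b'') v) * G v) * ta k (i, b') v)"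
  proof -
  have "(de v * G v) * s (i, b') v=G v * (SUM k<rk. (SUM b''<rk. C k b'' v * s (i, b'') v) * ta k (i, b') v)"
  unfolding e by (simp only: mult_ac)
  also have "... = (SUM k<rk. ((SUM b''<rk. C k b'' v * s (i, b'') v) * G v) * ta k (i, b') v)"
  unfolding sum_distrib_left[of "G v"] by (intro sum.cong refl) (simp only: mult_ac)
  finally show ?thesis .
  qed
  then show ?thesis unfolding f(2)[OF Q(6)] using As(2)[OF s _ Q(6)] by simp
  qed
  have "f v * s (i0, b) v=(SUM b'<rk. transition E i0 i Q b b' * (f v * s (i, b') v))"
  unfolding tr[OF sS i0(1) i(1) Q(1,4,3,5) b] sum_distrib_left by (simp only: mult.left_commute)
  also have "... = (SUM b'<rk. SUM k<rk. A (Some (s, k)) v * (transition E i0 i Q b b' * ta k (i, b') v))"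
  by (intro sum.cong refl) (simp add: 1 sum_distrib_left mult.left_commute)
  also have "... = (SUM k<rk. A (Some (s, k)) v * ta k (i0, b) v)"
  unfolding tr[OF ta(1) i0(1) i(1) Q(1,4,3,5) b] sum_distrib_left by (rule sum.swap)
  finally have e: "f v * s (i0, b) v=(SUM k<rk. A (Some (s, k)) v * ta k (i0, b) v)" .
  have "f v * Fv s b v=(f v * s (i0, b) v) * g v ^ N" using F(2)[OF s b Q(7)] b by (simp add: Fv_def mult.assoc)
  also have "... = (SUM k<rk. A (Some (s, k)) v * th k b v)" unfolding e sum_distrib_right th[OF b Q(7)] by (simp only: mult.assoc)
  finally show "?D v=0" by simp
  qed
  then show ?thesis by simp
  qed
  obtain l where l: "l<?m" "p l~=0" using p by blast
  \<comment> \<open>The extra power of a coordinate nonzero at \<open>p\<close> raises the degree to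
    \<open>d + c\<close>, as \<open>locbasis\<close> demands a degree of at least
    \<open>c\<close>.\<close>
  let ?f = "%v. f v * v l ^ c"
  have vl: "hform ?m c (%v. v l ^ c)" using hform_power[OF hform_var[OF l(1)], of c] by simp
  have "locbasis ?m NN (d + c) ?f rk th c"
  unfolding locbasis_def
  proof (intro conjI allI impI ballI)
  show "hform ?m (d + c) ?f" by (rule hform_mult[OF f(1) vl])
  show "th k:NN c" for k by (rule thN)
  fix d' x assume x: "x:NN d'"
  show "EX al. (ALL k<rk. hform ?m (d + c+d' - c) (al k))&smul ?f x=(SUM k<rk. smul (al k) (th k))"
  proof (cases "d' < c")
  case True
  then have "x=0" using x by (simp add: NN_def)
  then show ?thesis by (intro exI[of _ "%_ _. 0"]) (simp add: hform.zero)
  next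
  case False
  obtain q where q: "ALL s:B. hform ?m (d' - c) (q s)" "x=(SUM s:B. smul (q s) (Fv s))" using NND[OF x] by blast
  show ?thesis
  proof (intro exI[of _ "%k v. SUM s:B. q s v * A (Some (s, k)) v * v l ^ c"] conjI allI impI)
  fix k assume k: "k<rk"
  have deg: "d + c+d' - c=(d' - c)+d + c" using False by simp
  show "hform ?m (d + c+d' - c) (%v. SUM s:B. q s v * A (Some (s, k)) v * v l ^ c)"
  unfolding deg by (intro hform_sum hform_mult vl As(1) k bspec[OF q(1)])
  next
  show "smul ?f x=(SUM k<rk. smul (%v. SUM s:B. q s v * A (Some (s, k)) v * v l ^ c) (th k))"
  proof (rule ext, rule ext)
  fix b v
  have "smul ?f x b v=(SUM s:B. q s v * v l ^ c * (f v * Fv s b v))"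
  unfolding q(2) smul_def sum_apply2 sum_distrib_left by (simp only: mult_ac)
  also have "... = (SUM s:B. SUM k<rk. q s v * A (Some (s, k)) v * v l ^ c * th k b v)"
  by (intro sum.cong refl) (simp add: key sum_distrib_left mult_ac)
  also have "... = (SUM k<rk. smul (%v. SUM s:B. q s v * A (Some (s, k)) v * v l ^ c) (th k)) b v"
  unfolding smul_def sum_apply2 sum_distrib_right by (rule sum.swap)
  finally show "smul ?f x b v=(SUM k<rk. smul (%v. SUM s:B. q s v * A (Some (s, k)) v * v l ^ c) (th k)) b v" .
  qed
  qed
  qed
  next
  obtain Q0 where "Q0:V" using nV by blast
  from S.good_exists[OF oV this] obtain H where H: "S.good H" "Q0:H" "H \<subseteq> V" by blast
  obtain h e1 where h: "hform ?m e1 h" "0<e1" "H=bas n h" using H(1) unfolding S.good_def by blast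
  obtain w where w: "w:pcone n" "Q0=pt w" using H(2) h(3) unfolding bas_def proj_space_pt by blast
  have hw: "h w~=0" using H(2) unfolding h(3) w(2) pt_in_bas[OF h(1)] by blast
  show "EX e' h q. hform ?m e' h&h q~=0&(ALL v a. h v~=0-->(ALL b. (SUM k<rk. a k * th k b v)=0)-->(ALL k<rk. a k=0))"
  proof (intro exI[of _ e1] exI[of _ h] exI[of _ w] conjI h(1) hw allI impI)
  fix v and al :: "nat=>complex" and k' assume hv: "h v~=0" and z: "ALL b. (SUM k<rk. al k * th k b v)=0" and k': "k'<rk"
  let ?v = "trunc n v"
  have "?v:pcone n" by (rule trunc_cone[OF hform_nonzero_pos[OF h(1,2) hv]])
  then have "?v:\<Union>H" unfolding h(3) Union_bas[OF h(1)] using hv hform_trunc[OF h(1)] by simp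
  then have "?v:\<Union>V" using H(3) by blast
  from VD[OF this] obtain Q where Q: "Q:XX" "Q:W" "Q:chart E i" "Q:chart E i0" "?v:Q" "?v:\<Union>W" "?v:\<Union>U0" "f ?v~=0" by (elim exE conjE)
  have dev: "de ?v~=0" using f(2)[OF Q(6)] Q(8) by auto
  have z0: "(SUM k<rk. al k * ta k (i0, b) ?v)=0" if b: "b<rk" for b
  proof -
  have "th k b v=ta k (i0, b) ?v * g ?v ^ N" for k
  using th[OF b Q(7)] hform_trunc[OF VF_hform[OF gsub_VF[OF gN thN]], of k b v] by simp
  then have "(SUM k<rk. al k * ta k (i0, b) ?v) * g ?v ^ N=0" using spec[OF z, of b] by (simp add: sum_distrib_right mult.assoc)
  then show ?thesis using g0[OF Q(7)] by simp
  qed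
  have zi: "(SUM k<rk. al k * ta k (i, b) ?v)=0" if b: "b<rk" for b
  proof -
  have "(SUM k<rk. al k * ta k (i, b) ?v)=(SUM k<rk. SUM b'<rk. transition E i i0 Q b b' * (al k * ta k (i0, b') ?v))"
  unfolding tr[OF ta(1) i(1) i0(1) Q(1,3,4,5) b] sum_distrib_left by (simp only: mult.left_commute)
  also have "... = (SUM b'<rk. transition E i i0 Q b b' * (SUM k<rk. al k * ta k (i0, b') ?v))"
  unfolding sum_distrib_left by (rule sum.swap)
  also have "... = 0" using z0 by (intro sum.neutral) simp
  finally show ?thesis .
  qed
  have "0=(SUM b<rk. C k' b ?v * (SUM k<rk. al k * ta k (i, b) ?v))" using zi by simp
  also have "... = (SUM k<rk. al k * (SUM b<rk. C k' b ?v * ta k (i, b) ?v))"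
  unfolding sum_distrib_left by (subst sum.swap) (simp only: mult.left_commute)
  also have "... = (SUM k<rk. al k * (if k' = k then de ?v else 0))" using C1 k' by (intro sum.cong refl) simp
  also have "... = al k' * de ?v" using k' by (simp add: if_distrib[of "%x. _ * x"] cong: if_cong)
  finally show "al k'=0" using dev by simp
  qed
  qed simp
  moreover have "?f p~=0" using fv0 l(2) hform_trunc[OF f(1), of p] by (simp add: v0_def)
  ultimately show "EX e f s c. locbasis ?m NN e f rk s c&f p~=0" by (intro exI[of _ "d + c"] exI[of _ ?f] exI conjI)
 qed
 from no_low_rank_module[OF n a2 r gN this mu dim] show False by (simp add: NN_def)
qed

end

theorem theorem1:
  fixes n :: nat and a :: int
  assumes "n \<ge> 4" and "a \<ge> 2"
  shows "\<not> (\<exists>E :: 'i vbundle. 1 \<le> bundle_rank E \<and> bundle_rank E \<le> 3 \<and> ulrich_bundle n (twisting n a) E)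
    \<and> \<not> (\<exists>E :: 'i vbundle. vector_bundle n E \<and> 1 \<le> bundle_rank E \<and> bundle_rank E \<le> 3 \<and>
          (\<forall>q. \<forall>p\<in>{1..n}. bundle_cohomology_vanishes n (twist n E (- int p * a)) q))"
proof -
 have no: False if "vector_bundle n E" "1<=bundle_rank E" "bundle_rank E<=3"
  "!!q p. p:{1..n}==>bundle_cohomology_vanishes n (twist n E (- int p * a)) q" for E :: "'i vbundle"
 proof -
  have a: "int (nat a)=a" using assms(2) by simp
  interpret ulrich n E "nat a" by unfold_locales (use that assms a in auto)
  show False by (rule rank_bound) (use that assms in auto)
 qed
 \<comment> \<open>Powers of O(a) and twists O(-pa) have the same charts and transition functions,
   so the two formulations involve literally the same bundle.\<close>
 have tw: "tensor_bundle E (line_power (twisting n a) (- int p))=twist n E (- int p * a)" for E :: "'i vbundle" and p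
 proof -
  have "line_power (twisting n a) (- int p)=twisting n (- int p * a)"
  by (simp add: line_power_def twisting_def power_int_mult[symmetric] mult.commute)
  then show ?thesis by (simp add: twist_def)
 qed
 have u: "vector_bundle n E&(ALL q. ALL p:{1..n}. bundle_cohomology_vanishes n (twist n E (- int p * a)) q)" if "ulrich_bundle n (twisting n a) E" for E :: "'i vbundle"
  using that unfolding ulrich_bundle_def tw .
 show ?thesis
 proof (intro conjI notI; elim exE conjE)
  fix E :: "'i vbundle" assume r: "1<=bundle_rank E" "bundle_rank E<=3" and U: "ulrich_bundle n (twisting n a) E"
  show False by (rule no[OF conjunct1[OF u[OF U]] r bspec[OF spec[OF conjunct2[OF u[OF U]]]]])
 next
  fix E :: "'i vbundle" assume v: "vector_bundle n E" and r: "1<=bundle_rank E" "bundle_rank E<=3"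
  and h: "ALL q. ALL p:{1..n}. bundle_cohomology_vanishes n (twist n E (- int p * a)) q"
  show False by (rule no[OF v r bspec[OF spec[OF h]]])
 qed
qed

end
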